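(* Let $T\in(0,\infty)$, $\varepsilon_0\in(0,\tfrac{T}{2})$, $R>0$, $p\in(1,+\infty)$, and let $s$ satisfy $0<s<\inf\left(\tfrac1p,\,1-\tfrac1p\right)$. Then there exists a constant $C$, which does not depend on $u$ and $f$, such that the following holds. Suppose $u=u(t,\mathbf{x},\mathbf{p})$ and $f=f(t,\mathbf{x},\mathbf{p})$ both belong to $L^{p}((0,T)\times\mathbf{R}^3\times\mathbf{R}^3)$, satisfy $$\frac{\partial u}{\partial t}+\frac{\mathbf{p}}{p_0}\cdot\frac{\partial u}{\partial\mathbf{x}}=f ,\qquad p_0=(1+|\mathbf{p}|^2)^{1/2},$$ and $\operatorname{supp}u\subset[\varepsilon_0,T-\varepsilon_0]\times\mathbf{R}^3\times B_R$. Then the momentum average $$\widetilde{u}(t,\mathbf{x})=\int_{\mathbf{R}^3}u(t,\mathbf{x},\mathbf{p})\,d\mathbf{p}$$ belongs to $W^{s,p}((0,T)\times\mathbf{R}^3)$, and $$\|\widetilde{u}\|_{W^{s,p}}\le C\,\|u\|_{L^p}^{1-s}\,\|f\|_{L^p}^{s},$$ where $$\|\widetilde{u}\|_{W^{s,p}}=\left(\int_0^T\!\!\int_{\mathbf{R}^3}\int_0^T\!\!\int_{\mathbf{R}^3}\frac{|\widetilde{u}(t_1,\mathbf{x}_1)-\widetilde{u}(t_2,\mathbf{x}_2)|^{p}}{\left[(t_1-t_2)^2+|\mathbf{x}_1-\mathbf{x}_2|^2\right]^{\frac{4+sp}{2}}}\,d\mathbf{x}_1\,dt_1\,d\mathb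f{x}_2\,dt_2\right)^{1/p}.$$
   Context: Here $t\in(0,T)$ is time, $\mathbf{x}\in\mathbf{R}^3$ is position and $\mathbf{p}\in\mathbf{R}^3$ is momentum (the scalar $p$ is the Lebesgue exponent and is unrelated to $\mathbf{p}$). $B_R=\{\mathbf{p}\in\mathbf{R}^3:|\mathbf{p}|<R\}$ is the ball of radius $R$ centered at the origin. $\frac{\mathbf{p}}{p_0}\cdot\frac{\partial u}{\partial\mathbf{x}}=\sum_{i=1}^3\frac{\mathbf{p}_i}{p_0}\frac{\partial u}{\partial x_i}$, and the equation is understood in the sense of distributions on $(0,T)\times\mathbf{R}^3\times\mathbf{R}^3$. $\|u\|_{L^p}$ and $\|f\|_{L^p}$ are the norms in $L^p((0,T)\times\mathbf{R}^3\times\mathbf{R}^3)$. $W^{s,p}((0,T)\times\mathbf{R}^3)$ is the fractional Sobolev space of functions in $L^p((0,T)\times\mathbf{R}^3)$ for which the double-integral quantity denoted $\|\cdot\|_{W^{s,p}}$ in the claim is finite; that quantity (the Gagliardo seminorm) is what $\|\widetilde u\|_{W^{s,p}}$ means in the estimate. *)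

theory Defs
  imports "HOL-Analysis.Analysis"
begin

text \<open>A phase-space point \<open>(t, x, p)\<close> is encoded as \<open>((t, x), p)\<close>, so that its first component is
  the space-time point at which the momentum average is evaluated. Functions are total; only their
  restrictions to the open sets below matter, and Lebesgue measure is used throughout.\<close>

type_synonym spacetime = "real \<times> (real^3)"
type_synonym phase = "spacetime \<times> (real^3)"

definition spacetime_domain :: "real \<Rightarrow> spacetime set" where
  "spacetime_domain T = {0<..<T} \<times> UNIV"

definition phase_domain :: "real \<Rightarrow> phase set" where
  "phase_domain T = spacetime_domain T \<times> UNIV"


subsection \<open>Lebesgue spaces\<close>

definition in_Lp :: "'a::euclidean_space set \<Rightarrow> real \<Rightarrow> ('a \<Rightarrow> real) \<Rightarrow> bool" where
  "in_Lp D p g \<longleftrightarrow> g \<in> borel_measurable (lebesgue_on D) \<and>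
     integrable (lebesgue_on D) (\<lambda>z. \<bar>g z\<bar> powr p)"

definition Lp_norm :: "'a::euclidean_space set \<Rightarrow> real \<Rightarrow> ('a \<Rightarrow> real) \<Rightarrow> real" where
  "Lp_norm D p g = (LINT z|lebesgue_on D. \<bar>g z\<bar> powr p) powr (1 / p)"

text \<open>The support in the sense of distributions: the complement in \<open>D\<close> of the largest open set on
  which \<open>g\<close> vanishes almost everywhere. It is relatively closed in \<open>D\<close>.\<close>

definition ess_supp :: "'a::euclidean_space set \<Rightarrow> ('a \<Rightarrow> real) \<Rightarrow> 'a set" where
  "ess_supp D g = {z \<in> D. \<forall>r>0. \<not> (AE w in lebesgue_on D. w \<in> ball z r \<longrightarrow> g w = 0)}"


subsection \<open>The transport equation in the sense of distributions\<close>

primrec C_k :: "nat \<Rightarrow> ('a::euclidean_space \<Rightarrow> real) \<Rightarrow> bool" where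
  "C_k 0 g \<longleftrightarrow> continuous_on UNIV g"
| "C_k (Suc k) g \<longleftrightarrow> (\<forall>z. g differentiable (at z)) \<and>
     (\<forall>b\<in>Basis. C_k k (\<lambda>z. frechet_derivative g (at z) b))"

text \<open>Elements of \<open>C\<^sub>c\<^sup>\<infinity>(D)\<close> are represented by their extensions by zero.\<close>

definition test_function :: "'a::euclidean_space set \<Rightarrow> ('a \<Rightarrow> real) \<Rightarrow> bool" where
  "test_function D \<phi> \<longleftrightarrow> (\<forall>k. C_k k \<phi>) \<and>
     compact (closure {z. \<phi> z \<noteq> 0}) \<and> closure {z. \<phi> z \<noteq> 0} \<subseteq> D"

definition energy :: "real^3 \<Rightarrow> real" where
  "energy p = sqrt (1 + (norm p)\<^sup>2)"

definition transport :: "(phase \<Rightarrow> real) \<Rightarrow> phase \<Rightarrow> real" where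
  "transport \<phi> = (\<lambda>(y, p). frechet_derivative \<phi> (at (y, p)) ((1, 0), 0) +
     (\<Sum>i\<in>UNIV. p $ i / energy p * frechet_derivative \<phi> (at (y, p)) ((0, axis i 1), 0)))"

text \<open>The coefficients \<open>p\<^sub>i / p\<^sub>0\<close> are smooth and do not depend on \<open>(t, x)\<close>, so moving the
  derivatives of the distribution \<open>u\<close> onto the test function only changes the sign.\<close>

definition transport_equation :: "real \<Rightarrow> (phase \<Rightarrow> real) \<Rightarrow> (phase \<Rightarrow> real) \<Rightarrow> bool" where
  "transport_equation T u f \<longleftrightarrow> (\<forall>\<phi>. test_function (phase_domain T) \<phi> \<longrightarrow>
     - (LINT z|lebesgue_on (phase_domain T). u z * transport \<phi> z) =
     (LINT z|lebesgue_on (phase_domain T). f z * \<phi> z))"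

definition momentum_average :: "(phase \<Rightarrow> real) \<Rightarrow> spacetime \<Rightarrow> real" where
  "momentum_average u = (\<lambda>y. LINT p|lebesgue. u (y, p))"


subsection \<open>Fractional Sobolev spaces\<close>

definition gagliardo_integral :: "real \<Rightarrow> real \<Rightarrow> real \<Rightarrow> (spacetime \<Rightarrow> real) \<Rightarrow> ennreal" where
  "gagliardo_integral T s p v =
     (\<integral>\<^sup>+ t2. \<integral>\<^sup>+ x2. \<integral>\<^sup>+ t1. \<integral>\<^sup>+ x1.
        ennreal (\<bar>v (t1, x1) - v (t2, x2)\<bar> powr p /
          ((t1 - t2)\<^sup>2 + (norm (x1 - x2))\<^sup>2) powr ((4 + s * p) / 2))
      \<partial>lebesgue \<partial>lebesgue_on {0<..<T} \<partial>lebesgue \<partial>lebesgue_on {0<..<T})"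

definition in_Wsp :: "real \<Rightarrow> real \<Rightarrow> real \<Rightarrow> (spacetime \<Rightarrow> real) \<Rightarrow> bool" where
  "in_Wsp T s p v \<longleftrightarrow> in_Lp (spacetime_domain T) p v \<and> gagliardo_integral T s p v < \<infinity>"

text \<open>Meaningful only when the Gagliardo integral is finite, since \<open>enn2real \<infinity> = 0\<close>.\<close>

definition Wsp_seminorm :: "real \<Rightarrow> real \<Rightarrow> real \<Rightarrow> (spacetime \<Rightarrow> real) \<Rightarrow> real" where
  "Wsp_seminorm T s p v = enn2real (gagliardo_integral T s p v) powr (1 / p)"

end

theory Submission
  imports Defs
begin

text \<open>
  Write \<open>w = (1, p / p\<^sub>0)\<close> for the direction of the rays. Averaging Duhamel's formula over ray segments of
  length \<open>\<delta>\<close> expresses the pairing of \<open>u\<close> with a function \<open>\<psi>\<close> of \<open>(t, x)\<close> through the pairings of \<open>u / \<delta>\<close>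
  and \<open>f\<close> with integrals of \<open>\<psi>\<close> along segments of length \<open>\<delta>\<close>. Applied to \<open>\<psi> = \<phi>(\<cdot> - h) - \<phi>\<close>, these ray
  integrals gain, in \<open>L\<^sup>2\<close>, a power \<open>\<kappa>\<close> of \<open>min 1 (|h| / \<delta>)\<close> for every \<open>\<kappa> < 1\<close>: by \<open>T T\<^sup>*\<close> their norm only involves
  the autocorrelation of \<open>\<phi>\<close>, and a dilation of the velocity cube shows that the velocity average of an
  autocorrelation varies slowly. They are bounded on \<open>L\<^sup>1\<close> and \<open>L\<^sup>\<infinity>\<close>, so the gain persists on \<open>L\<^sup>q\<close>,
  \<open>1/p + 1/q = 1\<close>, with exponent \<open>\<kappa> min 1 (q - 1)\<close>, by real interpolation. Duality turns this into a
  bound of the \<open>p\<close>-th power of the \<open>L\<^sup>p\<close> norm of the increment of the momentum average by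
  \<open>C (min 1 (|h| / \<delta>))\<^bsup>\<kappa> min 1 (p - 1)\<^esup> (\<parallel>u\<parallel>\<^sup>p + \<delta>\<^sup>p \<parallel>f\<parallel>\<^sup>p)\<close>.
  Since \<open>s p < min 1 (p - 1)\<close>, some \<open>\<kappa> < 1\<close> makes the Gagliardo integral over \<open>h\<close> converge, with value at most
  \<open>C \<delta>\<^bsup>-s p\<^esup> (\<parallel>u\<parallel>\<^sup>p + \<delta>\<^sup>p \<parallel>f\<parallel>\<^sup>p)\<close>, and \<open>\<delta> = \<parallel>u\<parallel> / \<parallel>f\<parallel>\<close> is the optimal choice.
\<close>

subsection \<open>Radial integrals\<close>

text \<open>The increment \<open>h\<close> has a time component, while averaging in the velocity
  \<open>v\<close> only moves the spatial end point \<open>r v\<close> of an autocorrelation. A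
  shear removes this obstacle: along a ray of direction \<open>(1, v)\<close> a time shift is a
  shift of the ray parameter, cheap because the weights have bounded variation, and the rest is a
  spatial shift that changes \<open>v\<close> by an affine map within order \<open>|h| / r\<close>
  of the identity. Only the cube is deformed, so no smoothness of the autocorrelation enters.
  Integrating over pairs of ray parameters forces \<open>\<kappa> < 1\<close>; at exponent 1 a
  logarithm appears, a loss that the strict inequality on \<open>s\<close> affords. The bound on the
  momenta matters because the Jacobian \<open>energy p powr (- 5)\<close> of the velocity map
  degenerates at infinity. Transported test functions may leave the time slab; the margin
  \<open>\<epsilon>0\<close> leaves room for cutoffs that are constant near the support of
  \<open>u\<close> and multiply \<open>f\<close> by a factor in [0, 1]. Duality raises the
  \<open>L\<^sup>q\<close> gain to the power \<open>p - 1\<close>, and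
  \<open>(q - 1) (p - 1) = 1\<close> turns \<open>min 1 (q - 1)\<close> into
  \<open>min 1 (p - 1)\<close>.\<close>

lemma nn_integral_powr_from_0:
  fixes c e :: real
  assumes "0 \<le> c" "0 < e"
  shows "(\<integral>\<^sup>+ r. ennreal (r powr (e - 1)) * indicator {0<..<c} r \<partial>lborel) = ennreal (c powr e / e)"
proof -
  have "((\<lambda>r. r powr (e - 1)) has_integral (c powr e / e)) {0..c}"
    using has_integral_powr_from_0[of "e - 1" c] assms by simp
  then have "((\<lambda>r. r powr (e - 1)) has_integral (c powr e / e)) {0<..<c}"
    by (rule has_integral_spike_set_eq[THEN iffD1, rotated -1])
      (auto intro!: negligible_subset[OF negligible_finite[of "{0,c}"]])
  then have "(\<integral>\<^sup>+ r. ennreal (indicator {0<..<c} r * r powr (e - 1)) \<partial>lborel) = ennreal (c powr e / e)"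
    by (intro nn_integral_has_integral_lebesgue) auto
  moreover have "ennreal (indicator {0<..<c} r * r powr (e - 1)) = ennreal (r powr (e - 1)) * indicator {0<..<c} r" for r
    by (auto simp: indicator_def)
  ultimately show ?thesis by simp
qed

lemma nn_integral_powr_to_inf:
  fixes c a :: real
  assumes "0 < c" "0 < a"
  shows "(\<integral>\<^sup>+ r. ennreal (r powr (- a - 1)) * indicator {c<..} r \<partial>lborel) = ennreal (c powr (- a) / a)"
proof -
  have "((\<lambda>r. r powr (- a - 1)) has_integral (c powr (- a) / a)) {c..}"
    using has_integral_powr_to_inf[of "- a - 1" c] assms by simp
  then have "((\<lambda>r. r powr (- a - 1)) has_integral (c powr (- a) / a)) {c<..}"
    by (rule has_integral_spike_set_eq[THEN iffD1, rotated -1])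
      (auto intro!: negligible_subset[OF negligible_finite[of "{c}"]])
  then have "(\<integral>\<^sup>+ r. ennreal (indicator {c<..} r * r powr (- a - 1)) \<partial>lborel) = ennreal (c powr (- a) / a)"
    by (intro nn_integral_has_integral_lebesgue) auto
  moreover have "ennreal (indicator {c<..} r * r powr (- a - 1)) = ennreal (r powr (- a - 1)) * indicator {c<..} r" for r
    by (auto simp: indicator_def)
  ultimately show ?thesis by simp
qed

text \<open>Polar coordinates are replaced by a layer cake: with \<open>m = n + a\<close>,
  \<open>norm h powr (- m)\<close> is \<open>m\<close> times the integral of
  \<open>r powr (- m - 1)\<close> over \<open>r > norm h\<close>, and the factor with
  \<open>min\<close> may be evaluated at the larger \<open>r\<close>. After exchanging the integrals
  only volumes of balls remain. The condition \<open>a < b\<close> makes the part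
  \<open>r < \<delta>\<close> converge, \<open>0 < a\<close> the part
  \<open>r > \<delta>\<close>.\<close>

lemma nn_integral_radial_bound:
  fixes a b :: real
  assumes "0 < a" "a < b"
  shows "\<exists>C\<ge>0. \<forall>\<delta>>0. (\<integral>\<^sup>+ (h::'a::euclidean_space).
     ennreal (norm h powr (- (DIM('a) + a)) * min 1 (norm h / \<delta>) powr b) \<partial>lborel) \<le> ennreal (C * \<delta> powr (- a))"
proof -
  define n where "n = real DIM('a)"
  define V where "V = unit_ball_vol n"
  define m where "m = n + a"
  have n: "n > 0" by (simp add: n_def)
  have V: "V \<ge> 0" by (simp add: V_def n_def)
  have m: "m > 0" using n assms by (simp add: m_def)
  have "(\<integral>\<^sup>+ (h::'a). ennreal (norm h powr (- m) * min 1 (norm h / \<delta>) powr b) \<partial>lborel)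
     \<le> ennreal ((m * V * (1/(b-a) + 1/a)) * \<delta> powr (- a))" if \<delta>: "\<delta> > 0" for \<delta>
  proof -
    let ?k = "\<lambda>r. m * r powr (- m - 1) * min 1 (r / \<delta>) powr b"
    have "(\<integral>\<^sup>+ (h::'a). ennreal (norm h powr (- m) * min 1 (norm h / \<delta>) powr b) \<partial>lborel)
       \<le> (\<integral>\<^sup>+ (h::'a). \<integral>\<^sup>+ r. ennreal (?k r) * indicator {norm h<..} r \<partial>lborel \<partial>lborel)"
    proof (rule nn_integral_mono)
      fix h :: 'a
      show "ennreal (norm h powr (- m) * min 1 (norm h / \<delta>) powr b)
         \<le> (\<integral>\<^sup>+ r. ennreal (?k r) * indicator {norm h<..} r \<partial>lborel)"
      proof (cases "h = 0")
        case False
        have "ennreal (norm h powr (- m) * min 1 (norm h / \<delta>) powr b)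
           = ennreal (m * min 1 (norm h / \<delta>) powr b) * ennreal (norm h powr (- m) / m)"
          using m by (subst ennreal_mult[symmetric]) auto
        also have "\<dots> = ennreal (m * min 1 (norm h / \<delta>) powr b) *
            (\<integral>\<^sup>+ r. ennreal (r powr (- m - 1)) * indicator {norm h<..} r \<partial>lborel)"
          using False m by (subst nn_integral_powr_to_inf) auto
        also have "\<dots> = (\<integral>\<^sup>+ r. ennreal (m * min 1 (norm h / \<delta>) powr b) *
             (ennreal (r powr (- m - 1)) * indicator {norm h<..} r) \<partial>lborel)"
          by (subst nn_integral_cmult) auto
        also have "\<dots> \<le> (\<integral>\<^sup>+ r. ennreal (?k r) * indicator {norm h<..} r \<partial>lborel)"
        proof (intro nn_integral_mono)
          fix r :: real
          show "ennreal (m * min 1 (norm h / \<delta>) powr b) * (ennreal (r powr (- m - 1)) * indicator {norm h<..} r)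
             \<le> ennreal (?k r) * indicator {norm h<..} r"
          proof (cases "norm h < r")
            case True
            have "min 1 (norm h / \<delta>) powr b \<le> min 1 (r / \<delta>) powr b"
              using True \<delta> assms by (intro powr_mono2 min.mono) (auto simp: divide_right_mono)
            then show ?thesis using True m
              by (simp add: ennreal_mult[symmetric] mult.commute[of "min 1 (norm h / \<delta>) powr b"] mult_left_mono mult.assoc)
          qed auto
        qed
        finally show ?thesis .
      qed simp
    qed
    also have "\<dots> = (\<integral>\<^sup>+ r. \<integral>\<^sup>+ (h::'a). ennreal (?k r) * indicator {norm h<..} r \<partial>lborel \<partial>lborel)"
    proof (rule lborel_pair.Fubini'[symmetric])
      have "(\<lambda>(h::'a, r). ennreal (?k r) * indicator {norm h<..} r)
          = (\<lambda>z. ennreal (?k (snd z)) * indicator {z. norm (fst z) < snd z} z)"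
        by (auto simp: indicator_def fun_eq_iff)
      also have "\<dots> \<in> borel_measurable (lborel \<Otimes>\<^sub>M lborel)"
        by measurable
      finally show "(\<lambda>(h::'a, r). ennreal (?k r) * indicator {norm h<..} r) \<in> borel_measurable (lborel \<Otimes>\<^sub>M lborel)" .
    qed
    also have "\<dots> \<le> (\<integral>\<^sup>+ r. ennreal (m * V) * (ennreal (\<delta> powr (- b)) * (ennreal (r powr (b - a - 1)) * indicator {0<..<\<delta>} r)
        + ennreal (r powr (- a - 1)) * indicator {\<delta><..} r) \<partial>lborel)"
    proof (rule nn_integral_mono_AE)
      have "AE r in lborel. r \<noteq> \<delta>"
        by (rule AE_lborel_singleton)
      then show "AE r in lborel. (\<integral>\<^sup>+ (h::'a). ennreal (?k r) * indicator {norm h<..} r \<partial>lborel)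
         \<le> ennreal (m * V) * (ennreal (\<delta> powr (- b)) * (ennreal (r powr (b - a - 1)) * indicator {0<..<\<delta>} r)
        + ennreal (r powr (- a - 1)) * indicator {\<delta><..} r)"
      proof eventually_elim
        case (elim r)
        show ?case
        proof (cases "r > 0")
          case False
          then have "indicator {norm h<..} r = (0::ennreal)" for h :: 'a
            by (auto simp: indicator_def) (meson le_less_trans norm_ge_zero)
          then show ?thesis by simp
        next
          case r: True
          have "(\<integral>\<^sup>+ (h::'a). ennreal (?k r) * indicator {norm h<..} r \<partial>lborel)
             = (\<integral>\<^sup>+ (h::'a). ennreal (?k r) * indicator (ball 0 r) h \<partial>lborel)"
            by (intro nn_integral_cong) (auto simp: indicator_def)
          also have "\<dots> = ennreal (?k r) * ennreal (V * r ^ DIM('a))"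
            using r by (subst nn_integral_cmult_indicator) (auto simp: emeasure_ball V_def n_def)
          also have "r ^ DIM('a) = r powr n" using r by (simp add: n_def powr_realpow)
          also have "ennreal (?k r) * ennreal (V * r powr n) = ennreal (m * V) * ennreal (r powr (- m - 1) * r powr n * min 1 (r / \<delta>) powr b)"
            using m V r by (simp add: ennreal_mult[symmetric] mult_ac)
          also have "r powr (- m - 1) * r powr n = r powr (- a - 1)"
            by (simp add: powr_add[symmetric] m_def)
          also have "ennreal (r powr (- a - 1) * min 1 (r / \<delta>) powr b) \<le>
             ennreal (\<delta> powr (- b)) * (ennreal (r powr (b - a - 1)) * indicator {0<..<\<delta>} r)
              + ennreal (r powr (- a - 1)) * indicator {\<delta><..} r"
          proof (cases "r < \<delta>")
            case True
            then have "r powr (- a - 1) * min 1 (r / \<delta>) powr b = \<delta> powr (- b) * r powr (b - a - 1)"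
              using r \<delta> by (simp add: min_def powr_divide powr_minus powr_diff powr_add field_simps)
            then show ?thesis using True r by (simp add: ennreal_mult[symmetric])
          next
            case False
            then show ?thesis using r \<delta> elim by (simp add: min_def)
          qed
          finally show ?thesis by (simp add: mult_left_mono)
        qed
      qed
    qed
    also have "\<dots> = ennreal (m * V) * (ennreal (\<delta> powr (- b)) * ennreal (\<delta> powr (b - a) / (b - a)) + ennreal (\<delta> powr (- a) / a))"
    proof -
      have "(\<integral>\<^sup>+ r. ennreal (r powr (b - a - 1)) * indicator {0<..<\<delta>} r \<partial>lborel) = ennreal (\<delta> powr (b - a) / (b - a))"
        using assms \<delta> nn_integral_powr_from_0[of \<delta> "b - a"] by simp
      moreover have "(\<integral>\<^sup>+ r. ennreal (r powr (- a - 1)) * indicator {\<delta><..} r \<partial>lborel) = ennreal (\<delta> powr (- a) / a)"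
        using assms \<delta> nn_integral_powr_to_inf[of \<delta> a] by simp
      ultimately show ?thesis by (simp add: nn_integral_cmult nn_integral_add)
    qed
    also have "\<dots> = ennreal ((m * V * (1/(b-a) + 1/a)) * \<delta> powr (- a))"
    proof -
      have "\<delta> powr (- b) * (\<delta> powr (b - a) / (b - a)) + \<delta> powr (- a) / a = (1/(b-a) + 1/a) * \<delta> powr (- a)"
        using assms by (simp add: powr_add[symmetric] field_simps)
      then show ?thesis using assms m V
        by (simp add: ennreal_mult[symmetric] ennreal_plus[symmetric] mult_ac del: ennreal_plus)
    qed
    finally show ?thesis .
  qed
  moreover have "m * V * (1/(b-a) + 1/a) \<ge> 0" using m V assms by auto
  ultimately show ?thesis unfolding m_def n_def by blast
qed

subsection \<open>Interpolation between \<open>L\<^sup>1\<close>, \<open>L\<^sup>2\<close> and \<open>L\<^sup>\<infinity>\<close>\<close>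

lemma emeasure_superlevel_le:
  fixes F :: "'a::euclidean_space \<Rightarrow> real"
  assumes [measurable]: "F \<in> borel_measurable borel" and "\<alpha> > 0" "r > 0"
  shows "emeasure lborel {y. \<alpha> < \<bar>F y\<bar>} \<le> ennreal (\<alpha> powr (- r)) * (\<integral>\<^sup>+ y. ennreal (\<bar>F y\<bar> powr r) \<partial>lborel)"
proof -
  have "emeasure lborel {y. \<alpha> < \<bar>F y\<bar>} = (\<integral>\<^sup>+ y. indicator {y. \<alpha> < \<bar>F y\<bar>} y \<partial>lborel)"
    by (subst nn_integral_indicator) auto
  also have "\<dots> \<le> (\<integral>\<^sup>+ y. ennreal (\<alpha> powr (- r)) * ennreal (\<bar>F y\<bar> powr r) \<partial>lborel)"
  proof (rule nn_integral_mono)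
    fix y
    show "indicator {y. \<alpha> < \<bar>F y\<bar>} y \<le> ennreal (\<alpha> powr (- r)) * ennreal (\<bar>F y\<bar> powr r)"
    proof (cases "\<alpha> < \<bar>F y\<bar>")
      case True
      then have "\<alpha> powr r \<le> \<bar>F y\<bar> powr r" using assms by (intro powr_mono2) auto
      then have "1 \<le> \<alpha> powr (- r) * \<bar>F y\<bar> powr r"
        using assms by (simp add: powr_minus field_simps)
      then show ?thesis using True by (simp add: ennreal_mult[symmetric])
    qed auto
  qed
  also have "\<dots> = ennreal (\<alpha> powr (- r)) * (\<integral>\<^sup>+ y. ennreal (\<bar>F y\<bar> powr r) \<partial>lborel)"
    by (rule nn_integral_cmult) measurable
  finally show ?thesis .
qed

lemma nn_integral_powr_layer_cake:
  fixes F :: "'a::euclidean_space \<Rightarrow> real"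
  assumes [measurable]: "F \<in> borel_measurable borel" and q: "q > 0"
  shows "(\<integral>\<^sup>+ y. ennreal (\<bar>F y\<bar> powr q) \<partial>lborel)
    = (\<integral>\<^sup>+ \<alpha>. ennreal (q * \<alpha> powr (q - 1)) * indicator {0<..} \<alpha> * emeasure lborel {y. \<alpha> < \<bar>F y\<bar>} \<partial>lborel)"
proof -
  have "(\<integral>\<^sup>+ y. ennreal (\<bar>F y\<bar> powr q) \<partial>lborel)
     = (\<integral>\<^sup>+ y. \<integral>\<^sup>+ \<alpha>. ennreal (q * \<alpha> powr (q - 1)) * indicator {0<..} \<alpha> * indicator {\<alpha><..} \<bar>F y\<bar> \<partial>lborel \<partial>lborel)"
  proof (rule nn_integral_cong)
    fix y
    have "ennreal (\<bar>F y\<bar> powr q) = ennreal q * ennreal (\<bar>F y\<bar> powr q / q)"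
      using q by (simp add: ennreal_mult[symmetric])
    also have "\<dots> = (\<integral>\<^sup>+ \<alpha>. ennreal q * (ennreal (\<alpha> powr (q - 1)) * indicator {0<..<\<bar>F y\<bar>} \<alpha>) \<partial>lborel)"
      using q by (subst nn_integral_cmult) (auto simp: nn_integral_powr_from_0)
    also have "\<dots> = (\<integral>\<^sup>+ \<alpha>. ennreal (q * \<alpha> powr (q - 1)) * indicator {0<..} \<alpha> * indicator {\<alpha><..} \<bar>F y\<bar> \<partial>lborel)"
      using q by (intro nn_integral_cong) (auto simp: ennreal_mult indicator_def)
    finally show "ennreal (\<bar>F y\<bar> powr q) = \<dots>" .
  qed
  also have "\<dots> = (\<integral>\<^sup>+ \<alpha>. \<integral>\<^sup>+ y. ennreal (q * \<alpha> powr (q - 1)) * indicator {0<..} \<alpha> * indicator {\<alpha><..} \<bar>F y\<bar> \<partial>lborel \<partial>lborel)"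
  proof (rule lborel_pair.Fubini'[symmetric])
    have "(\<lambda>(y, \<alpha>). ennreal (q * \<alpha> powr (q - 1)) * indicator {0<..} \<alpha> * indicator {\<alpha><..} \<bar>F y\<bar>)
      = (\<lambda>z. ennreal (q * snd z powr (q - 1)) * indicator {0<..} (snd z) * indicator {z. snd z < \<bar>F (fst z)\<bar>} z)"
      by (auto simp: indicator_def fun_eq_iff)
    also have "\<dots> \<in> borel_measurable (lborel \<Otimes>\<^sub>M lborel)" by measurable
    finally show "(\<lambda>(y, \<alpha>). ennreal (q * \<alpha> powr (q - 1)) * indicator {0<..} \<alpha> * indicator {\<alpha><..} \<bar>F y\<bar>)
        \<in> borel_measurable (lborel \<Otimes>\<^sub>M lborel)" .
  qed
  also have "\<dots> = (\<integral>\<^sup>+ \<alpha>. ennreal (q * \<alpha> powr (q - 1)) * indicator {0<..} \<alpha> * emeasure lborel {y. \<alpha> < \<bar>F y\<bar>} \<partial>lborel)"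
  proof (rule nn_integral_cong)
    fix \<alpha>
    have "(\<integral>\<^sup>+ y. ennreal (q * \<alpha> powr (q - 1)) * indicator {0<..} \<alpha> * indicator {\<alpha><..} \<bar>F y\<bar> \<partial>lborel)
      = (\<integral>\<^sup>+ y. (ennreal (q * \<alpha> powr (q - 1)) * indicator {0<..} \<alpha>) * indicator {y. \<alpha> < \<bar>F y\<bar>} y \<partial>lborel)"
      by (intro nn_integral_cong) (auto simp: indicator_def)
    also have "\<dots> = ennreal (q * \<alpha> powr (q - 1)) * indicator {0<..} \<alpha> * emeasure lborel {y. \<alpha> < \<bar>F y\<bar>}"
      by (rule nn_integral_cmult_indicator) auto
    finally show "(\<integral>\<^sup>+ y. ennreal (q * \<alpha> powr (q - 1)) * indicator {0<..} \<alpha> * indicator {\<alpha><..} \<bar>F y\<bar> \<partial>lborel) = \<dots>" .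
  qed
  finally show ?thesis .
qed

text \<open>A weak-type bound for every level \<open>\<alpha>\<close> is given as an integral over
  \<open>x\<close> of a kernel that depends only on \<open>\<alpha>\<close> and
  \<open>|\<phi> x|\<close>. Exchanging the integrals leaves, for each \<open>x\<close>, a
  one-dimensional integral in \<open>\<alpha>\<close>, which is all that the two interpolation
  lemmas have to compute.\<close>

lemma nn_integral_powr_le_from_superlevel:
  fixes F :: "'b::euclidean_space \<Rightarrow> real" and \<phi> :: "'a::euclidean_space \<Rightarrow> real"
    and H :: "real \<Rightarrow> real \<Rightarrow> ennreal"
  assumes [measurable]: "F \<in> borel_measurable borel" "\<phi> \<in> borel_measurable borel"
    and H[measurable]: "case_prod H \<in> borel_measurable (borel \<Otimes>\<^sub>M borel)" and q: "q > 0"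
    and le: "\<And>\<alpha>. \<alpha> > 0 \<Longrightarrow> emeasure lborel {y. \<alpha> < \<bar>F y\<bar>} \<le> (\<integral>\<^sup>+ x. H \<alpha> \<bar>\<phi> x\<bar> \<partial>lborel)"
  shows "(\<integral>\<^sup>+ y. ennreal (\<bar>F y\<bar> powr q) \<partial>lborel)
    \<le> (\<integral>\<^sup>+ x. \<integral>\<^sup>+ \<alpha>. ennreal (q * \<alpha> powr (q - 1)) * indicator {0<..} \<alpha> * H \<alpha> \<bar>\<phi> x\<bar> \<partial>lborel \<partial>lborel)"
proof -
  have "(\<integral>\<^sup>+ y. ennreal (\<bar>F y\<bar> powr q) \<partial>lborel) \<le>
     (\<integral>\<^sup>+ \<alpha>. ennreal (q * \<alpha> powr (q - 1)) * indicator {0<..} \<alpha> * (\<integral>\<^sup>+ x. H \<alpha> \<bar>\<phi> x\<bar> \<partial>lborel) \<partial>lborel)"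
    unfolding nn_integral_powr_layer_cake[OF assms(1) q]
    by (intro nn_integral_mono) (auto simp: indicator_def intro!: mult_left_mono le)
  also have "\<dots> = (\<integral>\<^sup>+ \<alpha>. \<integral>\<^sup>+ x. ennreal (q * \<alpha> powr (q - 1)) * indicator {0<..} \<alpha> * H \<alpha> \<bar>\<phi> x\<bar> \<partial>lborel \<partial>lborel)"
    by (intro nn_integral_cong nn_integral_cmult[symmetric]) measurable
  also have "\<dots> = (\<integral>\<^sup>+ x. \<integral>\<^sup>+ \<alpha>. ennreal (q * \<alpha> powr (q - 1)) * indicator {0<..} \<alpha> * H \<alpha> \<bar>\<phi> x\<bar> \<partial>lborel \<partial>lborel)"
    by (rule lborel_pair.Fubini') measurable
  finally show ?thesis .
qed

text \<open>\<open>T\<close> is \<open>K\<close>-bounded on \<open>L\<^sup>1\<close> and on \<open>L\<^sup>\<infinity>\<close> and gains the factor \<open>\<epsilon>\<close> on \<open>L\<^sup>2\<close>; only the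
  truncations of one function \<open>\<phi>\<close> are needed for interpolation.\<close>

definition interpolable :: "real \<Rightarrow> real \<Rightarrow> (('a::euclidean_space \<Rightarrow> real) \<Rightarrow> 'b::euclidean_space \<Rightarrow> real) \<Rightarrow> ('a \<Rightarrow> real) \<Rightarrow> bool" where
  "interpolable K \<epsilon> T \<phi> \<longleftrightarrow> \<phi> \<in> borel_measurable borel \<and> T \<phi> \<in> borel_measurable borel \<and>
    (\<forall>A\<in>sets borel. T (\<lambda>x. indicator A x * \<phi> x) \<in> borel_measurable borel \<and>
      (\<forall>y. T \<phi> y = T (\<lambda>x. indicator A x * \<phi> x) y + T (\<lambda>x. indicator (- A) x * \<phi> x) y) \<and>
      (\<integral>\<^sup>+ y. ennreal \<bar>T (\<lambda>x. indicator A x * \<phi> x) y\<bar> \<partial>lborel) \<le> ennreal K * (\<integral>\<^sup>+ x. indicator A x * ennreal \<bar>\<phi> x\<bar> \<partial>lborel) \<and>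
      (\<integral>\<^sup>+ y. ennreal (\<bar>T (\<lambda>x. indicator A x * \<phi> x) y\<bar>\<^sup>2) \<partial>lborel) \<le> ennreal (K * \<epsilon>) * (\<integral>\<^sup>+ x. indicator A x * ennreal (\<bar>\<phi> x\<bar>\<^sup>2) \<partial>lborel) \<and>
      (\<forall>N\<ge>0. (\<forall>x\<in>A. \<bar>\<phi> x\<bar> \<le> N) \<longrightarrow> (\<forall>y. \<bar>T (\<lambda>x. indicator A x * \<phi> x) y\<bar> \<le> K * N)))"

text \<open>Marcinkiewicz interpolation with the truncation height tied to
  \<open>\<epsilon>\<close>: at level \<open>\<alpha>\<close> the part of \<open>\<phi>\<close>
  above \<open>\<alpha> / \<epsilon>\<close> is charged to the \<open>L\<^sup>1\<close> bound and
  the rest to \<open>L\<^sup>2\<close>. With this height both parts produce the same power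
  \<open>\<epsilon> powr (q - 1)\<close>. The integrals in \<open>\<alpha>\<close> converge at 0
  because \<open>1 < q\<close> and at infinity because \<open>q < 2\<close>.\<close>

lemma interpolation_low:
  assumes T: "interpolable K \<epsilon> T \<phi>" and K: "K > 0" and \<epsilon>: "\<epsilon> > 0" and q: "1 < q" "q < 2"
  shows "(\<integral>\<^sup>+ y. ennreal (\<bar>T \<phi> y\<bar> powr q) \<partial>lborel)
    \<le> ennreal ((2 * q / (q - 1) + 4 * q / (2 - q)) * K * \<epsilon> powr (q - 1)) * (\<integral>\<^sup>+ x. ennreal (\<bar>\<phi> x\<bar> powr q) \<partial>lborel)"
proof -
  have [measurable]: "\<phi> \<in> borel_measurable borel" "T \<phi> \<in> borel_measurable borel"
    using T by (auto simp: interpolable_def)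
  define H :: "real \<Rightarrow> real \<Rightarrow> ennreal" where "H = (\<lambda>\<alpha> t. ennreal (2 * K / \<alpha> * t) * indicator {z. fst z < \<epsilon> * snd z} (\<alpha>, t)
      + ennreal (4 * K * \<epsilon> / \<alpha>\<^sup>2 * t\<^sup>2) * indicator {z. fst z \<ge> \<epsilon> * snd z} (\<alpha>, t))"
  have Hm: "case_prod H \<in> borel_measurable (borel \<Otimes>\<^sub>M borel)"
  proof -
    have "case_prod H = (\<lambda>z. ennreal (2 * K / fst z * snd z) * indicator {z. fst z < \<epsilon> * snd z} z
      + ennreal (4 * K * \<epsilon> / (fst z)\<^sup>2 * (snd z)\<^sup>2) * indicator {z. fst z \<ge> \<epsilon> * snd z} z)"
      by (auto simp: H_def fun_eq_iff)
    also have "\<dots> \<in> borel_measurable (borel \<Otimes>\<^sub>M borel)" by measurable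
    finally show ?thesis .
  qed
  have "(\<integral>\<^sup>+ y. ennreal (\<bar>T \<phi> y\<bar> powr q) \<partial>lborel)
    \<le> (\<integral>\<^sup>+ x. \<integral>\<^sup>+ \<alpha>. ennreal (q * \<alpha> powr (q - 1)) * indicator {0<..} \<alpha> * H \<alpha> \<bar>\<phi> x\<bar> \<partial>lborel \<partial>lborel)"
  proof (rule nn_integral_powr_le_from_superlevel)
    fix \<alpha> :: real assume \<alpha>: "\<alpha> > 0"
    define A where "A = {x. \<alpha> < \<epsilon> * \<bar>\<phi> x\<bar>}"
    have A[measurable]: "A \<in> sets borel" unfolding A_def by measurable
    define T1 where "T1 = T (\<lambda>x. indicator A x * \<phi> x)"
    define T2 where "T2 = T (\<lambda>x. indicator (- A) x * \<phi> x)"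
    have nA: "- A \<in> sets borel" by auto
    have [measurable]: "T1 \<in> borel_measurable borel" "T2 \<in> borel_measurable borel"
      using T A nA by (auto simp: interpolable_def T1_def T2_def)
    have eq: "T \<phi> y = T1 y + T2 y" for y
      using T A unfolding interpolable_def T1_def T2_def by blast
    have b1: "(\<integral>\<^sup>+ y. ennreal \<bar>T1 y\<bar> \<partial>lborel) \<le> ennreal K * (\<integral>\<^sup>+ x. indicator A x * ennreal \<bar>\<phi> x\<bar> \<partial>lborel)"
      using T A unfolding interpolable_def T1_def by blast
    have b2: "(\<integral>\<^sup>+ y. ennreal (\<bar>T2 y\<bar>\<^sup>2) \<partial>lborel) \<le> ennreal (K * \<epsilon>) * (\<integral>\<^sup>+ x. indicator (- A) x * ennreal (\<bar>\<phi> x\<bar>\<^sup>2) \<partial>lborel)"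
      using T nA unfolding interpolable_def T2_def by blast
    have "emeasure lborel {y. \<alpha> < \<bar>T \<phi> y\<bar>} \<le> emeasure lborel ({y. \<alpha> / 2 < \<bar>T1 y\<bar>} \<union> {y. \<alpha> / 2 < \<bar>T2 y\<bar>})"
      by (rule emeasure_mono) (auto simp: eq)
    also have "\<dots> \<le> emeasure lborel {y. \<alpha> / 2 < \<bar>T1 y\<bar>} + emeasure lborel {y. \<alpha> / 2 < \<bar>T2 y\<bar>}"
      by (rule emeasure_subadditive) auto
    also have "\<dots> \<le> ennreal ((\<alpha> / 2) powr - 1) * (\<integral>\<^sup>+ y. ennreal (\<bar>T1 y\<bar> powr 1) \<partial>lborel)
        + ennreal ((\<alpha> / 2) powr - 2) * (\<integral>\<^sup>+ y. ennreal (\<bar>T2 y\<bar> powr 2) \<partial>lborel)"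
      using \<alpha> by (intro add_mono emeasure_superlevel_le) auto
    also have "\<dots> \<le> ennreal (2 / \<alpha>) * (ennreal K * (\<integral>\<^sup>+ x. indicator A x * ennreal \<bar>\<phi> x\<bar> \<partial>lborel))
        + ennreal (4 / \<alpha>\<^sup>2) * (ennreal (K * \<epsilon>) * (\<integral>\<^sup>+ x. indicator (- A) x * ennreal (\<bar>\<phi> x\<bar>\<^sup>2) \<partial>lborel))"
    proof -
      have "(\<alpha> / 2) powr - 1 = 2 / \<alpha>" using \<alpha> by (simp add: powr_minus)
      moreover have "(\<alpha> / 2) powr - 2 = 4 / \<alpha>\<^sup>2" using \<alpha> by (simp add: powr_minus power_divide)
      ultimately show ?thesis using b1 b2 by (simp add: add_mono mult_left_mono)
    qed
    also have "\<dots> = (\<integral>\<^sup>+ x. ennreal (2 / \<alpha>) * (ennreal K * (indicator A x * ennreal \<bar>\<phi> x\<bar>))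
        + ennreal (4 / \<alpha>\<^sup>2) * (ennreal (K * \<epsilon>) * (indicator (- A) x * ennreal (\<bar>\<phi> x\<bar>\<^sup>2))) \<partial>lborel)"
      by (simp add: nn_integral_add nn_integral_cmult)
    also have "\<dots> = (\<integral>\<^sup>+ x. H \<alpha> \<bar>\<phi> x\<bar> \<partial>lborel)"
      using K \<epsilon> \<alpha> by (intro nn_integral_cong) (auto simp: H_def A_def indicator_def ennreal_mult[symmetric] power2_eq_square)
    finally show "emeasure lborel {y. \<alpha> < \<bar>T \<phi> y\<bar>} \<le> (\<integral>\<^sup>+ x. H \<alpha> \<bar>\<phi> x\<bar> \<partial>lborel)" .
  qed (use Hm q in auto)
  also have "\<dots> \<le> (\<integral>\<^sup>+ x. ennreal ((2 * q / (q - 1) + 4 * q / (2 - q)) * K * \<epsilon> powr (q - 1)) * ennreal (\<bar>\<phi> x\<bar> powr q) \<partial>lborel)"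
  proof (rule nn_integral_mono)
    fix x
    define t where "t = \<bar>\<phi> x\<bar>"
    have t: "t \<ge> 0" by (simp add: t_def)
    show "(\<integral>\<^sup>+ \<alpha>. ennreal (q * \<alpha> powr (q - 1)) * indicator {0<..} \<alpha> * H \<alpha> \<bar>\<phi> x\<bar> \<partial>lborel)
       \<le> ennreal ((2 * q / (q - 1) + 4 * q / (2 - q)) * K * \<epsilon> powr (q - 1)) * ennreal (\<bar>\<phi> x\<bar> powr q)"
      unfolding t_def[symmetric]
    proof (cases "t = 0")
      case True
      have "H \<alpha> 0 = 0" for \<alpha> by (simp add: H_def)
      then show "(\<integral>\<^sup>+ \<alpha>. ennreal (q * \<alpha> powr (q - 1)) * indicator {0<..} \<alpha> * H \<alpha> t \<partial>lborel)
       \<le> ennreal ((2 * q / (q - 1) + 4 * q / (2 - q)) * K * \<epsilon> powr (q - 1)) * ennreal (t powr q)"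
        using True by simp
    next
      case False
      then have t: "t > 0" using t by simp
      have "(\<integral>\<^sup>+ \<alpha>. ennreal (q * \<alpha> powr (q - 1)) * indicator {0<..} \<alpha> * H \<alpha> t \<partial>lborel)
        = (\<integral>\<^sup>+ \<alpha>. ennreal (2 * q * K * t) * (ennreal (\<alpha> powr (q - 1 - 1)) * indicator {0<..<\<epsilon> * t} \<alpha>)
          + ennreal (4 * q * K * \<epsilon> * t\<^sup>2) * (ennreal (\<alpha> powr (- (2 - q) - 1)) * indicator {\<epsilon> * t<..} \<alpha>) \<partial>lborel)"
      proof (rule nn_integral_cong_AE)
        \<comment> \<open>The level \<open>\<alpha> = \<epsilon> * t\<close> belongs to neither of
          the two open intervals.\<close>
        have "AE \<alpha> in lborel. \<alpha> \<noteq> \<epsilon> * t"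
          by (rule AE_lborel_singleton)
        then show "AE \<alpha> in lborel. ennreal (q * \<alpha> powr (q - 1)) * indicator {0<..} \<alpha> * H \<alpha> t
          = ennreal (2 * q * K * t) * (ennreal (\<alpha> powr (q - 1 - 1)) * indicator {0<..<\<epsilon> * t} \<alpha>)
          + ennreal (4 * q * K * \<epsilon> * t\<^sup>2) * (ennreal (\<alpha> powr (- (2 - q) - 1)) * indicator {\<epsilon> * t<..} \<alpha>)"
        proof eventually_elim
          case (elim \<alpha>)
          have et: "\<epsilon> * t > 0" using \<epsilon> t by simp
          have "\<alpha> powr (q - 1) / \<alpha> = \<alpha> powr (q - 1 - 1)" if "\<alpha> > 0"
            using that by (subst powr_diff[of \<alpha> "q - 1" 1]) auto
          moreover have "\<alpha> powr (q - 1) / \<alpha>\<^sup>2 = \<alpha> powr (- (2 - q) - 1)" if "\<alpha> > 0"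
          proof -
            have "\<alpha> powr (- (2 - q) - 1) = \<alpha> powr (q - 1 - 2)" by (rule arg_cong[where f="\<lambda>z. \<alpha> powr z"]) simp
            then show ?thesis using that by (subst (asm) powr_diff) auto
          qed
          ultimately show ?case using elim et q K \<epsilon> t
            apply (auto simp: H_def indicator_def ennreal_mult[symmetric] dest: order_less_trans[OF et])
             apply (simp_all add: field_simps power2_eq_square)
            done
        qed
      qed
      also have "\<dots> = ennreal (2 * q * K * t) * ennreal ((\<epsilon> * t) powr (q - 1) / (q - 1))
          + ennreal (4 * q * K * \<epsilon> * t\<^sup>2) * ennreal ((\<epsilon> * t) powr (- (2 - q)) / (2 - q))"
        using nn_integral_powr_from_0[of "\<epsilon> * t" "q - 1"] nn_integral_powr_to_inf[of "\<epsilon> * t" "2 - q"] \<epsilon> t q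
        by (simp add: nn_integral_add nn_integral_cmult)
      also have "\<dots> = ennreal (2 * q * K * t * ((\<epsilon> * t) powr (q - 1) / (q - 1)) + 4 * q * K * \<epsilon> * t\<^sup>2 * ((\<epsilon> * t) powr (- (2 - q)) / (2 - q)))"
        using K \<epsilon> t q by (simp add: ennreal_mult[symmetric] ennreal_plus[symmetric] del: ennreal_plus)
      also have "2 * q * K * t * ((\<epsilon> * t) powr (q - 1) / (q - 1)) + 4 * q * K * \<epsilon> * t\<^sup>2 * ((\<epsilon> * t) powr (- (2 - q)) / (2 - q))
         = (2 * q / (q - 1) + 4 * q / (2 - q)) * K * \<epsilon> powr (q - 1) * t powr q"
      proof -
        have 1: "t * t powr (q - 1) = t powr q"
          using t by (simp add: powr_diff)
        have e: "x powr (- (2 - q)) = x powr q / x\<^sup>2" if "x > 0" for x :: real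
        proof -
          have "x powr (- (2 - q)) = x powr (q - 2)" by simp
          then show ?thesis using that by (subst (asm) powr_diff) auto
        qed
        have 2: "t\<^sup>2 * t powr (- (2 - q)) = t powr q" using t by (simp only: e) simp
        have 3: "\<epsilon> * \<epsilon> powr (- (2 - q)) = \<epsilon> powr (q - 1)"
          using \<epsilon> by (simp only: e) (simp add: powr_diff power2_eq_square)
        have a: "2 * q * K * t * ((\<epsilon> * t) powr (q - 1) / (q - 1)) = 2 * q / (q - 1) * K * \<epsilon> powr (q - 1) * (t * t powr (q - 1))"
          using \<epsilon> t by (simp add: powr_mult)
        have b: "4 * q * K * \<epsilon> * t\<^sup>2 * ((\<epsilon> * t) powr (- (2 - q)) / (2 - q))
           = 4 * q / (2 - q) * K * (\<epsilon> * \<epsilon> powr (- (2 - q))) * (t\<^sup>2 * t powr (- (2 - q)))"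
          using \<epsilon> t by (simp add: powr_mult)
        show ?thesis unfolding a b 1 2 3 by (simp add: algebra_simps)
      qed
      finally show "(\<integral>\<^sup>+ \<alpha>. ennreal (q * \<alpha> powr (q - 1)) * indicator {0<..} \<alpha> * H \<alpha> t \<partial>lborel)
       \<le> ennreal ((2 * q / (q - 1) + 4 * q / (2 - q)) * K * \<epsilon> powr (q - 1)) * ennreal (t powr q)"
        using K \<epsilon> q by (simp add: ennreal_mult[symmetric])
    qed
  qed
  also have "\<dots> = ennreal ((2 * q / (q - 1) + 4 * q / (2 - q)) * K * \<epsilon> powr (q - 1)) * (\<integral>\<^sup>+ x. ennreal (\<bar>\<phi> x\<bar> powr q) \<partial>lborel)"
    by (rule nn_integral_cmult) measurable
  finally show ?thesis .
qed

text \<open>At level \<open>\<alpha>\<close> the truncation height is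
  \<open>\<alpha> / (2 K)\<close>, so the bounded part contributes at most
  \<open>\<alpha> / 2\<close> by the sup bound and drops out of the superlevel set. What remains is
  charged to \<open>L\<^sup>2\<close>; its integral over \<open>\<alpha> < 2 K t\<close> converges
  at 0 because \<open>q > 2\<close>, and the gain stays \<open>\<epsilon>\<close> to the first
  power.\<close>

lemma interpolation_high:
  assumes T: "interpolable K \<epsilon> T \<phi>" and K: "K > 0" and \<epsilon>: "\<epsilon> > 0" and q: "2 < q"
  shows "(\<integral>\<^sup>+ y. ennreal (\<bar>T \<phi> y\<bar> powr q) \<partial>lborel)
    \<le> ennreal (4 * q / (q - 2) * K * (2 * K) powr (q - 2) * \<epsilon>) * (\<integral>\<^sup>+ x. ennreal (\<bar>\<phi> x\<bar> powr q) \<partial>lborel)"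
proof -
  have [measurable]: "\<phi> \<in> borel_measurable borel" "T \<phi> \<in> borel_measurable borel"
    using T by (auto simp: interpolable_def)
  define H :: "real \<Rightarrow> real \<Rightarrow> ennreal" where
    "H = (\<lambda>\<alpha> t. ennreal (4 * K * \<epsilon> / \<alpha>\<^sup>2 * t\<^sup>2) * indicator {z. fst z < 2 * K * snd z} (\<alpha>, t))"
  have Hm: "case_prod H \<in> borel_measurable (borel \<Otimes>\<^sub>M borel)"
  proof -
    have "case_prod H = (\<lambda>z. ennreal (4 * K * \<epsilon> / (fst z)\<^sup>2 * (snd z)\<^sup>2) * indicator {z. fst z < 2 * K * snd z} z)"
      by (auto simp: H_def fun_eq_iff)
    also have "\<dots> \<in> borel_measurable (borel \<Otimes>\<^sub>M borel)" by measurable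
    finally show ?thesis .
  qed
  have "(\<integral>\<^sup>+ y. ennreal (\<bar>T \<phi> y\<bar> powr q) \<partial>lborel)
    \<le> (\<integral>\<^sup>+ x. \<integral>\<^sup>+ \<alpha>. ennreal (q * \<alpha> powr (q - 1)) * indicator {0<..} \<alpha> * H \<alpha> \<bar>\<phi> x\<bar> \<partial>lborel \<partial>lborel)"
  proof (rule nn_integral_powr_le_from_superlevel)
    fix \<alpha> :: real assume \<alpha>: "\<alpha> > 0"
    define A where "A = {x. \<alpha> < 2 * K * \<bar>\<phi> x\<bar>}"
    have A[measurable]: "A \<in> sets borel" unfolding A_def by measurable
    define T1 where "T1 = T (\<lambda>x. indicator A x * \<phi> x)"
    define T2 where "T2 = T (\<lambda>x. indicator (- A) x * \<phi> x)"
    have nA: "- A \<in> sets borel" by auto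
    have [measurable]: "T1 \<in> borel_measurable borel" "T2 \<in> borel_measurable borel"
      using T A nA by (auto simp: interpolable_def T1_def T2_def)
    have eq: "T \<phi> y = T1 y + T2 y" for y
      using T A unfolding interpolable_def T1_def T2_def by blast
    have "\<forall>x\<in>-A. \<bar>\<phi> x\<bar> \<le> \<alpha> / (2 * K)"
      using K by (auto simp: A_def field_simps)
    moreover have "0 \<le> \<alpha> / (2 * K)" using \<alpha> K by simp
    ultimately have "\<bar>T2 y\<bar> \<le> K * (\<alpha> / (2 * K))" for y
      using T nA unfolding interpolable_def T2_def by blast
    then have i2: "\<bar>T2 y\<bar> \<le> \<alpha> / 2" for y using K by simp
    have b2: "(\<integral>\<^sup>+ y. ennreal (\<bar>T1 y\<bar>\<^sup>2) \<partial>lborel) \<le> ennreal (K * \<epsilon>) * (\<integral>\<^sup>+ x. indicator A x * ennreal (\<bar>\<phi> x\<bar>\<^sup>2) \<partial>lborel)"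
      using T A unfolding interpolable_def T1_def by blast
    have "\<alpha> / 2 < \<bar>T1 y\<bar>" if "\<alpha> < \<bar>T \<phi> y\<bar>" for y
      using that i2[of y] by (auto simp: eq)
    then have "emeasure lborel {y. \<alpha> < \<bar>T \<phi> y\<bar>} \<le> emeasure lborel {y. \<alpha> / 2 < \<bar>T1 y\<bar>}"
      by (intro emeasure_mono) auto
    also have "\<dots> \<le> ennreal ((\<alpha> / 2) powr - 2) * (\<integral>\<^sup>+ y. ennreal (\<bar>T1 y\<bar> powr 2) \<partial>lborel)"
      using \<alpha> by (intro emeasure_superlevel_le) auto
    also have "\<dots> \<le> ennreal (4 / \<alpha>\<^sup>2) * (ennreal (K * \<epsilon>) * (\<integral>\<^sup>+ x. indicator A x * ennreal (\<bar>\<phi> x\<bar>\<^sup>2) \<partial>lborel))"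
    proof -
      have "(\<alpha> / 2) powr - 2 = 4 / \<alpha>\<^sup>2" using \<alpha> by (simp add: powr_minus power_divide)
      then show ?thesis using b2 by (simp add: mult_left_mono)
    qed
    also have "\<dots> = (\<integral>\<^sup>+ x. ennreal (4 / \<alpha>\<^sup>2) * (ennreal (K * \<epsilon>) * (indicator A x * ennreal (\<bar>\<phi> x\<bar>\<^sup>2))) \<partial>lborel)"
      by (simp add: nn_integral_cmult)
    also have "\<dots> = (\<integral>\<^sup>+ x. H \<alpha> \<bar>\<phi> x\<bar> \<partial>lborel)"
      using K \<epsilon> \<alpha> by (intro nn_integral_cong) (auto simp: H_def A_def indicator_def ennreal_mult[symmetric] power2_eq_square)
    finally show "emeasure lborel {y. \<alpha> < \<bar>T \<phi> y\<bar>} \<le> (\<integral>\<^sup>+ x. H \<alpha> \<bar>\<phi> x\<bar> \<partial>lborel)" .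
  qed (use Hm q in auto)
  also have "\<dots> \<le> (\<integral>\<^sup>+ x. ennreal (4 * q / (q - 2) * K * (2 * K) powr (q - 2) * \<epsilon>) * ennreal (\<bar>\<phi> x\<bar> powr q) \<partial>lborel)"
  proof (rule nn_integral_mono)
    fix x
    define t where "t = \<bar>\<phi> x\<bar>"
    have t: "t \<ge> 0" by (simp add: t_def)
    have "(\<integral>\<^sup>+ \<alpha>. ennreal (q * \<alpha> powr (q - 1)) * indicator {0<..} \<alpha> * H \<alpha> t \<partial>lborel)
        = (\<integral>\<^sup>+ \<alpha>. ennreal (4 * q * K * \<epsilon> * t\<^sup>2) * (ennreal (\<alpha> powr ((q - 2) - 1)) * indicator {0<..<2 * K * t} \<alpha>) \<partial>lborel)"
    proof (rule nn_integral_cong)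
      fix \<alpha> :: real
      have "\<alpha> powr (q - 1) / \<alpha>\<^sup>2 = \<alpha> powr ((q - 2) - 1)" if "\<alpha> > 0"
      proof -
        have "\<alpha> powr ((q - 2) - 1) = \<alpha> powr (q - 1 - 2)" by (rule arg_cong[where f="\<lambda>z. \<alpha> powr z"]) simp
        then show ?thesis using that by (subst (asm) powr_diff) auto
      qed
      then show "ennreal (q * \<alpha> powr (q - 1)) * indicator {0<..} \<alpha> * H \<alpha> t
        = ennreal (4 * q * K * \<epsilon> * t\<^sup>2) * (ennreal (\<alpha> powr ((q - 2) - 1)) * indicator {0<..<2 * K * t} \<alpha>)"
        using q K \<epsilon> t
        apply (auto simp: H_def indicator_def ennreal_mult[symmetric])
        apply (simp_all add: field_simps)
        done
    qed
    also have "\<dots> = ennreal (4 * q * K * \<epsilon> * t\<^sup>2) * ennreal ((2 * K * t) powr (q - 2) / (q - 2))"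
      using nn_integral_powr_from_0[of "2 * K * t" "q - 2"] K t q
      by (simp add: nn_integral_cmult)
    also have "\<dots> = ennreal (4 * q * K * \<epsilon> * t\<^sup>2 * ((2 * K * t) powr (q - 2) / (q - 2)))"
      using K \<epsilon> t q by (simp add: ennreal_mult[symmetric])
    also have "4 * q * K * \<epsilon> * t\<^sup>2 * ((2 * K * t) powr (q - 2) / (q - 2))
       = 4 * q / (q - 2) * K * (2 * K) powr (q - 2) * \<epsilon> * (t\<^sup>2 * t powr (q - 2))"
      using K t by (simp add: powr_mult)
    also have "t\<^sup>2 * t powr (q - 2) = t powr q"
      using t q by (cases "t = 0") (auto simp: powr_diff)
    finally show "(\<integral>\<^sup>+ \<alpha>. ennreal (q * \<alpha> powr (q - 1)) * indicator {0<..} \<alpha> * H \<alpha> \<bar>\<phi> x\<bar> \<partial>lborel)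
       \<le> ennreal (4 * q / (q - 2) * K * (2 * K) powr (q - 2) * \<epsilon>) * ennreal (\<bar>\<phi> x\<bar> powr q)"
      using K \<epsilon> q by (simp add: ennreal_mult[symmetric] t_def)
  qed
  also have "\<dots> = ennreal (4 * q / (q - 2) * K * (2 * K) powr (q - 2) * \<epsilon>) * (\<integral>\<^sup>+ x. ennreal (\<bar>\<phi> x\<bar> powr q) \<partial>lborel)"
    by (rule nn_integral_cmult) measurable
  finally show ?thesis .
qed

lemma interpolation:
  fixes K q :: real
  assumes K: "K > 0" and q: "q > 1"
  shows "\<exists>C>0. \<forall>\<epsilon>>0. \<forall>(T :: ('a::euclidean_space \<Rightarrow> real) \<Rightarrow> 'b::euclidean_space \<Rightarrow> real) \<phi>. interpolable K \<epsilon> T \<phi> \<longrightarrow>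
    (\<integral>\<^sup>+ y. ennreal (\<bar>T \<phi> y\<bar> powr q) \<partial>lborel) \<le> ennreal (C * \<epsilon> powr min 1 (q - 1)) * (\<integral>\<^sup>+ x. ennreal (\<bar>\<phi> x\<bar> powr q) \<partial>lborel)"
proof -
  consider "q < 2" | "q = 2" | "q > 2" by linarith
  then show ?thesis
  proof cases
    case 1
    then show ?thesis using q K
      by (intro exI[of _ "(2 * q / (q - 1) + 4 * q / (2 - q)) * K"])
        (auto simp: min_def intro!: mult_pos_pos add_pos_pos interpolation_low)
  next
    case 2
    \<comment> \<open>At \<open>q = 2\<close> both splittings would diverge logarithmically; the
      \<open>L\<^sup>2\<close> bound for \<open>A = UNIV\<close> is the claim itself.\<close>
    have "(\<integral>\<^sup>+ y. ennreal (\<bar>T \<phi> y\<bar>\<^sup>2) \<partial>lborel) \<le> ennreal (K * \<epsilon>) * (\<integral>\<^sup>+ x. ennreal (\<bar>\<phi> x\<bar>\<^sup>2) \<partial>lborel)"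
      if "interpolable K \<epsilon> T \<phi>" for \<epsilon> and T :: "('a \<Rightarrow> real) \<Rightarrow> 'b \<Rightarrow> real" and \<phi>
    proof -
      have "(\<integral>\<^sup>+ y. ennreal (\<bar>T (\<lambda>x. indicator UNIV x * \<phi> x) y\<bar>\<^sup>2) \<partial>lborel) \<le> ennreal (K * \<epsilon>) * (\<integral>\<^sup>+ x. indicator UNIV x * ennreal (\<bar>\<phi> x\<bar>\<^sup>2) \<partial>lborel)"
        using that sets.top[of "borel :: 'a measure"] unfolding interpolable_def space_borel by blast
      then show ?thesis by simp
    qed
    then show ?thesis using 2 K by (intro exI[of _ K]) auto
  next
    case 3
    then show ?thesis using q K interpolation_high[OF _ K _ 3]
      by (intro exI[of _ "4 * q / (q - 2) * K * (2 * K) powr (q - 2)"]) (auto simp: min_def)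
  qed
qed

subsection \<open>Translations and cubes\<close>

lemma borel_measurable_fst [measurable (raw)]:
  fixes f :: "'c \<Rightarrow> 'a::second_countable_topology \<times> 'b::second_countable_topology"
  assumes "f \<in> borel_measurable M" shows "(\<lambda>x. fst (f x)) \<in> borel_measurable M"
  by (rule measurable_compose[OF assms[unfolded borel_prod[symmetric]] measurable_fst])

lemma borel_measurable_snd [measurable (raw)]:
  fixes f :: "'c \<Rightarrow> 'a::second_countable_topology \<times> 'b::second_countable_topology"
  assumes "f \<in> borel_measurable M" shows "(\<lambda>x. snd (f x)) \<in> borel_measurable M"
  by (rule measurable_compose[OF assms[unfolded borel_prod[symmetric]] measurable_snd])

text \<open>The class in which all dual functions live. Smooth functions would not do: interpolation
  cuts \<open>\<phi>\<close> off on Borel sets, and the extremal function of the duality argument is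
  a truncated power of an increment. The class is stable under these truncations, under translations
  and under integration along rays.\<close>

definition bounded_supp :: "('a::euclidean_space \<Rightarrow> real) \<Rightarrow> bool" where
  "bounded_supp \<phi> \<longleftrightarrow> \<phi> \<in> borel_measurable borel \<and> bounded (range \<phi>) \<and> bounded {y. \<phi> y \<noteq> 0}"

lemma bounded_suppI:
  assumes "\<phi> \<in> borel_measurable borel" "\<And>y. \<bar>\<phi> y\<bar> \<le> N" "\<And>y. \<phi> y \<noteq> 0 \<Longrightarrow> norm y \<le> r"
  shows "bounded_supp \<phi>"
  using assms by (auto simp: bounded_supp_def bounded_iff)

lemma bounded_suppE:
  assumes "bounded_supp \<phi>"
  obtains N r where "N \<ge> 0" "r \<ge> 0" "\<And>y. \<bar>\<phi> y\<bar> \<le> N" "\<And>y. r < norm y \<Longrightarrow> \<phi> y = 0"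
proof -
  obtain N where N: "\<And>y. \<bar>\<phi> y\<bar> \<le> N" using assms by (auto simp: bounded_supp_def bounded_iff)
  obtain r where r: "\<And>y. \<phi> y \<noteq> 0 \<Longrightarrow> norm y \<le> r" using assms by (auto simp: bounded_supp_def bounded_iff)
  show ?thesis
  proof (rule that[of "\<bar>N\<bar>" "\<bar>r\<bar>"])
    fix y show "\<bar>\<phi> y\<bar> \<le> \<bar>N\<bar>" using N[of y] by linarith
    assume "\<bar>r\<bar> < norm y" then show "\<phi> y = 0" using r[of y] by linarith
  qed auto
qed

lemma bounded_supp_measurable: "bounded_supp \<phi> \<Longrightarrow> \<phi> \<in> borel_measurable borel"
  by (simp add: bounded_supp_def)

lemma bounded_supp_integrable:
  fixes \<phi> :: "'a::euclidean_space \<Rightarrow> real"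
  assumes "bounded_supp \<phi>" shows "integrable lborel \<phi>"
proof -
  obtain N r where N: "N \<ge> 0" "r \<ge> 0" "\<And>y. \<bar>\<phi> y\<bar> \<le> N" "\<And>y. r < norm y \<Longrightarrow> \<phi> y = 0"
    using bounded_suppE[OF assms] by metis
  show ?thesis
  proof (rule integrableI_bounded_set[where A="cball 0 r" and B=N])
    show "AE x in lborel. x \<in> cball 0 r \<longrightarrow> norm (\<phi> x) \<le> N" using N by auto
    show "AE x in lborel. x \<notin> cball 0 r \<longrightarrow> \<phi> x = 0" using N by (auto simp: not_le)
    show "emeasure lborel (cball 0 r :: 'a set) < \<infinity>" by (rule emeasure_lborel_cball_finite)
  qed (use bounded_supp_measurable[OF assms] in auto)
qed

lemma bounded_supp_mult:
  assumes "bounded_supp \<phi>" "g \<in> borel_measurable borel" "\<And>y. \<bar>g y\<bar> \<le> M"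
  shows "bounded_supp (\<lambda>y. g y * \<phi> y)"
proof -
  obtain N r where N: "N \<ge> 0" "r \<ge> 0" "\<And>y. \<bar>\<phi> y\<bar> \<le> N" "\<And>y. r < norm y \<Longrightarrow> \<phi> y = 0"
    using bounded_suppE[OF assms(1)] by metis
  show ?thesis
  proof (rule bounded_suppI[where N="M * N" and r=r])
    show "\<bar>g y * \<phi> y\<bar> \<le> M * N" for y
      unfolding abs_mult using assms(3) N by (intro mult_mono) (auto intro: order_trans[OF abs_ge_zero])
    show "norm y \<le> r" if "g y * \<phi> y \<noteq> 0" for y using N(4)[of y] that by (cases "r < norm y") auto
  qed (use assms(2) bounded_supp_measurable[OF assms(1)] in measurable)
qed

lemma bounded_supp_indicator: "bounded_supp \<phi> \<Longrightarrow> A \<in> sets borel \<Longrightarrow> bounded_supp (\<lambda>y. indicator A y * \<phi> y)"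
  by (rule bounded_supp_mult[where M=1]) (auto simp: indicator_def)

lemma bounded_supp_power2: "bounded_supp \<phi> \<Longrightarrow> bounded_supp (\<lambda>y. (\<phi> y)\<^sup>2)"
  unfolding power2_eq_square
  by (rule bounded_suppE, assumption) (rule bounded_supp_mult, auto simp: bounded_supp_def)

lemma bounded_supp_diff:
  assumes "bounded_supp \<phi>" "bounded_supp \<psi>"
  shows "bounded_supp (\<lambda>y. \<phi> y - \<psi> y)"
proof -
  obtain N r where N: "N \<ge> 0" "r \<ge> 0" "\<And>y. \<bar>\<phi> y\<bar> \<le> N" "\<And>y. r < norm y \<Longrightarrow> \<phi> y = 0"
    using bounded_suppE[OF assms(1)] by metis
  obtain M s where M: "M \<ge> 0" "s \<ge> 0" "\<And>y. \<bar>\<psi> y\<bar> \<le> M" "\<And>y. s < norm y \<Longrightarrow> \<psi> y = 0"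
    using bounded_suppE[OF assms(2)] by metis
  show ?thesis
  proof (rule bounded_suppI[where N="N + M" and r="max r s"])
    show "\<bar>\<phi> y - \<psi> y\<bar> \<le> N + M" for y using N(3)[of y] M(3)[of y] by linarith
    show "norm y \<le> max r s" if "\<phi> y - \<psi> y \<noteq> 0" for y using N(4)[of y] M(4)[of y] that by force
  qed (use bounded_supp_measurable[OF assms(1)] bounded_supp_measurable[OF assms(2)] in measurable)
qed

lemma bounded_supp_translate:
  fixes \<phi> :: "'a::euclidean_space \<Rightarrow> real"
  assumes "bounded_supp \<phi>"
  shows "bounded_supp (\<lambda>y. \<phi> (y + a))"
proof -
  obtain N r where N: "N \<ge> 0" "r \<ge> 0" "\<And>y. \<bar>\<phi> y\<bar> \<le> N" "\<And>y. r < norm y \<Longrightarrow> \<phi> y = 0"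
    using bounded_suppE[OF assms(1)] by metis
  have [measurable]: "\<phi> \<in> borel_measurable borel" by (rule bounded_supp_measurable[OF assms])
  show ?thesis
  proof (rule bounded_suppI[where N=N and r="r + norm a"])
    show "norm y \<le> r + norm a" if "\<phi> (y + a) \<noteq> 0" for y
      using N(4)[of "y + a"] that norm_diff_ineq[of y a] by linarith
  qed (use N in auto)
qed

lemma bounded_supp_Fubini:
  fixes F :: "'a::euclidean_space \<times> 'b::euclidean_space \<Rightarrow> real"
  assumes "bounded_supp F"
  shows "(LINT x|lborel. LINT y|lborel. F (x, y)) = (LINT y|lborel. LINT x|lborel. F (x, y))"
    and "(LINT x|lborel. LINT y|lborel. F (x, y)) = (LINT z|lborel. F z)"
proof -
  have i: "integrable (lborel \<Otimes>\<^sub>M lborel) F"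
    using bounded_supp_integrable[OF assms] by (simp add: lborel_prod)
  show "(LINT x|lborel. LINT y|lborel. F (x, y)) = (LINT y|lborel. LINT x|lborel. F (x, y))"
    using lborel_pair.Fubini_integral[of "\<lambda>x y. F (x, y)"] i by simp
  show "(LINT x|lborel. LINT y|lborel. F (x, y)) = (LINT z|lborel. F z)"
    using lborel_pair.integral_fst'[OF i] by (simp add: lborel_prod)
qed

lemma bounded_supp_integral_fst:
  fixes F :: "'a::euclidean_space \<times> 'b::euclidean_space \<Rightarrow> real"
  assumes "bounded_supp F"
  shows "bounded_supp (\<lambda>x. LINT y|lborel. F (x, y))"
proof -
  obtain N r where N: "N \<ge> 0" "r \<ge> 0" "\<And>y. \<bar>F y\<bar> \<le> N" "\<And>y. r < norm y \<Longrightarrow> F y = 0"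
    using bounded_suppE[OF assms(1)] by metis
  have [measurable]: "F \<in> borel_measurable borel" by (rule bounded_supp_measurable[OF assms])
  show ?thesis
  proof (rule bounded_suppI[where r=r])
    show "\<bar>LINT y|lborel. F (x, y)\<bar> \<le> N * measure lborel (cball (0::'b) r)" for x
    proof -
      have b: "norm (F (x, y)) \<le> N * indicator (cball 0 r) y" for y
      proof (cases "norm y \<le> r")
        case False
        then have "r < norm (x, y)" using norm_snd_le[of y x] by simp
        then show ?thesis using N False by (auto simp: indicator_def)
      qed (use N in auto)
      have "integrable lborel (\<lambda>y::'b. N * indicator (cball 0 r) y)"
        by (intro integrable_mult_right integrable_real_indicator emeasure_lborel_cball_finite) auto
      then have "norm (LINT y|lborel. F (x, y)) \<le> (LINT y|lborel. N * indicator (cball (0::'b) r) y)"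
        using b by (intro Bochner_Integration.integral_norm_bound_integral Bochner_Integration.integrable_bound[OF \<open>integrable lborel (\<lambda>y::'b. N * indicator (cball 0 r) y)\<close>])
          (auto simp: abs_mult N(1))
      then show ?thesis by simp
    qed
    show "norm x \<le> r" if "(LINT y|lborel. F (x, y)) \<noteq> 0" for x
    proof (rule ccontr)
      assume "\<not> norm x \<le> r"
      then have "r < norm (x, y)" for y using norm_fst_le[of x y] by (simp add: not_le less_le_trans)
      then have "F (x, y) = 0" for y using N by blast
      then show False using that by simp
    qed
    show "(\<lambda>x. LINT y|lborel. F (x, y)) \<in> borel_measurable borel"
      by measurable
  qed
qed

section \<open>Translation invariance and affine perturbations of a cube\<close>

lemma lborel_nn_integral_translate:
  fixes f :: "'a::euclidean_space \<Rightarrow> ennreal"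
  assumes "f \<in> borel_measurable borel"
  shows "(\<integral>\<^sup>+ y. f (y + a) \<partial>lborel) = (\<integral>\<^sup>+ y. f y \<partial>lborel)"
proof -
  have "(\<integral>\<^sup>+ y. f y \<partial>lborel) = (\<integral>\<^sup>+ y. f y \<partial>(distr lborel borel ((+) a)))" by (simp add: lborel_distr_plus)
  also have "\<dots> = (\<integral>\<^sup>+ y. f (y + a) \<partial>lborel)" using assms
    by (subst nn_integral_distr) (auto simp: add.commute)
  finally show ?thesis by simp
qed

lemma lborel_integral_translate:
  fixes f :: "'a::euclidean_space \<Rightarrow> real"
  assumes "f \<in> borel_measurable borel"
  shows "(LINT y|lborel. f (y + a)) = (LINT y|lborel. f y)"
proof -
  have "(LINT y|lborel. f y) = (LINT y|(distr lborel borel ((+) a)). f y)" by (simp add: lborel_distr_plus)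
  also have "\<dots> = (LINT y|lborel. f (y + a))" using assms
    by (subst integral_distr) (auto simp: add.commute)
  finally show ?thesis by simp
qed

lemma measure_lborel_symmetric_cbox:
  "r \<ge> 0 \<Longrightarrow> measure lborel (cbox (- (r *\<^sub>R One)) (r *\<^sub>R One) :: 'a::euclidean_space set) = (2 * r) ^ DIM('a)"
  by (subst measure_lborel_cbox_eq) (auto simp: inner_simps)

text \<open>The affine map is moved onto the cube by substitution, so \<open>c\<close> enters only
  through its bound. What is left is the \<open>L\<^sup>1\<close> distance between the indicator of
  the cube and the density of its affine image. This is the total mass minus twice the common mass,
  and a smaller concentric cube on which both densities are bounded below controls the
  latter.\<close>

lemma cube_affine_perturbation:
  fixes c :: "'a::euclidean_space \<Rightarrow> real" and B \<beta> l :: real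
  assumes [measurable]: "c \<in> borel_measurable borel" and B: "\<And>x. \<bar>c x\<bar> \<le> B"
    and b: "\<And>i. i \<in> Basis \<Longrightarrow> \<bar>b \<bullet> i\<bar> \<le> \<beta>" and \<beta>: "\<beta> \<ge> 0"
  shows "\<bar>(LINT v|lborel. indicator (cbox (- One) One) v * c (l *\<^sub>R v + b)) - (LINT v|lborel. indicator (cbox (- One) One) v * c v)\<bar>
     \<le> 2 ^ (DIM('a) + 1) * DIM('a) * B * (\<bar>l - 1\<bar> + \<beta>)"
proof -
  define Q :: "'a set" where "Q = cbox (- One) One"
  define n where "n = DIM('a)"
  have B0: "B \<ge> 0" using B[of 0] by linarith
  have n1: "1 \<le> n" by (simp add: n_def DIM_positive Suc_le_eq)
  have cube: "measure lborel (cbox (- (r *\<^sub>R One)) (r *\<^sub>R One) :: 'a set) = (2 * r) ^ n" if "r \<ge> 0" for r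
    using measure_lborel_symmetric_cbox[OF that] by (simp add: n_def)
  have mQ: "measure lborel Q = 2 ^ n" using cube[of 1] by (simp add: Q_def)
  have [measurable]: "Q \<in> sets borel" by (simp add: Q_def)
  have fQ: "emeasure lborel Q < \<infinity>" by (simp add: Q_def emeasure_lborel_cbox_finite)
  have iQ: "integrable lborel (indicator Q :: 'a \<Rightarrow> real)" using fQ by (intro integrable_real_indicator) auto
  have iQc: "integrable lborel (\<lambda>v. indicator Q v * f v)" if "f \<in> borel_measurable borel" "\<And>x. \<bar>f x\<bar> \<le> B" for f :: "'a \<Rightarrow> real"
    by (rule Bochner_Integration.integrable_bound[OF integrable_mult_right[OF iQ, of B]]) (use that B0 in \<open>auto simp: indicator_def\<close>)
  let ?e = "\<bar>l - 1\<bar> + \<beta>"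
  have "\<bar>(LINT v|lborel. indicator Q v * c (l *\<^sub>R v + b)) - (LINT v|lborel. indicator Q v * c v)\<bar> \<le> 2 ^ (n + 1) * n * B * ?e"
  proof (cases "?e < 1")
    case False
    \<comment> \<open>A large perturbation calls for no comparison: each of the two integrals is at
      most \<open>B * 2 ^ n\<close>.\<close>
    have t: "\<bar>LINT v|lborel. indicator Q v * f v\<bar> \<le> B * 2 ^ n" if "f \<in> borel_measurable borel" "\<And>x. \<bar>f x\<bar> \<le> B" for f
    proof -
      have "norm (LINT v|lborel. indicator Q v * f v) \<le> (LINT v|lborel. B * indicator Q v)"
        by (rule Bochner_Integration.integral_norm_bound_integral[OF iQc[OF that] integrable_mult_right[OF iQ]])
          (use that in \<open>auto simp: indicator_def\<close>)
      then show ?thesis using fQ by (simp add: mQ)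
    qed
    have "\<bar>(LINT v|lborel. indicator Q v * c (l *\<^sub>R v + b)) - (LINT v|lborel. indicator Q v * c v)\<bar> \<le> B * 2 ^ n + B * 2 ^ n"
      using t[of "\<lambda>v. c (l *\<^sub>R v + b)"] t[of c] B by auto
    also have "\<dots> = 2 ^ (n + 1) * 1 * B * 1" by simp
    also have "\<dots> \<le> 2 ^ (n + 1) * n * B * ?e"
      using False B0 n1 by (intro mult_mono) auto
    finally show ?thesis .
  next
    case True
    have l: "l > 0" using True \<beta> by linarith
    \<comment> \<open>The cube of half side \<open>r\<close> lies both in \<open>Q\<close> and in
      the image \<open>l Q + b\<close>, and \<open>\<mu> ^ n\<close> is a lower bound there for both
      densities, 1 and \<open>(1 / l) ^ n\<close>.\<close>
    define r where "r = min 1 (l - \<beta>)"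
    have r: "0 < r" "r \<le> 1" using True \<beta> by (auto simp: r_def)
    define \<mu> where "\<mu> = min 1 (1 / l)"
    have \<mu>: "0 < \<mu>" "\<mu> \<le> 1" "\<mu> \<le> 1 / l" using l by (auto simp: \<mu>_def)
    have \<mu>r: "1 - ?e \<le> \<mu> * r"
    proof (cases "l \<ge> 1")
      case True
      then have \<mu>: "\<mu> = 1 / l" by (simp add: \<mu>_def min_def)
      have 1: "2 - l \<le> 1 / l"
      proof -
        have "l * (2 - l) \<le> 1" using zero_le_power2[of "l - 1"] by (simp add: power2_eq_square algebra_simps)
        then show ?thesis using l by (simp add: field_simps)
      qed
      have 2: "1 - \<beta> \<le> (l - \<beta>) / l" using True \<beta> l mult_left_mono[OF True \<beta>] by (simp add: field_simps)
      show ?thesis unfolding \<mu> r_def using 1 2 True \<beta> by (auto simp: min_def)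
    next
      case False
      then show ?thesis using l \<beta> by (auto simp: r_def \<mu>_def min_def field_simps)
    qed
    \<comment> \<open>The density of the image of Lebesgue measure on the cube under
      \<open>v \<mapsto> l v + b\<close>.\<close>
    define k1 where "k1 = (\<lambda>x. (1 / l) ^ n * indicator Q ((x - b) /\<^sub>R l))"
    have k1m[measurable]: "k1 \<in> borel_measurable borel" unfolding k1_def by measurable
    have subst: "(LINT v|lborel. indicator Q v * f (l *\<^sub>R v + b)) = (LINT x|lborel. k1 x * f x)"
      if [measurable]: "f \<in> borel_measurable borel" for f :: "'a \<Rightarrow> real"
    proof -
      have d: "lborel = density (distr lborel borel (\<lambda>v. b + l *\<^sub>R v)) (\<lambda>_. ennreal (\<bar>l\<bar> ^ DIM('a)))"
        by (rule lborel_affine) (use l in simp)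
      have "(LINT x|lborel. k1 x * f x) = (LINT x|density (distr lborel borel (\<lambda>v. b + l *\<^sub>R v)) (\<lambda>_. ennreal (\<bar>l\<bar> ^ DIM('a))). k1 x * f x)"
        by (subst (1) d) simp
      also have "\<dots> = (LINT v|lborel. l ^ n * (k1 (b + l *\<^sub>R v) * f (b + l *\<^sub>R v)))"
        using l by (subst integral_density) (auto simp: integral_distr n_def)
      also have "\<dots> = (LINT v|lborel. indicator Q v * f (l *\<^sub>R v + b))"
        using l by (intro Bochner_Integration.integral_cong) (auto simp: k1_def power_one_over add.commute)
      finally show ?thesis by simp
    qed
    have ik1: "integrable lborel k1"
    proof -
      have "bounded_supp k1"
      proof (rule bounded_suppI[where N="(1 / l) ^ n" and r="l * norm (One :: 'a) + norm b"])
        show "\<bar>k1 y\<bar> \<le> (1 / l) ^ n" for y using l by (auto simp: k1_def indicator_def)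
        fix y assume "k1 y \<noteq> 0"
        then have "(y - b) /\<^sub>R l \<in> Q" by (auto simp: k1_def indicator_def split: if_splits)
        then have "norm ((y - b) /\<^sub>R l) \<le> norm (One :: 'a)"
          unfolding Q_def by (intro norm_le_componentwise) (auto simp: mem_box inner_simps abs_le_iff)
        then have "norm (y - b) \<le> l * norm (One :: 'a)" using l unfolding norm_scaleR by (simp add: field_simps)
        then show "norm y \<le> l * norm (One :: 'a) + norm b" using norm_triangle_sub[of y b] by linarith
      qed simp
      then show ?thesis by (rule bounded_supp_integrable)
    qed
    have ik1c: "integrable lborel (\<lambda>x. k1 x * c x)"
    proof (rule Bochner_Integration.integrable_bound[OF integrable_mult_right[OF ik1, of B]])
      have "0 \<le> k1 x" for x using l by (auto simp: k1_def)
      then show "AE x in lborel. norm (k1 x * c x) \<le> norm (B * k1 x)"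
        using B B0 by (auto simp: abs_mult mult.commute[of B] intro!: mult_left_mono)
    qed measurable
    have int1: "(LINT x|lborel. k1 x) = 2 ^ n" using subst[of "\<lambda>_. 1"] fQ by (simp add: mQ)
    define P where "P = cbox (- (r *\<^sub>R One)) (r *\<^sub>R One :: 'a)"
    have [measurable]: "P \<in> sets borel" by (simp add: P_def)
    have mP: "measure lborel P = (2 * r) ^ n" unfolding P_def by (rule cube) (use r in auto)
    have fP: "emeasure lborel P < \<infinity>" unfolding P_def by (rule emeasure_lborel_cbox_finite)
    have iP: "integrable lborel (indicator P :: 'a \<Rightarrow> real)" using fP by (intro integrable_real_indicator) auto
    have PQ: "x \<in> Q" if "x \<in> P" for x using that r by (auto simp: P_def Q_def mem_box inner_simps)
    have PQ': "(x - b) /\<^sub>R l \<in> Q" if "x \<in> P" for x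
      unfolding Q_def mem_box
    proof (intro ballI)
      fix i :: 'a assume i: "i \<in> Basis"
      have "\<bar>x \<bullet> i\<bar> \<le> r" using that i by (auto simp: P_def mem_box inner_simps abs_le_iff)
      then have "\<bar>(x - b) \<bullet> i\<bar> \<le> l" using b[OF i] by (auto simp: inner_simps r_def)
      then have "\<bar>(x - b) \<bullet> i\<bar> / l \<le> 1" using l by simp
      then show "- One \<bullet> i \<le> ((x - b) /\<^sub>R l) \<bullet> i \<and> ((x - b) /\<^sub>R l) \<bullet> i \<le> One \<bullet> i"
        using i l by (auto simp: abs_le_iff inner_simps field_simps)
    qed
    \<comment> \<open>This is \<open>|x - y| = x + y - 2 min x y\<close>, with the minimum bounded
      below on \<open>P\<close>.\<close>
    have pt: "\<bar>k1 x - indicator Q x\<bar> \<le> k1 x + indicator Q x - 2 * \<mu> ^ n * indicator P x" for x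
    proof (cases "x \<in> P")
      case True
      then have "k1 x = (1 / l) ^ n" "indicator Q x = (1::real)" using PQ PQ' by (auto simp: k1_def)
      moreover have "\<mu> ^ n \<le> 1" "\<mu> ^ n \<le> (1 / l) ^ n" using \<mu> by (auto intro: power_le_one power_mono)
      ultimately show ?thesis using True by (auto simp: abs_if)
    next
      case False
      have "0 \<le> k1 x" using l by (auto simp: k1_def)
      then show ?thesis using False by (auto simp: indicator_def)
    qed
    have i0: "integrable lborel (\<lambda>x. B * (k1 x + indicator Q x - 2 * \<mu> ^ n * indicator P x))"
      by (intro integrable_mult_right Bochner_Integration.integrable_diff Bochner_Integration.integrable_add ik1 iQ iP)
    have "\<bar>(LINT v|lborel. indicator Q v * c (l *\<^sub>R v + b)) - (LINT v|lborel. indicator Q v * c v)\<bar>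
      = norm (LINT x|lborel. k1 x * c x - indicator Q x * c x)"
      unfolding subst[OF assms(1)] by (subst Bochner_Integration.integral_diff) (use ik1c iQc B in auto)
    also have "\<dots> \<le> (LINT x|lborel. B * (k1 x + indicator Q x - 2 * \<mu> ^ n * indicator P x))"
    proof (rule Bochner_Integration.integral_norm_bound_integral[OF _ i0])
      show "integrable lborel (\<lambda>x. k1 x * c x - indicator Q x * c x)"
        by (intro Bochner_Integration.integrable_diff ik1c iQc) (use B in auto)
      fix x
      have "norm (k1 x * c x - indicator Q x * c x) = \<bar>c x\<bar> * \<bar>k1 x - indicator Q x\<bar>"
        by (simp add: abs_mult[symmetric] algebra_simps)
      also have "\<dots> \<le> B * (k1 x + indicator Q x - 2 * \<mu> ^ n * indicator P x)"
        using B B0 pt by (intro mult_mono) auto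
      finally show "norm (k1 x * c x - indicator Q x * c x) \<le> B * (k1 x + indicator Q x - 2 * \<mu> ^ n * indicator P x)" .
    qed
    also have "\<dots> = B * (2 ^ n + 2 ^ n - 2 * \<mu> ^ n * (2 * r) ^ n)"
      using ik1 iQ iP by (simp add: int1 mQ mP)
    also have "\<dots> = 2 ^ (n + 1) * B * (1 - (\<mu> * r) ^ n)"
      by (simp add: power_mult_distrib algebra_simps)
    also have "\<dots> \<le> 2 ^ (n + 1) * B * (n * ?e)"
    proof -
      \<comment> \<open>Bernoulli's inequality linearises the power; it requires
        \<open>?e \<le> 1\<close>, hence the case distinction.\<close>
      have "1 - n * ?e \<le> (1 - ?e) ^ n"
        using Bernoulli_inequality[of "- ?e" n] True by (simp only: diff_conv_add_uminus mult_minus_right)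
      also have "\<dots> \<le> (\<mu> * r) ^ n" using \<mu>r True by (intro power_mono) auto
      finally show ?thesis using B0 by (intro mult_left_mono) auto
    qed
    finally show ?thesis by (simp add: mult_ac)
  qed
  then show ?thesis by (simp add: Q_def n_def)
qed

subsection \<open>The ray transform and its autocorrelation\<close>

definition autocorr :: "('a::euclidean_space \<Rightarrow> real) \<Rightarrow> 'a \<Rightarrow> real" where
  "autocorr \<phi> z = (LINT y|lborel. \<phi> y * \<phi> (y + z))"

lemma bounded_supp_product_translates:
  fixes \<phi> :: "'a::euclidean_space \<Rightarrow> real"
  assumes "bounded_supp \<phi>"
  shows "bounded_supp (\<lambda>y. \<phi> (y + a) * \<phi> (y + b))"
proof -
  obtain N where "\<And>y. \<bar>\<phi> y\<bar> \<le> N" using bounded_suppE[OF assms(1)] by metis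
  then show ?thesis
    by (intro bounded_supp_mult[where M=N] bounded_supp_translate[OF assms])
      (use bounded_supp_measurable[OF bounded_supp_translate[OF assms]] in auto)
qed

lemma autocorr_measurable [measurable]:
  assumes "bounded_supp \<phi>" shows "autocorr \<phi> \<in> borel_measurable borel"
proof -
  have [measurable]: "\<phi> \<in> borel_measurable borel" by (rule bounded_supp_measurable[OF assms])
  show ?thesis unfolding autocorr_def[abs_def] by measurable
qed

lemma integral_product_translates:
  assumes "bounded_supp \<phi>"
  shows "(LINT y|lborel. \<phi> (y + a) * \<phi> (y + b)) = autocorr \<phi> (b - a)"
proof -
  have [measurable]: "\<phi> \<in> borel_measurable borel" by (rule bounded_supp_measurable[OF assms])
  have "(LINT y|lborel. \<phi> (y + a) * \<phi> (y + b)) = (LINT y|lborel. (\<lambda>y. \<phi> y * \<phi> (y + (b - a))) (y + a))"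
    by (simp add: algebra_simps)
  also have "\<dots> = autocorr \<phi> (b - a)"
    unfolding autocorr_def by (rule lborel_integral_translate) measurable
  finally show ?thesis .
qed

text \<open>The inequality \<open>2 a b \<le> a\<^sup>2 + b\<^sup>2\<close> and translation
  invariance take the place of Cauchy-Schwarz.\<close>

lemma autocorr_bound:
  assumes "bounded_supp \<phi>"
  shows "\<bar>autocorr \<phi> z\<bar> \<le> (LINT y|lborel. (\<phi> y)\<^sup>2)"
proof -
  have [measurable]: "\<phi> \<in> borel_measurable borel" by (rule bounded_supp_measurable[OF assms])
  have i: "integrable lborel (\<lambda>y. (\<phi> y)\<^sup>2)"
    by (intro bounded_supp_integrable bounded_supp_power2 assms)
  have i': "integrable lborel (\<lambda>y. (\<phi> (y + z))\<^sup>2)"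
    by (intro bounded_supp_integrable bounded_supp_power2 bounded_supp_translate assms)
  have "norm (autocorr \<phi> z) \<le> (LINT y|lborel. ((\<phi> y)\<^sup>2 + (\<phi> (y + z))\<^sup>2) / 2)"
    unfolding autocorr_def
  proof (rule Bochner_Integration.integral_norm_bound_integral)
    show "integrable lborel (\<lambda>y. \<phi> y * \<phi> (y + z))"
      using bounded_supp_integrable[OF bounded_supp_product_translates[OF assms, of 0 z]] by simp
    show "norm (\<phi> y * \<phi> (y + z)) \<le> ((\<phi> y)\<^sup>2 + (\<phi> (y + z))\<^sup>2) / 2" for y
      using sum_squares_bound[of "\<bar>\<phi> y\<bar>" "\<bar>\<phi> (y + z)\<bar>"] by (simp add: abs_mult)
  qed (use i i' in auto)
  also have "\<dots> = (LINT y|lborel. (\<phi> y)\<^sup>2)"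
    using i i' lborel_integral_translate[of "\<lambda>y. (\<phi> y)\<^sup>2" z] by simp
  finally show ?thesis by simp
qed

definition ray_integral :: "(real \<Rightarrow> real) \<Rightarrow> ('a::euclidean_space \<Rightarrow> real) \<Rightarrow> 'a \<Rightarrow> 'a \<Rightarrow> real" where
  "ray_integral \<eta> \<psi> y w = (LINT \<tau>|lborel. \<eta> \<tau> * \<psi> (y + \<tau> *\<^sub>R w))"

lemma ray_integral_measurable [measurable]:
  assumes [measurable]: "\<eta> \<in> borel_measurable borel" "\<psi> \<in> borel_measurable borel"
    "f \<in> borel_measurable M" "g \<in> borel_measurable M"
  shows "(\<lambda>x. ray_integral \<eta> \<psi> (f x) (g x)) \<in> borel_measurable M"
  unfolding ray_integral_def by measurable

lemma bounded_supp_ray_product: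
  fixes \<psi> :: "'a::euclidean_space \<Rightarrow> real"
  assumes "bounded_supp \<eta>" "bounded_supp \<psi>"
  shows "bounded_supp (\<lambda>(y, \<tau>). \<eta> \<tau> * \<psi> (y + \<tau> *\<^sub>R w))"
proof -
  have [measurable]: "\<eta> \<in> borel_measurable borel" "\<psi> \<in> borel_measurable borel"
    using assms by (auto intro: bounded_supp_measurable)
  obtain N r where N: "N \<ge> 0" "r \<ge> 0" "\<And>y. \<bar>\<eta> y\<bar> \<le> N" "\<And>y. r < norm y \<Longrightarrow> \<eta> y = 0"
    using bounded_suppE[OF assms(1)] by metis
  obtain M s where M: "M \<ge> 0" "s \<ge> 0" "\<And>y. \<bar>\<psi> y\<bar> \<le> M" "\<And>y. s < norm y \<Longrightarrow> \<psi> y = 0"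
    using bounded_suppE[OF assms(2)] by metis
  show ?thesis
  proof (rule bounded_suppI[where N="N * M" and r="s + r * norm w + r"])
    show "\<bar>case y of (y, \<tau>) \<Rightarrow> \<eta> \<tau> * \<psi> (y + \<tau> *\<^sub>R w)\<bar> \<le> N * M" for y
      using N M by (auto simp: abs_mult split: prod.splits intro!: mult_mono)
    show "norm y \<le> s + r * norm w + r" if "(case y of (y, \<tau>) \<Rightarrow> \<eta> \<tau> * \<psi> (y + \<tau> *\<^sub>R w)) \<noteq> 0" for y
    proof -
      obtain x \<tau> where y: "y = (x, \<tau>)" by fastforce
      have 1: "\<bar>\<tau>\<bar> \<le> r" using that N(4)[of \<tau>] by (auto simp: y not_less[symmetric])
      have "norm (x + \<tau> *\<^sub>R w) \<le> s" using that M(4) by (auto simp: y not_less[symmetric])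
      then have "norm x \<le> s + \<bar>\<tau>\<bar> * norm w" using norm_triangle_ineq4[of "x + \<tau> *\<^sub>R w" "\<tau> *\<^sub>R w"] by simp
      moreover have "\<bar>\<tau>\<bar> * norm w \<le> r * norm w" using 1 by (intro mult_right_mono) auto
      ultimately show ?thesis using norm_Pair_le[of x \<tau>] 1 by (simp add: y)
    qed
  qed (simp add: case_prod_beta', measurable)
qed

lemma bounded_supp_ray_integral:
  fixes \<psi> :: "'a::euclidean_space \<Rightarrow> real"
  assumes "bounded_supp \<eta>" "bounded_supp \<psi>"
  shows "bounded_supp (\<lambda>y. ray_integral \<eta> \<psi> y w)"
  using bounded_supp_integral_fst[OF bounded_supp_ray_product[OF assms, of w]] by (simp add: ray_integral_def)

lemma integrable_ray:
  assumes "bounded_supp \<eta>" "bounded_supp \<psi>"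
  shows "integrable lborel (\<lambda>\<tau>. \<eta> \<tau> * \<psi> (y + \<tau> *\<^sub>R w))"
proof -
  have [measurable]: "\<psi> \<in> borel_measurable borel" using assms by (auto intro: bounded_supp_measurable)
  obtain M s where M: "M \<ge> 0" "\<And>y. \<bar>\<psi> y\<bar> \<le> M" using bounded_suppE[OF assms(2)] by metis
  have "bounded_supp (\<lambda>\<tau>. \<psi> (y + \<tau> *\<^sub>R w) * \<eta> \<tau>)"
    by (rule bounded_supp_mult[OF assms(1), where M=M]) (use M in auto)
  then show ?thesis by (simp add: bounded_supp_integrable mult.commute)
qed

text \<open>The \<open>T T\<^sup>*\<close> identity: the \<open>L\<^sup>2\<close> norm of the ray transform only involves the autocorrelation.\<close>

lemma ray_integral_square:
  fixes \<psi> :: "'a::euclidean_space \<Rightarrow> real"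
  assumes \<eta>: "bounded_supp \<eta>" and \<psi>: "bounded_supp \<psi>"
  shows "(LINT y|lborel. (ray_integral \<eta> \<psi> y w)\<^sup>2)
    = (LINT z|lborel. \<eta> (fst z) * \<eta> (snd z) * autocorr \<psi> ((snd z - fst z) *\<^sub>R w))"
proof -
  have [measurable]: "\<eta> \<in> borel_measurable borel" "\<psi> \<in> borel_measurable borel"
    using assms by (auto intro: bounded_supp_measurable)
  obtain N r where N: "N \<ge> 0" "r \<ge> 0" "\<And>y. \<bar>\<eta> y\<bar> \<le> N" "\<And>y. r < norm y \<Longrightarrow> \<eta> y = 0"
    using bounded_suppE[OF assms(1)] by metis
  obtain M s where M: "M \<ge> 0" "s \<ge> 0" "\<And>y. \<bar>\<psi> y\<bar> \<le> M" "\<And>y. s < norm y \<Longrightarrow> \<psi> y = 0"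
    using bounded_suppE[OF assms(2)] by metis
  define F where "F = (\<lambda>(y, \<tau>, \<tau>'). (\<eta> \<tau> * \<psi> (y + \<tau> *\<^sub>R w)) * (\<eta> \<tau>' * \<psi> (y + \<tau>' *\<^sub>R w)))"
  have F: "bounded_supp F"
  proof (rule bounded_suppI[where N="(N * M) * (N * M)" and r="(s + r * norm w + r) + r"])
    show "F \<in> borel_measurable borel" unfolding F_def by (simp add: case_prod_beta') measurable
    have a: "\<bar>\<eta> \<tau> * \<psi> y\<bar> \<le> N * M" for \<tau> y using N M by (auto simp: abs_mult intro!: mult_mono)
    show "\<bar>F y\<bar> \<le> (N * M) * (N * M)" for y
      using a N M by (cases y) (auto simp: F_def abs_mult[of "_ * _" "_ * _"] intro!: mult_mono)
    fix z assume z: "F z \<noteq> 0"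
    obtain x \<tau> \<tau>' where y: "z = (x, \<tau>, \<tau>')" by (cases z) auto
    have 1: "\<bar>\<tau>\<bar> \<le> r" "\<bar>\<tau>'\<bar> \<le> r" using z N(4)[of \<tau>] N(4)[of \<tau>'] by (auto simp: F_def y not_less[symmetric])
    have "norm (x + \<tau> *\<^sub>R w) \<le> s" using z M(4) by (auto simp: F_def y not_less[symmetric])
    then have "norm x \<le> s + \<bar>\<tau>\<bar> * norm w" using norm_triangle_ineq4[of "x + \<tau> *\<^sub>R w" "\<tau> *\<^sub>R w"] by simp
    moreover have "\<bar>\<tau>\<bar> * norm w \<le> r * norm w" using 1 by (intro mult_right_mono) auto
    moreover have "norm (x, \<tau>, \<tau>') \<le> norm x + (norm \<tau> + norm \<tau>')"
      using norm_Pair_le[of x "(\<tau>, \<tau>')"] norm_Pair_le[of \<tau> \<tau>'] by linarith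
    ultimately show "norm z \<le> (s + r * norm w + r) + r" using 1 by (simp add: y)
  qed
  have G: "bounded_supp (\<lambda>z. F (y, z))" for y
  proof (rule bounded_suppE[OF F])
    fix N r assume "0 \<le> N" "0 \<le> r" "\<And>y. \<bar>F y\<bar> \<le> N" and r: "\<And>y. r < norm y \<Longrightarrow> F y = 0"
    moreover have "F (y, z) = 0" if "r < norm z" for z
      using r[of "(y, z)"] that norm_snd_le[of z y] by auto
    moreover have [measurable]: "F \<in> borel_measurable borel" by (rule bounded_supp_measurable[OF F])
    ultimately show "bounded_supp (\<lambda>z. F (y, z))"
      by (intro bounded_suppI[where N=N and r=r]) (auto simp: not_less[symmetric])
  qed
  have "(LINT y|lborel. (ray_integral \<eta> \<psi> y w)\<^sup>2) = (LINT y|lborel. LINT z|lborel. F (y, z))"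
  proof (rule Bochner_Integration.integral_cong)
    fix y
    have "(LINT z|lborel. F (y, z)) = (LINT \<tau>|lborel. LINT \<tau>'|lborel. F (y, \<tau>, \<tau>'))"
      using bounded_supp_Fubini(2)[OF G[of y]] by simp
    also have "\<dots> = (ray_integral \<eta> \<psi> y w)\<^sup>2"
      by (simp add: F_def ray_integral_def power2_eq_square)
    finally show "(ray_integral \<eta> \<psi> y w)\<^sup>2 = (LINT z|lborel. F (y, z))" by simp
  qed simp
  also have "\<dots> = (LINT z|lborel. LINT y|lborel. F (y, z))"
    by (rule bounded_supp_Fubini(1)[OF F])
  also have "\<dots> = (LINT z|lborel. \<eta> (fst z) * \<eta> (snd z) * autocorr \<psi> ((snd z - fst z) *\<^sub>R w))"
  proof (rule Bochner_Integration.integral_cong)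
    fix z :: "real \<times> real"
    obtain \<tau> \<tau>' where z: "z = (\<tau>, \<tau>')" by (cases z)
    have "(LINT y|lborel. F (y, z)) = (LINT y|lborel. (\<eta> \<tau> * \<eta> \<tau>') * (\<psi> (y + \<tau> *\<^sub>R w) * \<psi> (y + \<tau>' *\<^sub>R w)))"
      by (simp add: z F_def mult_ac)
    also have "\<dots> = \<eta> \<tau> * \<eta> \<tau>' * autocorr \<psi> ((\<tau>' - \<tau>) *\<^sub>R w)"
      by (simp add: integral_product_translates[OF \<psi>] scaleR_left_diff_distrib)
    finally show "(LINT y|lborel. F (y, z)) = \<eta> (fst z) * \<eta> (snd z) * autocorr \<psi> ((snd z - fst z) *\<^sub>R w)"
      by (simp add: z)
  qed simp
  finally show ?thesis .
qed

text \<open>Meant for a signed weight with small \<open>L\<^sup>1\<close> norm, the increment of an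
  admissible weight. The right side comes from bounding the autocorrelation by its value at
  0.\<close>

lemma ray_integral_square_le:
  fixes \<psi> :: "'a::euclidean_space \<Rightarrow> real"
  assumes \<eta>: "bounded_supp \<eta>" and \<psi>: "bounded_supp \<psi>"
  shows "(LINT y|lborel. (ray_integral \<eta> \<psi> y w)\<^sup>2) \<le> (LINT \<tau>|lborel. \<bar>\<eta> \<tau>\<bar>)\<^sup>2 * (LINT y|lborel. (\<psi> y)\<^sup>2)"
proof -
  have [measurable]: "\<eta> \<in> borel_measurable borel" "\<psi> \<in> borel_measurable borel" "autocorr \<psi> \<in> borel_measurable borel"
    using assms by (auto intro: bounded_supp_measurable)
  define X where "X = (LINT y|lborel. (\<psi> y)\<^sup>2)"
  have X0: "X \<ge> 0" by (simp add: X_def)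
  have b\<eta>: "bounded_supp (\<lambda>\<tau>. \<bar>\<eta> \<tau>\<bar>)"
    using \<eta> by (auto simp: bounded_supp_def bounded_iff)
  obtain N r where N: "N \<ge> 0" "r \<ge> 0" "\<And>y. \<bar>\<eta> y\<bar> \<le> N" "\<And>y. r < norm y \<Longrightarrow> \<eta> y = 0"
    using bounded_suppE[OF assms(1)] by metis
  have b2: "bounded_supp (\<lambda>z. \<bar>\<eta> (fst z)\<bar> * \<bar>\<eta> (snd z)\<bar>)"
  proof (rule bounded_suppI[where N="N * N" and r="r + r"])
    fix z show "\<bar>\<bar>\<eta> (fst z)\<bar> * \<bar>\<eta> (snd z)\<bar>\<bar> \<le> N * N" using N by (auto simp: abs_mult intro!: mult_mono)
    assume "\<bar>\<eta> (fst z)\<bar> * \<bar>\<eta> (snd z)\<bar> \<noteq> 0"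
    then have "norm (fst z) \<le> r" "norm (snd z) \<le> r" using N(4)[of "fst z"] N(4)[of "snd z"] by (auto simp: not_less[symmetric])
    then show "norm z \<le> r + r" using norm_Pair_le[of "fst z" "snd z"] by simp
  qed measurable
  have "(LINT y|lborel. (ray_integral \<eta> \<psi> y w)\<^sup>2) \<le> norm (LINT z|lborel. \<eta> (fst z) * \<eta> (snd z) * autocorr \<psi> ((snd z - fst z) *\<^sub>R w))"
    unfolding ray_integral_square[OF assms] by simp
  also have "\<dots> \<le> (LINT z|lborel. (\<bar>\<eta> (fst z)\<bar> * \<bar>\<eta> (snd z)\<bar>) * X)"
  proof (rule Bochner_Integration.integral_norm_bound_integral)
    show i: "integrable lborel (\<lambda>z. (\<bar>\<eta> (fst z)\<bar> * \<bar>\<eta> (snd z)\<bar>) * X)"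
      using bounded_supp_integrable[OF b2] by (intro integrable_mult_left) auto
    show le: "norm (\<eta> (fst z) * \<eta> (snd z) * autocorr \<psi> ((snd z - fst z) *\<^sub>R w)) \<le> (\<bar>\<eta> (fst z)\<bar> * \<bar>\<eta> (snd z)\<bar>) * X" for z
      using autocorr_bound[OF \<psi>] by (auto simp: abs_mult X_def intro!: mult_mono)
    show "integrable lborel (\<lambda>z. \<eta> (fst z) * \<eta> (snd z) * autocorr \<psi> ((snd z - fst z) *\<^sub>R w))"
      by (rule Bochner_Integration.integrable_bound[OF i]) (use le X0 in \<open>auto simp: abs_mult\<close>)
  qed
  also have "\<dots> = (LINT z|lborel. \<bar>\<eta> (fst z)\<bar> * \<bar>\<eta> (snd z)\<bar>) * X" by simp
  also have "(LINT z|lborel. \<bar>\<eta> (fst z)\<bar> * \<bar>\<eta> (snd z)\<bar>) = (LINT \<tau>|lborel. \<bar>\<eta> \<tau>\<bar>)\<^sup>2"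
    using bounded_supp_Fubini(2)[OF b2] by (simp add: power2_eq_square)
  finally show ?thesis by (simp add: X_def)
qed

text \<open>The last clause is bounded variation in quantitative form: a unimodal weight of height
  at most 1 has variation at most 2, and each of the two translates has mass at most
  \<open>\<delta>\<close>. Nothing else about the two weights of Duhamel's formula enters the
  estimates, so both are treated at once.\<close>

definition admissible :: "real \<Rightarrow> (real \<Rightarrow> real) \<Rightarrow> bool" where
  "admissible \<delta> \<eta> \<longleftrightarrow> \<eta> \<in> borel_measurable borel \<and> (\<forall>\<tau>. 0 \<le> \<eta> \<tau> \<and> \<eta> \<tau> \<le> 1) \<and>
     (\<forall>\<tau>. \<tau> \<notin> {0..\<delta>} \<longrightarrow> \<eta> \<tau> = 0) \<and> (\<forall>s. (LINT \<tau>|lborel. \<bar>\<eta> (\<tau> + s) - \<eta> \<tau>\<bar>) \<le> 2 * min \<bar>s\<bar> \<delta>)"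

lemma admissible_bounded_supp: "admissible \<delta> \<eta> \<Longrightarrow> bounded_supp \<eta>"
proof (rule bounded_suppI[where N=1 and r="\<bar>\<delta>\<bar>"])
  assume a: "admissible \<delta> \<eta>"
  show "\<eta> \<in> borel_measurable borel" using a by (simp add: admissible_def)
  show "\<bar>\<eta> y\<bar> \<le> 1" for y using a by (simp add: admissible_def)
  show "norm y \<le> \<bar>\<delta>\<bar>" if "\<eta> y \<noteq> 0" for y
  proof -
    have "y \<in> {0..\<delta>}" using a that unfolding admissible_def by blast
    then show ?thesis by auto
  qed
qed

section \<open>Averages over the velocity cube\<close>

abbreviation cube :: "'a::euclidean_space set" where "cube \<equiv> cbox (- One) One"

text \<open>The singularity \<open>|\<tau>' - \<tau>| powr (- \<kappa>)\<close> on the diagonal is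
  integrable because \<open>\<kappa> < 1\<close>; the factor \<open>1 / (1 - \<kappa>)\<close> is
  the price, and the reason why the gain stops short of exponent 1. The inner integral is bounded by
  \<open>\<delta>\<close> and by
  \<open>2 / (1 - \<kappa>) * \<delta> * (a / \<delta>) powr \<kappa>\<close>; which of the two is
  used depends on where the minimum is attained.\<close>

lemma double_integral_min_powr:
  fixes \<kappa> \<delta> a :: real
  assumes \<kappa>: "0 < \<kappa>" "\<kappa> < 1" and \<delta>: "\<delta> > 0" and a: "a \<ge> 0"
  shows "(\<integral>\<^sup>+ z. indicator ({0..\<delta>} \<times> {0..\<delta>}) z * ennreal (min 1 (a / \<bar>snd z - fst z\<bar>) powr \<kappa>) \<partial>lborel)
     \<le> ennreal (2 / (1 - \<kappa>) * \<delta>\<^sup>2 * min 1 (a / \<delta>) powr \<kappa>)"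
proof -
  let ?f = "\<lambda>r. ennreal (min 1 (a / \<bar>r\<bar>) powr \<kappa>)"
  have 0: "emeasure lborel {0..\<delta>} = ennreal \<delta>" using \<delta> by simp
  have "(\<integral>\<^sup>+ z. indicator ({0..\<delta>} \<times> {0..\<delta>}) z * ?f (snd z - fst z) \<partial>lborel)
    = (\<integral>\<^sup>+ x. \<integral>\<^sup>+ y. indicator {0..\<delta>} x * (indicator {0..\<delta>} y * ?f (y - x)) \<partial>lborel \<partial>lborel)"
    unfolding lborel_prod[symmetric]
    by (subst lborel.nn_integral_fst[symmetric]) (auto simp: indicator_times mult_ac intro!: nn_integral_cong)
  also have "\<dots> = (\<integral>\<^sup>+ x. indicator {0..\<delta>} x * (\<integral>\<^sup>+ y. indicator {0..\<delta>} y * ?f (y - x) \<partial>lborel) \<partial>lborel)"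
    by (intro nn_integral_cong nn_integral_cmult) measurable
  also have "\<dots> \<le> (\<integral>\<^sup>+ x. indicator {0..\<delta>} x * ennreal (2 / (1 - \<kappa>) * \<delta> * min 1 (a / \<delta>) powr \<kappa>) \<partial>lborel)"
  proof (intro nn_integral_mono)
    fix x :: real
    show "indicator {0..\<delta>} x * (\<integral>\<^sup>+ y. indicator {0..\<delta>} y * ?f (y - x) \<partial>lborel)
       \<le> indicator {0..\<delta>} x * ennreal (2 / (1 - \<kappa>) * \<delta> * min 1 (a / \<delta>) powr \<kappa>)"
    proof (cases "x \<in> {0..\<delta>}")
      case x: True
      have le1: "(\<integral>\<^sup>+ y. indicator {0..\<delta>} y * ?f (y - x) \<partial>lborel) \<le> ennreal \<delta>"
      proof -
        have "min 1 (a / \<bar>y - x\<bar>) powr \<kappa> \<le> 1 powr \<kappa>" for y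
          using a \<kappa> by (intro powr_mono2) auto
        then have "(\<integral>\<^sup>+ y. indicator {0..\<delta>} y * ?f (y - x) \<partial>lborel) \<le> (\<integral>\<^sup>+ y. indicator {0..\<delta>} y \<partial>lborel)"
          by (intro nn_integral_mono) (auto simp: indicator_def intro!: ennreal_leI)
        also have "\<dots> = ennreal \<delta>" using 0 by (simp del: emeasure_lborel_Icc)
        finally show ?thesis .
      qed
      have le2: "(\<integral>\<^sup>+ y. indicator {0..\<delta>} y * ?f (y - x) \<partial>lborel) \<le> ennreal (2 / (1 - \<kappa>) * \<delta> * (a / \<delta>) powr \<kappa>)"
      proof -
        have "(\<integral>\<^sup>+ y. indicator {0..\<delta>} y * ?f (y - x) \<partial>lborel) = (\<integral>\<^sup>+ y. indicator {-x..\<delta> - x} y * ?f y \<partial>lborel)"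
        proof -
          have "(\<integral>\<^sup>+ y. indicator {0..\<delta>} y * ?f (y - x) \<partial>lborel) = (\<integral>\<^sup>+ y. indicator {0..\<delta>} (y + x) * ?f (y + x - x) \<partial>lborel)"
            by (rule lborel_nn_integral_translate[symmetric]) measurable
          also have "\<dots> = (\<integral>\<^sup>+ y. indicator {-x..\<delta> - x} y * ?f y \<partial>lborel)"
            by (intro nn_integral_cong) (auto simp: indicator_def)
          finally show ?thesis .
        qed
        also have "\<dots> \<le> (\<integral>\<^sup>+ y. ennreal (a powr \<kappa>) * (ennreal (y powr ((1 - \<kappa>) - 1)) * indicator {0<..<\<delta>} y)
            + ennreal (a powr \<kappa>) * (ennreal ((- y) powr ((1 - \<kappa>) - 1)) * indicator {0<..<\<delta>} (- y)) \<partial>lborel)"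
        proof (intro nn_integral_mono_AE)
          have "AE y in lborel. y \<noteq> 0 \<and> y \<noteq> \<delta> \<and> y \<noteq> - \<delta>"
            by (intro AE_conjI AE_lborel_singleton)
          then show "AE y in lborel. indicator {-x..\<delta> - x} y * ?f y
            \<le> ennreal (a powr \<kappa>) * (ennreal (y powr ((1 - \<kappa>) - 1)) * indicator {0<..<\<delta>} y)
            + ennreal (a powr \<kappa>) * (ennreal ((- y) powr ((1 - \<kappa>) - 1)) * indicator {0<..<\<delta>} (- y))"
          proof eventually_elim
            case (elim y)
            have f: "min 1 (a / \<bar>y\<bar>) powr \<kappa> \<le> a powr \<kappa> * \<bar>y\<bar> powr ((1 - \<kappa>) - 1)"
            proof -
              have "min 1 (a / \<bar>y\<bar>) powr \<kappa> \<le> (a / \<bar>y\<bar>) powr \<kappa>" using a \<kappa> by (intro powr_mono2) auto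
              also have "\<dots> = a powr \<kappa> * \<bar>y\<bar> powr ((1 - \<kappa>) - 1)"
                using a by (subst powr_divide) (auto simp: powr_minus divide_inverse)
              finally show ?thesis .
            qed
            show ?case
            proof (cases "y > 0")
              case True
              then show ?thesis using f elim x by (auto simp: indicator_def ennreal_mult[symmetric] intro!: ennreal_leI)
            next
              case False
              then show ?thesis using f elim x by (auto simp: indicator_def ennreal_mult[symmetric] intro!: ennreal_leI)
            qed
          qed
        qed
        also have "\<dots> = ennreal (a powr \<kappa>) * ennreal (\<delta> powr (1 - \<kappa>) / (1 - \<kappa>)) + ennreal (a powr \<kappa>) * ennreal (\<delta> powr (1 - \<kappa>) / (1 - \<kappa>))"
        proof -
          have 1: "(\<integral>\<^sup>+ y. ennreal (y powr ((1 - \<kappa>) - 1)) * indicator {0<..<\<delta>} y \<partial>lborel) = ennreal (\<delta> powr (1 - \<kappa>) / (1 - \<kappa>))"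
            using nn_integral_powr_from_0[of \<delta> "1 - \<kappa>"] \<kappa> \<delta> by simp
          have "(\<integral>\<^sup>+ y. ennreal ((- y) powr ((1 - \<kappa>) - 1)) * indicator {0<..<\<delta>} (- y) \<partial>lborel)
            = (\<integral>\<^sup>+ y. ennreal (y powr ((1 - \<kappa>) - 1)) * indicator {0<..<\<delta>} y \<partial>(distr lborel borel uminus))"
            by (subst nn_integral_distr) auto
          then have 2: "(\<integral>\<^sup>+ y. ennreal ((- y) powr ((1 - \<kappa>) - 1)) * indicator {0<..<\<delta>} (- y) \<partial>lborel) = ennreal (\<delta> powr (1 - \<kappa>) / (1 - \<kappa>))"
            unfolding lborel_distr_uminus 1 .
          show ?thesis unfolding 1[symmetric] by (subst (2) 1[folded 2]) (simp add: nn_integral_add nn_integral_cmult)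
        qed
        also have "\<dots> = ennreal (2 / (1 - \<kappa>) * (a powr \<kappa> * \<delta> powr (1 - \<kappa>)))"
          using \<kappa> by (simp add: ennreal_mult[symmetric] ennreal_plus[symmetric] del: ennreal_plus)
        also have "a powr \<kappa> * \<delta> powr (1 - \<kappa>) = \<delta> * (a / \<delta>) powr \<kappa>"
          using \<delta> a by (simp add: powr_diff powr_divide)
        finally show ?thesis by (simp add: mult.assoc)
      qed
      show ?thesis
      proof (cases "a / \<delta> \<le> 1")
        case True
        then have "min 1 (a / \<delta>) = a / \<delta>" by simp
        then show ?thesis using le2 x by simp
      next
        case False
        then have "min 1 (a / \<delta>) = 1" by simp
        moreover have "\<delta> \<le> 2 / (1 - \<kappa>) * \<delta> * 1" using \<delta> \<kappa> by (simp add: field_simps)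
        ultimately show ?thesis using le1 x by (auto intro: order_trans ennreal_leI)
      qed
    qed auto
  qed
  also have "\<dots> = ennreal \<delta> * ennreal (2 / (1 - \<kappa>) * \<delta> * min 1 (a / \<delta>) powr \<kappa>)"
    using 0 by (subst nn_integral_multc) (auto simp del: emeasure_lborel_Icc)
  also have "\<dots> = ennreal (2 / (1 - \<kappa>) * \<delta>\<^sup>2 * min 1 (a / \<delta>) powr \<kappa>)"
    using \<delta> \<kappa> by (simp add: ennreal_mult[symmetric] power2_eq_square mult_ac)
  finally show ?thesis .
qed

text \<open>Along the direction \<open>(1, v)\<close>, translating by \<open>- h\<close> agrees with the purely spatial translation by
  \<open>shear h v\<close> up to a shift of the ray parameter by \<open>fst h\<close>.\<close>

definition shear :: "spacetime \<Rightarrow> real^3 \<Rightarrow> spacetime" where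
  "shear h v = (0, fst h *\<^sub>R v - snd h)"

lemma shear_measurable [measurable]: "f \<in> borel_measurable M \<Longrightarrow> (\<lambda>x. shear h (f x)) \<in> borel_measurable M"
  unfolding shear_def
  by (intro borel_measurable_Pair borel_measurable_diff borel_measurable_scaleR borel_measurable_const)

text \<open>Turns the quadratic dependence on \<open>\<phi>\<close> into a linear one on
  \<open>autocorr \<phi>\<close>: a symmetric second difference, on which averaging over
  \<open>v\<close> can act by a change of variables.\<close>

lemma autocorr_difference:
  assumes "bounded_supp \<phi>"
  shows "autocorr (\<lambda>y. \<phi> (y + g) - \<phi> y) z = 2 * autocorr \<phi> z - autocorr \<phi> (z - g) - autocorr \<phi> (z + g)"
proof -
  note i = bounded_supp_integrable[OF bounded_supp_product_translates[OF assms]]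
  have "autocorr (\<lambda>y. \<phi> (y + g) - \<phi> y) z =
    (LINT y|lborel. (\<phi> (y + g) * \<phi> (y + (z + g)) - \<phi> (y + g) * \<phi> (y + z)) - (\<phi> (y + 0) * \<phi> (y + (z + g)) - \<phi> (y + 0) * \<phi> (y + z)))"
    unfolding autocorr_def by (simp add: algebra_simps)
  also have "\<dots> = autocorr \<phi> (z + g - g) - autocorr \<phi> (z - g) - (autocorr \<phi> (z + g - 0) - autocorr \<phi> (z - 0))"
    by (subst Bochner_Integration.integral_diff, (intro Bochner_Integration.integrable_diff i)+,
        subst Bochner_Integration.integral_diff, (intro i)+, subst Bochner_Integration.integral_diff, (intro i)+)
      (simp only: integral_product_translates[OF assms])
  finally show ?thesis by simp
qed

text \<open>The two shifted arguments arise from \<open>(r, r v)\<close> by substituting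
  \<open>v \<mapsto> (1 + \<sigma> fst h / r) v - \<sigma> snd h / r\<close>, so the average over
  the cube changes only through the deformation of the cube. The resulting bound is linear in
  \<open>norm h / |r|\<close>; it is weakened to the power \<open>\<kappa>\<close> so that its
  integral over pairs of ray parameters carries no logarithm.\<close>

lemma autocorr_cube_bound:
  fixes h :: spacetime and r :: real
  assumes \<phi>: "bounded_supp \<phi>" and r: "r \<noteq> 0" and \<kappa>: "0 < \<kappa>" "\<kappa> < 1"
  shows "\<bar>LINT v|lborel. indicator cube v * autocorr (\<lambda>y. \<phi> (y + shear h v) - \<phi> y) (r *\<^sub>R (1, v))\<bar>
     \<le> 192 * (LINT y|lborel. (\<phi> y)\<^sup>2) * min 1 (norm h / \<bar>r\<bar>) powr \<kappa>"
proof -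
  have [measurable]: "autocorr \<phi> \<in> borel_measurable borel" using \<phi> by measurable
  define X where "X = (LINT y|lborel. (\<phi> y)\<^sup>2)"
  have X: "X \<ge> 0" by (simp add: X_def)
  have bd: "\<bar>autocorr \<phi> z\<bar> \<le> X" for z unfolding X_def by (rule autocorr_bound[OF \<phi>])
  define c where "c = (\<lambda>v :: real^3. autocorr \<phi> (r, r *\<^sub>R v))"
  have [measurable]: "c \<in> borel_measurable borel" unfolding c_def by measurable
  have cb: "\<bar>c v\<bar> \<le> X" for v unfolding c_def by (rule bd)
  \<comment> \<open>The values \<open>\<sigma> = 1\<close> and \<open>\<sigma> = - 1\<close> give
    the two outer terms of the second difference, written as affine substitutions in
    \<open>c\<close>.\<close>
  define A where "A = (\<lambda>\<sigma> v. c ((1 + \<sigma> * fst h / r) *\<^sub>R v + (- \<sigma> / r) *\<^sub>R snd h))"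
  have Am: "A \<sigma> \<in> borel_measurable borel" for \<sigma> unfolding A_def by measurable
  have Ab: "\<bar>A \<sigma> v\<bar> \<le> X" for \<sigma> v unfolding A_def by (rule cb)
  have iQ: "integrable lborel (\<lambda>v :: real^3. indicator cube v * f v)" if "f \<in> borel_measurable borel" "\<And>v. \<bar>f v\<bar> \<le> X" for f
  proof -
    have "bounded_supp (\<lambda>v::real^3. f v * indicator cube v)"
    proof (rule bounded_supp_mult[where M=X])
      have "bounded (cube :: (real^3) set)" by (rule bounded_cbox)
      then obtain b where "\<And>x::real^3. x \<in> cube \<Longrightarrow> norm x \<le> b" by (auto simp: bounded_iff)
      then show "bounded_supp (indicator cube :: real^3 \<Rightarrow> real)"
        by (intro bounded_suppI[where N=1 and r=b]) (auto simp: indicator_def)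
    qed (use that in auto)
    then show ?thesis by (simp add: bounded_supp_integrable mult.commute)
  qed
  have eq: "autocorr (\<lambda>y. \<phi> (y + shear h v) - \<phi> y) (r *\<^sub>R (1, v)) = (c v - A (-1) v) + (c v - A 1 v)" for v
  proof -
    have "r *\<^sub>R (1, v) = (r, r *\<^sub>R v)" by simp
    moreover have "r *\<^sub>R (1, v) - shear h v = (r, r *\<^sub>R ((1 + (-1) * fst h / r) *\<^sub>R v + (- (-1) / r) *\<^sub>R snd h))"
      using r by (simp add: shear_def algebra_simps)
    moreover have "r *\<^sub>R (1, v) + shear h v = (r, r *\<^sub>R ((1 + 1 * fst h / r) *\<^sub>R v + (- 1 / r) *\<^sub>R snd h))"
      using r by (simp add: shear_def algebra_simps)
    ultimately show ?thesis unfolding autocorr_difference[OF \<phi>] c_def A_def by simp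
  qed
  define I where "I = (\<lambda>f :: real^3 \<Rightarrow> real. LINT v|lborel. indicator cube v * f v)"
  have split: "(LINT v|lborel. indicator cube v * autocorr (\<lambda>y. \<phi> (y + shear h v) - \<phi> y) (r *\<^sub>R (1, v)))
     = (I c - I (A (-1))) + (I c - I (A 1))"
  proof -
    have "(LINT v|lborel. indicator cube v * autocorr (\<lambda>y. \<phi> (y + shear h v) - \<phi> y) (r *\<^sub>R (1, v)))
       = (LINT v|lborel. (indicator cube v * c v - indicator cube v * A (-1) v) + (indicator cube v * c v - indicator cube v * A 1 v))"
      unfolding eq by (intro Bochner_Integration.integral_cong) (auto simp: algebra_simps)
    also have "\<dots> = (I c - I (A (-1))) + (I c - I (A 1))"
    proof -
      have i: "integrable lborel (\<lambda>v. indicator cube v * c v)" "integrable lborel (\<lambda>v. indicator cube v * A \<sigma> v)" for \<sigma>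
        using cb Ab Am by (auto intro!: iQ)
      show ?thesis unfolding I_def
        by (simp only: Bochner_Integration.integral_add Bochner_Integration.integral_diff Bochner_Integration.integrable_diff i)
    qed
    finally show ?thesis .
  qed
  have D3: "DIM(real^3) = 3" by simp
  \<comment> \<open>In dimension 3 the perturbation lemma has the constant
    \<open>2 ^ 4 * 3 = 48\<close>. It doubles because \<open>|fst h|\<close> and
    \<open>norm (snd h)\<close> are each bounded by \<open>norm h\<close>, and doubles again later
    because two shifts occur.\<close>
  have lin: "\<bar>I (A \<sigma>) - I c\<bar> \<le> 96 * X * (norm h / \<bar>r\<bar>)" if "\<bar>\<sigma>\<bar> = 1" for \<sigma>
  proof -
    have "\<bar>I (A \<sigma>) - I c\<bar> \<le> 2 ^ (DIM(real^3) + 1) * DIM(real^3) * X * (\<bar>(1 + \<sigma> * fst h / r) - 1\<bar> + norm (snd h) / \<bar>r\<bar>)"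
      unfolding I_def A_def
    proof (rule cube_affine_perturbation)
      fix i :: "real^3" assume "i \<in> Basis"
      then have "\<bar>snd h \<bullet> i\<bar> \<le> norm (snd h)" by (rule Basis_le_norm)
      then show "\<bar>((- \<sigma> / r) *\<^sub>R snd h) \<bullet> i\<bar> \<le> norm (snd h) / \<bar>r\<bar>"
        using that r by (simp add: abs_mult divide_right_mono)
    qed (use cb in auto)
    also have "\<dots> = 48 * X * ((\<bar>fst h\<bar> + norm (snd h)) / \<bar>r\<bar>)"
      using that by (simp add: abs_mult add_divide_distrib)
    also have "\<dots> \<le> 48 * X * ((2 * norm h) / \<bar>r\<bar>)"
      using X norm_fst_le[of "fst h" "snd h"] norm_snd_le[of "snd h" "fst h"]
      by (intro mult_left_mono divide_right_mono) auto
    finally show ?thesis by simp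
  qed
  have triv: "\<bar>I f\<bar> \<le> 8 * X" if "f \<in> borel_measurable borel" "\<And>v. \<bar>f v\<bar> \<le> X" for f
  proof -
    have "norm (I f) \<le> (LINT v::real^3|lborel. indicator cube v * X)"
      unfolding I_def
    proof (rule Bochner_Integration.integral_norm_bound_integral)
      show "integrable lborel (\<lambda>v. indicator cube v * f v)" by (rule iQ) fact+
      show "integrable lborel (\<lambda>v::real^3. indicator cube v * X)" by (rule iQ) (use X in auto)
      show "norm (indicator cube v * f v) \<le> indicator cube v * X" for v
        using that by (simp add: indicator_def)
    qed
    also have "\<dots> = 8 * X"
    proof -
      have "measure lborel (cube :: (real^3) set) = 2 ^ 3"
        using measure_lborel_symmetric_cbox[of 1, where 'a="real^3"] by simp
      then show ?thesis by simp
    qed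
    finally show ?thesis by simp
  qed
  have tot: "\<bar>(I c - I (A (-1))) + (I c - I (A 1))\<bar> \<le> 192 * X * min 1 (norm h / \<bar>r\<bar>)"
  proof (cases "norm h / \<bar>r\<bar> \<le> 1")
    case True
    then have m: "min 1 (norm h / \<bar>r\<bar>) = norm h / \<bar>r\<bar>" by simp
    have "\<bar>I (A 1) - I c\<bar> \<le> 96 * X * (norm h / \<bar>r\<bar>)" "\<bar>I (A (-1)) - I c\<bar> \<le> 96 * X * (norm h / \<bar>r\<bar>)"
      by (rule lin; simp)+
    moreover have "192 * X * (norm h / \<bar>r\<bar>) = 2 * (96 * X * (norm h / \<bar>r\<bar>))" by simp
    ultimately show ?thesis unfolding m by linarith
  next
    case False
    \<comment> \<open>For \<open>norm h > |r|\<close> no cancellation is used: four terms of size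
      \<open>8 X\<close> stay below \<open>192 X\<close>.\<close>
    have "\<bar>I c\<bar> \<le> 8 * X" "\<bar>I (A 1)\<bar> \<le> 8 * X" "\<bar>I (A (-1))\<bar> \<le> 8 * X"
      using cb Ab Am by (auto intro!: triv)
    then show ?thesis using False X by (simp add: min_def)
  qed
  also have "\<dots> \<le> 192 * X * min 1 (norm h / \<bar>r\<bar>) powr \<kappa>"
  proof (intro mult_left_mono)
    let ?m = "min 1 (norm h / \<bar>r\<bar>)"
    show "?m \<le> ?m powr \<kappa>"
    proof (cases "?m = 0")
      case False
      moreover have "?m \<ge> 0" by simp
      ultimately have "?m > 0" by linarith
      then have "?m powr 1 \<le> ?m powr \<kappa>" using \<kappa> by (intro powr_mono') auto
      then show ?thesis using \<open>?m > 0\<close> by simp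
    qed simp
  qed (use X in auto)
  finally show ?thesis unfolding split X_def .
qed

text \<open>From \<open>h = fst h (1, v) - shear h v\<close>: the time part is absorbed by
  translating the ray parameter, so the first term carries an increment of the weight only and the
  second a spatial increment of \<open>\<phi>\<close> only.\<close>

lemma ray_integral_shift_decomposition:
  fixes h :: spacetime and v :: "real^3"
  assumes \<eta>: "bounded_supp \<eta>" and \<phi>: "bounded_supp \<phi>"
  shows "ray_integral \<eta> (\<lambda>y. \<phi> (y - h) - \<phi> y) y (1, v)
    = ray_integral (\<lambda>\<tau>. \<eta> (\<tau> + fst h) - \<eta> \<tau>) (\<lambda>y. \<phi> (y + shear h v)) y (1, v)
      + ray_integral \<eta> (\<lambda>y. \<phi> (y + shear h v) - \<phi> y) y (1, v)"
proof -
  have [measurable]: "\<eta> \<in> borel_measurable borel" "\<phi> \<in> borel_measurable borel"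
    using assms by (auto intro: bounded_supp_measurable)
  let ?w = "(1, v) :: spacetime"
  have \<phi>s: "bounded_supp (\<lambda>y. \<phi> (y + shear h v))" by (rule bounded_supp_translate[OF \<phi>])
  have \<eta>s: "bounded_supp (\<lambda>\<tau>. \<eta> (\<tau> + fst h))" by (rule bounded_supp_translate[OF \<eta>])
  note i1 = integrable_ray[OF \<eta> \<phi>, of y ?w]
  note i2 = integrable_ray[OF \<eta> \<phi>s, of y ?w]
  note i3 = integrable_ray[OF \<eta>s \<phi>s, of y ?w]
  note i4 = integrable_ray[OF \<eta> bounded_supp_translate[OF \<phi>, of "- h"], of y ?w]
  \<comment> \<open>Translating the ray parameter by \<open>fst h\<close> compensates the time part
    of the shift by \<open>- h\<close>.\<close>
  have key: "(LINT \<tau>|lborel. \<eta> \<tau> * \<phi> (y + \<tau> *\<^sub>R ?w + - h)) = (LINT \<tau>|lborel. \<eta> (\<tau> + fst h) * \<phi> (y + \<tau> *\<^sub>R ?w + shear h v))"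
  proof -
    have eq: "y + (\<tau> + fst h) *\<^sub>R ?w + - h = y + \<tau> *\<^sub>R ?w + shear h v" for \<tau>
      by (cases h) (auto simp: shear_def algebra_simps prod_eq_iff)
    then have "(LINT \<tau>|lborel. \<eta> (\<tau> + fst h) * \<phi> (y + \<tau> *\<^sub>R ?w + shear h v))
        = (LINT \<tau>|lborel. (\<lambda>\<tau>. \<eta> \<tau> * \<phi> (y + \<tau> *\<^sub>R ?w + - h)) (\<tau> + fst h))"
      by (simp only: eq)
    also have "\<dots> = (LINT \<tau>|lborel. \<eta> \<tau> * \<phi> (y + \<tau> *\<^sub>R ?w + - h))"
      by (rule lborel_integral_translate) measurable
    finally show ?thesis by simp
  qed
  have "ray_integral \<eta> (\<lambda>y. \<phi> (y - h) - \<phi> y) y ?w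
    = (LINT \<tau>|lborel. \<eta> \<tau> * \<phi> (y + \<tau> *\<^sub>R ?w + - h) - \<eta> \<tau> * \<phi> (y + \<tau> *\<^sub>R ?w))"
    unfolding ray_integral_def by (intro Bochner_Integration.integral_cong) (auto simp: algebra_simps)
  also have "\<dots> = (LINT \<tau>|lborel. \<eta> (\<tau> + fst h) * \<phi> (y + \<tau> *\<^sub>R ?w + shear h v)) - (LINT \<tau>|lborel. \<eta> \<tau> * \<phi> (y + \<tau> *\<^sub>R ?w))"
    unfolding key[symmetric] by (rule Bochner_Integration.integral_diff[OF i4 i1])
  also have "\<dots> = ((LINT \<tau>|lborel. \<eta> (\<tau> + fst h) * \<phi> (y + \<tau> *\<^sub>R ?w + shear h v)) - (LINT \<tau>|lborel. \<eta> \<tau> * \<phi> (y + \<tau> *\<^sub>R ?w + shear h v)))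
     + ((LINT \<tau>|lborel. \<eta> \<tau> * \<phi> (y + \<tau> *\<^sub>R ?w + shear h v)) - (LINT \<tau>|lborel. \<eta> \<tau> * \<phi> (y + \<tau> *\<^sub>R ?w)))"
    by simp
  also have "\<dots> = (LINT \<tau>|lborel. \<eta> (\<tau> + fst h) * \<phi> (y + \<tau> *\<^sub>R ?w + shear h v) - \<eta> \<tau> * \<phi> (y + \<tau> *\<^sub>R ?w + shear h v))
     + (LINT \<tau>|lborel. \<eta> \<tau> * \<phi> (y + \<tau> *\<^sub>R ?w + shear h v) - \<eta> \<tau> * \<phi> (y + \<tau> *\<^sub>R ?w))"
    by (simp only: Bochner_Integration.integral_diff[OF i3 i2] Bochner_Integration.integral_diff[OF i2 i1])
  finally show ?thesis unfolding ray_integral_def by (simp only: left_diff_distrib right_diff_distrib)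
qed

text \<open>The velocity integral is carried out before absolute values are taken: the cancellation
  lies in the average over \<open>v\<close> for a fixed pair of ray parameters. Afterwards the pair
  is integrated against the singular bound, which gives the constant
  \<open>192 * 2 = 384\<close>.\<close>

lemma ray_integral_cube_shear:
  fixes \<kappa> \<delta> :: real and h :: spacetime
  assumes \<kappa>: "0 < \<kappa>" "\<kappa> < 1" and \<delta>: "\<delta> > 0" and \<eta>: "admissible \<delta> \<eta>" and \<phi>: "bounded_supp \<phi>"
  defines "I \<equiv> \<lambda>v::real^3. LINT y|lborel. (ray_integral \<eta> (\<lambda>y. \<phi> (y + shear h v) - \<phi> y) y (1, v))\<^sup>2"
  shows "integrable lborel (\<lambda>v. indicator cube v * I v)"
    and "(LINT v|lborel. indicator cube v * I v) \<le> 384 / (1 - \<kappa>) * \<delta>\<^sup>2 * min 1 (norm h / \<delta>) powr \<kappa> * (LINT y|lborel. (\<phi> y)\<^sup>2)"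
proof -
  have b\<eta>: "bounded_supp \<eta>" by (rule admissible_bounded_supp[OF \<eta>])
  have \<eta>01: "0 \<le> \<eta> \<tau>" "\<eta> \<tau> \<le> 1" for \<tau> using \<eta> by (auto simp: admissible_def)
  have \<eta>0: "\<eta> \<tau> = 0" if "\<tau> \<notin> {0..\<delta>}" for \<tau> using \<eta> that by (auto simp: admissible_def)
  have [measurable]: "\<eta> \<in> borel_measurable borel" "\<phi> \<in> borel_measurable borel" "autocorr \<phi> \<in> borel_measurable borel"
    using b\<eta> \<phi> by (auto intro: bounded_supp_measurable autocorr_measurable)
  define X where "X = (LINT y|lborel. (\<phi> y)\<^sup>2)"
  have X: "X \<ge> 0" by (simp add: X_def)
  have bd: "\<bar>autocorr \<phi> z\<bar> \<le> X" for z unfolding X_def by (rule autocorr_bound[OF \<phi>])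
  define A where "A = (\<lambda>v r. autocorr (\<lambda>y. \<phi> (y + shear h v) - \<phi> y) (r *\<^sub>R (1, v)))"
  have A_eq: "A v r = 2 * autocorr \<phi> (r *\<^sub>R (1, v)) - autocorr \<phi> (r *\<^sub>R (1, v) - shear h v) - autocorr \<phi> (r *\<^sub>R (1, v) + shear h v)" for v r
    unfolding A_def by (rule autocorr_difference[OF \<phi>])
  have A_le: "\<bar>A v r\<bar> \<le> 4 * X" for v r
    using bd[of "r *\<^sub>R (1, v)"] bd[of "r *\<^sub>R (1, v) - shear h v"] bd[of "r *\<^sub>R (1, v) + shear h v"] unfolding A_eq by linarith
  \<comment> \<open>The joint integrand in \<open>v\<close> and the pair of ray parameters; its
    boundedness and bounded support justify Fubini.\<close>
  define G where "G = (\<lambda>(v, z). indicator cube v * (\<eta> (fst z) * \<eta> (snd z) * A v (snd z - fst z)))"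
  have G: "bounded_supp G"
  proof -
    have "bounded (cube :: (real^3) set)" by (rule bounded_cbox)
    then obtain b where b: "\<And>x::real^3. x \<in> cube \<Longrightarrow> norm x \<le> b" by (auto simp: bounded_iff)
    show ?thesis
    proof (rule bounded_suppI[where N="4 * X" and r="b + (\<delta> + \<delta>)"])
      show "G \<in> borel_measurable borel"
      proof -
        define f where "f = (\<lambda>x :: (real^3) \<times> (real \<times> real). (snd (snd x) - fst (snd x)) *\<^sub>R (1 :: real, fst x))"
        define g where "g = (\<lambda>x :: (real^3) \<times> (real \<times> real). shear h (fst x))"
        have fg: "f \<in> borel_measurable borel" "g \<in> borel_measurable borel"
          unfolding f_def g_def shear_def by (intro borel_measurable_continuous_onI continuous_intros)+
        have c: "(\<lambda>x :: (real^3) \<times> (real \<times> real). fst (snd x)) \<in> borel_measurable borel"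
          "(\<lambda>x :: (real^3) \<times> (real \<times> real). snd (snd x)) \<in> borel_measurable borel"
          "(\<lambda>x :: (real^3) \<times> (real \<times> real). fst x) \<in> borel_measurable borel"
          by (intro borel_measurable_continuous_onI continuous_intros)+
        have ind: "(indicator cube :: real^3 \<Rightarrow> real) \<in> borel_measurable borel" by simp
        note m = measurable_compose[OF c(1) \<open>\<eta> \<in> borel_measurable borel\<close>]
          measurable_compose[OF c(2) \<open>\<eta> \<in> borel_measurable borel\<close>]
          measurable_compose[OF c(3) ind]
        have "G = (\<lambda>x. indicator cube (fst x) * (\<eta> (fst (snd x)) * \<eta> (snd (snd x)) *
            (2 * autocorr \<phi> (f x) - autocorr \<phi> (f x - g x) - autocorr \<phi> (f x + g x))))"
          by (simp add: G_def A_eq f_def g_def fun_eq_iff split: prod.splits)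
        also have "\<dots> \<in> borel_measurable borel"
          by (intro borel_measurable_times borel_measurable_diff borel_measurable_add borel_measurable_const m fg
            measurable_compose[OF _ \<open>autocorr \<phi> \<in> borel_measurable borel\<close>])
        finally show ?thesis .
      qed
      fix vz :: "(real^3) \<times> (real \<times> real)"
      obtain v \<tau> \<tau>' where vz: "vz = (v, \<tau>, \<tau>')" by (cases vz) auto
      have e: "0 \<le> \<eta> \<tau> * \<eta> \<tau>'" "\<eta> \<tau> * \<eta> \<tau>' \<le> 1" using \<eta>01 by (auto intro: mult_le_one)
      have "\<bar>\<eta> \<tau> * \<eta> \<tau>' * A v (\<tau>' - \<tau>)\<bar> \<le> 1 * (4 * X)"
        unfolding abs_mult[of "\<eta> \<tau> * \<eta> \<tau>'"] using e A_le by (intro mult_mono) auto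
      then show "\<bar>G vz\<bar> \<le> 4 * X" using X by (auto simp: G_def vz indicator_def)
      assume nz: "G vz \<noteq> 0"
      have "norm v \<le> b" using nz b by (auto simp: G_def vz indicator_def split: if_splits)
      moreover have "\<tau> \<in> {0..\<delta>}" "\<tau>' \<in> {0..\<delta>}" using nz \<eta>0[of \<tau>] \<eta>0[of \<tau>'] by (auto simp: G_def vz)
      ultimately show "norm vz \<le> b + (\<delta> + \<delta>)"
        unfolding vz using norm_Pair_le[of v "(\<tau>, \<tau>')"] norm_Pair_le[of \<tau> \<tau>'] by auto
    qed
  qed
  have IG: "indicator cube v * I v = (LINT z|lborel. G (v, z))" for v
  proof -
    have "I v = (LINT z|lborel. \<eta> (fst z) * \<eta> (snd z) * A v (snd z - fst z))"
      unfolding I_def A_def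
      by (rule ray_integral_square[OF b\<eta> bounded_supp_diff[OF bounded_supp_translate[OF \<phi>] \<phi>]])
    then show ?thesis by (simp add: G_def)
  qed
  show "integrable lborel (\<lambda>v. indicator cube v * I v)"
    unfolding IG by (rule bounded_supp_integrable[OF bounded_supp_integral_fst[OF G]])
  have iz: "integrable lborel (\<lambda>z. LINT v|lborel. G (v, z))"
    using lborel_pair.integrable_snd[of "\<lambda>x y. G (x, y)"] bounded_supp_integrable[OF G] by (simp add: lborel_prod)
  have "(LINT v|lborel. indicator cube v * I v) = (LINT z|lborel. LINT v|lborel. G (v, z))"
    unfolding IG by (rule bounded_supp_Fubini(1)[OF G])
  then have "ennreal (LINT v|lborel. indicator cube v * I v) \<le> ennreal (norm (LINT z|lborel. LINT v|lborel. G (v, z)))"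
    by (simp add: ennreal_leI)
  also have "\<dots> \<le> (\<integral>\<^sup>+ z. ennreal (norm (LINT v|lborel. G (v, z))) \<partial>lborel)"
    by (rule integral_norm_bound_ennreal[OF iz])
  also have "\<dots> \<le> (\<integral>\<^sup>+ z. ennreal (192 * X) * (indicator ({0..\<delta>} \<times> {0..\<delta>}) z * ennreal (min 1 (norm h / \<bar>snd z - fst z\<bar>) powr \<kappa>)) \<partial>lborel)"
  proof (rule nn_integral_mono_AE)
    \<comment> \<open>The diagonal is a null set; it has to be removed because
      \<open>autocorr_cube_bound\<close> excludes \<open>r = 0\<close>.\<close>
    have "AE z in (lborel \<Otimes>\<^sub>M lborel). snd z - fst z \<noteq> (0::real)"
    proof (rule lborel_pair.AE_pair_measure)
      show "AE x in lborel. AE y in lborel. snd (x, y) - fst (x, y) \<noteq> (0::real)"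
      proof (rule AE_I2)
        fix x :: real
        have "AE y in lborel. y \<noteq> x" by (rule AE_lborel_singleton)
        then show "AE y in lborel. snd (x, y) - fst (x, y) \<noteq> 0" by eventually_elim simp
      qed
    qed measurable
    then have "AE z in lborel. snd z - fst z \<noteq> (0::real)" unfolding lborel_prod .
    then show "AE z in lborel. ennreal (norm (LINT v|lborel. G (v, z))) \<le> ennreal (192 * X) * (indicator ({0..\<delta>} \<times> {0..\<delta>}) z * ennreal (min 1 (norm h / \<bar>snd z - fst z\<bar>) powr \<kappa>))"
    proof eventually_elim
      case (elim z)
      obtain \<tau> \<tau>' where z: "z = (\<tau>, \<tau>')" by (cases z)
      define J where "J = (LINT v|lborel. indicator cube v * A v (\<tau>' - \<tau>))"
      have J: "\<bar>J\<bar> \<le> 192 * X * min 1 (norm h / \<bar>\<tau>' - \<tau>\<bar>) powr \<kappa>"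
        unfolding J_def A_def X_def by (rule autocorr_cube_bound[OF \<phi> _ \<kappa>]) (use elim z in auto)
      have "(LINT v|lborel. G (v, z)) = \<eta> \<tau> * \<eta> \<tau>' * J"
      proof -
        have "(LINT v|lborel. G (v, z)) = (LINT v|lborel. (\<eta> \<tau> * \<eta> \<tau>') * (indicator cube v * A v (\<tau>' - \<tau>)))"
          by (simp add: G_def z mult_ac)
        then show ?thesis by (simp add: J_def)
      qed
      moreover have "\<bar>\<eta> \<tau> * \<eta> \<tau>' * J\<bar> \<le> 1 * (192 * X * min 1 (norm h / \<bar>\<tau>' - \<tau>\<bar>) powr \<kappa>)"
        unfolding abs_mult[of "\<eta> \<tau> * \<eta> \<tau>'"] using J \<eta>01 by (intro mult_mono) (auto intro: mult_le_one)
      moreover have "\<eta> \<tau> * \<eta> \<tau>' = 0" if "z \<notin> {0..\<delta>} \<times> {0..\<delta>}"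
        using that \<eta>0[of \<tau>] \<eta>0[of \<tau>'] by (auto simp: z)
      ultimately show ?case using X by (cases "z \<in> {0..\<delta>} \<times> {0..\<delta>}") (auto simp: z ennreal_mult[symmetric] intro!: ennreal_leI)
    qed
  qed
  also have "\<dots> = ennreal (192 * X) * (\<integral>\<^sup>+ z. (indicator ({0..\<delta>} \<times> {0..\<delta>}) z * ennreal (min 1 (norm h / \<bar>snd z - fst z\<bar>) powr \<kappa>)) \<partial>lborel)"
  proof (rule nn_integral_cmult)
    have "(\<lambda>z::real \<times> real. snd z - fst z) \<in> borel_measurable borel"
      by (intro borel_measurable_continuous_onI continuous_intros)
    from measurable_compose[OF this, of "\<lambda>r. ennreal (min 1 (norm h / \<bar>r\<bar>) powr \<kappa>)" borel]
    have "(\<lambda>z::real \<times> real. ennreal (min 1 (norm h / \<bar>snd z - fst z\<bar>) powr \<kappa>)) \<in> borel_measurable borel" by simp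
    moreover have "{0..\<delta>} \<times> {0..\<delta>} \<in> sets borel" by (intro borel_closed closed_Times) auto
    ultimately show "(\<lambda>z. indicator ({0..\<delta>} \<times> {0..\<delta>}) z * ennreal (min 1 (norm h / \<bar>snd z - fst z\<bar>) powr \<kappa>)) \<in> borel_measurable lborel"
      by (intro borel_measurable_times_ennreal borel_measurable_indicator) simp_all
  qed
  also have "\<dots> \<le> ennreal (192 * X) * ennreal (2 / (1 - \<kappa>) * \<delta>\<^sup>2 * min 1 (norm h / \<delta>) powr \<kappa>)"
    by (intro mult_left_mono double_integral_min_powr \<kappa> \<delta>) auto
  also have "\<dots> = ennreal (384 / (1 - \<kappa>) * \<delta>\<^sup>2 * min 1 (norm h / \<delta>) powr \<kappa> * X)"
    using X \<kappa> \<delta> by (simp add: ennreal_mult[symmetric] mult_ac)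
  finally show "(LINT v|lborel. indicator cube v * I v) \<le> 384 / (1 - \<kappa>) * \<delta>\<^sup>2 * min 1 (norm h / \<delta>) powr \<kappa> * (LINT y|lborel. (\<phi> y)\<^sup>2)"
    unfolding X_def[symmetric] using X \<kappa> by (subst (asm) ennreal_le_iff) auto
qed

text \<open>Splitting into weight increment and shear costs a factor 2 in the square. The weight
  part gives \<open>2 * 4 * 8 = 64\<close>, where 8 is the volume of the cube, and the shear part
  gives \<open>2 * 384 = 768\<close>.\<close>

lemma ray_integral_cube_L2:
  fixes \<kappa> \<delta> :: real and h :: spacetime
  assumes \<kappa>: "0 < \<kappa>" "\<kappa> < 1" and \<delta>: "\<delta> > 0" and \<eta>: "admissible \<delta> \<eta>" and \<phi>: "bounded_supp \<phi>"
  shows "(\<integral>\<^sup>+ v. indicator cube v * (\<integral>\<^sup>+ y. ennreal ((ray_integral \<eta> (\<lambda>y. \<phi> (y - h) - \<phi> y) y (1, v :: real^3))\<^sup>2) \<partial>lborel) \<partial>lborel)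
    \<le> ennreal ((64 + 768 / (1 - \<kappa>)) * \<delta>\<^sup>2 * min 1 (norm h / \<delta>) powr \<kappa>) * (\<integral>\<^sup>+ y. ennreal ((\<phi> y)\<^sup>2) \<partial>lborel)"
proof -
  have b\<eta>: "bounded_supp \<eta>" by (rule admissible_bounded_supp[OF \<eta>])
  have [measurable]: "\<eta> \<in> borel_measurable borel" "\<phi> \<in> borel_measurable borel"
    using b\<eta> \<phi> by (auto intro: bounded_supp_measurable)
  define X where "X = (LINT y|lborel. (\<phi> y)\<^sup>2)"
  have X: "X \<ge> 0" by (simp add: X_def)
  define m where "m = (\<lambda>\<tau>. \<eta> (\<tau> + fst h) - \<eta> \<tau>)"
  have bm: "bounded_supp m" unfolding m_def by (intro bounded_supp_diff bounded_supp_translate b\<eta>)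
  define M where "M = min 1 (norm h / \<delta>) powr \<kappa>"
  define I where "I v = (LINT y|lborel. (ray_integral \<eta> (\<lambda>y. \<phi> (y + shear h v) - \<phi> y) y (1, v))\<^sup>2)" for v :: "real^3"
  note shear_bound = ray_integral_cube_shear[OF \<kappa> \<delta> \<eta> \<phi>, of h, folded I_def X_def M_def]
  \<comment> \<open>Bounded variation of the weight yields a full power of
    \<open>min 1 (norm h / \<delta>)\<close>, squared here. As this number is at most 1, its power
    \<open>\<kappa>\<close> is a weaker bound.\<close>
  have mX: "(LINT \<tau>|lborel. \<bar>m \<tau>\<bar>)\<^sup>2 \<le> 4 * \<delta>\<^sup>2 * M"
  proof -
    have "(LINT \<tau>|lborel. \<bar>m \<tau>\<bar>) \<le> 2 * min \<bar>fst h\<bar> \<delta>" using \<eta> by (auto simp: m_def admissible_def)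
    also have "\<dots> \<le> 2 * (\<delta> * min 1 (norm h / \<delta>))"
      using \<delta> norm_fst_le[of "fst h" "snd h"] by (auto simp: min_def field_simps)
    finally have "(LINT \<tau>|lborel. \<bar>m \<tau>\<bar>)\<^sup>2 \<le> (2 * (\<delta> * min 1 (norm h / \<delta>)))\<^sup>2"
      by (intro power_mono) auto
    also have "\<dots> = 4 * \<delta>\<^sup>2 * (min 1 (norm h / \<delta>))\<^sup>2" by (simp add: power_mult_distrib)
    also have "(min 1 (norm h / \<delta>))\<^sup>2 \<le> M"
    proof -
      let ?m = "min 1 (norm h / \<delta>)"
      have m01: "0 \<le> ?m" "?m \<le> 1" using \<delta> by auto
      show ?thesis
      proof (cases "?m = 0")
        case False
        then have "?m powr 2 \<le> ?m powr \<kappa>" using \<kappa> m01 by (intro powr_mono') auto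
        then show ?thesis using False m01 by (simp add: M_def)
      qed (simp add: M_def)
    qed
    finally show ?thesis by (simp add: mult_left_mono)
  qed
  have inner: "(\<integral>\<^sup>+ y. ennreal ((ray_integral \<eta> (\<lambda>y. \<phi> (y - h) - \<phi> y) y (1, v))\<^sup>2) \<partial>lborel) \<le> ennreal (8 * \<delta>\<^sup>2 * M * X + 2 * I v)" for v :: "real^3"
  proof -
    define E where "E = (\<lambda>y. ray_integral m (\<lambda>y. \<phi> (y + shear h v)) y (1, v))"
    define D where "D = (\<lambda>y. ray_integral \<eta> (\<lambda>y. \<phi> (y + shear h v) - \<phi> y) y (1, v))"
    have bE: "bounded_supp E" unfolding E_def by (intro bounded_supp_ray_integral bm bounded_supp_translate \<phi>)
    have bD: "bounded_supp D" unfolding D_def by (intro bounded_supp_ray_integral b\<eta> bounded_supp_diff bounded_supp_translate \<phi>)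
    have i: "integrable lborel (\<lambda>y. (E y)\<^sup>2)" "integrable lborel (\<lambda>y. (D y)\<^sup>2)"
      using bE bD by (auto intro: bounded_supp_integrable bounded_supp_power2)
    have EX: "(LINT y|lborel. (E y)\<^sup>2) \<le> 4 * \<delta>\<^sup>2 * M * X"
    proof -
      have "(LINT y|lborel. (E y)\<^sup>2) \<le> (LINT \<tau>|lborel. \<bar>m \<tau>\<bar>)\<^sup>2 * (LINT y|lborel. (\<phi> (y + shear h v))\<^sup>2)"
        unfolding E_def by (intro ray_integral_square_le bm bounded_supp_translate \<phi>)
      also have "(LINT y|lborel. (\<phi> (y + shear h v))\<^sup>2) = X"
        unfolding X_def by (rule lborel_integral_translate[of "\<lambda>y. (\<phi> y)\<^sup>2"]) measurable
      finally show ?thesis using mult_right_mono[OF mX X] by linarith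
    qed
    have "(\<integral>\<^sup>+ y. ennreal ((ray_integral \<eta> (\<lambda>y. \<phi> (y - h) - \<phi> y) y (1, v))\<^sup>2) \<partial>lborel)
       = (\<integral>\<^sup>+ y. ennreal ((E y + D y)\<^sup>2) \<partial>lborel)"
      unfolding ray_integral_shift_decomposition[OF b\<eta> \<phi>] E_def D_def m_def ..
    also have "\<dots> \<le> (\<integral>\<^sup>+ y. ennreal (2 * (E y)\<^sup>2 + 2 * (D y)\<^sup>2) \<partial>lborel)"
    proof (intro nn_integral_mono ennreal_leI)
      show "(E y + D y)\<^sup>2 \<le> 2 * (E y)\<^sup>2 + 2 * (D y)\<^sup>2" for y
        using zero_le_power2[of "E y - D y"] by (simp add: power2_eq_square algebra_simps)
    qed
    also have "\<dots> = ennreal (LINT y|lborel. 2 * (E y)\<^sup>2 + 2 * (D y)\<^sup>2)"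
      using i by (intro nn_integral_eq_integral) auto
    also have "\<dots> \<le> ennreal (8 * \<delta>\<^sup>2 * M * X + 2 * I v)"
      using i EX by (intro ennreal_leI) (simp add: I_def D_def mult_ac)
    finally show ?thesis .
  qed
  have cQ: "emeasure lborel (cube :: (real^3) set) = 8"
    using measure_lborel_symmetric_cbox[of 1, where 'a="real^3"] emeasure_lborel_cbox_finite[of "- One" "One :: real^3"]
    by (simp add: emeasure_eq_ennreal_measure)
  have I0: "0 \<le> I v" for v unfolding I_def by (rule integral_nonneg_AE) simp
  have M0: "M \<ge> 0" by (simp add: M_def)
  have bX: "0 \<le> 8 * \<delta>\<^sup>2 * M * X" using M0 X by simp
  have "(\<integral>\<^sup>+ v. indicator cube v * (\<integral>\<^sup>+ y. ennreal ((ray_integral \<eta> (\<lambda>y. \<phi> (y - h) - \<phi> y) y (1, v :: real^3))\<^sup>2) \<partial>lborel) \<partial>lborel)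
    \<le> (\<integral>\<^sup>+ (v::real^3). ennreal (8 * \<delta>\<^sup>2 * M * X) * indicator cube v + ennreal 2 * ennreal (indicator cube v * I v) \<partial>lborel)"
  proof (intro nn_integral_mono)
    fix v :: "real^3"
    have "indicator cube v * (\<integral>\<^sup>+ y. ennreal ((ray_integral \<eta> (\<lambda>y. \<phi> (y - h) - \<phi> y) y (1, v :: real^3))\<^sup>2) \<partial>lborel)
      \<le> indicator cube v * ennreal (8 * \<delta>\<^sup>2 * M * X + 2 * I v)"
      by (intro mult_left_mono inner) auto
    also have "\<dots> = ennreal (8 * \<delta>\<^sup>2 * M * X) * indicator cube v + ennreal 2 * ennreal (indicator cube v * I v)"
      using I0[of v] bX by (auto simp: indicator_def ennreal_mult)
    finally show "indicator cube v * (\<integral>\<^sup>+ y. ennreal ((ray_integral \<eta> (\<lambda>y. \<phi> (y - h) - \<phi> y) y (1, v :: real^3))\<^sup>2) \<partial>lborel)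
      \<le> ennreal (8 * \<delta>\<^sup>2 * M * X) * indicator cube v + ennreal 2 * ennreal (indicator cube v * I v)" .
  qed
  also have "\<dots> = ennreal (8 * \<delta>\<^sup>2 * M * X) * 8 + ennreal 2 * ennreal (LINT v|lborel. indicator cube v * I v)"
  proof -
    have [measurable]: "(\<lambda>v. indicator cube v * I v) \<in> borel_measurable borel"
      using borel_measurable_integrable[OF shear_bound(1)] by simp
    have "(\<integral>\<^sup>+ v. ennreal (indicator cube v * I v) \<partial>lborel) = ennreal (LINT v|lborel. indicator cube v * I v)"
      using shear_bound(1) I0 by (intro nn_integral_eq_integral) auto
    moreover have "(\<integral>\<^sup>+ (v::real^3). ennreal (8 * \<delta>\<^sup>2 * M * X) * indicator cube v \<partial>lborel) = ennreal (8 * \<delta>\<^sup>2 * M * X) * 8"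
      unfolding cQ[symmetric] by (rule nn_integral_cmult_indicator) simp
    ultimately show ?thesis by (subst nn_integral_add) (auto simp: nn_integral_cmult)
  qed
  also have "\<dots> \<le> ennreal (8 * \<delta>\<^sup>2 * M * X) * ennreal 8 + ennreal 2 * ennreal (384 / (1 - \<kappa>) * \<delta>\<^sup>2 * M * X)"
    using shear_bound(2) by (intro add_mono mult_left_mono ennreal_leI) auto
  also have "\<dots> = ennreal ((64 + 768 / (1 - \<kappa>)) * \<delta>\<^sup>2 * M * X)"
  proof -
    have "0 \<le> 384 / (1 - \<kappa>) * \<delta>\<^sup>2 * M * X" using M0 X \<kappa> by simp
    moreover have "ennreal a * ennreal 8 + ennreal 2 * ennreal b = ennreal (a * 8 + 2 * b)" if "0 \<le> a" "0 \<le> b" for a b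
      using that by (simp add: ennreal_mult)
    ultimately have "ennreal (8 * \<delta>\<^sup>2 * M * X) * ennreal 8 + ennreal 2 * ennreal (384 / (1 - \<kappa>) * \<delta>\<^sup>2 * M * X)
      = ennreal ((8 * \<delta>\<^sup>2 * M * X) * 8 + 2 * (384 / (1 - \<kappa>) * \<delta>\<^sup>2 * M * X))"
      using bX by blast
    also have "(8 * \<delta>\<^sup>2 * M * X) * 8 + 2 * (384 / (1 - \<kappa>) * \<delta>\<^sup>2 * M * X) = (64 + 768 / (1 - \<kappa>)) * \<delta>\<^sup>2 * M * X"
      by (simp add: algebra_simps)
    finally show ?thesis .
  qed
  also have "\<dots> = ennreal ((64 + 768 / (1 - \<kappa>)) * \<delta>\<^sup>2 * M) * ennreal X"
    using M0 X \<kappa> by (intro ennreal_mult) auto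
  also have "ennreal X = (\<integral>\<^sup>+ y. ennreal ((\<phi> y)\<^sup>2) \<partial>lborel)"
    unfolding X_def by (rule nn_integral_eq_integral[symmetric]) (auto intro: bounded_supp_integrable bounded_supp_power2 \<phi>)
  finally show ?thesis unfolding M_def .
qed

subsection \<open>Relativistic velocities\<close>

definition velocity :: "real^3 \<Rightarrow> real^3" where
  "velocity p = (1 / energy p) *\<^sub>R p"

lemma energy_pos: "energy p > 0"
  unfolding energy_def by (simp add: add_pos_nonneg)

lemma energy_power2: "(energy p)\<^sup>2 = 1 + (norm p)\<^sup>2"
  unfolding energy_def by (simp add: add_nonneg_nonneg)

lemma continuous_on_energy [continuous_intros]: "continuous_on S energy"
  unfolding energy_def by (intro continuous_intros)

lemma continuous_on_velocity: "continuous_on S velocity"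
  unfolding velocity_def using energy_pos by (intro continuous_intros) (auto simp: less_imp_neq[symmetric])

lemma velocity_measurable [measurable]: "velocity \<in> borel_measurable borel"
  by (intro borel_measurable_continuous_onI continuous_on_velocity)

lemma norm_velocity_less_1: "norm (velocity p) < 1"
proof -
  have "norm p < energy p" unfolding energy_def by (rule real_less_rsqrt) simp
  then show ?thesis using energy_pos[of p] by (simp add: velocity_def)
qed

lemma velocity_in_cube: "velocity p \<in> cube"
proof -
  have "\<bar>velocity p \<bullet> i\<bar> \<le> 1" if "i \<in> Basis" for i
    using Basis_le_norm[OF that, of "velocity p"] norm_velocity_less_1[of p] by linarith
  then show ?thesis by (auto simp: mem_box abs_le_iff)
qed

lemma has_derivative_velocity:
  "(velocity has_derivative (\<lambda>k. (1 / energy p) *\<^sub>R k - ((p \<bullet> k) / energy p ^ 3) *\<^sub>R p)) (at p within S)"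
proof -
  have "(energy has_derivative (\<lambda>k. (p \<bullet> k) / energy p)) (at p within S)"
  proof -
    have e: "energy = (\<lambda>p. sqrt (1 + p \<bullet> p))" by (auto simp: energy_def power2_norm_eq_inner)
    have pos: "0 < 1 + p \<bullet> p" by (simp add: add_pos_nonneg)
    have "((\<lambda>p. 1 + p \<bullet> p) has_derivative (\<lambda>k. 0 + (p \<bullet> k + k \<bullet> p))) (at p within S)"
      by (intro has_derivative_add has_derivative_const has_derivative_inner has_derivative_ident)
    from has_derivative_real_sqrt[OF pos this]
    have "(energy has_derivative (\<lambda>k. (0 + (p \<bullet> k + k \<bullet> p)) * (inverse (energy p) / 2))) (at p within S)"
      by (simp only: e)
    moreover have "(0 + (p \<bullet> k + k \<bullet> p)) * (inverse (energy p) / 2) = (p \<bullet> k) / energy p" for k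
      by (simp only: inner_commute[of k p] divide_inverse) simp
    ultimately show ?thesis by (simp only:)
  qed
  from Deriv.has_derivative_inverse[OF _ this]
  have "((\<lambda>p. inverse (energy p)) has_derivative (\<lambda>k. - (inverse (energy p) * ((p \<bullet> k) / energy p) * inverse (energy p)))) (at p within S)"
    using energy_pos[of p] by simp
  from has_derivative_scaleR[OF this has_derivative_ident]
  have "((\<lambda>p. inverse (energy p) *\<^sub>R p) has_derivative
      (\<lambda>k. inverse (energy p) *\<^sub>R k + (- (inverse (energy p) * ((p \<bullet> k) / energy p) * inverse (energy p))) *\<^sub>R p)) (at p within S)" .
  moreover have "velocity = (\<lambda>p. inverse (energy p) *\<^sub>R p)"
    by (simp add: velocity_def fun_eq_iff divide_inverse)
  moreover have "(\<lambda>k. inverse (energy p) *\<^sub>R k + (- (inverse (energy p) * ((p \<bullet> k) / energy p) * inverse (energy p))) *\<^sub>R p)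
     = (\<lambda>k. (1 / energy p) *\<^sub>R k - ((p \<bullet> k) / energy p ^ 3) *\<^sub>R p)"
    by (simp add: fun_eq_iff power3_eq_cube divide_inverse mult_ac)
  ultimately show ?thesis by simp
qed

text \<open>The matrix is a rank-one perturbation \<open>a I - b p p^T\<close> of a multiple of the
  identity, with determinant \<open>a ^ 3 - a\<^sup>2 b |p|\<^sup>2\<close>. Inserting
  \<open>a = 1 / e\<close>, \<open>b = 1 / e ^ 3\<close> and
  \<open>|p|\<^sup>2 = e\<^sup>2 - 1\<close> leaves a single term.\<close>

lemma det_velocity_derivative:
  "det (matrix (\<lambda>k. (1 / energy p) *\<^sub>R k - ((p \<bullet> k) / energy p ^ 3) *\<^sub>R p)) = 1 / energy p ^ 5"
proof -
  define e where "e = energy p"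
  have e: "e > 0" by (simp add: e_def energy_pos)
  have e2: "e\<^sup>2 = 1 + (p$1 * p$1 + p$2 * p$2 + p$3 * p$3)"
    unfolding e_def energy_power2 power2_norm_eq_inner by (simp add: inner_vec_def sum_3)
  define a b where "a = 1 / e" and "b = 1 / e ^ 3"
  have m: "matrix (\<lambda>k. (1 / e) *\<^sub>R k - ((p \<bullet> k) / e ^ 3) *\<^sub>R p) $ i $ j = (if i = j then a else 0) - b * p $ i * p $ j" for i j
  proof -
    have "axis j (1::real) $ i = (if i = j then 1 else 0)" by (simp add: axis_def)
    then show ?thesis by (simp add: matrix_def a_def b_def inner_axis)
  qed
  have "det (matrix (\<lambda>k. (1 / e) *\<^sub>R k - ((p \<bullet> k) / e ^ 3) *\<^sub>R p)) = a ^ 3 - a\<^sup>2 * b * (p$1 * p$1 + p$2 * p$2 + p$3 * p$3)"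
    unfolding det_3 m by (simp add: algebra_simps power2_eq_square power3_eq_cube)
  also have "\<dots> = a ^ 3 - a\<^sup>2 * b * (e\<^sup>2 - 1)" by (simp add: e2)
  also have "\<dots> = 1 / e ^ 5"
  proof -
    have c: "(1 / x) * y * x = y" if "x \<noteq> 0" for x y :: real using that by simp
    have "a ^ 3 - a\<^sup>2 * b * (e\<^sup>2 - 1) = 1 / e ^ 3 - (1 / e\<^sup>2) * (1 / e ^ 3) * e\<^sup>2 + 1 / (e\<^sup>2 * e ^ 3)"
      by (simp add: a_def b_def power_one_over algebra_simps diff_divide_distrib)
    also have "\<dots> = 1 / (e\<^sup>2 * e ^ 3)" using e by (subst c) simp_all
    also have "e\<^sup>2 * e ^ 3 = e ^ 5" by (simp add: power_add[symmetric])
    finally show ?thesis .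
  qed
  finally show ?thesis by (simp add: e_def)
qed

text \<open>The speed determines the energy through
  \<open>|v|\<^sup>2 = 1 - 1 / energy\<^sup>2\<close>, and the momentum is the energy times the
  velocity.\<close>

lemma inj_velocity: "inj velocity"
proof (rule injI)
  fix p q assume eq: "velocity p = velocity q"
  have n: "(norm (velocity p))\<^sup>2 = 1 - 1 / (energy p)\<^sup>2" for p
  proof -
    have "(norm (velocity p))\<^sup>2 = (norm p)\<^sup>2 / (energy p)\<^sup>2"
      by (simp add: velocity_def power_mult_distrib power_divide)
    also have "(norm p)\<^sup>2 = (energy p)\<^sup>2 - 1" by (simp add: energy_power2)
    finally show ?thesis using energy_pos[of p] by (simp add: diff_divide_distrib)
  qed
  have "1 / (energy p)\<^sup>2 = 1 / (energy q)\<^sup>2" using n[of p] n[of q] eq by simp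
  then have "(energy p)\<^sup>2 = (energy q)\<^sup>2" by simp
  then have "energy p = energy q" using energy_pos[of p] energy_pos[of q] by (simp add: power2_eq_iff)
  then show "p = q" using eq energy_pos[of q] by (simp add: velocity_def)
qed

text \<open>The change of variables has density \<open>energy p powr (- 5)\<close>, which on
  \<open>ball 0 \<rho>\<close> is bounded below by \<open>(1 + \<rho>\<^sup>2) powr (- 3)\<close>.
  This passes from averages over momenta to averages over velocities; enlarging the range of the
  velocities to a cube makes the affine deformation argument applicable.\<close>

lemma emeasure_velocity_vimage_le:
  assumes E: "E \<in> sets borel"
  shows "emeasure lborel (ball 0 \<rho> \<inter> velocity -` E) \<le> ennreal ((1 + \<rho>\<^sup>2) ^ 3) * emeasure lborel (cube \<inter> E)"
proof -
  define S where "S = ball 0 \<rho> \<inter> velocity -` E"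
  define d where "d = (\<lambda>p::real^3. \<lambda>k::real^3. (1 / energy p) *\<^sub>R k - ((p \<bullet> k) / energy p ^ 3) *\<^sub>R p)"
  have Sb: "S \<in> sets borel" unfolding S_def using measurable_sets[OF velocity_measurable E] by auto
  then have Sl: "S \<in> sets lebesgue" by simp
  have der: "(velocity has_derivative d p) (at p within S)" for p
    unfolding d_def by (rule has_derivative_velocity)
  have inj: "inj_on velocity S" using inj_velocity by (rule inj_on_subset) simp
  have det: "\<bar>det (matrix (d p))\<bar> = 1 / energy p ^ 5" for p
    unfolding d_def det_velocity_derivative using energy_pos[of p] by simp
  have Sf: "emeasure lborel S < \<infinity>"
  proof -
    have "emeasure lborel S \<le> emeasure lborel (ball (0::real^3) \<rho>)" by (rule emeasure_mono) (auto simp: S_def)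
    also have "\<dots> < \<infinity>" by (rule emeasure_lborel_ball_finite)
    finally show ?thesis .
  qed
  have int: "(\<lambda>p. \<bar>det (matrix (d p))\<bar>) integrable_on S"
  proof -
    have "continuous_on UNIV (\<lambda>p. 1 / energy p ^ 5)"
      using energy_pos by (intro continuous_intros) (auto simp: less_imp_neq[symmetric])
    then have m: "(\<lambda>p. 1 / energy p ^ 5) \<in> borel_measurable borel" by (rule borel_measurable_continuous_onI)
    have "integrable lborel (\<lambda>p. indicator S p *\<^sub>R (1 / energy p ^ 5))"
    proof (rule integrableI_bounded_set[where A=S and B=1])
      show "AE x in lborel. x \<in> S \<longrightarrow> norm (indicator S x *\<^sub>R (1 / energy x ^ 5)) \<le> 1"
      proof (intro AE_I2 impI)
        fix x
        have "1 \<le> energy x" unfolding energy_def by simp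
        then have "1 \<le> energy x ^ 5" by (rule one_le_power)
        moreover have "0 \<le> 1 / z" "1 / z \<le> 1" if "1 \<le> z" for z :: real using that by auto
        ultimately have "0 \<le> 1 / energy x ^ 5" "1 / energy x ^ 5 \<le> 1" by blast+
        moreover have "norm (indicator S x *\<^sub>R y) \<le> 1" if "0 \<le> y" "y \<le> 1" for y :: real
          using that by (auto simp: indicator_def)
        ultimately show "norm (indicator S x *\<^sub>R (1 / energy x ^ 5)) \<le> 1" by blast
      qed
      show "(\<lambda>p. indicator S p *\<^sub>R (1 / energy p ^ 5)) \<in> borel_measurable lborel"
        using borel_measurable_scaleR[OF borel_measurable_indicator[OF Sb] m] by (simp only: measurable_lborel2)
    qed (use Sb Sf in auto)
    then have "set_integrable lborel S (\<lambda>p. 1 / energy p ^ 5)" by (simp add: set_integrable_def)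
    then have "(\<lambda>p. 1 / energy p ^ 5) integrable_on S" by (rule set_borel_integral_eq_integral)
    then show ?thesis by (simp add: det)
  qed
  have img: "velocity ` S \<in> lmeasurable" "measure lebesgue (velocity ` S) = integral S (\<lambda>p. \<bar>det (matrix (d p))\<bar>)"
    using measurable_differentiable_image_eq[OF Sl der inj] measure_differentiable_image_eq[OF Sl der inj int] int by auto
  have Slm: "S \<in> lmeasurable" using Sf Sb by (simp add: fmeasurable_def)
  define c where "c = 1 / (1 + \<rho>\<^sup>2) ^ 3"
  have c: "c > 0" by (simp add: c_def add_pos_nonneg)
  have cle: "c \<le> \<bar>det (matrix (d p))\<bar>" if "p \<in> S" for p
  proof -
    have e1: "1 \<le> energy p" unfolding energy_def by simp
    have "norm p < \<rho>" using that by (simp add: S_def)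
    then have "(norm p)\<^sup>2 \<le> \<rho>\<^sup>2" by (intro power_mono) auto
    \<comment> \<open>One power is given away to reach an even exponent, so that the bound becomes a
      polynomial in \<open>\<rho>\<close>.\<close>
    have "energy p ^ 5 \<le> energy p ^ 6" by (rule power_increasing[OF _ e1]) simp
    also have "\<dots> = ((energy p)\<^sup>2) ^ 3" by (simp add: power_mult[symmetric])
    also have "\<dots> \<le> (1 + \<rho>\<^sup>2) ^ 3" unfolding energy_power2 using \<open>(norm p)\<^sup>2 \<le> \<rho>\<^sup>2\<close> by (intro power_mono) auto
    finally show ?thesis unfolding det c_def using energy_pos[of p] by (intro divide_left_mono) (auto simp: add_pos_nonneg)
  qed
  have "c * measure lebesgue S = integral S (\<lambda>p. c)"
    using lmeasure_integral[OF Slm] integral_mult_right[of S c "\<lambda>_. 1 :: real"] by simp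
  also have "\<dots> \<le> integral S (\<lambda>p. \<bar>det (matrix (d p))\<bar>)"
    using Slm by (intro integral_le int cle integrable_on_const)
  also have "\<dots> \<le> measure lebesgue (cube \<inter> E)"
  proof -
    have "velocity ` S \<subseteq> cube \<inter> E" using velocity_in_cube by (auto simp: S_def)
    moreover have "cube \<inter> E \<in> lmeasurable"
      using E by (intro fmeasurable_Int_fmeasurable lmeasurable_cbox) simp
    ultimately have "measure lebesgue (velocity ` S) \<le> measure lebesgue (cube \<inter> E)"
      by (rule measure_mono_fmeasurable[OF _ fmeasurableD[OF img(1)]])
    then show ?thesis by (simp only: img(2))
  qed
  finally have "measure lebesgue S \<le> measure lebesgue (cube \<inter> E) / c"
    using c by (subst pos_le_divide_eq) (simp_all only: mult.commute)
  then have le: "measure lborel S \<le> (1 + \<rho>\<^sup>2) ^ 3 * measure lborel (cube \<inter> E)"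
    using Sb E by (simp add: measure_completion c_def mult.commute)
  have Ef: "emeasure lborel (cube \<inter> E) < \<infinity>"
  proof -
    have "emeasure lborel (cube \<inter> E) \<le> emeasure lborel (cube :: (real^3) set)" by (rule emeasure_mono) auto
    also have "\<dots> < \<infinity>" by (rule emeasure_lborel_cbox_finite)
    finally show ?thesis .
  qed
  have "emeasure lborel S = ennreal (measure lborel S)"
    using Sf by (intro emeasure_eq_ennreal_measure) (simp only: less_top infinity_ennreal_def)
  also have "\<dots> \<le> ennreal ((1 + \<rho>\<^sup>2) ^ 3 * measure lborel (cube \<inter> E))" by (rule ennreal_leI[OF le])
  also have "\<dots> = ennreal ((1 + \<rho>\<^sup>2) ^ 3) * ennreal (measure lborel (cube \<inter> E))"
    by (rule ennreal_mult) auto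
  also have "ennreal (measure lborel (cube \<inter> E)) = emeasure lborel (cube \<inter> E)"
    using Ef by (intro emeasure_eq_ennreal_measure[symmetric]) (simp only: less_top infinity_ennreal_def)
  finally show ?thesis unfolding S_def .
qed

text \<open>The comparison on Borel sets says that the pushed-forward measure \<open>M\<close> lies
  below a multiple \<open>N\<close> of Lebesgue measure on the cube, and integrals of nonnegative
  functions are monotone in the measure.\<close>

lemma nn_integral_velocity_le:
  fixes G :: "real^3 \<Rightarrow> ennreal"
  assumes [measurable]: "G \<in> borel_measurable borel"
  shows "(\<integral>\<^sup>+ p. indicator (ball 0 \<rho>) p * G (velocity p) \<partial>lborel) \<le> ennreal ((1 + \<rho>\<^sup>2) ^ 3) * (\<integral>\<^sup>+ v. indicator cube v * G v \<partial>lborel)"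
proof -
  define c where "c = ennreal ((1 + \<rho>\<^sup>2) ^ 3)"
  define M where "M = distr (density lborel (indicator (ball 0 \<rho>))) borel velocity"
  define N where "N = density lborel (\<lambda>v::real^3. c * indicator cube v)"
  have "M \<le> N"
  proof -
    have "emeasure M E \<le> emeasure N E" if E: "E \<in> sets borel" for E
    proof -
      have 1: "emeasure M E = emeasure lborel (ball 0 \<rho> \<inter> velocity -` E)"
      proof -
        have V: "velocity -` E \<in> sets borel" using measurable_sets[OF velocity_measurable E] by simp
        have "emeasure M E = emeasure (density lborel (indicator (ball 0 \<rho>))) (velocity -` E)"
          unfolding M_def using E by (subst emeasure_distr) auto
        also have "\<dots> = (\<integral>\<^sup>+ p. indicator (ball 0 \<rho>) p * indicator (velocity -` E) p \<partial>lborel)"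
          using V by (intro emeasure_density borel_measurable_indicator) auto
        also have "\<dots> = emeasure lborel (ball 0 \<rho> \<inter> velocity -` E)"
          unfolding indicator_inter_arith[symmetric] using V by (intro nn_integral_indicator) auto
        finally show ?thesis .
      qed
      have 2: "emeasure N E = c * emeasure lborel (cube \<inter> E)"
      proof -
        have "emeasure N E = (\<integral>\<^sup>+ v. c * indicator (cube \<inter> E) v \<partial>lborel)"
          unfolding N_def using E by (subst emeasure_density) (auto simp: indicator_inter_arith mult.assoc)
        also have "\<dots> = c * emeasure lborel (cube \<inter> E)" using E by (intro nn_integral_cmult_indicator) auto
        finally show ?thesis .
      qed
      show ?thesis unfolding 1 2 c_def by (rule emeasure_velocity_vimage_le[OF E])
    qed
    moreover have sets: "sets M = sets borel" "sets N = sets borel" by (simp_all add: M_def N_def)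
    moreover have "emeasure M E = 0" if "E \<notin> sets borel" for E
      using that sets by (intro emeasure_notin_sets) simp
    ultimately have "emeasure M \<le> emeasure N"
      unfolding le_fun_def by (metis zero_le)
    then show ?thesis
      using sets sets_eq_imp_space_eq[of M N] by (simp add: le_measure_iff)
  qed
  then have "nn_integral M G \<le> nn_integral N G"
    by (intro nn_integral_mono_measure) (auto simp: M_def N_def)
  moreover have "nn_integral M G = (\<integral>\<^sup>+ p. indicator (ball 0 \<rho>) p * G (velocity p) \<partial>lborel)"
  proof -
    have "nn_integral M G = (\<integral>\<^sup>+ p. G (velocity p) \<partial>density lborel (indicator (ball 0 \<rho>)))"
      unfolding M_def by (subst nn_integral_distr) auto
    also have "\<dots> = (\<integral>\<^sup>+ p. indicator (ball 0 \<rho>) p * G (velocity p) \<partial>lborel)"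
      by (intro nn_integral_density borel_measurable_indicator) auto
    finally show ?thesis .
  qed
  moreover have "nn_integral N G = c * (\<integral>\<^sup>+ v. indicator cube v * G v \<partial>lborel)"
    unfolding N_def by (subst nn_integral_density) (auto simp: nn_integral_cmult mult.assoc)
  ultimately show ?thesis by (simp add: c_def)
qed

text \<open>The dual of the increment operator on momentum averages. Dividing by
  \<open>\<delta>\<close> makes its endpoint bounds independent of \<open>\<delta>\<close>; the
  momentum cutoff is invisible to functions supported in the ball and makes the
  \<open>L\<^sup>1\<close> bound finite.\<close>

definition phase_op :: "real \<Rightarrow> real \<Rightarrow> (real \<Rightarrow> real) \<Rightarrow> spacetime \<Rightarrow> (spacetime \<Rightarrow> real) \<Rightarrow> phase \<Rightarrow> real" where
  "phase_op \<rho> \<delta> \<eta> h \<phi> z = indicator (ball 0 \<rho>) (snd z) *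
     (ray_integral \<eta> (\<lambda>y. \<phi> (y - h) - \<phi> y) (fst z) (1, velocity (snd z)) / \<delta>)"

section \<open>Endpoint bounds of the phase-space operator\<close>

lemma ray_integral_phase_measurable:
  assumes "\<eta> \<in> borel_measurable borel" "\<psi> \<in> borel_measurable borel"
  shows "(\<lambda>z :: phase. ray_integral \<eta> \<psi> (fst z) (1, velocity (snd z))) \<in> borel_measurable borel"
proof (rule ray_integral_measurable[OF assms])
  show "(\<lambda>z :: phase. fst z) \<in> borel_measurable borel"
    by (intro borel_measurable_continuous_onI continuous_intros)
  have "continuous_on UNIV (\<lambda>z :: phase. velocity (snd z))"
    by (rule continuous_on_compose2[OF continuous_on_velocity[of UNIV]]) (auto intro: continuous_intros)
  then show "(\<lambda>z :: phase. (1, velocity (snd z)) :: spacetime) \<in> borel_measurable borel"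
    by (intro borel_measurable_continuous_onI continuous_intros)
qed

lemma indicator_snd_measurable:
  "(\<lambda>z :: phase. indicator (ball 0 \<rho>) (snd z) :: real) \<in> borel_measurable borel"
proof -
  have 1: "(snd :: phase \<Rightarrow> _) \<in> borel_measurable borel"
    by (intro borel_measurable_continuous_onI continuous_intros)
  have 2: "(indicator (ball 0 \<rho>) :: real^3 \<Rightarrow> real) \<in> borel_measurable borel"
    by (intro borel_measurable_indicator) simp
  show ?thesis by (rule measurable_compose[OF 1 2])
qed

lemma bounded_supp_shift_diff: "bounded_supp \<phi> \<Longrightarrow> bounded_supp (\<lambda>y. \<phi> (y - h) - \<phi> y)"
  using bounded_supp_diff[OF bounded_supp_translate[of \<phi> "- h"]] by simp

lemma phase_op_measurable:
  assumes "\<eta> \<in> borel_measurable borel" "bounded_supp \<phi>"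
  shows "phase_op \<rho> \<delta> \<eta> h \<phi> \<in> borel_measurable borel"
  unfolding phase_op_def[abs_def]
  by (intro borel_measurable_times borel_measurable_divide borel_measurable_const indicator_snd_measurable
      ray_integral_phase_measurable assms bounded_supp_measurable bounded_supp_shift_diff)

lemma ray_integral_add:
  assumes "bounded_supp \<eta>" "bounded_supp \<psi>1" "bounded_supp \<psi>2"
  shows "ray_integral \<eta> (\<lambda>y. \<psi>1 y + \<psi>2 y) y w = ray_integral \<eta> \<psi>1 y w + ray_integral \<eta> \<psi>2 y w"
  unfolding ray_integral_def distrib_left
  by (rule Bochner_Integration.integral_add) (intro integrable_ray assms)+

lemma admissible_integral_le:
  assumes "admissible \<delta> \<eta>" "\<delta> > 0"
  shows "(\<integral>\<^sup>+ \<tau>. ennreal (\<eta> \<tau>) \<partial>lborel) \<le> ennreal \<delta>"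
proof -
  have "\<eta> \<tau> \<le> indicator {0..\<delta>} \<tau>" for \<tau>
    using assms(1) by (cases "\<tau> \<in> {0..\<delta>}") (auto simp: admissible_def)
  then have "(\<integral>\<^sup>+ \<tau>. ennreal (\<eta> \<tau>) \<partial>lborel) \<le> (\<integral>\<^sup>+ \<tau>. ennreal (indicator {0..\<delta>} \<tau>) \<partial>lborel)"
    by (intro nn_integral_mono ennreal_leI)
  also have "\<dots> = (\<integral>\<^sup>+ \<tau>. indicator {0..\<delta>} \<tau> \<partial>lborel)" by (intro nn_integral_cong) (auto simp: indicator_def)
  also have "\<dots> = emeasure lborel {0..\<delta>}" by (rule nn_integral_indicator) simp
  also have "\<dots> = ennreal \<delta>" using assms by simp
  finally show ?thesis .
qed

lemma ray_integral_abs_le: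
  fixes \<psi> :: "'a::euclidean_space \<Rightarrow> real"
  assumes \<eta>: "admissible \<delta> \<eta>" and \<psi>: "bounded_supp \<psi>"
  shows "ennreal \<bar>ray_integral \<eta> \<psi> y w\<bar> \<le> (\<integral>\<^sup>+ \<tau>. ennreal (\<eta> \<tau>) * ennreal \<bar>\<psi> (y + \<tau> *\<^sub>R w)\<bar> \<partial>lborel)"
proof -
  have "ennreal (norm (ray_integral \<eta> \<psi> y w)) \<le> (\<integral>\<^sup>+ \<tau>. ennreal (norm (\<eta> \<tau> * \<psi> (y + \<tau> *\<^sub>R w))) \<partial>lborel)"
    unfolding ray_integral_def
    by (rule integral_norm_bound_ennreal[OF integrable_ray[OF admissible_bounded_supp[OF \<eta>] \<psi>]])
  also have "\<dots> = (\<integral>\<^sup>+ \<tau>. ennreal (\<eta> \<tau>) * ennreal \<bar>\<psi> (y + \<tau> *\<^sub>R w)\<bar> \<partial>lborel)"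
    using \<eta> by (intro nn_integral_cong) (auto simp: admissible_def abs_mult ennreal_mult)
  finally show ?thesis by simp
qed

lemma ray_integral_sup_le:
  fixes \<psi> :: "'a::euclidean_space \<Rightarrow> real"
  assumes \<eta>: "admissible \<delta> \<eta>" and \<psi>: "bounded_supp \<psi>" and \<delta>: "\<delta> > 0" and N: "\<And>y. \<bar>\<psi> y\<bar> \<le> N"
  shows "\<bar>ray_integral \<eta> \<psi> y w\<bar> \<le> \<delta> * N"
proof -
  have N0: "N \<ge> 0" using N[of 0] by linarith
  have [measurable]: "\<eta> \<in> borel_measurable borel" using \<eta> by (simp add: admissible_def)
  have "ennreal \<bar>ray_integral \<eta> \<psi> y w\<bar> \<le> (\<integral>\<^sup>+ \<tau>. ennreal (\<eta> \<tau>) * ennreal \<bar>\<psi> (y + \<tau> *\<^sub>R w)\<bar> \<partial>lborel)"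
    by (rule ray_integral_abs_le[OF \<eta> \<psi>])
  also have "\<dots> \<le> (\<integral>\<^sup>+ \<tau>. ennreal (\<eta> \<tau>) * ennreal N \<partial>lborel)"
    using N by (intro nn_integral_mono mult_left_mono ennreal_leI) auto
  also have "\<dots> = (\<integral>\<^sup>+ \<tau>. ennreal (\<eta> \<tau>) \<partial>lborel) * ennreal N" by (rule nn_integral_multc) measurable
  also have "\<dots> \<le> ennreal \<delta> * ennreal N" by (intro mult_right_mono admissible_integral_le[OF \<eta> \<delta>]) auto
  also have "\<dots> = ennreal (\<delta> * N)" using \<delta> N0 by (simp add: ennreal_mult)
  finally show ?thesis using \<delta> N0 by (subst (asm) ennreal_le_iff) auto
qed

lemma ray_integral_L1_le:
  fixes \<psi> :: "'a::euclidean_space \<Rightarrow> real"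
  assumes \<eta>: "admissible \<delta> \<eta>" and \<psi>: "bounded_supp \<psi>" and \<delta>: "\<delta> > 0"
  shows "(\<integral>\<^sup>+ y. ennreal \<bar>ray_integral \<eta> \<psi> y w\<bar> \<partial>lborel) \<le> ennreal \<delta> * (\<integral>\<^sup>+ y. ennreal \<bar>\<psi> y\<bar> \<partial>lborel)"
proof -
  have [measurable]: "\<eta> \<in> borel_measurable borel" using \<eta> by (simp add: admissible_def)
  have [measurable]: "\<psi> \<in> borel_measurable borel" by (rule bounded_supp_measurable[OF \<psi>])
  have "(\<integral>\<^sup>+ y. ennreal \<bar>ray_integral \<eta> \<psi> y w\<bar> \<partial>lborel)
     \<le> (\<integral>\<^sup>+ y. \<integral>\<^sup>+ \<tau>. ennreal (\<eta> \<tau>) * ennreal \<bar>\<psi> (y + \<tau> *\<^sub>R w)\<bar> \<partial>lborel \<partial>lborel)"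
    by (intro nn_integral_mono ray_integral_abs_le[OF \<eta> \<psi>])
  also have "\<dots> = (\<integral>\<^sup>+ \<tau>. \<integral>\<^sup>+ y. ennreal (\<eta> \<tau>) * ennreal \<bar>\<psi> (y + \<tau> *\<^sub>R w)\<bar> \<partial>lborel \<partial>lborel)"
    by (rule lborel_pair.Fubini'[symmetric]) measurable
  also have "\<dots> = (\<integral>\<^sup>+ \<tau>. ennreal (\<eta> \<tau>) * (\<integral>\<^sup>+ y. ennreal \<bar>\<psi> y\<bar> \<partial>lborel) \<partial>lborel)"
  proof (rule nn_integral_cong)
    fix \<tau>
    have "(\<integral>\<^sup>+ y. ennreal (\<eta> \<tau>) * ennreal \<bar>\<psi> (y + \<tau> *\<^sub>R w)\<bar> \<partial>lborel) = ennreal (\<eta> \<tau>) * (\<integral>\<^sup>+ y. ennreal \<bar>\<psi> (y + \<tau> *\<^sub>R w)\<bar> \<partial>lborel)"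
      by (rule nn_integral_cmult) measurable
    also have "(\<integral>\<^sup>+ y. ennreal \<bar>\<psi> (y + \<tau> *\<^sub>R w)\<bar> \<partial>lborel) = (\<integral>\<^sup>+ y. ennreal \<bar>\<psi> y\<bar> \<partial>lborel)"
      by (rule lborel_nn_integral_translate) measurable
    finally show "(\<integral>\<^sup>+ y. ennreal (\<eta> \<tau>) * ennreal \<bar>\<psi> (y + \<tau> *\<^sub>R w)\<bar> \<partial>lborel) = ennreal (\<eta> \<tau>) * (\<integral>\<^sup>+ y. ennreal \<bar>\<psi> y\<bar> \<partial>lborel)" .
  qed
  also have "\<dots> = (\<integral>\<^sup>+ \<tau>. ennreal (\<eta> \<tau>) \<partial>lborel) * (\<integral>\<^sup>+ y. ennreal \<bar>\<psi> y\<bar> \<partial>lborel)"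
    by (rule nn_integral_multc) measurable
  also have "\<dots> \<le> ennreal \<delta> * (\<integral>\<^sup>+ y. ennreal \<bar>\<psi> y\<bar> \<partial>lborel)"
    by (intro mult_right_mono admissible_integral_le[OF \<eta> \<delta>]) auto
  finally show ?thesis .
qed

lemma nn_integral_phase:
  fixes F :: "phase \<Rightarrow> ennreal"
  assumes "F \<in> borel_measurable borel"
  shows "(\<integral>\<^sup>+ z. F z \<partial>lborel) = (\<integral>\<^sup>+ p. \<integral>\<^sup>+ y. F (y, p) \<partial>lborel \<partial>lborel)"
proof -
  have "F \<in> borel_measurable (lborel \<Otimes>\<^sub>M lborel)" using assms by (simp add: lborel_prod)
  from lborel_pair.nn_integral_snd[OF this] show ?thesis by (simp add: lborel_prod)
qed

text \<open>For every momentum in the ball each of the two translates contributes the norm of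
  \<open>\<phi>\<close>; hence twice the volume of the ball.\<close>

lemma phase_op_L1_le:
  assumes \<eta>: "admissible \<delta> \<eta>" and \<phi>: "bounded_supp \<phi>" and \<delta>: "\<delta> > 0"
  shows "(\<integral>\<^sup>+ z. ennreal \<bar>phase_op \<rho> \<delta> \<eta> h \<phi> z\<bar> \<partial>lborel)
     \<le> ennreal (2 * measure lborel (ball (0::real^3) \<rho>)) * (\<integral>\<^sup>+ y. ennreal \<bar>\<phi> y\<bar> \<partial>lborel)"
proof -
  have \<eta>m: "\<eta> \<in> borel_measurable borel" using \<eta> by (simp add: admissible_def)
  have [measurable]: "\<phi> \<in> borel_measurable borel" by (rule bounded_supp_measurable[OF \<phi>])
  define \<psi> where "\<psi> = (\<lambda>y. \<phi> (y - h) - \<phi> y)"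
  have \<psi>: "bounded_supp \<psi>" unfolding \<psi>_def by (rule bounded_supp_shift_diff[OF \<phi>])
  have [measurable]: "\<psi> \<in> borel_measurable borel" by (rule bounded_supp_measurable[OF \<psi>])
  define X where "X = (\<integral>\<^sup>+ y. ennreal \<bar>\<phi> y\<bar> \<partial>lborel)"
  have \<psi>X: "(\<integral>\<^sup>+ y. ennreal \<bar>\<psi> y\<bar> \<partial>lborel) \<le> 2 * X"
  proof -
    have "(\<integral>\<^sup>+ y. ennreal \<bar>\<psi> y\<bar> \<partial>lborel) \<le> (\<integral>\<^sup>+ y. ennreal \<bar>\<phi> (y + - h)\<bar> + ennreal \<bar>\<phi> y\<bar> \<partial>lborel)"
      by (intro nn_integral_mono) (auto simp: \<psi>_def ennreal_plus[symmetric] simp del: ennreal_plus intro!: ennreal_leI)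
    also have "\<dots> = (\<integral>\<^sup>+ y. ennreal \<bar>\<phi> (y + - h)\<bar> \<partial>lborel) + X"
      unfolding X_def by (rule nn_integral_add) measurable
    also have "(\<integral>\<^sup>+ y. ennreal \<bar>\<phi> (y + - h)\<bar> \<partial>lborel) = X"
      unfolding X_def by (rule lborel_nn_integral_translate) measurable
    finally show ?thesis by (simp add: mult_2)
  qed
  have m: "(\<lambda>z. ennreal \<bar>phase_op \<rho> \<delta> \<eta> h \<phi> z\<bar>) \<in> borel_measurable borel"
    using phase_op_measurable[OF \<eta>m \<phi>] by (intro measurable_compose[OF borel_measurable_abs measurable_ennreal])
  have bm: "ball (0::real^3) \<rho> \<in> sets lborel" by simp
  have "(\<integral>\<^sup>+ z. ennreal \<bar>phase_op \<rho> \<delta> \<eta> h \<phi> z\<bar> \<partial>lborel)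
     = (\<integral>\<^sup>+ p. \<integral>\<^sup>+ y. ennreal \<bar>phase_op \<rho> \<delta> \<eta> h \<phi> (y, p)\<bar> \<partial>lborel \<partial>lborel)"
    by (rule nn_integral_phase[OF m])
  also have "\<dots> \<le> (\<integral>\<^sup>+ (p::real^3). 2 * X * indicator (ball 0 \<rho>) p \<partial>lborel)"
  proof (rule nn_integral_mono)
    fix p :: "real^3"
    have rm: "(\<lambda>y. ray_integral \<eta> \<psi> y (1, velocity p)) \<in> borel_measurable borel"
      using bounded_supp_measurable[OF bounded_supp_ray_integral[OF admissible_bounded_supp[OF \<eta>] \<psi>]] .
    have rm': "(\<lambda>y. ennreal \<bar>ray_integral \<eta> \<psi> y (1, velocity p)\<bar>) \<in> borel_measurable lborel"
      using rm by simp
    have "(\<integral>\<^sup>+ y. ennreal \<bar>phase_op \<rho> \<delta> \<eta> h \<phi> (y, p)\<bar> \<partial>lborel)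
      = (\<integral>\<^sup>+ y. ennreal (indicator (ball 0 \<rho>) p / \<delta>) * ennreal \<bar>ray_integral \<eta> \<psi> y (1, velocity p)\<bar> \<partial>lborel)"
      using \<delta> by (intro nn_integral_cong) (auto simp: phase_op_def \<psi>_def abs_mult ennreal_mult[symmetric])
    also have "\<dots> = ennreal (indicator (ball 0 \<rho>) p / \<delta>) * (\<integral>\<^sup>+ y. ennreal \<bar>ray_integral \<eta> \<psi> y (1, velocity p)\<bar> \<partial>lborel)"
      by (rule nn_integral_cmult[OF rm'])
    also have "\<dots> \<le> ennreal (indicator (ball 0 \<rho>) p / \<delta>) * (ennreal \<delta> * (2 * X))"
      by (intro mult_left_mono order_trans[OF ray_integral_L1_le[OF \<eta> \<psi> \<delta>]] \<psi>X) auto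
    also have "\<dots> = 2 * X * indicator (ball 0 \<rho>) p"
      unfolding mult.assoc[symmetric] using \<delta> by (subst ennreal_mult[symmetric]) (auto simp: indicator_def)
    finally show "(\<integral>\<^sup>+ y. ennreal \<bar>phase_op \<rho> \<delta> \<eta> h \<phi> (y, p)\<bar> \<partial>lborel) \<le> 2 * X * indicator (ball 0 \<rho>) p" .
  qed
  also have "\<dots> = 2 * X * emeasure lborel (ball (0::real^3) \<rho>)"
    by (rule nn_integral_cmult_indicator[OF bm])
  also have "emeasure lborel (ball (0::real^3) \<rho>) = ennreal (measure lborel (ball (0::real^3) \<rho>))"
    using emeasure_lborel_ball_finite[of "0::real^3" \<rho>] by (intro emeasure_eq_ennreal_measure) (simp only: less_top infinity_ennreal_def)
  finally show ?thesis by (simp add: X_def ennreal_mult mult_ac)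
qed

text \<open>The momentum integral is dominated by the integral over the velocity cube, where the
  averaging gain is available; the factor \<open>\<delta>\<^sup>2\<close> of that estimate cancels
  against the normalisation.\<close>

lemma phase_op_L2_le:
  assumes \<kappa>: "0 < \<kappa>" "\<kappa> < 1" and \<eta>: "admissible \<delta> \<eta>" and \<phi>: "bounded_supp \<phi>" and \<delta>: "\<delta> > 0"
  shows "(\<integral>\<^sup>+ z. ennreal (\<bar>phase_op \<rho> \<delta> \<eta> h \<phi> z\<bar>\<^sup>2) \<partial>lborel)
     \<le> ennreal ((1 + \<rho>\<^sup>2) ^ 3 * (64 + 768 / (1 - \<kappa>)) * min 1 (norm h / \<delta>) powr \<kappa>) * (\<integral>\<^sup>+ y. ennreal (\<bar>\<phi> y\<bar>\<^sup>2) \<partial>lborel)"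
proof -
  have \<eta>m: "\<eta> \<in> borel_measurable borel" using \<eta> by (simp add: admissible_def)
  define \<psi> where "\<psi> = (\<lambda>y. \<phi> (y - h) - \<phi> y)"
  have \<psi>: "bounded_supp \<psi>" unfolding \<psi>_def by (rule bounded_supp_shift_diff[OF \<phi>])
  have \<psi>m: "\<psi> \<in> borel_measurable borel" by (rule bounded_supp_measurable[OF \<psi>])
  define G where "G = (\<lambda>v. \<integral>\<^sup>+ y. ennreal ((ray_integral \<eta> \<psi> y (1, v))\<^sup>2) \<partial>lborel)"
  have Gm: "G \<in> borel_measurable borel"
  proof -
    have "(\<lambda>z :: (real^3) \<times> spacetime. ray_integral \<eta> \<psi> (snd z) (1, fst z)) \<in> borel_measurable borel"
      by (intro ray_integral_measurable \<eta>m \<psi>m borel_measurable_continuous_onI continuous_intros)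
    then have "(\<lambda>z :: (real^3) \<times> spacetime. ennreal ((ray_integral \<eta> \<psi> (snd z) (1, fst z))\<^sup>2)) \<in> borel_measurable (borel \<Otimes>\<^sub>M lborel)"
      by (simp add: borel_prod[symmetric] cong: measurable_cong_sets)
    then have "(\<lambda>v. \<integral>\<^sup>+ y. ennreal ((ray_integral \<eta> \<psi> (snd (v, y)) (1, fst (v, y)))\<^sup>2) \<partial>lborel) \<in> borel_measurable borel"
      by (rule lborel.borel_measurable_nn_integral_fst)
    then show ?thesis by (simp add: G_def)
  qed
  have m: "(\<lambda>z. ennreal (\<bar>phase_op \<rho> \<delta> \<eta> h \<phi> z\<bar>\<^sup>2)) \<in> borel_measurable borel"
    using phase_op_measurable[OF \<eta>m \<phi>] by simp
  define c where "c = ennreal (1 / \<delta>\<^sup>2)"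
  have Gind: "(\<lambda>v. indicator cube v * G v) \<in> borel_measurable lborel"
    using Gm by simp
  have "(\<integral>\<^sup>+ z. ennreal (\<bar>phase_op \<rho> \<delta> \<eta> h \<phi> z\<bar>\<^sup>2) \<partial>lborel)
     = (\<integral>\<^sup>+ p. \<integral>\<^sup>+ y. ennreal (\<bar>phase_op \<rho> \<delta> \<eta> h \<phi> (y, p)\<bar>\<^sup>2) \<partial>lborel \<partial>lborel)"
    by (rule nn_integral_phase[OF m])
  also have "\<dots> = (\<integral>\<^sup>+ p. indicator (ball 0 \<rho>) p * (c * G (velocity p)) \<partial>lborel)"
  proof (rule nn_integral_cong)
    fix p :: "real^3"
    have rm: "(\<lambda>y. ray_integral \<eta> \<psi> y (1, velocity p)) \<in> borel_measurable borel"
      using bounded_supp_measurable[OF bounded_supp_ray_integral[OF admissible_bounded_supp[OF \<eta>] \<psi>]] .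
    have "(\<integral>\<^sup>+ y. ennreal (\<bar>phase_op \<rho> \<delta> \<eta> h \<phi> (y, p)\<bar>\<^sup>2) \<partial>lborel)
      = (\<integral>\<^sup>+ y. (indicator (ball 0 \<rho>) p * c) * ennreal ((ray_integral \<eta> \<psi> y (1, velocity p))\<^sup>2) \<partial>lborel)"
      using \<delta> by (intro nn_integral_cong) (auto simp: phase_op_def \<psi>_def indicator_def c_def power_divide ennreal_mult[symmetric])
    also have "\<dots> = (indicator (ball 0 \<rho>) p * c) * G (velocity p)"
      unfolding G_def by (rule nn_integral_cmult) (use rm in simp)
    finally show "(\<integral>\<^sup>+ y. ennreal (\<bar>phase_op \<rho> \<delta> \<eta> h \<phi> (y, p)\<bar>\<^sup>2) \<partial>lborel) = indicator (ball 0 \<rho>) p * (c * G (velocity p))"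
      by (simp add: mult.assoc)
  qed
  also have "\<dots> \<le> ennreal ((1 + \<rho>\<^sup>2) ^ 3) * (\<integral>\<^sup>+ v. indicator cube v * (c * G v) \<partial>lborel)"
    by (rule nn_integral_velocity_le) (use Gm in simp)
  also have "(\<integral>\<^sup>+ v. indicator cube v * (c * G v) \<partial>lborel) = c * (\<integral>\<^sup>+ v. indicator cube v * G v \<partial>lborel)"
    using nn_integral_cmult[OF Gind, of c] by (simp add: mult.left_commute)
  also have "(\<integral>\<^sup>+ v. indicator cube v * G v \<partial>lborel) \<le> ennreal ((64 + 768 / (1 - \<kappa>)) * \<delta>\<^sup>2 * min 1 (norm h / \<delta>) powr \<kappa>) * (\<integral>\<^sup>+ y. ennreal ((\<phi> y)\<^sup>2) \<partial>lborel)"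
    unfolding G_def \<psi>_def by (rule ray_integral_cube_L2[OF \<kappa> \<delta> \<eta> \<phi>])
  finally have "(\<integral>\<^sup>+ z. ennreal (\<bar>phase_op \<rho> \<delta> \<eta> h \<phi> z\<bar>\<^sup>2) \<partial>lborel)
    \<le> ennreal ((1 + \<rho>\<^sup>2) ^ 3) * (c * (ennreal ((64 + 768 / (1 - \<kappa>)) * \<delta>\<^sup>2 * min 1 (norm h / \<delta>) powr \<kappa>) * (\<integral>\<^sup>+ y. ennreal ((\<phi> y)\<^sup>2) \<partial>lborel)))"
    by (simp add: mult_left_mono)
  also have "\<dots> = ennreal ((1 + \<rho>\<^sup>2) ^ 3 * (1 / \<delta>\<^sup>2 * ((64 + 768 / (1 - \<kappa>)) * \<delta>\<^sup>2 * min 1 (norm h / \<delta>) powr \<kappa>))) * (\<integral>\<^sup>+ y. ennreal ((\<phi> y)\<^sup>2) \<partial>lborel)"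
    unfolding c_def mult.assoc[symmetric] using \<kappa> by (subst ennreal_mult[symmetric], simp, simp)+ (simp add: mult.assoc)
  also have "(1 + \<rho>\<^sup>2) ^ 3 * (1 / \<delta>\<^sup>2 * ((64 + 768 / (1 - \<kappa>)) * \<delta>\<^sup>2 * min 1 (norm h / \<delta>) powr \<kappa>))
     = (1 + \<rho>\<^sup>2) ^ 3 * (64 + 768 / (1 - \<kappa>)) * min 1 (norm h / \<delta>) powr \<kappa>"
    using \<delta> by simp
  finally show ?thesis by simp
qed

text \<open>The uniformity of \<open>K\<close> in the length \<open>\<delta>\<close> is the point:
  it leaves \<open>\<delta>\<close> free to be optimised against the norms of \<open>u\<close> and
  \<open>f\<close>.\<close>

lemma phase_op_interpolable:
  assumes \<kappa>: "0 < \<kappa>" "\<kappa> < 1"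
  shows "\<exists>K>0. \<forall>\<delta>>0. \<forall>\<eta> h \<phi>. admissible \<delta> \<eta> \<longrightarrow> bounded_supp \<phi> \<longrightarrow>
     interpolable K (min 1 (norm h / \<delta>) powr \<kappa>) (phase_op \<rho> \<delta> \<eta> h) \<phi>"
proof -
  define K1 where "K1 = 2 * measure lborel (ball (0::real^3) \<rho>)"
  define K2 where "K2 = (1 + \<rho>\<^sup>2) ^ 3 * (64 + 768 / (1 - \<kappa>))"
  \<comment> \<open>A common constant: 2 for the sup bound of a difference, \<open>K1\<close> for
    \<open>L\<^sup>1\<close> and \<open>K2\<close> for \<open>L\<^sup>2\<close>.\<close>
  define K where "K = 2 + K1 + K2"
  have K12: "0 \<le> K1" "0 \<le> K2" using \<kappa> by (auto simp: K1_def K2_def)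
  have "interpolable K (min 1 (norm h / \<delta>) powr \<kappa>) (phase_op \<rho> \<delta> \<eta> h) \<phi>"
    if \<delta>: "\<delta> > 0" and \<eta>: "admissible \<delta> \<eta>" and \<phi>: "bounded_supp \<phi>" for \<delta> \<eta> h \<phi>
  proof -
    have \<eta>m: "\<eta> \<in> borel_measurable borel" using \<eta> by (simp add: admissible_def)
    let ?T = "phase_op \<rho> \<delta> \<eta> h"
    let ?A = "\<lambda>A. (\<lambda>x. indicator A x * \<phi> x)"
    have b: "bounded_supp (?A A)" if "A \<in> sets borel" for A by (rule bounded_supp_indicator[OF \<phi> that])
    have 1: "?T \<phi> z = ?T (?A A) z + ?T (?A (- A)) z" if A: "A \<in> sets borel" for A z
    proof -
      have nA: "- A \<in> sets borel" using A by auto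
      have "(\<lambda>y. \<phi> (y - h) - \<phi> y) = (\<lambda>y. (?A A (y - h) - ?A A y) + (?A (- A) (y - h) - ?A (- A) y))"
        by (auto simp: indicator_def fun_eq_iff)
      then show ?thesis unfolding phase_op_def
        using ray_integral_add[OF admissible_bounded_supp[OF \<eta>] bounded_supp_shift_diff[OF b[OF A], of h] bounded_supp_shift_diff[OF b[OF nA], of h]]
        by (simp add: add_divide_distrib distrib_left)
    qed
    have 2: "(\<integral>\<^sup>+ y. ennreal \<bar>?T (?A A) y\<bar> \<partial>lborel) \<le> ennreal K * (\<integral>\<^sup>+ x. indicator A x * ennreal \<bar>\<phi> x\<bar> \<partial>lborel)" if A: "A \<in> sets borel" for A
    proof -
      have "(\<integral>\<^sup>+ y. ennreal \<bar>?T (?A A) y\<bar> \<partial>lborel) \<le> ennreal K1 * (\<integral>\<^sup>+ x. ennreal \<bar>?A A x\<bar> \<partial>lborel)"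
        unfolding K1_def by (rule phase_op_L1_le[OF \<eta> b[OF A] \<delta>])
      also have "(\<integral>\<^sup>+ x. ennreal \<bar>?A A x\<bar> \<partial>lborel) = (\<integral>\<^sup>+ x. indicator A x * ennreal \<bar>\<phi> x\<bar> \<partial>lborel)"
        by (intro nn_integral_cong) (auto simp: indicator_def)
      also have "ennreal K1 * (\<integral>\<^sup>+ x. indicator A x * ennreal \<bar>\<phi> x\<bar> \<partial>lborel) \<le> ennreal K * (\<integral>\<^sup>+ x. indicator A x * ennreal \<bar>\<phi> x\<bar> \<partial>lborel)"
        using K12 by (intro mult_right_mono ennreal_leI) (auto simp: K_def)
      finally show ?thesis .
    qed
    have 3: "(\<integral>\<^sup>+ y. ennreal (\<bar>?T (?A A) y\<bar>\<^sup>2) \<partial>lborel) \<le> ennreal (K * min 1 (norm h / \<delta>) powr \<kappa>) * (\<integral>\<^sup>+ x. indicator A x * ennreal (\<bar>\<phi> x\<bar>\<^sup>2) \<partial>lborel)" if A: "A \<in> sets borel" for A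
    proof -
      have "(\<integral>\<^sup>+ y. ennreal (\<bar>?T (?A A) y\<bar>\<^sup>2) \<partial>lborel) \<le> ennreal (K2 * min 1 (norm h / \<delta>) powr \<kappa>) * (\<integral>\<^sup>+ x. ennreal (\<bar>?A A x\<bar>\<^sup>2) \<partial>lborel)"
        unfolding K2_def by (rule phase_op_L2_le[OF \<kappa> \<eta> b[OF A] \<delta>])
      also have "(\<integral>\<^sup>+ x. ennreal (\<bar>?A A x\<bar>\<^sup>2) \<partial>lborel) = (\<integral>\<^sup>+ x. indicator A x * ennreal (\<bar>\<phi> x\<bar>\<^sup>2) \<partial>lborel)"
        by (intro nn_integral_cong) (auto simp: indicator_def)
      also have "ennreal (K2 * min 1 (norm h / \<delta>) powr \<kappa>) * (\<integral>\<^sup>+ x. indicator A x * ennreal (\<bar>\<phi> x\<bar>\<^sup>2) \<partial>lborel)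
         \<le> ennreal (K * min 1 (norm h / \<delta>) powr \<kappa>) * (\<integral>\<^sup>+ x. indicator A x * ennreal (\<bar>\<phi> x\<bar>\<^sup>2) \<partial>lborel)"
        using K12 by (intro mult_right_mono ennreal_leI) (auto simp: K_def)
      finally show ?thesis .
    qed
    have 4: "\<bar>?T (?A A) z\<bar> \<le> K * N" if A: "A \<in> sets borel" and N: "N \<ge> 0" "\<forall>x\<in>A. \<bar>\<phi> x\<bar> \<le> N" for A N z
    proof -
      have n: "\<bar>?A A y\<bar> \<le> N" for y using N by (auto simp: indicator_def)
      have "\<bar>ray_integral \<eta> (\<lambda>y. ?A A (y - h) - ?A A y) (fst z) (1, velocity (snd z))\<bar> \<le> \<delta> * (2 * N)"
      proof (rule ray_integral_sup_le[OF \<eta> bounded_supp_shift_diff[OF b[OF A]] \<delta>])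
        show "\<bar>?A A (y - h) - ?A A y\<bar> \<le> 2 * N" for y using n[of "y - h"] n[of y] by linarith
      qed
      then have "\<bar>ray_integral \<eta> (\<lambda>y. ?A A (y - h) - ?A A y) (fst z) (1, velocity (snd z)) / \<delta>\<bar> \<le> 2 * N"
        using \<delta> by (simp add: field_simps)
      then have "\<bar>?T (?A A) z\<bar> \<le> 2 * N" unfolding phase_op_def using N by (auto simp: indicator_def)
      also have "\<dots> \<le> K * N" using K12 N by (intro mult_right_mono) (auto simp: K_def)
      finally show ?thesis .
    qed
    show ?thesis unfolding interpolable_def
      by (intro conjI ballI allI impI bounded_supp_measurable[OF \<phi>] phase_op_measurable[OF \<eta>m \<phi>]
          phase_op_measurable[OF \<eta>m b]) (fact 1 2 3 4 | assumption)+
  qed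
  moreover have "K > 0" using K12 by (simp add: K_def)
  ultimately show ?thesis by blast
qed

subsection \<open>Smooth bumps and cutoffs\<close>

lemma C_k_SucI:
  assumes "\<And>z. (g has_derivative D z) (at z)" "\<And>b. b \<in> Basis \<Longrightarrow> C_k k (\<lambda>z. D z b)"
  shows "C_k (Suc k) g"
proof -
  have "frechet_derivative g (at z) = D z" for z
    using frechet_derivative_at[OF assms(1)[of z]] by simp
  then show ?thesis using assms by (auto simp: differentiable_def)
qed

lemma C_k_SucD:
  assumes "C_k (Suc k) g"
  shows "(g has_derivative frechet_derivative g (at z)) (at z)"
    and "b \<in> Basis \<Longrightarrow> C_k k (\<lambda>z. frechet_derivative g (at z) b)"
  using assms by (auto simp: frechet_derivative_works)

lemma C_k_Suc: "C_k (Suc k) g \<Longrightarrow> C_k k g"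
proof (induction k arbitrary: g)
  case 0
  then show ?case
    using has_derivative_continuous[OF C_k_SucD(1)[OF 0]] by (simp add: continuous_on_eq_continuous_at)
next
  case (Suc k)
  show ?case
    by (rule C_k_SucI[OF C_k_SucD(1)[OF Suc.prems]]) (intro Suc.IH C_k_SucD(2)[OF Suc.prems])
qed

lemma C_k_continuous: "C_k k g \<Longrightarrow> continuous_on UNIV g"
  by (induction k) (simp, metis C_k_Suc)

lemma C_k_const: "C_k k (\<lambda>z. c)"
proof (induction k arbitrary: c)
  case (Suc k)
  show ?case by (rule C_k_SucI[OF has_derivative_const]) (rule Suc)
qed simp

lemma C_k_linear: "bounded_linear g \<Longrightarrow> C_k k g"
proof (cases k)
  case 0
  assume "bounded_linear g" then show ?thesis using 0 by (simp add: linear_continuous_on)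
next
  case (Suc j)
  assume g: "bounded_linear g"
  show ?thesis unfolding Suc
    by (rule C_k_SucI[OF bounded_linear_imp_has_derivative[OF g]]) (rule C_k_const)
qed

lemma C_k_add: "C_k k f \<Longrightarrow> C_k k g \<Longrightarrow> C_k k (\<lambda>z. f z + g z)"
proof (induction k arbitrary: f g)
  case (Suc k)
  show ?case
    by (rule C_k_SucI[OF has_derivative_add[OF C_k_SucD(1)[OF Suc.prems(1)] C_k_SucD(1)[OF Suc.prems(2)]]])
      (intro Suc.IH C_k_SucD(2)[OF Suc.prems(1)] C_k_SucD(2)[OF Suc.prems(2)])
qed (auto intro: continuous_on_add)

lemma C_k_mult: "C_k k f \<Longrightarrow> C_k k g \<Longrightarrow> C_k k (\<lambda>z. f z * g z)"
proof (induction k arbitrary: f g)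
  case (Suc k)
  show ?case
    by (rule C_k_SucI[OF has_derivative_mult[OF C_k_SucD(1)[OF Suc.prems(1)] C_k_SucD(1)[OF Suc.prems(2)]]])
      (intro C_k_add Suc.IH C_k_SucD(2)[OF Suc.prems(1)] C_k_SucD(2)[OF Suc.prems(2)] C_k_Suc[OF Suc.prems(1)] C_k_Suc[OF Suc.prems(2)])
qed (auto intro: continuous_on_mult)

lemma C_k_prod: "finite A \<Longrightarrow> (\<And>i. i \<in> A \<Longrightarrow> C_k k (f i)) \<Longrightarrow> C_k k (\<lambda>z. \<Prod>i\<in>A. f i z)"
  by (induction rule: finite_induct) (auto intro: C_k_mult C_k_const)

lemma C_k_minus: "C_k k f \<Longrightarrow> C_k k (\<lambda>z. - f z)"
  using C_k_mult[OF C_k_const[of k "-1"]] by simp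

lemma C_k_diff: "C_k k f \<Longrightarrow> C_k k g \<Longrightarrow> C_k k (\<lambda>z. f z - g z)"
  using C_k_add[OF _ C_k_minus] by simp

lemma C_k_compose:
  fixes g :: "real \<Rightarrow> real"
  shows "C_k k g \<Longrightarrow> C_k k f \<Longrightarrow> C_k k (\<lambda>z. g (f z))"
proof (induction k arbitrary: g f)
  case 0
  then show ?case by (auto intro: continuous_on_compose2)
next
  case (Suc k)
  let ?g' = "\<lambda>x. frechet_derivative g (at x) 1"
  have "((\<lambda>z. g (f z)) has_derivative (\<lambda>h. frechet_derivative g (at (f z)) (frechet_derivative f (at z) h))) (at z)" for z
    by (rule has_derivative_compose[OF C_k_SucD(1)[OF Suc.prems(2)] C_k_SucD(1)[OF Suc.prems(1)]])
  moreover have "(\<lambda>h. frechet_derivative g (at (f z)) (frechet_derivative f (at z) h)) = (\<lambda>h. ?g' (f z) * frechet_derivative f (at z) h)" for z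
  proof
    fix h
    define c where "c = frechet_derivative f (at z) h"
    have "frechet_derivative g (at (f z)) (c *\<^sub>R 1) = c *\<^sub>R ?g' (f z)"
      by (rule linear_scale[OF has_derivative_linear[OF C_k_SucD(1)[OF Suc.prems(1)]]])
    then have "frechet_derivative g (at (f z)) c = ?g' (f z) * c"
      unfolding real_scaleR_def mult_1_right by (simp only: mult.commute)
    then show "frechet_derivative g (at (f z)) (frechet_derivative f (at z) h) = ?g' (f z) * frechet_derivative f (at z) h"
      by (simp only: c_def)
  qed
  ultimately have "((\<lambda>z. g (f z)) has_derivative (\<lambda>h. ?g' (f z) * frechet_derivative f (at z) h)) (at z)" for z
    by (simp only:)
  then show ?case
  proof (rule C_k_SucI)
    fix b :: 'a assume b: "b \<in> Basis"
    have "C_k k ?g'" by (rule C_k_SucD(2)[OF Suc.prems(1)]) simp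
    from C_k_mult[OF Suc.IH[OF this C_k_Suc[OF Suc.prems(2)]] C_k_SucD(2)[OF Suc.prems(2) b]]
    show "C_k k (\<lambda>z. ?g' (f z) * frechet_derivative f (at z) b)" .
  qed
qed

lemma C_k_inverse: "(\<And>z. f z \<noteq> 0) \<Longrightarrow> C_k k f \<Longrightarrow> C_k k (\<lambda>z. inverse (f z))"
proof (induction k)
  case 0
  then show ?case by (auto intro: continuous_on_inverse)
next
  case (Suc k)
  have i: "C_k k (\<lambda>z. inverse (f z))" using Suc C_k_Suc by blast
  show ?case
    by (rule C_k_SucI[OF Deriv.has_derivative_inverse[OF Suc.prems(1) C_k_SucD(1)[OF Suc.prems(2)]]])
      (intro C_k_minus C_k_mult i C_k_SucD(2)[OF Suc.prems(2)])
qed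

text \<open>The derivative of \<open>1 / energy\<close> is again a product of copies of
  \<open>1 / energy\<close> and a linear function, so the induction closes and only the first
  derivative of the square root is ever computed.\<close>

lemma C_k_inverse_energy: "C_k k (\<lambda>p. inverse (energy p))"
proof (induction k)
  case 0
  show ?case using energy_pos by (auto intro!: continuous_intros simp: less_imp_neq[symmetric])
next
  case (Suc k)
  have en: "(energy has_derivative (\<lambda>h. (p \<bullet> h) * inverse (energy p))) (at p)" for p
  proof -
    have e: "energy = (\<lambda>p. sqrt (1 + p \<bullet> p))" by (auto simp: energy_def power2_norm_eq_inner)
    have pos: "0 < 1 + p \<bullet> p" by (simp add: add_pos_nonneg)
    have "((\<lambda>p. 1 + p \<bullet> p) has_derivative (\<lambda>k. 0 + (p \<bullet> k + k \<bullet> p))) (at p)"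
      by (intro has_derivative_add has_derivative_const has_derivative_inner has_derivative_ident)
    from has_derivative_real_sqrt[OF pos this]
    have "(energy has_derivative (\<lambda>k. (0 + (p \<bullet> k + k \<bullet> p)) * (inverse (energy p) / 2))) (at p)"
      by (simp only: e)
    moreover have "(0 + (p \<bullet> k + k \<bullet> p)) * (inverse (energy p) / 2) = (p \<bullet> k) * inverse (energy p)" for k
      by (simp only: inner_commute[of k p]) simp
    ultimately show ?thesis by (simp only:)
  qed
  have ne: "energy p \<noteq> 0" for p using energy_pos[of p] by simp
  show ?case
    by (rule C_k_SucI[OF Deriv.has_derivative_inverse[OF ne en]])
      (intro C_k_minus C_k_mult Suc C_k_linear bounded_linear_inner_left)
qed

text \<open>The index makes the span of the family stable under differentiation;
  \<open>n = 0\<close> is the usual flat function \<open>exp (- 1 / x)\<close>.\<close>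

definition flat_exp :: "nat \<Rightarrow> real \<Rightarrow> real" where
  "flat_exp n x = (if x > 0 then inverse x ^ n * exp (- inverse x) else 0)"

lemma flat_exp_tendsto_0: "(flat_exp n \<longlongrightarrow> 0) (at 0)"
proof -
  have "((\<lambda>x. inverse x ^ n * exp (- inverse x)) \<longlongrightarrow> 0) (at_right (0::real))"
    using filterlim_compose[OF tendsto_power_div_exp_0[of n] filterlim_inverse_at_top_right]
    by (simp add: exp_minus field_simps)
  moreover have "\<forall>\<^sub>F x in at_right 0. inverse x ^ n * exp (- inverse x) = flat_exp n x"
    by (auto simp: eventually_at_filter flat_exp_def)
  ultimately have r: "(flat_exp n \<longlongrightarrow> 0) (at_right 0)" by (rule Lim_transform_eventually)
  have "\<forall>\<^sub>F x in at_left 0. 0 = flat_exp n x"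
    by (auto simp: eventually_at_filter flat_exp_def)
  then have "(flat_exp n \<longlongrightarrow> 0) (at_left 0)" by (rule Lim_transform_eventually[OF tendsto_const])
  with r show ?thesis by (simp add: filterlim_split_at)
qed

lemma flat_exp_deriv: "(flat_exp n has_real_derivative (flat_exp (n + 2) x - real n * flat_exp (n + 1) x)) (at x)"
proof -
  consider "x > 0" | "x = 0" | "x < 0" by linarith
  then show ?thesis
  proof cases
    case 1
    have d: "((\<lambda>x. inverse x ^ n * exp (- inverse x)) has_real_derivative
      (inverse x ^ (n + 2) * exp (- inverse x) - real n * (inverse x ^ (n + 1) * exp (- inverse x)))) (at x)"
    proof -
      have "(inverse has_real_derivative - (inverse x ^ Suc (Suc 0))) (at x)"
        using 1 by (intro DERIV_inverse) simp
      then have i: "(inverse has_real_derivative - (inverse x * inverse x)) (at x)"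
        by (simp only: power_Suc power_0 mult_1_right)
      have e: "((\<lambda>x. exp (- inverse x)) has_real_derivative exp (- inverse x) * (- (- (inverse x * inverse x)))) (at x)"
        by (rule DERIV_fun_exp[OF DERIV_minus[OF i]])
      have alg: "real n * (- (y * y) * y ^ (n - Suc 0)) * E + E * (- (- (y * y))) * y ^ n = y ^ (n + 2) * E - real n * (y ^ (n + 1) * E)" for y E :: real
        by (cases n) (simp_all add: algebra_simps)
      show ?thesis
        using DERIV_mult[OF DERIV_power[OF i, of n] e] unfolding alg .
    qed
    have "flat_exp (n + 2) x - real n * flat_exp (n + 1) x
      = inverse x ^ (n + 2) * exp (- inverse x) - real n * (inverse x ^ (n + 1) * exp (- inverse x))"
      using 1 by (simp only: flat_exp_def if_True)
    then show ?thesis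
      using has_field_derivative_transform_within_open[OF d, of "{0<..}" "flat_exp n"] 1
      by (simp only:) (simp add: flat_exp_def)
  next
    case 2
    \<comment> \<open>At 0 the difference quotient of \<open>flat_exp n\<close> is
      \<open>flat_exp (n + 1)\<close>, which tends to 0.\<close>
    have "((\<lambda>h. (flat_exp n (0 + h) - flat_exp n 0) / h) \<longlongrightarrow> 0) (at 0)"
    proof (rule Lim_transform_eventually[OF flat_exp_tendsto_0[of "Suc n"]])
      show "\<forall>\<^sub>F x in at 0. flat_exp (Suc n) x = (flat_exp n (0 + x) - flat_exp n 0) / x"
        by (auto simp: eventually_at_filter flat_exp_def divide_inverse)
    qed
    then show ?thesis using 2 by (simp add: DERIV_def flat_exp_def)
  next
    case 3
    have "((\<lambda>x. 0) has_real_derivative 0) (at x)" by simp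
    then show ?thesis using 3
      using has_field_derivative_transform_within_open[of "\<lambda>x. 0" 0 x "{..<0}" "flat_exp n"]
      by (simp add: flat_exp_def)
  qed
qed

lemma C_k_flat_exp: "C_k k (flat_exp n)"
proof (induction k arbitrary: n)
  case 0
  show ?case using DERIV_isCont[OF flat_exp_deriv] by (simp add: continuous_on_eq_continuous_at)
next
  case (Suc k)
  show ?case
    by (rule C_k_SucI[OF flat_exp_deriv[unfolded has_field_derivative_def]])
      (auto intro!: C_k_mult C_k_diff C_k_const Suc)
qed

lemma flat_exp_0_bounds: "0 \<le> flat_exp 0 x" "flat_exp 0 x \<le> 1" "x > 0 \<Longrightarrow> flat_exp 0 x > 0" "x \<le> 0 \<Longrightarrow> flat_exp 0 x = 0"
  by (auto simp: flat_exp_def)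

text \<open>The index \<open>n\<close> steepens the flanks: the bumps converge pointwise to the
  indicator of the open interval while staying between 0 and this indicator. This allows the passage
  from smooth test functions to boxes.\<close>

definition interval_bump :: "nat \<Rightarrow> real \<Rightarrow> real \<Rightarrow> real \<Rightarrow> real" where
  "interval_bump n a b x = flat_exp 0 (real n * (x - a)) * flat_exp 0 (real n * (b - x))"

lemma C_k_affine: "C_k k (\<lambda>x::real. c * (x - a))" "C_k k (\<lambda>x::real. c * (a - x))"
  by (intro C_k_mult C_k_const C_k_diff C_k_linear bounded_linear_ident)+

lemma C_k_interval_bump: "C_k k (interval_bump n a b)"
  unfolding interval_bump_def[abs_def]
  by (rule C_k_mult[OF C_k_compose[OF C_k_flat_exp C_k_affine(1)] C_k_compose[OF C_k_flat_exp C_k_affine(2)]])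

lemma interval_bump_bounds: "0 \<le> interval_bump n a b x" "interval_bump n a b x \<le> 1"
  unfolding interval_bump_def by (auto intro: mult_le_one flat_exp_0_bounds mult_nonneg_nonneg)

lemma interval_bump_outside: "x \<notin> {a<..<b} \<Longrightarrow> interval_bump n a b x = 0"
  unfolding interval_bump_def by (auto simp: not_less flat_exp_0_bounds(4) mult_nonneg_nonpos)

lemma interval_bump_tendsto: "(\<lambda>n. interval_bump n a b x) \<longlonglongrightarrow> indicator {a<..<b} x"
proof (cases "x \<in> {a<..<b}")
  case True
  have l: "(\<lambda>n. flat_exp 0 (real n * c)) \<longlonglongrightarrow> 1" if c: "c > 0" for c
  proof -
    have "(\<lambda>n. exp (- (inverse (real n) * inverse c))) \<longlonglongrightarrow> exp (- (0 * inverse c))"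
      by (intro tendsto_intros lim_inverse_n)
    moreover have "\<forall>\<^sub>F n in sequentially. exp (- (inverse (real n) * inverse c)) = flat_exp 0 (real n * c)"
      using eventually_gt_at_top[of 0] by eventually_elim (use c in \<open>auto simp: flat_exp_def\<close>)
    ultimately show ?thesis by (auto intro: Lim_transform_eventually)
  qed
  have "(\<lambda>n. interval_bump n a b x) \<longlonglongrightarrow> 1 * 1"
    unfolding interval_bump_def using True by (intro tendsto_mult l) auto
  then show ?thesis using True by simp
qed (simp add: interval_bump_outside)

definition box_bump :: "nat \<Rightarrow> 'a::euclidean_space \<Rightarrow> 'a \<Rightarrow> 'a \<Rightarrow> real" where
  "box_bump n a b x = (\<Prod>i\<in>Basis. interval_bump n (a \<bullet> i) (b \<bullet> i) (x \<bullet> i))"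

lemma C_k_box_bump: "C_k k (box_bump n a b)"
  unfolding box_bump_def[abs_def]
proof (rule C_k_prod)
  fix i :: 'a
  show "C_k k (\<lambda>z. interval_bump n (a \<bullet> i) (b \<bullet> i) (z \<bullet> i))"
    by (rule C_k_compose[OF C_k_interval_bump[of k n "a \<bullet> i" "b \<bullet> i"] C_k_linear[OF bounded_linear_inner_left[of i]]])
qed simp

lemma box_bump_bounds: "0 \<le> box_bump n a b x" "box_bump n a b x \<le> 1"
  unfolding box_bump_def by (auto intro!: prod_nonneg prod_le_1 interval_bump_bounds)

lemma box_bump_outside: "x \<notin> box a b \<Longrightarrow> box_bump n a b x = 0"
proof -
  assume "x \<notin> box a b"
  then obtain i where "i \<in> Basis" "x \<bullet> i \<notin> {a \<bullet> i<..<b \<bullet> i}" by (auto simp: mem_box)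
  then have "\<exists>i\<in>Basis. interval_bump n (a \<bullet> i) (b \<bullet> i) (x \<bullet> i) = 0" using interval_bump_outside by blast
  then show ?thesis unfolding box_bump_def by (intro prod_zero) auto
qed

lemma box_bump_tendsto: "(\<lambda>n. box_bump n a b x) \<longlonglongrightarrow> indicator (box a b) x"
proof -
  have "(\<lambda>n. box_bump n a b x) \<longlonglongrightarrow> (\<Prod>i\<in>Basis. indicator {a \<bullet> i<..<b \<bullet> i} (x \<bullet> i))"
    unfolding box_bump_def by (intro tendsto_prod interval_bump_tendsto)
  also have "(\<Prod>i\<in>Basis. indicator {a \<bullet> i<..<b \<bullet> i} (x \<bullet> i)) = (indicator (box a b) x :: real)"
  proof (cases "x \<in> box a b")
    case True
    then show ?thesis by (subst prod.neutral) (auto simp: mem_box)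
  next
    case False
    then obtain i where "i \<in> Basis" "x \<bullet> i \<notin> {a \<bullet> i<..<b \<bullet> i}" by (auto simp: mem_box)
    then have "\<exists>i\<in>Basis. indicator {a \<bullet> i<..<b \<bullet> i} (x \<bullet> i) = (0::real)" by (auto simp: indicator_def)
    then have "(\<Prod>i\<in>Basis. indicator {a \<bullet> i<..<b \<bullet> i} (x \<bullet> i)) = (0::real)" by (intro prod_zero) auto
    then show ?thesis using False by simp
  qed
  finally show ?thesis .
qed

definition smooth_step :: "real \<Rightarrow> real" where
  "smooth_step x = flat_exp 0 x * inverse (flat_exp 0 x + flat_exp 0 (1 - x))"

lemma smooth_step_denominator: "flat_exp 0 x + flat_exp 0 (1 - x) > 0"
  using flat_exp_0_bounds(1)[of x] flat_exp_0_bounds(1)[of "1 - x"] flat_exp_0_bounds(3)[of x] flat_exp_0_bounds(3)[of "1 - x"]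
  by (cases "x > 0") (auto intro: add_pos_nonneg add_nonneg_pos)

lemma C_k_smooth_step: "C_k k smooth_step"
proof -
  have "C_k k (\<lambda>x. flat_exp 0 x + flat_exp 0 (1 - x))"
    by (rule C_k_add[OF C_k_flat_exp C_k_compose[OF C_k_flat_exp C_k_diff[OF C_k_const C_k_linear[OF bounded_linear_ident]]]])
  moreover have "flat_exp 0 x + flat_exp 0 (1 - x) \<noteq> 0" for x using smooth_step_denominator[of x] by simp
  ultimately have "C_k k (\<lambda>x. inverse (flat_exp 0 x + flat_exp 0 (1 - x)))" by (intro C_k_inverse)
  from C_k_mult[OF C_k_flat_exp this] show ?thesis unfolding smooth_step_def[abs_def] .
qed

lemma smooth_step_bounds: "0 \<le> smooth_step x" "smooth_step x \<le> 1"
  using smooth_step_denominator[of x] flat_exp_0_bounds(1)[of x] flat_exp_0_bounds(1)[of "1 - x"]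
  by (auto simp: smooth_step_def field_simps)

lemma smooth_step_0: "x \<le> 0 \<Longrightarrow> smooth_step x = 0"
  by (simp add: smooth_step_def flat_exp_0_bounds)

lemma smooth_step_1: "x \<ge> 1 \<Longrightarrow> smooth_step x = 1"
  using flat_exp_0_bounds(3)[of x] flat_exp_0_bounds(4)[of "1 - x"] by (simp add: smooth_step_def)

subsection \<open>Integrals over momentum slabs\<close>

lemma Int_stable_range_box: "Int_stable (range (\<lambda>(a, b). box a b :: 'a::euclidean_space set))"
proof (rule Int_stableI)
  fix A B :: "'a set" assume "A \<in> range (\<lambda>(a, b). box a b)" "B \<in> range (\<lambda>(a, b). box a b)"
  then obtain a b c d where AB: "A = box a b" "B = box c d" by auto
  have "A \<inter> B = box (\<Sum>i\<in>Basis. max (a \<bullet> i) (c \<bullet> i) *\<^sub>R i) (\<Sum>i\<in>Basis. min (b \<bullet> i) (d \<bullet> i) *\<^sub>R i)"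
    unfolding AB by (rule box_Int_box)
  then show "A \<inter> B \<in> range (\<lambda>(a, b). box a b)" by auto
qed

text \<open>A monotone class principle: a linear functional that is continuous under bounded pointwise
  convergence is determined by its values on boxes.\<close>

lemma functional_zero_on_bounded_supp:
  fixes J :: "('a::euclidean_space \<Rightarrow> real) \<Rightarrow> real"
  assumes add: "\<And>f g. bounded_supp f \<Longrightarrow> bounded_supp g \<Longrightarrow> J (\<lambda>x. f x + g x) = J f + J g"
    and scale: "\<And>c f. bounded_supp f \<Longrightarrow> J (\<lambda>x. c * f x) = c * J f"
    and lim: "\<And>F f N r. (\<And>n. F n \<in> borel_measurable borel) \<Longrightarrow> f \<in> borel_measurable borel \<Longrightarrow>
      (\<And>n x. \<bar>F n x\<bar> \<le> N) \<Longrightarrow> (\<And>n x. r < norm x \<Longrightarrow> F n x = 0) \<Longrightarrow> (\<And>x. (\<lambda>n. F n x) \<longlonglongrightarrow> f x) \<Longrightarrow>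
      (\<lambda>n. J (F n)) \<longlonglongrightarrow> J f"
    and box: "\<And>a b. J (indicator (box a b)) = 0"
    and f: "bounded_supp f"
  shows "J f = 0"
proof -
  obtain N r where N: "N \<ge> 0" "r \<ge> 0" "\<And>y. \<bar>f y\<bar> \<le> N" "\<And>y. r < norm y \<Longrightarrow> f y = 0"
    using bounded_suppE[OF f] by metis
  \<comment> \<open>Indicators of Borel sets may have unbounded support. All sets are therefore
    intersected with the open box \<open>K\<close>, which contains the support of \<open>f\<close>;
    as an intersection of boxes is a box, this stays within the generating family.\<close>
  define K where "K = box (- ((r + 1) *\<^sub>R One)) ((r + 1) *\<^sub>R One :: 'a)"
  have K: "K \<in> sets borel" by (simp add: K_def)
  have rK: "x \<in> K" if "norm x \<le> r" for x
  proof -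
    have "- r - 1 < x \<bullet> i" "x \<bullet> i < r + 1" if "i \<in> Basis" for i
      using Basis_le_norm[OF that, of x] \<open>norm x \<le> r\<close> by linarith+
    then show ?thesis unfolding K_def mem_box by simp
  qed
  obtain s where s: "\<And>x. x \<in> K \<Longrightarrow> norm x \<le> s"
    using bounded_box[of "- ((r + 1) *\<^sub>R One)" "(r + 1) *\<^sub>R One :: 'a"] by (auto simp: K_def bounded_iff)
  have ib: "bounded_supp (indicator (A \<inter> K) :: 'a \<Rightarrow> real)" if "A \<in> sets borel" for A
    by (rule bounded_suppI[where N=1 and r=s]) (use that K s in \<open>auto simp: indicator_def\<close>)
  have J0: "J (\<lambda>x. 0) = 0" using scale[OF ib[OF sets.empty_sets], of 0] by simp
  \<comment> \<open>Dynkin's argument: complements are taken relative to \<open>K\<close>, and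
    countable disjoint unions are limits of finite ones, handled by \<open>lim\<close>.\<close>
  have PA: "J (indicator (A \<inter> K)) = 0" if "A \<in> sets borel" for A
  proof -
    have sub: "range (\<lambda>(a, b). box a b :: 'a set) \<subseteq> Pow UNIV" by simp
    have "A \<in> sigma_sets UNIV (range (\<lambda>(a, b). box a b))"
      using that unfolding borel_eq_box by (simp add: sets_measure_of)
    with Int_stable_range_box sub show ?thesis
    proof (induction rule: sigma_sets_induct_disjoint)
      case (basic A)
      then obtain a b where "A = box a b" by auto
      have "A \<inter> K \<in> range (\<lambda>(a, b). box a b)"
        using Int_stableD[OF Int_stable_range_box basic] by (auto simp: K_def)
      then show ?case using box by auto
    next
      case empty then show ?case using J0 by (simp add: indicator_def)
    next
      case (compl A)
      have A: "A \<in> sets borel" using compl(1) unfolding borel_eq_box by (simp add: sets_measure_of)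
      have "(indicator ((UNIV - A) \<inter> K) :: 'a \<Rightarrow> real) = (\<lambda>x. indicator (UNIV \<inter> K) x + (- 1) * indicator (A \<inter> K) x)"
        by (auto simp: indicator_def)
      moreover have "J (\<lambda>x. indicator (UNIV \<inter> K) x + (- 1) * indicator (A \<inter> K) x) = J (indicator (UNIV \<inter> K)) + (- 1) * J (indicator (A \<inter> K))"
        using add[OF ib[OF sets.top[of borel, unfolded space_borel]] bounded_supp_mult[OF ib[OF A], of "\<lambda>_. - 1" 1]] scale[OF ib[OF A], of "- 1"] by simp
      moreover have "J (indicator (UNIV \<inter> K)) = 0" using box by (simp add: K_def)
      ultimately show ?case using compl(2) by simp
    next
      case (union A)
      have A: "A i \<in> sets borel" for i using union(2) unfolding borel_eq_box by (auto simp: sets_measure_of)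
      define F where "F = (\<lambda>n x. indicator ((\<Union>i<n. A i) \<inter> K) x :: real)"
      have F0: "J (F n) = 0" for n
      proof (induction n)
        case 0 show ?case using J0 by (simp add: F_def)
      next
        case (Suc n)
        have "F (Suc n) = (\<lambda>x. F n x + indicator (A n \<inter> K) x)"
        proof
          fix x
          have "\<not> (x \<in> A n \<and> x \<in> A i)" if "i < n" for i using union(1) that unfolding disjoint_family_on_def by (metis IntI UNIV_I empty_iff less_irrefl)
          then show "F (Suc n) x = F n x + indicator (A n \<inter> K) x"
            by (auto simp: F_def indicator_def less_Suc_eq)
        qed
        moreover have "bounded_supp (F n)" unfolding F_def using A by (intro ib) auto
        ultimately show ?case using add[OF _ ib[OF A]] Suc union(3) by simp
      qed
      have "(\<lambda>n. J (F n)) \<longlonglongrightarrow> J (indicator ((\<Union>i. A i) \<inter> K))"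
      proof (rule lim[where N=1 and r=s])
        show "F n \<in> borel_measurable borel" for n unfolding F_def using A K by (intro borel_measurable_indicator) auto
        show "(indicator ((\<Union>i. A i) \<inter> K) :: 'a \<Rightarrow> real) \<in> borel_measurable borel"
          using A K by (intro borel_measurable_indicator) auto
        show "\<bar>F n x\<bar> \<le> 1" for n x by (simp add: F_def indicator_def)
        show "F n x = 0" if "s < norm x" for n x using s[of x] that by (auto simp: F_def indicator_def)
        fix x
        show "(\<lambda>n. F n x) \<longlonglongrightarrow> indicator ((\<Union>i. A i) \<inter> K) x"
        proof (cases "x \<in> (\<Union>i. A i) \<inter> K")
          case True
          then obtain i where i: "x \<in> A i" "x \<in> K" by auto
          have "\<forall>\<^sub>F n in sequentially. F n x = 1"
            using eventually_gt_at_top[of i] by eventually_elim (use i in \<open>auto simp: F_def indicator_def\<close>)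
          then show ?thesis using True by (simp add: tendsto_eventually)
        qed (auto simp: F_def indicator_def)
      qed
      then show ?case using F0 LIMSEQ_unique[OF tendsto_const] by force
    qed
  qed
  have Jsimple: "J g = 0" if g: "simple_function borel g" "\<And>x. x \<notin> K \<Longrightarrow> g x = 0" for g
  proof -
    have fin: "finite (range g)" using g(1) by (simp add: simple_function_def)
    have Ac: "g -` {c} \<in> sets borel" for c using simple_functionD(2)[OF g(1), of "{c}"] by simp
    have "bounded_supp (\<lambda>x. \<Sum>c\<in>S. c * indicator (g -` {c} \<inter> K) x) \<and> J (\<lambda>x. \<Sum>c\<in>S. c * indicator (g -` {c} \<inter> K) x) = 0"
      if "finite S" for S :: "real set"
      using that
    proof (induction S)
      case empty
      show ?case using J0 bounded_suppI[of "\<lambda>_::'a. 0::real" 0 0] by auto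
    next
      case (insert c S)
      have bc: "bounded_supp (\<lambda>x. c * indicator (g -` {c} \<inter> K) x)"
        by (rule bounded_supp_mult[OF ib[OF Ac], where M="\<bar>c\<bar>"]) auto
      have bn: "bounded_supp (\<lambda>x. - (\<Sum>c\<in>S. c * indicator (g -` {c} \<inter> K) x))"
        using bounded_supp_mult[of "\<lambda>x. \<Sum>c\<in>S. c * indicator (g -` {c} \<inter> K) x" "\<lambda>_. -1" 1] insert.IH by auto
      have "bounded_supp (\<lambda>x. c * indicator (g -` {c} \<inter> K) x + (\<Sum>c\<in>S. c * indicator (g -` {c} \<inter> K) x))"
        using bounded_supp_diff[OF bc bn] by simp
      moreover have "J (\<lambda>x. c * indicator (g -` {c} \<inter> K) x + (\<Sum>c\<in>S. c * indicator (g -` {c} \<inter> K) x)) = 0"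
        using add[OF bc] insert.IH scale[OF ib[OF Ac], of c c] PA[OF Ac] by auto
      ultimately show ?case unfolding sum.insert[OF insert.hyps] by blast
    qed
    from this[OF fin] have "J (\<lambda>x. \<Sum>c\<in>range g. c * indicator (g -` {c} \<inter> K) x) = 0" by simp
    moreover have "(\<lambda>x. \<Sum>c\<in>range g. c * indicator (g -` {c} \<inter> K) x) = g"
    proof
      fix x
      have "(\<Sum>c\<in>range g. c * indicator (g -` {c} \<inter> K) x) = (\<Sum>c\<in>range g. if c = g x then c * indicator K x else 0)"
        by (intro sum.cong) (auto simp: indicator_def)
      also have "\<dots> = g x * indicator K x" using fin by (subst sum.delta) auto
      also have "\<dots> = g x" using g(2)[of x] by (auto simp: indicator_def)
      finally show "(\<Sum>c\<in>range g. c * indicator (g -` {c} \<inter> K) x) = g x" .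
    qed
    ultimately show ?thesis by simp
  qed
  have fm: "f \<in> borel_measurable borel" by (rule bounded_supp_measurable[OF f])
  \<comment> \<open>The bound by \<open>2 |f|\<close> keeps the simple approximations uniformly
    bounded and makes them vanish where \<open>f\<close> does.\<close>
  obtain F where F: "\<And>i. simple_function borel (F i)" "\<And>x. (\<lambda>i. F i x) \<longlonglongrightarrow> f x" "\<And>i x. dist (F i x) 0 \<le> 2 * dist (f x) 0"
    using borel_measurable_implies_sequence_metric[OF fm, of 0] by auto
  have Fz: "F i x = 0" if "r < norm x" for i x using F(3)[of i x] N(4)[OF that] by simp
  have "(\<lambda>i. J (F i)) \<longlonglongrightarrow> J f"
  proof (rule lim[where N="2 * N" and r=r])
    show "F i \<in> borel_measurable borel" for i by (rule borel_measurable_simple_function[OF F(1)])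
    show "\<bar>F i x\<bar> \<le> 2 * N" for i x using F(3)[of i x] N(3)[of x] by simp
  qed (use fm Fz F in auto)
  moreover have "J (F i) = 0" for i
  proof (rule Jsimple[OF F(1)])
    show "F i x = 0" if "x \<notin> K" for x using Fz[of x i] rK[of x] that by (cases "norm x \<le> r") auto
  qed
  ultimately show ?thesis using LIMSEQ_unique[OF tendsto_const] by force
qed

text \<open>A function in \<open>L\<^sup>p\<close> of the slab may fail to be integrable, hence only
  integrability on balls is asked for. Since the momentum is bounded, a factor that vanishes for
  large \<open>(t, x)\<close> already localises the integral.\<close>

definition slab_integrable :: "real \<Rightarrow> (phase \<Rightarrow> real) \<Rightarrow> bool" where
  "slab_integrable \<rho> g \<longleftrightarrow> g \<in> borel_measurable borel \<and> (\<forall>z. \<rho> \<le> norm (snd z) \<longrightarrow> g z = 0) \<and>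
     (\<forall>r. integrable lborel (\<lambda>z. indicator (cball 0 r) z * g z))"

lemma slab_integrable_bound:
  assumes g: "slab_integrable \<rho> g" and "g z \<noteq> 0" "norm (fst z) \<le> r"
  shows "z \<in> cball 0 (r + \<rho>)"
proof -
  have "\<forall>z. \<rho> \<le> norm (snd z) \<longrightarrow> g z = 0" using g unfolding slab_integrable_def by blast
  then have "norm (snd z) < \<rho>" using assms(2) by (meson not_le)
  moreover have "norm z \<le> norm (fst z) + norm (snd z)" using norm_Pair_le[of "fst z" "snd z"] by simp
  ultimately show ?thesis using assms(3) by simp
qed

lemma slab_integrable_mult:
  assumes g: "slab_integrable \<rho> g" and q: "q \<in> borel_measurable borel" "\<And>z. \<bar>q z\<bar> \<le> C" "\<And>z. q z \<noteq> 0 \<Longrightarrow> norm (fst z) \<le> r"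
  shows "integrable lborel (\<lambda>z. g z * q z)"
proof -
  have i: "integrable lborel (\<lambda>z. C * (indicator (cball 0 (r + \<rho>)) z * g z))"
    using g by (intro integrable_mult_right) (auto simp: slab_integrable_def)
  show ?thesis
  proof (rule Bochner_Integration.integrable_bound[OF i])
    show "(\<lambda>z. g z * q z) \<in> borel_measurable lborel"
      using g q(1) by (simp add: slab_integrable_def borel_measurable_times)
    show "AE z in lborel. norm (g z * q z) \<le> norm (C * (indicator (cball 0 (r + \<rho>)) z * g z))"
    proof (intro AE_I2)
      fix z
      have C: "C \<ge> 0" using q(2)[of z] by linarith
      show "norm (g z * q z) \<le> norm (C * (indicator (cball 0 (r + \<rho>)) z * g z))"
      proof (cases "g z = 0 \<or> q z = 0")
        case False
        then have "z \<in> cball 0 (r + \<rho>)" using slab_integrable_bound[OF g, of z r] q(3) by auto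
        then show ?thesis using mult_right_mono[OF q(2)[of z] abs_ge_zero[of "g z"]] C by (simp add: abs_mult mult.commute)
      qed auto
    qed
  qed
qed

text \<open>Serves to exchange the ray parameter with the phase integral. Where \<open>Q\<close>
  does not vanish, \<open>\<sigma>\<close> and \<open>(t, x)\<close> are bounded, so
  \<open>g\<close> may be replaced by an integrable truncation.\<close>

lemma slab_integrable_Fubini:
  fixes Q :: "real \<times> phase \<Rightarrow> real"
  assumes g: "slab_integrable \<rho> g" and Q: "Q \<in> borel_measurable borel"
    and le: "\<And>\<sigma> z. \<bar>Q (\<sigma>, z)\<bar> \<le> C" and supp: "\<And>\<sigma> z. Q (\<sigma>, z) \<noteq> 0 \<Longrightarrow> \<bar>\<sigma>\<bar> \<le> s \<and> norm (fst z) \<le> r"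
  shows "(LINT \<sigma>|lborel. LINT z|lborel. g z * Q (\<sigma>, z)) = (LINT z|lborel. g z * (LINT \<sigma>|lborel. Q (\<sigma>, z)))"
proof -
  define h where "h = (\<lambda>z. indicator (cball 0 (r + \<rho>)) z * g z)"
  have C: "C \<ge> 0" using le[of 0 0] by linarith
  have h: "integrable lborel h" using g by (auto simp: h_def slab_integrable_def)
  have hQ: "g z * Q (\<sigma>, z) = h z * Q (\<sigma>, z)" for \<sigma> z
    using slab_integrable_bound[OF g, of z r] supp[of \<sigma> z] by (cases "g z = 0 \<or> Q (\<sigma>, z) = 0") (auto simp: h_def)
  have hm: "h \<in> borel_measurable borel" using borel_measurable_integrable[OF h] by simp
  have s2: "(snd :: real \<times> phase \<Rightarrow> phase) \<in> borel_measurable borel"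
    by (intro borel_measurable_continuous_onI continuous_intros)
  have "(\<lambda>x :: real \<times> phase. h (snd x) * Q x) \<in> borel_measurable (borel :: (real \<times> phase) measure)"
    by (rule borel_measurable_times[OF measurable_compose[OF s2 hm] Q])
  then have m: "(\<lambda>x. h (snd x) * Q x) \<in> borel_measurable (lborel \<Otimes>\<^sub>M lborel)"
    by (simp add: lborel_prod)
  have Qz: "(\<lambda>z. Q (\<sigma>, z)) \<in> borel_measurable borel" for \<sigma>
    by (rule measurable_compose[OF _ Q]) (intro borel_measurable_continuous_onI continuous_intros)
  have dom: "norm (h z * Q (\<sigma>, z)) \<le> indicator {-s..s} \<sigma> * (C * norm (h z))" for \<sigma> z
  proof (cases "Q (\<sigma>, z) = 0")
    case False
    have "norm (h z) * \<bar>Q (\<sigma>, z)\<bar> \<le> norm (h z) * C" by (intro mult_left_mono le) simp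
    moreover have "\<sigma> \<in> {-s..s}" using supp[OF False] by (simp add: abs_le_iff)
    ultimately show ?thesis by (simp add: abs_mult mult.commute)
  qed (use C in simp)
  have int1: "integrable lborel (\<lambda>z. h z * Q (\<sigma>, z))" for \<sigma>
  proof (rule Bochner_Integration.integrable_bound[OF integrable_mult_right[OF integrable_norm[OF h], of C]])
    show "(\<lambda>z. h z * Q (\<sigma>, z)) \<in> borel_measurable lborel"
      using borel_measurable_times[OF hm Qz] by simp
    show "AE z in lborel. norm (h z * Q (\<sigma>, z)) \<le> norm (C * norm (h z))"
      using C by (intro AE_I2 order_trans[OF dom]) (auto simp: indicator_def)
  qed
  have "integrable (lborel \<Otimes>\<^sub>M lborel) (\<lambda>x. h (snd x) * Q x)"
  proof (rule lborel_pair.Fubini_integrable[OF m])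
    show "integrable lborel (\<lambda>\<sigma>. LINT z|lborel. norm (h (snd (\<sigma>, z)) * Q (\<sigma>, z)))"
    proof (rule Bochner_Integration.integrable_bound)
      show "integrable lborel (\<lambda>\<sigma>. indicator {-s..s} \<sigma> * (C * (LINT z|lborel. norm (h z))))"
        by (intro integrable_mult_left integrable_real_indicator) (auto simp: emeasure_lborel_Icc_eq)
      have "case_prod (\<lambda>\<sigma> z. norm (h (snd (\<sigma>, z)) * Q (\<sigma>, z))) \<in> borel_measurable (lborel \<Otimes>\<^sub>M lborel)"
        using measurable_compose[OF m borel_measurable_norm] by (simp add: case_prod_beta')
      from lborel.borel_measurable_lebesgue_integral[OF this]
      show "(\<lambda>\<sigma>. LINT z|lborel. norm (h (snd (\<sigma>, z)) * Q (\<sigma>, z))) \<in> borel_measurable lborel" .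
      show "AE \<sigma> in lborel. norm (LINT z|lborel. norm (h (snd (\<sigma>, z)) * Q (\<sigma>, z))) \<le> norm (indicator {-s..s} \<sigma> * (C * (LINT z|lborel. norm (h z))))"
      proof (intro AE_I2)
        fix \<sigma>
        have "(LINT z|lborel. norm (h z * Q (\<sigma>, z))) \<le> (LINT z|lborel. indicator {-s..s} \<sigma> * (C * norm (h z)))"
          by (intro integral_mono integrable_norm[OF int1] integrable_mult_right integrable_norm[OF h] dom)
        then show "norm (LINT z|lborel. norm (h (snd (\<sigma>, z)) * Q (\<sigma>, z))) \<le> norm (indicator {-s..s} \<sigma> * (C * (LINT z|lborel. norm (h z))))"
          using C by (simp add: abs_mult)
      qed
    qed
    show "AE \<sigma> in lborel. integrable lborel (\<lambda>z. h (snd (\<sigma>, z)) * Q (\<sigma>, z))"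
      using int1 by simp
  qed
  then have "(LINT z|lborel. LINT \<sigma>|lborel. h (snd (\<sigma>, z)) * Q (\<sigma>, z)) = (LINT \<sigma>|lborel. LINT z|lborel. h (snd (\<sigma>, z)) * Q (\<sigma>, z))"
    using lborel_pair.Fubini_integral[of "\<lambda>\<sigma> z. h (snd (\<sigma>, z)) * Q (\<sigma>, z)"] by (simp add: case_prod_beta')
  then have "(LINT \<sigma>|lborel. LINT z|lborel. g z * Q (\<sigma>, z)) = (LINT z|lborel. LINT \<sigma>|lborel. g z * Q (\<sigma>, z))"
    unfolding hQ by simp
  also have "\<dots> = (LINT z|lborel. g z * (LINT \<sigma>|lborel. Q (\<sigma>, z)))" by simp
  finally show ?thesis .
qed

text \<open>What evaluation at \<open>(t, x)\<close> and integration along a ray have in common, so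
  that linearity and bounded convergence of their pairings are proved once. The constant
  \<open>c\<close> serves both as the bound of the operator and as the distance over which supports
  may spread.\<close>

definition local_op :: "real \<Rightarrow> ((spacetime \<Rightarrow> real) \<Rightarrow> phase \<Rightarrow> real) \<Rightarrow> bool" where
  "local_op c S \<longleftrightarrow>
    (\<forall>\<psi>. bounded_supp \<psi> \<longrightarrow> S \<psi> \<in> borel_measurable borel) \<and>
    (\<forall>\<psi>1 \<psi>2 z. bounded_supp \<psi>1 \<longrightarrow> bounded_supp \<psi>2 \<longrightarrow> S (\<lambda>y. \<psi>1 y + \<psi>2 y) z = S \<psi>1 z + S \<psi>2 z) \<and>
    (\<forall>\<psi> a z. bounded_supp \<psi> \<longrightarrow> S (\<lambda>y. a * \<psi> y) z = a * S \<psi> z) \<and>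
    (\<forall>F f N z. (\<forall>n. F n \<in> borel_measurable borel) \<longrightarrow> f \<in> borel_measurable borel \<longrightarrow> (\<forall>n y. \<bar>F n y\<bar> \<le> N) \<longrightarrow>
       (\<forall>y. (\<lambda>n. F n y) \<longlonglongrightarrow> f y) \<longrightarrow> (\<lambda>n. S (F n) z) \<longlonglongrightarrow> S f z) \<and>
    (\<forall>\<psi> N r z. bounded_supp \<psi> \<longrightarrow> (\<forall>y. \<bar>\<psi> y\<bar> \<le> N) \<longrightarrow> (\<forall>y. r < norm y \<longrightarrow> \<psi> y = 0) \<longrightarrow>
       \<bar>S \<psi> z\<bar> \<le> c * N \<and> (r + c < norm (fst z) \<longrightarrow> S \<psi> z = 0))"

lemma local_op_integrable:
  assumes S: "local_op c S" and g: "slab_integrable \<rho> g" and \<psi>: "bounded_supp \<psi>"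
  shows "integrable lborel (\<lambda>z. g z * S \<psi> z)"
proof -
  obtain N r where N: "\<forall>y. \<bar>\<psi> y\<bar> \<le> N" "\<forall>y. r < norm y \<longrightarrow> \<psi> y = 0"
    using bounded_suppE[OF \<psi>] by metis
  have b: "\<bar>S \<psi> z\<bar> \<le> c * N" "r + c < norm (fst z) \<Longrightarrow> S \<psi> z = 0" for z
    using S \<psi> N unfolding local_op_def by blast+
  show ?thesis
  proof (rule slab_integrable_mult[OF g _ b(1)])
    show "S \<psi> \<in> borel_measurable borel" using S \<psi> unfolding local_op_def by blast
    show "norm (fst z) \<le> r + c" if "S \<psi> z \<noteq> 0" for z using b(2)[of z] that by (meson not_le)
  qed
qed

text \<open>Provides the linearity and continuity hypotheses of
  \<open>functional_zero_on_bounded_supp\<close> for each term of the weak identity.\<close>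

lemma local_op_pairing:
  assumes S: "local_op c S" and g: "slab_integrable \<rho> g"
  defines "J \<equiv> \<lambda>\<psi>. LINT z|lborel. g z * S \<psi> z"
  shows "bounded_supp \<psi>1 \<Longrightarrow> bounded_supp \<psi>2 \<Longrightarrow> J (\<lambda>y. \<psi>1 y + \<psi>2 y) = J \<psi>1 + J \<psi>2"
    and "bounded_supp \<psi>1 \<Longrightarrow> J (\<lambda>y. a * \<psi>1 y) = a * J \<psi>1"
    and "(\<And>n. F n \<in> borel_measurable borel) \<Longrightarrow> f \<in> borel_measurable borel \<Longrightarrow>
      (\<And>n x. \<bar>F n x\<bar> \<le> N) \<Longrightarrow> (\<And>n x. r < norm x \<Longrightarrow> F n x = 0) \<Longrightarrow> (\<And>x. (\<lambda>n. F n x) \<longlonglongrightarrow> f x) \<Longrightarrow>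
      (\<lambda>n. J (F n)) \<longlonglongrightarrow> J f"
proof -
  note i = local_op_integrable[OF S g]
  { assume b: "bounded_supp \<psi>1" "bounded_supp \<psi>2"
    have "S (\<lambda>y. \<psi>1 y + \<psi>2 y) z = S \<psi>1 z + S \<psi>2 z" for z using S b unfolding local_op_def by blast
    then show "J (\<lambda>y. \<psi>1 y + \<psi>2 y) = J \<psi>1 + J \<psi>2"
      unfolding J_def using i[OF b(1)] i[OF b(2)] by (simp add: distrib_left) }
  { assume b: "bounded_supp \<psi>1"
    have "S (\<lambda>y. a * \<psi>1 y) z = a * S \<psi>1 z" for z using S b unfolding local_op_def by blast
    then show "J (\<lambda>y. a * \<psi>1 y) = a * J \<psi>1"
      unfolding J_def by (simp add: mult.left_commute) }
  { assume F: "\<And>n. F n \<in> borel_measurable borel" "f \<in> borel_measurable borel"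
      "\<And>n x. \<bar>F n x\<bar> \<le> N" "\<And>n x. r < norm x \<Longrightarrow> F n x = 0" "\<And>x. (\<lambda>n. F n x) \<longlonglongrightarrow> f x"
    have bF: "bounded_supp (F n)" for n
      by (rule bounded_suppI[OF F(1) F(3), where r=r]) (use F(4) in \<open>meson not_le\<close>)
    have fN: "\<bar>f x\<bar> \<le> N" for x
      by (rule LIMSEQ_le_const2[OF tendsto_rabs[OF F(5)]]) (use F(3) in auto)
    have fr: "f x = 0" if "r < norm x" for x
      using F(5)[of x] F(4)[OF that] LIMSEQ_unique[OF tendsto_const] by force
    have bf: "bounded_supp f"
      by (rule bounded_suppI[OF F(2) fN, where r=r]) (use fr in \<open>meson not_le\<close>)
    have Sb: "\<bar>S (F n) z\<bar> \<le> c * N" "r + c < norm (fst z) \<Longrightarrow> S (F n) z = 0" for n z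
      using S bF[of n] F(3)[of n] F(4)[of _ n] unfolding local_op_def by blast+
    have cN: "0 \<le> c * N" using Sb(1)[of 0 0] by linarith
    have Sl: "(\<lambda>n. S (F n) z) \<longlonglongrightarrow> S f z" for z
      using S F(1,2,3,5) unfolding local_op_def by blast
    have m: "(\<lambda>z. g z * S \<psi> z) \<in> borel_measurable lborel" if "bounded_supp \<psi>" for \<psi>
      using borel_measurable_integrable[OF i[OF that]] .
    have gi: "integrable lborel (\<lambda>z. indicator (cball 0 ((r + c) + \<rho>)) z * g z)"
      using g by (auto simp: slab_integrable_def)
    show "(\<lambda>n. J (F n)) \<longlonglongrightarrow> J f"
      unfolding J_def
    proof (rule integral_dominated_convergence[where w="\<lambda>z. (c * N) * norm (indicator (cball 0 ((r + c) + \<rho>)) z * g z)"])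
      show "integrable lborel (\<lambda>z. (c * N) * norm (indicator (cball 0 ((r + c) + \<rho>)) z * g z))"
        by (intro integrable_mult_right integrable_norm gi)
      show "AE z in lborel. (\<lambda>n. g z * S (F n) z) \<longlonglongrightarrow> g z * S f z"
        by (intro AE_I2 tendsto_mult_left Sl)
      show "AE z in lborel. norm (g z * S (F n) z) \<le> (c * N) * norm (indicator (cball 0 ((r + c) + \<rho>)) z * g z)" for n
      proof (intro AE_I2)
        fix z
        show "norm (g z * S (F n) z) \<le> (c * N) * norm (indicator (cball 0 ((r + c) + \<rho>)) z * g z)"
        proof (cases "g z = 0 \<or> S (F n) z = 0")
          case False
          then have "norm (fst z) \<le> r + c" using Sb(2)[of z n] by (meson not_le)
          then have "z \<in> cball 0 ((r + c) + \<rho>)" using slab_integrable_bound[OF g, of z "r + c"] False by auto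
          then show ?thesis using mult_right_mono[OF Sb(1)[of n z] abs_ge_zero[of "g z"]] by (simp add: abs_mult mult.commute)
        qed (use cN in auto)
      qed
    qed (intro m bF bf)+ }
qed

lemma local_op_eval: "local_op 1 (\<lambda>\<psi> z. \<psi> (fst z))"
proof -
  have m: "(\<lambda>z :: phase. \<psi> (fst z)) \<in> borel_measurable borel" if "bounded_supp \<psi>" for \<psi> :: "spacetime \<Rightarrow> real"
    by (rule measurable_compose[OF _ bounded_supp_measurable[OF that]]) (intro borel_measurable_continuous_onI continuous_intros)
  show ?thesis unfolding local_op_def
  proof (intro conjI allI impI)
    fix \<psi> :: "spacetime \<Rightarrow> real" and N r and z :: phase
    assume N: "\<forall>y. \<bar>\<psi> y\<bar> \<le> N" and r: "\<forall>y. r < norm y \<longrightarrow> \<psi> y = 0"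
    show "\<bar>\<psi> (fst z)\<bar> \<le> 1 * N" unfolding mult_1 using N by blast
    assume "r + 1 < norm (fst z)"
    then have "r < norm (fst z)" by linarith
    then show "\<psi> (fst z) = 0" using r by blast
  qed (use m in auto)
qed

lemma norm_velocity_pair_le: "norm ((1::real), velocity p) \<le> 2"
  using norm_Pair_le[of "1::real" "velocity p"] norm_velocity_less_1[of p] by simp

text \<open>The ray parameter runs up to \<open>\<delta>\<close> and the direction has norm at most
  2, so supports spread by at most \<open>2 * \<delta>\<close>.\<close>

lemma local_op_ray:
  assumes \<eta>: "admissible \<delta> \<eta>" and \<delta>: "\<delta> > 0"
  shows "local_op (2 * \<delta>) (\<lambda>\<psi> z. ray_integral \<eta> \<psi> (fst z) (1, velocity (snd z)))"
proof -
  have b\<eta>: "bounded_supp \<eta>" by (rule admissible_bounded_supp[OF \<eta>])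
  have \<eta>m: "\<eta> \<in> borel_measurable borel" using \<eta> by (simp add: admissible_def)
  have \<eta>0: "\<eta> \<tau> = 0" if "\<tau> \<notin> {0..\<delta>}" for \<tau> using \<eta> that unfolding admissible_def by blast
  show ?thesis unfolding local_op_def
  proof (intro conjI allI impI)
    fix \<psi> :: "spacetime \<Rightarrow> real" assume "bounded_supp \<psi>"
    then show "(\<lambda>z :: phase. ray_integral \<eta> \<psi> (fst z) (1, velocity (snd z))) \<in> borel_measurable borel"
      by (intro ray_integral_phase_measurable \<eta>m bounded_supp_measurable)
  next
    fix \<psi>1 \<psi>2 :: "spacetime \<Rightarrow> real" and z :: phase assume "bounded_supp \<psi>1" "bounded_supp \<psi>2"
    then show "ray_integral \<eta> (\<lambda>y. \<psi>1 y + \<psi>2 y) (fst z) (1, velocity (snd z)) =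
       ray_integral \<eta> \<psi>1 (fst z) (1, velocity (snd z)) + ray_integral \<eta> \<psi>2 (fst z) (1, velocity (snd z))"
      by (rule ray_integral_add[OF b\<eta>])
  next
    fix \<psi> :: "spacetime \<Rightarrow> real" and a and z :: phase
    show "ray_integral \<eta> (\<lambda>y. a * \<psi> y) (fst z) (1, velocity (snd z)) = a * ray_integral \<eta> \<psi> (fst z) (1, velocity (snd z))"
      unfolding ray_integral_def by (simp add: mult.left_commute)
  next
    fix F :: "nat \<Rightarrow> spacetime \<Rightarrow> real" and f N and z :: phase
    assume F: "\<forall>n. F n \<in> borel_measurable borel" "f \<in> borel_measurable borel" "\<forall>n y. \<bar>F n y\<bar> \<le> N" "\<forall>y. (\<lambda>n. F n y) \<longlonglongrightarrow> f y"
    have l: "(\<lambda>\<tau>. fst z + \<tau> *\<^sub>R (1, velocity (snd z))) \<in> borel_measurable borel"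
      by (intro borel_measurable_continuous_onI continuous_intros)
    have m: "(\<lambda>\<tau>. \<eta> \<tau> * \<psi> (fst z + \<tau> *\<^sub>R (1, velocity (snd z)))) \<in> borel_measurable lborel" if "\<psi> \<in> borel_measurable borel" for \<psi> :: "spacetime \<Rightarrow> real"
      using borel_measurable_times[OF \<eta>m measurable_compose[OF l that]] by simp
    show "(\<lambda>n. ray_integral \<eta> (F n) (fst z) (1, velocity (snd z))) \<longlonglongrightarrow> ray_integral \<eta> f (fst z) (1, velocity (snd z))"
      unfolding ray_integral_def
    proof (rule integral_dominated_convergence[where w="\<lambda>\<tau>. N * norm (\<eta> \<tau>)"])
      show "integrable lborel (\<lambda>\<tau>. N * norm (\<eta> \<tau>))" by (intro integrable_mult_right integrable_norm bounded_supp_integrable b\<eta>)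
      show "AE \<tau> in lborel. (\<lambda>n. \<eta> \<tau> * F n (fst z + \<tau> *\<^sub>R (1, velocity (snd z)))) \<longlonglongrightarrow> \<eta> \<tau> * f (fst z + \<tau> *\<^sub>R (1, velocity (snd z)))"
        using F(4) by (intro AE_I2 tendsto_mult_left) blast
      show "AE \<tau> in lborel. norm (\<eta> \<tau> * F n (fst z + \<tau> *\<^sub>R (1, velocity (snd z)))) \<le> N * norm (\<eta> \<tau>)" for n
      proof (intro AE_I2)
        fix \<tau>
        have "\<bar>F n (fst z + \<tau> *\<^sub>R (1, velocity (snd z)))\<bar> \<le> N" using F(3) by blast
        from mult_left_mono[OF this abs_ge_zero[of "\<eta> \<tau>"]]
        show "norm (\<eta> \<tau> * F n (fst z + \<tau> *\<^sub>R (1, velocity (snd z)))) \<le> N * norm (\<eta> \<tau>)"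
          by (simp only: real_norm_def abs_mult mult.commute)
      qed
    qed (use m F in auto)
  next
    fix \<psi> :: "spacetime \<Rightarrow> real" and N r and z :: phase
    assume \<psi>: "bounded_supp \<psi>" and N: "\<forall>y. \<bar>\<psi> y\<bar> \<le> N" and r: "\<forall>y. r < norm y \<longrightarrow> \<psi> y = 0"
    have N0: "N \<ge> 0" using N[rule_format, of 0] by linarith
    have "\<bar>ray_integral \<eta> \<psi> (fst z) (1, velocity (snd z))\<bar> \<le> \<delta> * N"
      by (rule ray_integral_sup_le[OF \<eta> \<psi> \<delta>]) (use N in auto)
    then show "\<bar>ray_integral \<eta> \<psi> (fst z) (1, velocity (snd z))\<bar> \<le> 2 * \<delta> * N"
      using mult_nonneg_nonneg[of \<delta> N] N0 \<delta> by linarith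
    assume far: "r + 2 * \<delta> < norm (fst z)"
    have "\<eta> \<tau> * \<psi> (fst z + \<tau> *\<^sub>R (1, velocity (snd z))) = 0" for \<tau>
    proof (cases "\<tau> \<in> {0..\<delta>}")
      case True
      have "norm (\<tau> *\<^sub>R (1::real, velocity (snd z))) \<le> \<delta> * 2"
        unfolding norm_scaleR using True norm_velocity_pair_le by (intro mult_mono) auto
      then have "r < norm (fst z + \<tau> *\<^sub>R (1, velocity (snd z)))"
        using far norm_diff_ineq[of "fst z" "\<tau> *\<^sub>R (1::real, velocity (snd z))"] by linarith
      then have "\<psi> (fst z + \<tau> *\<^sub>R (1, velocity (snd z))) = 0" using r by blast
      then show ?thesis by simp
    qed (simp add: \<eta>0)
    then show "ray_integral \<eta> \<psi> (fst z) (1, velocity (snd z)) = 0" unfolding ray_integral_def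
      by (simp only: Bochner_Integration.integral_zero)
  qed
qed

text \<open>The weights in Duhamel's formula averaged over a ray segment of length \<open>\<delta>\<close>: the solution is averaged
  with \<open>uniform_kernel \<delta> / \<delta>\<close> and the source enters with \<open>linear_kernel \<delta>\<close>.\<close>

definition uniform_kernel :: "real \<Rightarrow> real \<Rightarrow> real" where
  "uniform_kernel \<delta> \<tau> = indicator {0..\<delta>} \<tau>"

definition linear_kernel :: "real \<Rightarrow> real \<Rightarrow> real" where
  "linear_kernel \<delta> \<tau> = indicator {0..\<delta>} \<tau> * (1 - \<tau> / \<delta>)"

text \<open>For \<open>a \<ge> 0\<close> the increment is nonnegative on \<open>\<tau> < 0\<close>,
  where \<open>\<eta>\<close> vanishes, and nonpositive on \<open>\<tau> \<ge> 0\<close> by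
  monotonicity. Its integral is 0, so its \<open>L\<^sup>1\<close> norm is twice the integral over
  \<open>{- a..<0}\<close>, which is at most \<open>a\<close> and at most \<open>\<delta>\<close>.
  Negative \<open>a\<close> follows by translation.\<close>

lemma antimono_kernel_variation:
  fixes \<eta> :: "real \<Rightarrow> real"
  assumes \<eta>m[measurable]: "\<eta> \<in> borel_measurable borel" and \<delta>: "\<delta> > 0"
    and b: "\<And>\<tau>. 0 \<le> \<eta> \<tau>" "\<And>\<tau>. \<eta> \<tau> \<le> 1" and s: "\<And>\<tau>. \<tau> \<notin> {0..\<delta>} \<Longrightarrow> \<eta> \<tau> = 0"
    and mono: "\<And>x y. 0 \<le> x \<Longrightarrow> x \<le> y \<Longrightarrow> \<eta> y \<le> \<eta> x"
  shows "(LINT \<tau>|lborel. \<bar>\<eta> (\<tau> + a) - \<eta> \<tau>\<bar>) \<le> 2 * min \<bar>a\<bar> \<delta>"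
proof -
  have b\<eta>: "bounded_supp \<eta>"
  proof (rule bounded_suppI[OF \<eta>m])
    show "\<bar>\<eta> y\<bar> \<le> 1" for y using b by simp
    show "norm y \<le> \<delta>" if "\<eta> y \<noteq> 0" for y using s[of y] that by force
  qed
  have pos: "(LINT \<tau>|lborel. \<bar>\<eta> (\<tau> + a) - \<eta> \<tau>\<bar>) \<le> 2 * min a \<delta>" if a: "a \<ge> 0" for a
  proof -
    have i0: "integrable lborel \<eta>" by (rule bounded_supp_integrable[OF b\<eta>])
    have i1: "integrable lborel (\<lambda>\<tau>. \<eta> (\<tau> + a))" by (rule bounded_supp_integrable[OF bounded_supp_translate[OF b\<eta>]])
    have i2: "integrable lborel (\<lambda>\<tau>. indicator {-a..<0} \<tau> * \<eta> (\<tau> + a))"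
      by (rule bounded_supp_integrable[OF bounded_supp_indicator[OF bounded_supp_translate[OF b\<eta>]]]) simp
    have pt: "\<bar>\<eta> (\<tau> + a) - \<eta> \<tau>\<bar> = 2 * (indicator {-a..<0} \<tau> * \<eta> (\<tau> + a)) - (\<eta> (\<tau> + a) - \<eta> \<tau>)" for \<tau>
    proof -
      consider "\<tau> < - a" | "- a \<le> \<tau>" "\<tau> < 0" | "0 \<le> \<tau>" by linarith
      then show ?thesis
      proof cases
        case 1 then show ?thesis using s[of \<tau>] s[of "\<tau> + a"] a by auto
      next
        case 2 then show ?thesis using s[of \<tau>] b(1)[of "\<tau> + a"] by auto
      next
        case 3 then show ?thesis using mono[of \<tau> "\<tau> + a"] a by auto
      qed
    qed
    have "(LINT \<tau>|lborel. \<bar>\<eta> (\<tau> + a) - \<eta> \<tau>\<bar>) = 2 * (LINT \<tau>|lborel. indicator {-a..<0} \<tau> * \<eta> (\<tau> + a)) - ((LINT \<tau>|lborel. \<eta> (\<tau> + a)) - (LINT \<tau>|lborel. \<eta> \<tau>))"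
      unfolding pt using i0 i1 i2 by simp
    also have "(LINT \<tau>|lborel. \<eta> (\<tau> + a)) = (LINT \<tau>|lborel. \<eta> \<tau>)" by (rule lborel_integral_translate[OF \<eta>m])
    finally have eq: "(LINT \<tau>|lborel. \<bar>\<eta> (\<tau> + a) - \<eta> \<tau>\<bar>) = 2 * (LINT \<tau>|lborel. indicator {-a..<0} \<tau> * \<eta> (\<tau> + a))" by simp
    have "(LINT \<tau>|lborel. indicator {-a..<0} \<tau> * \<eta> (\<tau> + a)) \<le> (LINT \<tau>|lborel. indicator {-a..<0} \<tau>)"
      by (intro integral_mono i2 integrable_real_indicator) (use b a in \<open>auto simp: indicator_def\<close>)
    also have "\<dots> = a" using a by simp
    finally have 1: "(LINT \<tau>|lborel. indicator {-a..<0} \<tau> * \<eta> (\<tau> + a)) \<le> a" .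
    have "(LINT \<tau>|lborel. indicator {-a..<0} \<tau> * \<eta> (\<tau> + a)) \<le> (LINT \<tau>|lborel. indicator {-a..\<delta> - a} \<tau>)"
    proof (intro integral_mono i2 integrable_real_indicator)
      show "indicator {-a..<0} \<tau> * \<eta> (\<tau> + a) \<le> indicator {-a..\<delta> - a} \<tau>" for \<tau>
        using b[of "\<tau> + a"] s[of "\<tau> + a"] by (auto simp: indicator_def)
    qed (auto simp: emeasure_lborel_Icc_eq)
    also have "\<dots> = \<delta>" using \<delta> by simp
    finally show ?thesis using 1 unfolding eq by simp
  qed
  show ?thesis
  proof (cases "a \<ge> 0")
    case False
    have "(LINT \<tau>|lborel. \<bar>\<eta> (\<tau> + a) - \<eta> \<tau>\<bar>) = (LINT \<tau>|lborel. \<bar>\<eta> ((\<tau> + a) + - a) - \<eta> (\<tau> + a)\<bar>)"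
      by (simp add: abs_minus_commute)
    also have "\<dots> = (LINT \<tau>|lborel. \<bar>\<eta> (\<tau> + - a) - \<eta> \<tau>\<bar>)"
      by (rule lborel_integral_translate[of "\<lambda>\<tau>. \<bar>\<eta> (\<tau> + - a) - \<eta> \<tau>\<bar>" a]) measurable
    also have "\<dots> \<le> 2 * min (- a) \<delta>" using pos[of "- a"] False by simp
    finally show ?thesis using False by simp
  qed (use pos[of a] in simp)
qed

lemma admissible_uniform_kernel: "\<delta> > 0 \<Longrightarrow> admissible \<delta> (uniform_kernel \<delta>)"
proof -
  assume \<delta>: "\<delta> > 0"
  have "(LINT \<tau>|lborel. \<bar>uniform_kernel \<delta> (\<tau> + a) - uniform_kernel \<delta> \<tau>\<bar>) \<le> 2 * min \<bar>a\<bar> \<delta>" for a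
    by (rule antimono_kernel_variation[OF _ \<delta>]) (auto simp: uniform_kernel_def[abs_def] indicator_def)
  then show ?thesis by (auto simp: admissible_def uniform_kernel_def[abs_def] indicator_def)
qed

lemma admissible_linear_kernel: "\<delta> > 0 \<Longrightarrow> admissible \<delta> (linear_kernel \<delta>)"
proof -
  assume \<delta>: "\<delta> > 0"
  have m: "linear_kernel \<delta> \<in> borel_measurable borel"
    unfolding linear_kernel_def[abs_def] by measurable
  have b: "0 \<le> linear_kernel \<delta> \<tau>" "linear_kernel \<delta> \<tau> \<le> 1" "\<tau> \<notin> {0..\<delta>} \<Longrightarrow> linear_kernel \<delta> \<tau> = 0" for \<tau>
    using \<delta> by (auto simp: linear_kernel_def indicator_def)
  have "linear_kernel \<delta> y \<le> linear_kernel \<delta> x" if "0 \<le> x" "x \<le> y" for x y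
    using that \<delta> by (auto simp: linear_kernel_def indicator_def divide_right_mono)
  then have "(LINT \<tau>|lborel. \<bar>linear_kernel \<delta> (\<tau> + a) - linear_kernel \<delta> \<tau>\<bar>) \<le> 2 * min \<bar>a\<bar> \<delta>" for a
    by (intro antimono_kernel_variation[OF m \<delta>] b)
  then show ?thesis using m b by (simp add: admissible_def)
qed

subsection \<open>Transport of test functions along the rays\<close>

lemma C_k_sum: "finite A \<Longrightarrow> (\<And>i. i \<in> A \<Longrightarrow> C_k k (f i)) \<Longrightarrow> C_k k (\<lambda>z. \<Sum>i\<in>A. f i z)"
proof (induction rule: finite_induct)
  case empty
  show ?case using C_k_const[of k 0] by simp
next
  case (insert x F)
  have "C_k k (\<lambda>z. f x z + (\<Sum>i\<in>F. f i z))" by (rule C_k_add) (use insert in auto)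
  then show ?case using insert.hyps by simp
qed

lemma frechet_derivative_sum_Basis:
  fixes g :: "'a::euclidean_space \<Rightarrow> real"
  assumes "g differentiable (at z)"
  shows "frechet_derivative g (at z) w = (\<Sum>i\<in>Basis. (w \<bullet> i) * frechet_derivative g (at z) i)"
proof -
  have l: "linear (frechet_derivative g (at z))" by (rule linear_frechet_derivative[OF assms])
  have "frechet_derivative g (at z) w = frechet_derivative g (at z) (\<Sum>i\<in>Basis. (w \<bullet> i) *\<^sub>R i)"
    by (simp only: euclidean_representation)
  also have "\<dots> = (\<Sum>i\<in>Basis. (w \<bullet> i) * frechet_derivative g (at z) i)"
    unfolding linear_sum[OF l] linear_scale[OF l] by simp
  finally show ?thesis .
qed

lemma C_k_compose_linear:
  assumes L: "bounded_linear L"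
  shows "C_k k g \<Longrightarrow> C_k k (\<lambda>z. g (L z))"
proof (induction k arbitrary: g)
  case 0
  then show ?case using L by (auto intro: continuous_on_compose2 linear_continuous_on)
next
  case (Suc k)
  have d: "((\<lambda>z. g (L z)) has_derivative (\<lambda>h. frechet_derivative g (at (L z)) (L h))) (at z)" for z
    by (rule has_derivative_compose[OF bounded_linear_imp_has_derivative[OF L] C_k_SucD(1)[OF Suc.prems]])
  show ?case
  proof (rule C_k_SucI[OF d])
    fix b :: 'a
    have "g differentiable (at x)" for x using Suc.prems by simp
    then have "(\<lambda>z. frechet_derivative g (at (L z)) (L b)) = (\<lambda>z. \<Sum>i\<in>Basis. (L b \<bullet> i) * frechet_derivative g (at (L z)) i)"
      by (intro ext frechet_derivative_sum_Basis)
    moreover have "C_k k (\<lambda>z. \<Sum>i\<in>Basis. (L b \<bullet> i) * frechet_derivative g (at (L z)) i)"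
      by (rule C_k_sum[OF finite_Basis C_k_mult[OF C_k_const Suc.IH[OF C_k_SucD(2)[OF Suc.prems]]]])
    ultimately show "C_k k (\<lambda>z. frechet_derivative g (at (L z)) (L b))" by simp
  qed
qed

section \<open>Transported bumps and cutoffs in time and momentum\<close>

definition transported :: "real \<Rightarrow> phase \<Rightarrow> spacetime" where
  "transported \<sigma> z = fst z + \<sigma> *\<^sub>R (1, velocity (snd z))"

lemma continuous_on_transported:
  assumes "continuous_on S f" "continuous_on S g"
  shows "continuous_on S (\<lambda>x. transported (f x) (g x))"
proof -
  have "continuous_on S (\<lambda>x. velocity (snd (g x)))"
    by (rule continuous_on_compose2[OF continuous_on_velocity[of UNIV]]) (auto intro!: continuous_intros assms)
  then show ?thesis unfolding transported_def by (intro continuous_intros assms)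
qed

lemma C_k_transported_inner: "C_k k (\<lambda>z. transported \<sigma> z \<bullet> i)"
proof -
  have e: "(\<lambda>z. transported \<sigma> z \<bullet> i) = (\<lambda>z. fst z \<bullet> i + (\<sigma> * fst i + \<sigma> * (inverse (energy (snd z)) * (snd z \<bullet> snd i))))"
    by (cases i) (auto simp: transported_def velocity_def inner_add_left fun_eq_iff divide_inverse algebra_simps)
  have 1: "C_k k (\<lambda>z :: phase. fst z \<bullet> i)"
    by (rule C_k_linear[OF bounded_linear_compose[OF bounded_linear_inner_left bounded_linear_fst]])
  have 2: "C_k k (\<lambda>z :: phase. inverse (energy (snd z)))"
    by (rule C_k_compose_linear[OF bounded_linear_snd C_k_inverse_energy])
  have 3: "C_k k (\<lambda>z :: phase. snd z \<bullet> snd i)"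
    by (rule C_k_linear[OF bounded_linear_compose[OF bounded_linear_inner_left bounded_linear_snd]])
  show ?thesis unfolding e
    by (rule C_k_add[OF 1 C_k_add[OF C_k_const C_k_mult[OF C_k_const C_k_mult[OF 2 3]]]])
qed

lemma C_k_box_bump_transported: "C_k k (\<lambda>z. box_bump n a b (transported \<sigma> z))"
  unfolding box_bump_def
proof (rule C_k_prod)
  fix i :: spacetime
  show "C_k k (\<lambda>z. interval_bump n (a \<bullet> i) (b \<bullet> i) (transported \<sigma> z \<bullet> i))"
    by (rule C_k_compose[OF C_k_interval_bump[of k n "a \<bullet> i" "b \<bullet> i"] C_k_transported_inner])
qed simp

text \<open>The slopes are chosen so that the function is 1 on
  \<open>[\<epsilon> / 2, T - \<epsilon> / 2]\<close> and 0 outside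
  \<open>[\<epsilon> / 4, T - \<epsilon> / 4]\<close>: constant in a neighbourhood of the times
  where \<open>u\<close> lives and compactly supported in the open time interval.\<close>

definition time_cutoff :: "real \<Rightarrow> real \<Rightarrow> real \<Rightarrow> real" where
  "time_cutoff \<epsilon> T t = smooth_step (4 / \<epsilon> * (t - \<epsilon> / 4)) * smooth_step (4 / \<epsilon> * ((T - \<epsilon> / 4) - t))"

text \<open>A product over coordinates rather than a function of the norm: smoothness is then
  inherited from \<open>smooth_step\<close>. It is 1 on the ball of radius \<open>R\<close> and
  vanishes outside the cube of half side \<open>R + 1\<close>. The factors \<open>1 *\<close> match
  the affine form of \<open>C_k_affine\<close>.\<close>

definition momentum_cutoff :: "real \<Rightarrow> real^3 \<Rightarrow> real" where
  "momentum_cutoff R p = (\<Prod>i\<in>Basis. smooth_step (1 * (p \<bullet> i - (- R - 1))) * smooth_step (1 * ((R + 1) - p \<bullet> i)))"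

definition phase_cutoff :: "real \<Rightarrow> real \<Rightarrow> real \<Rightarrow> phase \<Rightarrow> real" where
  "phase_cutoff \<epsilon> T R z = time_cutoff \<epsilon> T (fst (fst z)) * momentum_cutoff R (snd z)"

lemma time_cutoff_bounds: "0 \<le> time_cutoff \<epsilon> T t" "time_cutoff \<epsilon> T t \<le> 1"
  unfolding time_cutoff_def by (auto intro!: mult_nonneg_nonneg mult_le_one smooth_step_bounds)

lemma momentum_cutoff_bounds: "0 \<le> momentum_cutoff R p" "momentum_cutoff R p \<le> 1"
  unfolding momentum_cutoff_def by (auto intro!: prod_nonneg prod_le_1 mult_nonneg_nonneg mult_le_one smooth_step_bounds)

lemma phase_cutoff_bounds: "0 \<le> phase_cutoff \<epsilon> T R z" "phase_cutoff \<epsilon> T R z \<le> 1"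
  unfolding phase_cutoff_def by (auto intro!: mult_nonneg_nonneg mult_le_one time_cutoff_bounds momentum_cutoff_bounds)

lemma time_cutoff_nonzero:
  assumes "\<epsilon> > 0" "time_cutoff \<epsilon> T t \<noteq> 0" shows "\<epsilon> / 4 < t" "t < T - \<epsilon> / 4"
proof -
  have "4 / \<epsilon> * (t - \<epsilon> / 4) > 0" "4 / \<epsilon> * ((T - \<epsilon> / 4) - t) > 0"
  proof -
    have "smooth_step (4 / \<epsilon> * (t - \<epsilon> / 4)) \<noteq> 0" "smooth_step (4 / \<epsilon> * ((T - \<epsilon> / 4) - t)) \<noteq> 0"
      using assms(2) by (simp_all only: time_cutoff_def mult_eq_0_iff de_Morgan_disj not_False_eq_True)
    then show "4 / \<epsilon> * (t - \<epsilon> / 4) > 0" "4 / \<epsilon> * ((T - \<epsilon> / 4) - t) > 0"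
      using smooth_step_0[of "4 / \<epsilon> * (t - \<epsilon> / 4)"] smooth_step_0[of "4 / \<epsilon> * ((T - \<epsilon> / 4) - t)"] by linarith+
  qed
  then show "\<epsilon> / 4 < t" "t < T - \<epsilon> / 4"
    using assms(1) by (simp_all add: zero_less_mult_iff zero_less_divide_iff)
qed

lemma time_cutoff_eq_1:
  assumes "\<epsilon> > 0" "\<epsilon> / 2 \<le> t" "t \<le> T - \<epsilon> / 2" shows "time_cutoff \<epsilon> T t = 1"
proof -
  have "1 \<le> 4 / \<epsilon> * (t - \<epsilon> / 4)" "1 \<le> 4 / \<epsilon> * ((T - \<epsilon> / 4) - t)"
    using assms by (simp_all add: field_simps)
  then show ?thesis unfolding time_cutoff_def by (simp add: smooth_step_1)
qed

lemma momentum_cutoff_nonzero: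
  assumes "momentum_cutoff R p \<noteq> 0" "i \<in> Basis" shows "\<bar>p \<bullet> i\<bar> < R + 1"
proof -
  have pos: "0 < x" if "smooth_step x \<noteq> 0" for x
    using that smooth_step_0[of x] by (meson not_le)
  have "smooth_step (1 * (p \<bullet> i - (- R - 1))) * smooth_step (1 * ((R + 1) - p \<bullet> i)) \<noteq> 0"
    using assms(1) prod_zero[OF finite_Basis, of "\<lambda>i. smooth_step (1 * (p \<bullet> i - (- R - 1))) * smooth_step (1 * ((R + 1) - p \<bullet> i))"] assms(2)
    unfolding momentum_cutoff_def by blast
  then have "smooth_step (1 * (p \<bullet> i - (- R - 1))) \<noteq> 0" "smooth_step (1 * ((R + 1) - p \<bullet> i)) \<noteq> 0"
    by (simp_all only: mult_eq_0_iff de_Morgan_disj not_False_eq_True)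
  then show ?thesis
    using pos[of "1 * (p \<bullet> i - (- R - 1))"] pos[of "1 * ((R + 1) - p \<bullet> i)"] by (simp add: abs_less_iff)
qed

lemma momentum_cutoff_eq_1: "norm p \<le> R \<Longrightarrow> momentum_cutoff R p = 1"
  unfolding momentum_cutoff_def
proof (rule prod.neutral, intro ballI)
  fix i :: "real^3" assume p: "norm p \<le> R" and i: "i \<in> Basis"
  have "\<bar>p \<bullet> i\<bar> \<le> R" using Basis_le_norm[OF i, of p] p by linarith
  then have "1 \<le> 1 * (p \<bullet> i - (- R - 1))" "1 \<le> 1 * ((R + 1) - p \<bullet> i)" by (simp_all add: abs_le_iff)
  then show "smooth_step (1 * (p \<bullet> i - (- R - 1))) * smooth_step (1 * ((R + 1) - p \<bullet> i)) = 1"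
    by (simp only: smooth_step_1)
qed

text \<open>The three coordinates sum up to at most \<open>3 * (R + 1)\<close> in absolute value;
  one more unit makes the inequality strict.\<close>

lemma phase_cutoff_norm:
  assumes "phase_cutoff \<epsilon> T R z \<noteq> 0" shows "norm (snd z) < 3 * R + 4"
proof -
  have "momentum_cutoff R (snd z) \<noteq> 0" using assms by (simp add: phase_cutoff_def)
  then have "\<bar>snd z \<bullet> i\<bar> \<le> R + 1" if "i \<in> Basis" for i using momentum_cutoff_nonzero[OF _ that] by (simp add: less_imp_le)
  then have "(\<Sum>i\<in>Basis. \<bar>snd z \<bullet> i\<bar>) \<le> (\<Sum>i\<in>(Basis :: (real^3) set). R + 1)" by (intro sum_mono)
  then show ?thesis using norm_le_l1[of "snd z"] by simp
qed

lemma C_k_phase_cutoff: "C_k k (phase_cutoff \<epsilon> T R)"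
proof -
  have 1: "C_k k (\<lambda>z :: phase. time_cutoff \<epsilon> T (fst (fst z)))"
  proof -
    have "C_k k (time_cutoff \<epsilon> T)" unfolding time_cutoff_def[abs_def]
      by (rule C_k_mult[OF C_k_compose[OF C_k_smooth_step C_k_affine(1)] C_k_compose[OF C_k_smooth_step C_k_affine(2)]])
    then show ?thesis by (rule C_k_compose) (rule C_k_linear[OF bounded_linear_compose[OF bounded_linear_fst bounded_linear_fst]])
  qed
  have 2: "C_k k (momentum_cutoff R)" unfolding momentum_cutoff_def[abs_def]
  proof (rule C_k_prod)
    fix i :: "real^3"
    have "C_k k (\<lambda>x. smooth_step (1 * (x - (- R - 1))) * smooth_step (1 * ((R + 1) - x)))"
      by (rule C_k_mult[OF C_k_compose[OF C_k_smooth_step C_k_affine(1)] C_k_compose[OF C_k_smooth_step C_k_affine(2)]])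
    from C_k_compose[OF this C_k_linear[OF bounded_linear_inner_left[of i]]]
    show "C_k k (\<lambda>p. smooth_step (1 * (p \<bullet> i - (- R - 1))) * smooth_step (1 * ((R + 1) - p \<bullet> i)))" .
  qed simp
  show ?thesis unfolding phase_cutoff_def[abs_def]
    by (rule C_k_mult[OF 1 C_k_compose_linear[OF bounded_linear_snd 2]])
qed

text \<open>Since \<open>transported \<sigma>\<close> moves \<open>(t, x)\<close> by at most
  \<open>2 |\<sigma>|\<close>, preimages of boxes are bounded in \<open>(t, x)\<close>; the cutoff
  bounds the momentum and keeps the time away from the ends of the slab. The closed bounded set
  \<open>K\<close> collects these three conditions.\<close>

lemma test_function_transported_bump:
  assumes \<epsilon>: "0 < \<epsilon>" and T: "0 < T"
  shows "test_function (phase_domain T) (\<lambda>z. phase_cutoff \<epsilon> T R z * box_bump n a b (transported \<sigma> z))" (is "test_function _ ?\<phi>")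
proof -
  define K where "K = (\<lambda>z :: phase. fst (fst z)) -` {\<epsilon> / 4..T - \<epsilon> / 4} \<inter> (\<lambda>z. norm (snd z)) -` {..3 * R + 4} \<inter> transported \<sigma> -` cbox a b"
  have "continuous_on UNIV (transported \<sigma>)"
    by (rule continuous_on_transported[OF continuous_on_const continuous_on_id])
  then have "isCont (transported \<sigma>) x" for x by (simp only: continuous_on_eq_continuous_at[OF open_UNIV] UNIV_I ball_UNIV)
  then have cK: "closed K" unfolding K_def
    by (intro closed_Int continuous_closed_vimage closed_atLeastAtMost closed_atMost closed_cbox allI continuous_intros)
  have bK: "bounded K"
  proof -
    obtain B where B: "\<And>x. x \<in> cbox a b \<Longrightarrow> norm x \<le> B" using bounded_cbox[of a b] by (auto simp: bounded_iff)
    have "norm z \<le> B + \<bar>\<sigma>\<bar> * 2 + (3 * R + 4)" if "z \<in> K" for z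
    proof -
      have "norm (fst z + \<sigma> *\<^sub>R (1, velocity (snd z))) \<le> B" using that B unfolding K_def transported_def by blast
      moreover have "norm (\<sigma> *\<^sub>R (1::real, velocity (snd z))) \<le> \<bar>\<sigma>\<bar> * 2"
        unfolding norm_scaleR by (intro mult_left_mono norm_velocity_pair_le) auto
      ultimately have "norm (fst z) \<le> B + \<bar>\<sigma>\<bar> * 2"
        using norm_triangle_ineq4[of "fst z + \<sigma> *\<^sub>R (1, velocity (snd z))" "\<sigma> *\<^sub>R (1, velocity (snd z))"] by simp
      moreover have "norm (snd z) \<le> 3 * R + 4" using that by (simp add: K_def)
      moreover have "norm z \<le> norm (fst z) + norm (snd z)" using norm_Pair_le[of "fst z" "snd z"] by simp
      ultimately show ?thesis by linarith
    qed
    then show ?thesis unfolding bounded_iff by blast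
  qed
  have sub: "{z. ?\<phi> z \<noteq> 0} \<subseteq> K"
  proof
    fix z assume "z \<in> {z. ?\<phi> z \<noteq> 0}"
    then have nz: "phase_cutoff \<epsilon> T R z \<noteq> 0" "box_bump n a b (transported \<sigma> z) \<noteq> 0" by auto
    have "time_cutoff \<epsilon> T (fst (fst z)) \<noteq> 0" using nz(1) by (simp add: phase_cutoff_def)
    from time_cutoff_nonzero[OF \<epsilon> this] phase_cutoff_norm[OF nz(1)]
    have "fst (fst z) \<in> {\<epsilon> / 4..T - \<epsilon> / 4}" "norm (snd z) \<in> {..3 * R + 4}" by auto
    moreover have "transported \<sigma> z \<in> box a b" using box_bump_outside nz(2) by blast
    ultimately show "z \<in> K" unfolding K_def using box_subset_cbox by blast
  qed
  have cl: "closure {z. ?\<phi> z \<noteq> 0} \<subseteq> K" by (rule closure_minimal[OF sub cK])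
  have cl2: "bounded (closure {z. ?\<phi> z \<noteq> 0})" by (rule bounded_subset[OF bK cl])
  have "K \<subseteq> phase_domain T"
    using \<epsilon> by (auto simp: K_def phase_domain_def spacetime_domain_def)
  from order_trans[OF cl this] have "closure {z. ?\<phi> z \<noteq> 0} \<subseteq> phase_domain T" .
  moreover have "compact (closure {z. ?\<phi> z \<noteq> 0})"
    unfolding compact_eq_bounded_closed using cl2 closed_closure by (rule conjI)
  moreover have "C_k k ?\<phi>" for k by (rule C_k_mult[OF C_k_phase_cutoff C_k_box_bump_transported])
  ultimately show ?thesis unfolding test_function_def by (intro conjI allI)
qed

section \<open>Derivatives along rays and Duhamel's formula\<close>

lemma transport_eq_directional:
  assumes "\<phi> differentiable (at z)"
  shows "transport \<phi> z = frechet_derivative \<phi> (at z) ((1, velocity (snd z)), 0)"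
proof -
  obtain y p where z: "z = (y, p)" by (cases z)
  define D where "D = frechet_derivative \<phi> (at (y, p))"
  have l: "linear D" unfolding D_def using assms by (intro linear_frechet_derivative) (simp add: z)
  have "(((1, velocity p), 0) :: phase) = ((1, 0), 0) + (\<Sum>i\<in>UNIV. (p $ i / energy p) *\<^sub>R ((0, axis i 1), 0))"
  proof -
    have "(\<Sum>i\<in>UNIV. (p $ i / energy p) *\<^sub>R axis i (1::real)) = velocity p"
      by (simp add: vec_eq_iff velocity_def sum_component axis_def if_distrib cong: if_cong)
    moreover have "(\<Sum>i\<in>UNIV. (p $ i / energy p) *\<^sub>R (((0, axis i 1), 0) :: phase)) = ((0, \<Sum>i\<in>UNIV. (p $ i / energy p) *\<^sub>R axis i (1::real)), 0)"
      by (simp add: prod_eq_iff fst_sum snd_sum)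
    ultimately show ?thesis by simp
  qed
  then have "D ((1, velocity p), 0) = D ((1, 0), 0) + (\<Sum>i\<in>UNIV. D ((p $ i / energy p) *\<^sub>R ((0, axis i 1), 0)))"
    by (simp only: linear_add[OF l] linear_sum[OF l])
  then have "D ((1, velocity p), 0) = D ((1, 0), 0) + (\<Sum>i\<in>UNIV. p $ i / energy p * D ((0, axis i 1), 0))"
    by (simp only: linear_scale[OF l] real_scaleR_def)
  then show ?thesis by (simp add: transport_def z D_def)
qed

lemma DERIV_along_line:
  fixes \<psi> :: "'a::euclidean_space \<Rightarrow> real"
  assumes "C_k 1 \<psi>"
  shows "((\<lambda>\<sigma>. \<psi> (y + \<sigma> *\<^sub>R w)) has_real_derivative frechet_derivative \<psi> (at (y + \<sigma> *\<^sub>R w)) w) (at \<sigma>)"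
proof -
  have d: "(\<psi> has_derivative frechet_derivative \<psi> (at x)) (at x)" for x
    using C_k_SucD(1)[of 0 \<psi>] assms by simp
  have l: "((\<lambda>\<sigma>. y + \<sigma> *\<^sub>R w) has_derivative (\<lambda>h. 0 + h *\<^sub>R w)) (at \<sigma>)"
    by (intro has_derivative_add has_derivative_const bounded_linear_imp_has_derivative bounded_linear_scaleR_left)
  have "((\<lambda>\<sigma>. \<psi> (y + \<sigma> *\<^sub>R w)) has_derivative (\<lambda>h. frechet_derivative \<psi> (at (y + \<sigma> *\<^sub>R w)) (0 + h *\<^sub>R w))) (at \<sigma>)"
    by (rule has_derivative_compose[OF l d])
  moreover have "frechet_derivative \<psi> (at (y + \<sigma> *\<^sub>R w)) (0 + h *\<^sub>R w) = frechet_derivative \<psi> (at (y + \<sigma> *\<^sub>R w)) w * h" for h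
    using linear_scale[OF has_derivative_linear[OF d], of _ h w] by simp
  ultimately show ?thesis unfolding has_field_derivative_def by simp
qed

text \<open>The transport operator differentiates along the ray through \<open>z\<close>. On it the
  momentum is constant, and as long as the time moves by less than \<open>\<epsilon> / 2\<close> the
  cutoff is identically 1. Hence the cutoff produces no extra term on the support of
  \<open>u\<close>.\<close>

lemma transport_transported_bump:
  assumes \<epsilon>: "\<epsilon> > 0" and z: "\<epsilon> \<le> fst (fst z)" "fst (fst z) \<le> T - \<epsilon>" "norm (snd z) < R"
  shows "transport (\<lambda>z. phase_cutoff \<epsilon> T R z * box_bump n a b (transported \<sigma> z)) z
    = frechet_derivative (box_bump n a b) (at (transported \<sigma> z)) (1, velocity (snd z))"
proof -
  define \<phi> where "\<phi> = (\<lambda>z. phase_cutoff \<epsilon> T R z * box_bump n a b (transported \<sigma> z))"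
  define w where "w = (1::real, velocity (snd z))"
  have C1: "C_k 1 \<phi>" unfolding \<phi>_def by (rule C_k_mult[OF C_k_phase_cutoff C_k_box_bump_transported])
  then have diff: "\<phi> differentiable (at x)" for x unfolding One_nat_def C_k.simps by blast
  have "((\<lambda>s. \<phi> (z + s *\<^sub>R (w, 0))) has_real_derivative frechet_derivative \<phi> (at (z + 0 *\<^sub>R (w, 0))) (w, 0)) (at 0)"
    by (rule DERIV_along_line[OF C1])
  then have 1: "((\<lambda>s. \<phi> (z + s *\<^sub>R (w, 0))) has_real_derivative transport \<phi> z) (at 0)"
    unfolding transport_eq_directional[OF diff] w_def by (simp only: scaleR_zero_left add_0_right)
  have "C_k 1 (box_bump n a b :: spacetime \<Rightarrow> real)" by (rule C_k_box_bump)
  from DERIV_along_line[OF this, of "transported \<sigma> z" w 0]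
  have 2: "((\<lambda>s. box_bump n a b (transported \<sigma> z + s *\<^sub>R w)) has_real_derivative frechet_derivative (box_bump n a b) (at (transported \<sigma> z)) w) (at 0)"
    by simp
  have eq: "box_bump n a b (transported \<sigma> z + s *\<^sub>R w) = \<phi> (z + s *\<^sub>R (w, 0))" if "s \<in> {- \<epsilon> / 2<..<\<epsilon> / 2}" for s
  proof -
    have sn: "snd (z + s *\<^sub>R (w, 0)) = snd z" by simp
    have t: "fst (fst (z + s *\<^sub>R (w, 0))) = fst (fst z) + s" by (simp add: w_def)
    have "time_cutoff \<epsilon> T (fst (fst z) + s) = 1" using that z by (intro time_cutoff_eq_1 \<epsilon>) auto
    moreover have "momentum_cutoff R (snd z) = 1" using z by (intro momentum_cutoff_eq_1) simp
    moreover have "transported \<sigma> (z + s *\<^sub>R (w, 0)) = transported \<sigma> z + s *\<^sub>R w"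
      unfolding transported_def sn by (simp add: w_def algebra_simps)
    ultimately show ?thesis unfolding \<phi>_def phase_cutoff_def sn t by simp
  qed
  have "((\<lambda>s. \<phi> (z + s *\<^sub>R (w, 0))) has_real_derivative frechet_derivative (box_bump n a b) (at (transported \<sigma> z)) w) (at 0)"
    by (rule has_field_derivative_transform_within_open[OF 2, of "{- \<epsilon> / 2<..<\<epsilon> / 2}"]) (use \<epsilon> eq in auto)
  with 1 show ?thesis unfolding \<phi>_def w_def by (rule DERIV_unique)
qed

text \<open>Integration by parts against \<open>1 - \<sigma> / \<delta>\<close>: the boundary term
  vanishes at \<open>\<sigma> = \<delta>\<close>, the one at 0 contributes
  \<open>- \<psi> y\<close>, and the slope \<open>- 1 / \<delta>\<close> of the weight produces the
  uniform average. Both kernels originate here.\<close>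

lemma linear_kernel_integral:
  fixes \<psi> :: "'a::euclidean_space \<Rightarrow> real"
  assumes \<psi>: "C_k 1 \<psi>" and \<delta>: "\<delta> > 0"
  shows "(LINT \<sigma>|lborel. linear_kernel \<delta> \<sigma> * frechet_derivative \<psi> (at (y + \<sigma> *\<^sub>R w)) w) = ray_integral (uniform_kernel \<delta>) \<psi> y w / \<delta> - \<psi> y"
proof -
  define g where "g = (\<lambda>\<sigma>. \<psi> (y + \<sigma> *\<^sub>R w))"
  define g' where "g' = (\<lambda>\<sigma>. frechet_derivative \<psi> (at (y + \<sigma> *\<^sub>R w)) w)"
  have d: "(g has_real_derivative g' \<sigma>) (at \<sigma>)" for \<sigma> unfolding g_def g'_def by (rule DERIV_along_line[OF \<psi>])
  have line: "continuous_on UNIV (\<lambda>\<sigma>. y + \<sigma> *\<^sub>R w)" by (intro continuous_intros)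
  have cg: "continuous_on UNIV g" unfolding g_def
    by (rule continuous_on_compose2[OF C_k_continuous[OF \<psi>] line]) simp
  have diff: "\<psi> differentiable (at x)" for x using \<psi> by simp
  \<comment> \<open>\<open>C_k\<close> controls derivatives in basis directions only, so the
    direction \<open>w\<close> is expanded in the basis.\<close>
  have "continuous_on UNIV (\<lambda>x. frechet_derivative \<psi> (at x) i)" if "i \<in> Basis" for i
    using \<psi> that by simp
  then have "continuous_on UNIV (\<lambda>\<sigma>. frechet_derivative \<psi> (at (y + \<sigma> *\<^sub>R w)) i)" if "i \<in> Basis" for i
    using that by (intro continuous_on_compose2[OF _ line]) auto
  then have cg': "continuous_on UNIV g'" unfolding g'_def frechet_derivative_sum_Basis[OF diff, of _ w]
    by (intro continuous_intros) auto
  have ftc: "(LINT \<sigma>|lborel. ((1 - \<sigma> / \<delta>) * g' \<sigma> - g \<sigma> / \<delta>) * indicator {0..\<delta>} \<sigma>) = (1 - \<delta> / \<delta>) * g \<delta> - (1 - 0 / \<delta>) * g 0"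
  proof (rule integral_FTC_Icc_real)
    show "DERIV (\<lambda>\<sigma>. (1 - \<sigma> / \<delta>) * g \<sigma>) x :> (1 - x / \<delta>) * g' x - g x / \<delta>" for x
      using \<delta> by (auto intro!: derivative_eq_intros d)
    show "isCont (\<lambda>\<sigma>. (1 - \<sigma> / \<delta>) * g' \<sigma> - g \<sigma> / \<delta>) x" for x
      using cg cg' \<delta> by (auto intro!: continuous_intros simp: continuous_on_eq_continuous_at)
  qed (use \<delta> in simp)
  have bi: "integrable lborel (\<lambda>\<sigma>. indicator {0..\<delta>} \<sigma> * f \<sigma>)" if "continuous_on UNIV f" for f :: "real \<Rightarrow> real"
    using borel_integrable_atLeastAtMost'[of 0 \<delta> f] continuous_on_subset[OF that] by (simp add: set_integrable_def)
  have i1: "integrable lborel (\<lambda>\<sigma>. indicator {0..\<delta>} \<sigma> * ((1 - \<sigma> / \<delta>) * g' \<sigma>))"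
    using \<delta> by (intro bi continuous_intros cg') auto
  have i2: "integrable lborel (\<lambda>\<sigma>. indicator {0..\<delta>} \<sigma> * g \<sigma>)" by (rule bi[OF cg])
  have e: "((1 - \<sigma> / \<delta>) * g' \<sigma> - g \<sigma> / \<delta>) * indicator {0..\<delta>} \<sigma> = linear_kernel \<delta> \<sigma> * g' \<sigma> - (indicator {0..\<delta>} \<sigma> * g \<sigma>) / \<delta>" for \<sigma>
    by (simp add: linear_kernel_def algebra_simps)
  have "(LINT \<sigma>|lborel. linear_kernel \<delta> \<sigma> * g' \<sigma>) - (LINT \<sigma>|lborel. indicator {0..\<delta>} \<sigma> * g \<sigma>) / \<delta> = - g 0"
    using ftc \<delta> i1 i2 unfolding e by (simp add: linear_kernel_def mult.assoc)
  then show ?thesis by (simp add: g_def g'_def ray_integral_def uniform_kernel_def)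
qed

lemma bounded_supp_box_bump: "bounded_supp (box_bump n a b)"
proof -
  obtain B where B: "\<And>x. x \<in> box a b \<Longrightarrow> norm x \<le> B" using bounded_box[of a b] by (auto simp: bounded_iff)
  show ?thesis
  proof (rule bounded_suppI[where N=1 and r=B])
    show "box_bump n a b \<in> borel_measurable borel"
      by (rule borel_measurable_continuous_onI[OF C_k_continuous[OF C_k_box_bump[of 0]]])
    show "\<bar>box_bump n a b y\<bar> \<le> 1" for y using box_bump_bounds[of n a b y] by simp
    show "norm y \<le> B" if "box_bump n a b y \<noteq> 0" for y using that box_bump_outside B by blast
  qed
qed

lemma directional_derivative_box_bump_bound:
  "\<exists>C\<ge>0. \<forall>x w. \<bar>frechet_derivative (box_bump n a b) (at x) w\<bar> \<le> C * norm w \<and>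
     (x \<notin> cbox a b \<longrightarrow> frechet_derivative (box_bump n a b) (at x) w = 0)"
proof -
  let ?D = "\<lambda>x. frechet_derivative (box_bump n a b) (at x)"
  have C1: "C_k 1 (box_bump n a b)" by (rule C_k_box_bump)
  then have diff: "box_bump n a b differentiable (at x)" for x unfolding One_nat_def C_k.simps by blast
  have out: "?D x w = 0" if "x \<notin> cbox a b" for x w
  proof -
    have "((\<lambda>x. 0) has_derivative (\<lambda>h. 0)) (at x)" by (rule has_derivative_const)
    then have "(box_bump n a b has_derivative (\<lambda>h. 0)) (at x)"
    proof (rule has_derivative_transform_within_open[where s="- cbox a b"])
      show "open (- cbox a b)" by (intro open_Compl closed_cbox)
      show "x \<in> - cbox a b" using that by simp
      fix y assume "y \<in> - cbox a b"
      then show "0 = box_bump n a b y" using box_bump_outside box_subset_cbox by (metis ComplD subsetD)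
    qed
    from frechet_derivative_at[OF this] show ?thesis by (metis (no_types))
  qed
  have "\<exists>B. \<forall>x. \<bar>?D x i\<bar> \<le> B" if i: "i \<in> Basis" for i
  proof -
    have "continuous_on UNIV (\<lambda>x. ?D x i)" using C1 i unfolding One_nat_def C_k.simps by blast
    then have "continuous_on (cbox a b) (\<lambda>x. ?D x i)" by (rule continuous_on_subset) simp
    then have "compact ((\<lambda>x. ?D x i) ` cbox a b)" by (rule compact_continuous_image) (rule compact_cbox)
    then obtain B where B: "\<forall>y\<in>(\<lambda>x. ?D x i) ` cbox a b. norm y \<le> B" using compact_imp_bounded bounded_iff by metis
    have "\<bar>?D x i\<bar> \<le> \<bar>B\<bar>" for x
    proof (cases "x \<in> cbox a b")
      case True then show ?thesis using B by force
    next
      case False then show ?thesis using out[OF False, of i] by simp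
    qed
    then show ?thesis by blast
  qed
  then obtain B where B: "\<And>i x. i \<in> Basis \<Longrightarrow> \<bar>?D x i\<bar> \<le> B i" by metis
  define C where "C = (\<Sum>i\<in>Basis. \<bar>B i\<bar>)"
  have "\<bar>?D x w\<bar> \<le> C * norm w" for x w
  proof -
    have "\<bar>?D x w\<bar> \<le> (\<Sum>i\<in>Basis. \<bar>(w \<bullet> i) * ?D x i\<bar>)"
      unfolding frechet_derivative_sum_Basis[OF diff, of x w] by (rule sum_abs)
    also have "\<dots> \<le> (\<Sum>i\<in>Basis. norm w * \<bar>B i\<bar>)"
    proof (rule sum_mono)
      fix i :: 'a assume i: "i \<in> Basis"
      show "\<bar>(w \<bullet> i) * ?D x i\<bar> \<le> norm w * \<bar>B i\<bar>"
        unfolding abs_mult using B[OF i, of x] by (intro mult_mono Basis_le_norm[OF i]) auto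
    qed
    also have "\<dots> = C * norm w" by (simp add: C_def sum_distrib_left[symmetric] mult.commute)
    finally show ?thesis .
  qed
  moreover have "C \<ge> 0" by (simp add: C_def sum_nonneg)
  ultimately show ?thesis using out by blast
qed

lemma transported_norm_le: "\<bar>\<sigma>\<bar> \<le> \<delta> \<Longrightarrow> norm (fst z) \<le> norm (transported \<sigma> z) + 2 * \<delta>"
proof -
  assume s: "\<bar>\<sigma>\<bar> \<le> \<delta>"
  have "norm (\<sigma> *\<^sub>R (1::real, velocity (snd z))) \<le> \<delta> * 2"
    unfolding norm_scaleR using s by (intro mult_mono norm_velocity_pair_le) auto
  then show ?thesis unfolding transported_def
    using norm_triangle_ineq4[of "fst z + \<sigma> *\<^sub>R (1, velocity (snd z))" "\<sigma> *\<^sub>R (1, velocity (snd z))"] by simp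
qed

text \<open>The equation is tested with the cut-off bump transported by \<open>\<sigma>\<close>,
  multiplied by \<open>linear_kernel \<delta> \<sigma>\<close> and integrated over
  \<open>\<sigma>\<close>. On the support of \<open>U\<close> the transport derivative is a
  directional derivative of the bump, whose weighted integral is
  \<open>linear_kernel_integral\<close>; the source side becomes a ray integral.\<close>

lemma weak_identity_bump:
  assumes \<epsilon>: "0 < \<epsilon>" and T: "0 < T" and \<delta>: "\<delta> > 0"
    and U: "slab_integrable \<rho> U" and Us: "\<And>z. U z \<noteq> 0 \<Longrightarrow> \<epsilon> \<le> fst (fst z) \<and> fst (fst z) \<le> T - \<epsilon> \<and> norm (snd z) < R"
    and F: "slab_integrable \<rho>' (\<lambda>z. F z * phase_cutoff \<epsilon> T R z)"
    and eqn: "\<And>\<phi>. test_function (phase_domain T) \<phi> \<Longrightarrow> - (LINT z|lborel. U z * transport \<phi> z) = (LINT z|lborel. F z * \<phi> z)"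
  shows "(LINT z|lborel. U z * box_bump n a b (fst z))
    = (LINT z|lborel. U z * ray_integral (uniform_kernel \<delta>) (box_bump n a b) (fst z) (1, velocity (snd z))) / \<delta>
      + (LINT z|lborel. (F z * phase_cutoff \<epsilon> T R z) * ray_integral (linear_kernel \<delta>) (box_bump n a b) (fst z) (1, velocity (snd z)))"
proof -
  define \<psi> where "\<psi> = (box_bump n a b :: spacetime \<Rightarrow> real)"
  define b' where "b' = linear_kernel \<delta>"
  define G where "G = (\<lambda>z. F z * phase_cutoff \<epsilon> T R z)"
  define P where "P = (\<lambda>\<sigma> z. frechet_derivative \<psi> (at (transported \<sigma> z)) (1, velocity (snd z)))"
  have C1: "C_k 1 \<psi>" unfolding \<psi>_def by (rule C_k_box_bump)
  have diff: "\<psi> differentiable (at x)" for x using C1 unfolding One_nat_def C_k.simps by blast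
  have b\<psi>: "bounded_supp \<psi>" unfolding \<psi>_def by (rule bounded_supp_box_bump)
  have bm: "b' \<in> borel_measurable borel" and b01: "0 \<le> b' \<sigma>" "b' \<sigma> \<le> 1" "\<sigma> \<notin> {0..\<delta>} \<Longrightarrow> b' \<sigma> = 0" for \<sigma>
    using admissible_linear_kernel[OF \<delta>] unfolding admissible_def b'_def by blast+
  have bs: "b' (fst x) \<noteq> 0 \<Longrightarrow> \<bar>fst x\<bar> \<le> \<delta>" for x :: "real \<times> phase" using b01(3)[of "fst x"] by force
  have fstm: "(\<lambda>x :: real \<times> phase. b' (fst x)) \<in> borel_measurable borel"
    by (rule measurable_compose[OF _ bm]) (intro borel_measurable_continuous_onI continuous_intros)
  have tc: "continuous_on UNIV (\<lambda>x :: real \<times> phase. transported (fst x) (snd x))"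
    by (intro continuous_on_transported continuous_intros)
  obtain C where C: "C \<ge> 0" "\<And>x w. \<bar>frechet_derivative \<psi> (at x) w\<bar> \<le> C * norm w"
      "\<And>x w. x \<notin> cbox a b \<Longrightarrow> frechet_derivative \<psi> (at x) w = 0"
    using directional_derivative_box_bump_bound[of n a b] unfolding \<psi>_def by blast
  obtain r where r: "\<And>x. x \<in> cbox a b \<Longrightarrow> norm x \<le> r" using bounded_cbox[of a b] by (auto simp: bounded_iff)
  have P_le: "\<bar>P \<sigma> z\<bar> \<le> 2 * C" for \<sigma> z
    using C(2)[of "transported \<sigma> z" "(1, velocity (snd z))"] mult_left_mono[OF norm_velocity_pair_le[of "snd z"] C(1)] unfolding P_def by linarith
  have P_supp: "norm (fst z) \<le> r + 2 * \<delta>" if "P \<sigma> z \<noteq> 0" "\<bar>\<sigma>\<bar> \<le> \<delta>" for \<sigma> z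
  proof -
    have "transported \<sigma> z \<in> cbox a b" using C(3) that(1) unfolding P_def by blast
    then show ?thesis using r[of "transported \<sigma> z"] transported_norm_le[OF that(2), of z] by linarith
  qed
  have Pm: "(\<lambda>x :: real \<times> phase. P (fst x) (snd x)) \<in> borel_measurable borel"
  proof (rule borel_measurable_continuous_onI)
    have "continuous_on UNIV (\<lambda>x. frechet_derivative \<psi> (at x) i)" if "i \<in> Basis" for i
      using C1 that unfolding One_nat_def C_k.simps by blast
    then have 1: "continuous_on UNIV (\<lambda>x :: real \<times> phase. frechet_derivative \<psi> (at (transported (fst x) (snd x))) i)" if "i \<in> Basis" for i
      by (rule continuous_on_compose2[OF _ tc]) (use that in auto)
    have 2: "continuous_on UNIV (\<lambda>x :: real \<times> phase. velocity (snd (snd x)))"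
      by (rule continuous_on_compose2[OF continuous_on_velocity[of UNIV] continuous_on_snd[OF continuous_on_snd[OF continuous_on_id]]]) simp
    show "continuous_on UNIV (\<lambda>x :: real \<times> phase. P (fst x) (snd x))"
      unfolding P_def frechet_derivative_sum_Basis[OF diff, of _ "(1, velocity (snd (snd _)))"]
      by (intro continuous_on_sum continuous_on_mult continuous_on_inner continuous_on_Pair continuous_on_const 1 2)
  qed
  have \<psi>01: "\<bar>\<psi> x\<bar> \<le> 1" for x unfolding \<psi>_def using box_bump_bounds[of n a b x] by simp
  have \<psi>tm: "(\<lambda>x :: real \<times> phase. \<psi> (transported (fst x) (snd x))) \<in> borel_measurable borel"
    by (rule borel_measurable_continuous_onI[OF continuous_on_compose2[OF C_k_continuous[OF C1] tc]]) simp
  have step: "b' \<sigma> * (- (LINT z|lborel. U z * P \<sigma> z)) = b' \<sigma> * (LINT z|lborel. G z * \<psi> (transported \<sigma> z))" for \<sigma>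
  proof -
    let ?\<phi> = "\<lambda>z. phase_cutoff \<epsilon> T R z * box_bump n a b (transported \<sigma> z)"
    \<comment> \<open>Where \<open>U\<close> vanishes the value of the transport derivative does not
      matter; elsewhere the cutoff is 1 along a piece of the ray.\<close>
    have "U z * transport ?\<phi> z = U z * P \<sigma> z" for z
      using Us[of z] transport_transported_bump[OF \<epsilon>, of z T R n a b \<sigma>] unfolding P_def \<psi>_def by (cases "U z = 0") auto
    then have "- (LINT z|lborel. U z * P \<sigma> z) = (LINT z|lborel. F z * ?\<phi> z)"
      using eqn[OF test_function_transported_bump[OF \<epsilon> T, of R n a b \<sigma>]] by (simp only:)
    also have "\<dots> = (LINT z|lborel. G z * \<psi> (transported \<sigma> z))"
      unfolding G_def \<psi>_def by (simp only: mult.assoc)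
    finally show ?thesis by (simp only:)
  qed
  have fubU: "(LINT \<sigma>|lborel. LINT z|lborel. U z * (b' (fst (\<sigma>, z)) * P (fst (\<sigma>, z)) (snd (\<sigma>, z)))) = (LINT z|lborel. U z * (LINT \<sigma>|lborel. b' (fst (\<sigma>, z)) * P (fst (\<sigma>, z)) (snd (\<sigma>, z))))"
  proof (rule slab_integrable_Fubini[OF U borel_measurable_times[OF fstm Pm], where C="2 * C" and s=\<delta> and r="r + 2 * \<delta>"])
    fix \<sigma> and z :: phase
    show "\<bar>b' (fst (\<sigma>, z)) * P (fst (\<sigma>, z)) (snd (\<sigma>, z))\<bar> \<le> 2 * C"
      unfolding abs_mult fst_conv snd_conv using mult_mono[OF _ P_le[of \<sigma> z], of "\<bar>b' \<sigma>\<bar>" 1] b01[of \<sigma>] C(1) by simp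
    assume "b' (fst (\<sigma>, z)) * P (fst (\<sigma>, z)) (snd (\<sigma>, z)) \<noteq> 0"
    then show "\<bar>\<sigma>\<bar> \<le> \<delta> \<and> norm (fst z) \<le> r + 2 * \<delta>" using bs[of "(\<sigma>, z)"] P_supp[of \<sigma> z] by simp
  qed
  have fubG: "(LINT \<sigma>|lborel. LINT z|lborel. G z * (b' (fst (\<sigma>, z)) * \<psi> (transported (fst (\<sigma>, z)) (snd (\<sigma>, z))))) = (LINT z|lborel. G z * (LINT \<sigma>|lborel. b' (fst (\<sigma>, z)) * \<psi> (transported (fst (\<sigma>, z)) (snd (\<sigma>, z)))))"
  proof (rule slab_integrable_Fubini[OF F[folded G_def] borel_measurable_times[OF fstm \<psi>tm], where C="1" and s=\<delta> and r="r + 2 * \<delta>"])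
    fix \<sigma> and z :: phase
    show "\<bar>b' (fst (\<sigma>, z)) * \<psi> (transported (fst (\<sigma>, z)) (snd (\<sigma>, z)))\<bar> \<le> 1"
      unfolding abs_mult fst_conv snd_conv using \<psi>01[of "transported \<sigma> z"] b01[of \<sigma>] by (intro mult_le_one) auto
    assume "b' (fst (\<sigma>, z)) * \<psi> (transported (fst (\<sigma>, z)) (snd (\<sigma>, z))) \<noteq> 0"
    then have 1: "b' (fst (\<sigma>, z)) \<noteq> 0" "\<psi> (transported \<sigma> z) \<noteq> 0" by auto
    have s: "\<bar>\<sigma>\<bar> \<le> \<delta>" using bs[OF 1(1)] by simp
    have "transported \<sigma> z \<in> cbox a b" using 1(2) box_bump_outside box_subset_cbox unfolding \<psi>_def by blast
    then show "\<bar>\<sigma>\<bar> \<le> \<delta> \<and> norm (fst z) \<le> r + 2 * \<delta>" using s r[of "transported \<sigma> z"] transported_norm_le[OF s, of z] by linarith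
  qed
  have L: "(LINT \<sigma>|lborel. b' \<sigma> * P \<sigma> z) = ray_integral (uniform_kernel \<delta>) \<psi> (fst z) (1, velocity (snd z)) / \<delta> - \<psi> (fst z)" for z
    unfolding b'_def P_def transported_def by (rule linear_kernel_integral[OF C1 \<delta>])
  have "(LINT z|lborel. U z * \<psi> (fst z)) - (LINT z|lborel. U z * ray_integral (uniform_kernel \<delta>) \<psi> (fst z) (1, velocity (snd z))) / \<delta>
     = - (LINT z|lborel. U z * (LINT \<sigma>|lborel. b' \<sigma> * P \<sigma> z))"
  proof -
    have i1: "integrable lborel (\<lambda>z. U z * \<psi> (fst z))" by (rule local_op_integrable[OF local_op_eval U b\<psi>])
    have i2: "integrable lborel (\<lambda>z. U z * ray_integral (uniform_kernel \<delta>) \<psi> (fst z) (1, velocity (snd z)))"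
      by (rule local_op_integrable[OF local_op_ray[OF admissible_uniform_kernel[OF \<delta>] \<delta>] U b\<psi>])
    have "(LINT z|lborel. U z * (LINT \<sigma>|lborel. b' \<sigma> * P \<sigma> z))
      = (LINT z|lborel. (U z * ray_integral (uniform_kernel \<delta>) \<psi> (fst z) (1, velocity (snd z))) / \<delta> - U z * \<psi> (fst z))"
      unfolding L by (simp add: algebra_simps)
    also have "\<dots> = (LINT z|lborel. U z * ray_integral (uniform_kernel \<delta>) \<psi> (fst z) (1, velocity (snd z))) / \<delta> - (LINT z|lborel. U z * \<psi> (fst z))"
      using i1 i2 by (subst Bochner_Integration.integral_diff) auto
    finally show ?thesis by simp
  qed
  also have "\<dots> = - (LINT \<sigma>|lborel. LINT z|lborel. U z * (b' \<sigma> * P \<sigma> z))"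
    using fubU unfolding fst_conv snd_conv by (simp only:)
  also have "\<dots> = (LINT \<sigma>|lborel. b' \<sigma> * (- (LINT z|lborel. U z * P \<sigma> z)))"
  proof -
    have "(LINT z|lborel. U z * (b' \<sigma> * P \<sigma> z)) = b' \<sigma> * (LINT z|lborel. U z * P \<sigma> z)" for \<sigma>
      unfolding mult.left_commute[of "U _" "b' \<sigma>"] by (rule integral_mult_right_zero)
    then show ?thesis by (simp only: mult_minus_right Bochner_Integration.integral_minus)
  qed
  also have "\<dots> = (LINT \<sigma>|lborel. b' \<sigma> * (LINT z|lborel. G z * \<psi> (transported \<sigma> z)))"
    by (simp only: step)
  also have "\<dots> = (LINT \<sigma>|lborel. LINT z|lborel. G z * (b' \<sigma> * \<psi> (transported \<sigma> z)))"
  proof -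
    have "(LINT z|lborel. G z * (b' \<sigma> * \<psi> (transported \<sigma> z))) = b' \<sigma> * (LINT z|lborel. G z * \<psi> (transported \<sigma> z))" for \<sigma>
      unfolding mult.left_commute[of "G _" "b' \<sigma>"] by (rule integral_mult_right_zero)
    then show ?thesis by (simp only:)
  qed
  also have "\<dots> = (LINT z|lborel. G z * (LINT \<sigma>|lborel. b' \<sigma> * \<psi> (transported \<sigma> z)))"
    using fubG unfolding fst_conv snd_conv by (simp only:)
  also have "\<dots> = (LINT z|lborel. G z * ray_integral b' \<psi> (fst z) (1, velocity (snd z)))"
    by (simp only: ray_integral_def transported_def)
  finally show ?thesis unfolding G_def \<psi>_def b'_def by linarith
qed

text \<open>Smooth functions do not suffice as \<open>\<psi>\<close>, since the duality argument
  inserts increments of a bounded Borel function. Both sides are continuous under bounded pointwise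
  convergence with a common bounded support; bumps converge to indicators of boxes, and boxes
  determine the functional.\<close>

lemma weak_identity:
  assumes \<epsilon>: "0 < \<epsilon>" and T: "0 < T" and \<delta>: "\<delta> > 0"
    and U: "slab_integrable \<rho> U" and Us: "\<And>z. U z \<noteq> 0 \<Longrightarrow> \<epsilon> \<le> fst (fst z) \<and> fst (fst z) \<le> T - \<epsilon> \<and> norm (snd z) < R"
    and F: "slab_integrable \<rho>' (\<lambda>z. F z * phase_cutoff \<epsilon> T R z)"
    and eqn: "\<And>\<phi>. test_function (phase_domain T) \<phi> \<Longrightarrow> - (LINT z|lborel. U z * transport \<phi> z) = (LINT z|lborel. F z * \<phi> z)"
    and \<psi>: "bounded_supp \<psi>"
  shows "(LINT z|lborel. U z * \<psi> (fst z))
    = (LINT z|lborel. U z * ray_integral (uniform_kernel \<delta>) \<psi> (fst z) (1, velocity (snd z))) / \<delta>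
      + (LINT z|lborel. (F z * phase_cutoff \<epsilon> T R z) * ray_integral (linear_kernel \<delta>) \<psi> (fst z) (1, velocity (snd z)))"
proof -
  define J1 where "J1 = (\<lambda>\<psi> :: spacetime \<Rightarrow> real. LINT z|lborel. U z * \<psi> (fst z))"
  define J2 where "J2 = (\<lambda>\<psi> :: spacetime \<Rightarrow> real. LINT z|lborel. U z * ray_integral (uniform_kernel \<delta>) \<psi> (fst z) (1, velocity (snd z)))"
  define J3 where "J3 = (\<lambda>\<psi> :: spacetime \<Rightarrow> real. LINT z|lborel. (F z * phase_cutoff \<epsilon> T R z) * ray_integral (linear_kernel \<delta>) \<psi> (fst z) (1, velocity (snd z)))"
  note p1 = local_op_pairing(1,2)[OF local_op_eval U]
  note p2 = local_op_pairing(1,2)[OF local_op_ray[OF admissible_uniform_kernel[OF \<delta>] \<delta>] U]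
  note p3 = local_op_pairing(1,2)[OF local_op_ray[OF admissible_linear_kernel[OF \<delta>] \<delta>] F]
  define J where "J = (\<lambda>\<psi>. J1 \<psi> - J2 \<psi> / \<delta> - J3 \<psi>)"
  have lim: "(\<lambda>n. J (H n)) \<longlonglongrightarrow> J f" if "\<And>n. H n \<in> borel_measurable borel" "f \<in> borel_measurable borel"
      "\<And>n x. \<bar>H n x\<bar> \<le> N" "\<And>n x. r < norm x \<Longrightarrow> H n x = 0" "\<And>x. (\<lambda>n. H n x) \<longlonglongrightarrow> f x" for H f N r
  proof -
    have "(\<lambda>n. J1 (H n)) \<longlonglongrightarrow> J1 f" unfolding J1_def by (rule local_op_pairing(3)[OF local_op_eval U]) (fact that)+
    moreover have "(\<lambda>n. J2 (H n)) \<longlonglongrightarrow> J2 f" unfolding J2_def by (rule local_op_pairing(3)[OF local_op_ray[OF admissible_uniform_kernel[OF \<delta>] \<delta>] U]) (fact that)+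
    moreover have "(\<lambda>n. J3 (H n)) \<longlonglongrightarrow> J3 f" unfolding J3_def by (rule local_op_pairing(3)[OF local_op_ray[OF admissible_linear_kernel[OF \<delta>] \<delta>] F]) (fact that)+
    ultimately show ?thesis unfolding J_def using \<delta> by (intro tendsto_intros) auto
  qed
  have bump: "J (box_bump n a b) = 0" for n a b
    using weak_identity_bump[OF \<epsilon> T \<delta> U Us F eqn, of n a b] unfolding J_def J1_def J2_def J3_def by simp
  have "J \<psi> = 0"
  proof (rule functional_zero_on_bounded_supp[where J=J and f=\<psi>])
    fix f g :: "spacetime \<Rightarrow> real" assume fg: "bounded_supp f" "bounded_supp g"
    have "J1 (\<lambda>x. f x + g x) = J1 f + J1 g" unfolding J1_def by (rule p1(1)[OF fg])
    moreover have "J2 (\<lambda>x. f x + g x) = J2 f + J2 g" unfolding J2_def by (rule p2(1)[OF fg])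
    moreover have "J3 (\<lambda>x. f x + g x) = J3 f + J3 g" unfolding J3_def by (rule p3(1)[OF fg])
    ultimately show "J (\<lambda>x. f x + g x) = J f + J g" unfolding J_def by (simp add: add_divide_distrib)
  next
    fix c and f :: "spacetime \<Rightarrow> real" assume f: "bounded_supp f"
    have "J1 (\<lambda>x. c * f x) = c * J1 f" unfolding J1_def by (rule p1(2)[OF f])
    moreover have "J2 (\<lambda>x. c * f x) = c * J2 f" unfolding J2_def by (rule p2(2)[OF f])
    moreover have "J3 (\<lambda>x. c * f x) = c * J3 f" unfolding J3_def by (rule p3(2)[OF f])
    ultimately show "J (\<lambda>x. c * f x) = c * J f" unfolding J_def by (simp add: algebra_simps)
  next
    fix a b :: spacetime
    obtain B where B: "\<And>x. x \<in> box a b \<Longrightarrow> norm x \<le> B" using bounded_box[of a b] by (auto simp: bounded_iff)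
    have "(\<lambda>n. J (box_bump n a b)) \<longlonglongrightarrow> J (indicator (box a b))"
    proof (rule lim[where N=1 and r=B])
      show "box_bump n a b \<in> borel_measurable borel" for n by (rule bounded_supp_measurable[OF bounded_supp_box_bump])
      show "(indicator (box a b) :: spacetime \<Rightarrow> real) \<in> borel_measurable borel" by simp
      show "\<bar>box_bump n a b x\<bar> \<le> 1" for n x using box_bump_bounds[of n a b x] by simp
      show "box_bump n a b x = 0" if "B < norm x" for n x using B[of x] that by (intro box_bump_outside) force
      show "(\<lambda>n. box_bump n a b x) \<longlonglongrightarrow> indicator (box a b) x" for x by (rule box_bump_tendsto)
    qed
    then show "J (indicator (box a b)) = 0" unfolding bump by (rule LIMSEQ_unique[OF tendsto_const, symmetric])
  next
    show "bounded_supp \<psi>" by (rule \<psi>)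
  qed (rule lim; assumption)
  then show ?thesis unfolding J_def J1_def J2_def J3_def by linarith
qed

subsection \<open>Translates of the momentum average\<close>

lemma ennreal_norm_integral_le:
  fixes f :: "'a \<Rightarrow> real"
  shows "ennreal (norm (integral\<^sup>L M f)) \<le> (\<integral>\<^sup>+ x. ennreal (norm (f x)) \<partial>M)"
proof (cases "integrable M f")
  case True
  then show ?thesis by (rule integral_norm_bound_ennreal)
next
  \<comment> \<open>By convention the integral of a non-integrable function is 0.\<close>
  case False
  then show ?thesis by (simp add: not_integrable_integral_eq)
qed

text \<open>The pairings with \<open>U\<close> and \<open>G\<close> each return a quarter of the
  quantity being estimated; together this is half of it, which is absorbed on the left.\<close>

lemma absorb_quarters:
  fixes l1 l2 a b x :: real
  assumes "l1 \<le> a + x / 4" "l2 \<le> b + x / 4" "x = l1 + l2"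
  shows "x \<le> 2 * (a + b)"
proof -
  have "l1 + l2 \<le> (a + x / 4) + (b + x / 4)" using assms(1,2) by (rule add_mono)
  then show ?thesis unfolding assms(3)[symmetric] by argo
qed

text \<open>Young's inequality with constants 1, by comparing \<open>b\<close> with
  \<open>a powr (p - 1)\<close>. The free weight \<open>e\<close> allows the second coefficient to
  be made small enough for absorption.\<close>

lemma young_crude:
  fixes x t e p q :: real
  assumes p: "1 < p" and q: "q = p / (p - 1)" and e: "e > 0" and x: "x \<ge> 0" and t: "t \<ge> 0"
  shows "x * t \<le> e powr p * x powr p + e powr (- q) * t powr q"
proof -
  define a b where "a = e * x" and "b = t / e"
  have ab: "a \<ge> 0" "b \<ge> 0" using e x t by (auto simp: a_def b_def)
  have q0: "q > 1" using p by (simp add: q field_simps)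
  have "a * b \<le> a powr p + b powr q"
  proof (cases "b \<le> a powr (p - 1)")
    case True
    have "a * b \<le> a * a powr (p - 1)" using True ab by (intro mult_left_mono) auto
    also have "\<dots> = a powr p" using ab by (cases "a = 0") (auto simp: powr_diff)
    finally show ?thesis by (simp add: add_increasing2)
  next
    case False
    then have "(a powr (p - 1)) powr (1 / (p - 1)) \<le> b powr (1 / (p - 1))"
      using p by (intro powr_mono2) auto
    then have "a \<le> b powr (1 / (p - 1))" using p ab by (simp add: powr_powr)
    moreover have "1 / (p - 1) = q - 1" using p by (simp add: q field_simps)
    ultimately have "a * b \<le> b powr (q - 1) * b" using ab by (intro mult_right_mono) auto
    also have "\<dots> = b powr q" using ab q0 by (cases "b = 0") (auto simp: powr_diff)
    finally show ?thesis by (simp add: add_increasing)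
  qed
  moreover have "a * b = x * t" using e by (simp add: a_def b_def)
  moreover have "a powr p = e powr p * x powr p" using e x by (simp add: a_def powr_mult)
  moreover have "b powr q = e powr (- q) * t powr q" using e t by (simp add: b_def powr_divide powr_minus field_simps)
  ultimately show ?thesis by simp
qed

section \<open>Duality for increments of the momentum average\<close>

lemma momentum_integral_pairing:
  assumes U: "slab_integrable \<rho> U" and \<psi>: "bounded_supp \<psi>"
  defines "V \<equiv> \<lambda>y. LINT p|lborel. U (y, p)"
  shows "integrable lborel (\<lambda>y. V y * \<psi> y)" and "(LINT y|lborel. V y * \<psi> y) = (LINT z|lborel. U z * \<psi> (fst z))"
proof -
  have "integrable lborel (\<lambda>z. U z * \<psi> (fst z))" by (rule local_op_integrable[OF local_op_eval U \<psi>])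
  then have i: "integrable (lborel \<Otimes>\<^sub>M lborel) (\<lambda>z. U z * \<psi> (fst z))" unfolding lborel_prod .
  have e: "(LINT p|lborel. U (y, p) * \<psi> (fst (y, p))) = V y * \<psi> y" for y unfolding V_def by simp
  show "integrable lborel (\<lambda>y. V y * \<psi> y)"
    using lborel_pair.integrable_fst'[OF i] unfolding e .
  show "(LINT y|lborel. V y * \<psi> y) = (LINT z|lborel. U z * \<psi> (fst z))"
    using lborel_pair.integral_fst'[OF i] unfolding e lborel_prod .
qed

lemma momentum_integral_measurable:
  fixes U :: "phase \<Rightarrow> real"
  assumes "U \<in> borel_measurable borel"
  shows "(\<lambda>y :: spacetime. LINT p|lborel. U (y, p :: real^3)) \<in> borel_measurable borel"
proof -
  have "case_prod (\<lambda>y p. U (y, p)) \<in> borel_measurable (borel \<Otimes>\<^sub>M lborel)"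
    using assms by (simp add: borel_prod[symmetric] cong: measurable_cong_sets)
  then show ?thesis by (rule lborel.borel_measurable_lebesgue_integral)
qed

text \<open>The indicator inside \<open>phase_op\<close> is invisible here because \<open>U\<close>
  vanishes for momenta outside the ball; the factor \<open>\<delta>\<close> undoes the
  normalisation.\<close>

lemma phase_op_pairing:
  assumes U: "slab_integrable \<rho> U" and \<delta>: "\<delta> > 0"
  shows "(LINT z|lborel. U z * ray_integral \<eta> (\<lambda>y. \<phi> (y - h) - \<phi> y) (fst z) (1, velocity (snd z))) = \<delta> * (LINT z|lborel. U z * phase_op \<rho> \<delta> \<eta> h \<phi> z)"
proof -
  have "\<forall>z. \<rho> \<le> norm (snd z) \<longrightarrow> U z = 0" using U unfolding slab_integrable_def by blast
  then have s: "U z = 0" if "snd z \<notin> ball 0 \<rho>" for z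
  proof -
    have "\<rho> \<le> norm (snd z)" using that by simp
    then show ?thesis using \<open>\<forall>z. \<rho> \<le> norm (snd z) \<longrightarrow> U z = 0\<close> by blast
  qed
  have "U z * ray_integral \<eta> (\<lambda>y. \<phi> (y - h) - \<phi> y) (fst z) (1, velocity (snd z)) = \<delta> * (U z * phase_op \<rho> \<delta> \<eta> h \<phi> z)" for z
  proof (cases "snd z \<in> ball 0 \<rho>")
    case True
    then have "(indicator (ball 0 \<rho>) (snd z) :: real) = 1" by simp
    then show ?thesis unfolding phase_op_def using \<delta> by simp
  next
    case False then show ?thesis using s by simp
  qed
  then show ?thesis by (simp only: integral_mult_right_zero)
qed

lemma nn_integral_le_of_truncations:
  fixes f :: "'a::euclidean_space \<Rightarrow> ennreal" and A :: "nat \<Rightarrow> 'a set"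
  assumes f: "f \<in> borel_measurable borel" and A: "\<And>n. A n \<in> sets borel" "incseq A" "(\<Union>n. A n) = UNIV"
    and le: "\<And>n. (\<integral>\<^sup>+ x. indicator (A n) x * f x \<partial>lborel) \<le> c"
  shows "(\<integral>\<^sup>+ x. f x \<partial>lborel) \<le> c"
proof -
  have "f x = (SUP n. indicator (A n) x * f x)" for x
  proof (rule antisym)
    obtain n where "x \<in> A n" using A(3) by auto
    then have "f x = indicator (A n) x * f x" by simp
    also have "\<dots> \<le> (SUP n. indicator (A n) x * f x)" by (rule SUP_upper) simp
    finally show "f x \<le> (SUP n. indicator (A n) x * f x)" .
    show "(SUP n. indicator (A n) x * f x) \<le> f x" by (rule SUP_least) (auto simp: indicator_def)
  qed
  then have "(\<integral>\<^sup>+ x. f x \<partial>lborel) = (\<integral>\<^sup>+ x. (SUP n. indicator (A n) x * f x) \<partial>lborel)" by simp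
  also have "\<dots> = (SUP n. \<integral>\<^sup>+ x. indicator (A n) x * f x \<partial>lborel)"
  proof (rule nn_integral_monotone_convergence_SUP)
    show "incseq (\<lambda>n x. indicator (A n) x * f x)"
      using A(2) by (auto simp: incseq_def le_fun_def indicator_def)
    show "(\<lambda>x. indicator (A n) x * f x) \<in> borel_measurable lborel" for n
      using borel_measurable_times_ennreal[OF borel_measurable_indicator[OF A(1)] f] by simp
  qed
  also have "\<dots> \<le> c" by (rule SUP_least) (rule le)
  finally show ?thesis .
qed

text \<open>Duhamel's formula averaged over ray segments, in weak form.\<close>

definition ray_representation :: "(phase \<Rightarrow> real) \<Rightarrow> (phase \<Rightarrow> real) \<Rightarrow> bool" where
  "ray_representation U G \<longleftrightarrow> (\<forall>\<delta>>0. \<forall>\<psi>. bounded_supp \<psi> \<longrightarrow> (LINT z|lborel. U z * \<psi> (fst z))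
      = (LINT z|lborel. U z * ray_integral (uniform_kernel \<delta>) \<psi> (fst z) (1, velocity (snd z))) / \<delta>
        + (LINT z|lborel. G z * ray_integral (linear_kernel \<delta>) \<psi> (fst z) (1, velocity (snd z))))"

text \<open>The increment \<open>D\<close> is tested against its dual power
  \<open>D |D| powr (p - 2)\<close>, cut off where \<open>D\<close> and the point are bounded. For
  this \<open>\<phi>\<close> the pairing with \<open>D\<close> and the integral of
  \<open>|\<phi>| powr q\<close> are the same finite number \<open>X\<close>, so Young's inequality
  lets \<open>X\<close> absorb what it returns. The truncation is then removed by monotone
  convergence.\<close>

lemma translation_estimate:
  fixes p \<kappa> \<rho> :: real
  assumes p: "1 < p" and \<kappa>: "0 < \<kappa>" "\<kappa> < 1"
  shows "\<exists>C>0. \<forall>U G u f. slab_integrable \<rho> U \<longrightarrow> slab_integrable \<rho> G \<longrightarrow> 0 \<le> u \<longrightarrow> 0 \<le> f \<longrightarrow>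
    (\<integral>\<^sup>+ z. ennreal (\<bar>U z\<bar> powr p) \<partial>lborel) \<le> ennreal u \<longrightarrow> (\<integral>\<^sup>+ z. ennreal (\<bar>G z\<bar> powr p) \<partial>lborel) \<le> ennreal f \<longrightarrow>
    ray_representation U G \<longrightarrow>
    (\<forall>\<delta>>0. \<forall>h. h \<noteq> 0 \<longrightarrow>
      (\<integral>\<^sup>+ y. ennreal (\<bar>(LINT k|lborel. U (y + h, k)) - (LINT k|lborel. U (y, k))\<bar> powr p) \<partial>lborel)
        \<le> ennreal (C * min 1 (norm h / \<delta>) powr (\<kappa> * min 1 (p - 1)) * (u + \<delta> powr p * f)))"
proof -
  define q where "q = p / (p - 1)"
  have q1: "q > 1" using p by (simp add: q_def field_simps)
  have pq: "(p - 1) * q = p" using p by (simp add: q_def)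
  obtain K where K: "K > 0" "\<And>\<delta> \<eta> h \<phi>. \<delta> > 0 \<Longrightarrow> admissible \<delta> \<eta> \<Longrightarrow> bounded_supp \<phi> \<Longrightarrow>
     interpolable K (min 1 (norm h / \<delta>) powr \<kappa>) (phase_op \<rho> \<delta> \<eta> h) \<phi>"
    using phase_op_interpolable[OF \<kappa>, of \<rho>] by blast
  obtain M where M: "M > 0" "\<And>\<epsilon> (T :: (spacetime \<Rightarrow> real) \<Rightarrow> phase \<Rightarrow> real) \<phi>. \<epsilon> > 0 \<Longrightarrow> interpolable K \<epsilon> T \<phi> \<Longrightarrow>
    (\<integral>\<^sup>+ y. ennreal (\<bar>T \<phi> y\<bar> powr q) \<partial>lborel) \<le> ennreal (M * \<epsilon> powr min 1 (q - 1)) * (\<integral>\<^sup>+ x. ennreal (\<bar>\<phi> x\<bar> powr q) \<partial>lborel)"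
    using interpolation[OF K(1) q1, where 'a=spacetime and 'b=phase] by blast
  \<comment> \<open>The weight \<open>e\<close> chosen below satisfies
    \<open>e powr p = (4 m) powr (p - 1)\<close>, hence the power of \<open>4 M\<close>; the factor
    2 is left by the absorption.\<close>
  define C where "C = 2 * (4 * M) powr (p - 1)"
  have C: "C > 0" using M by (simp add: C_def)
  have main: "(\<integral>\<^sup>+ y. ennreal (\<bar>(LINT k|lborel. U (y + h, k)) - (LINT k|lborel. U (y, k))\<bar> powr p) \<partial>lborel)
        \<le> ennreal (C * min 1 (norm h / \<delta>) powr (\<kappa> * min 1 (p - 1)) * (u + \<delta> powr p * f))"
    if U: "slab_integrable \<rho> U" and G: "slab_integrable \<rho> G" and u: "0 \<le> u" and f: "0 \<le> f"
      and Up: "(\<integral>\<^sup>+ z. ennreal (\<bar>U z\<bar> powr p) \<partial>lborel) \<le> ennreal u" and Gp: "(\<integral>\<^sup>+ z. ennreal (\<bar>G z\<bar> powr p) \<partial>lborel) \<le> ennreal f"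
      and id_all: "ray_representation U G"
      and \<delta>: "\<delta> > 0" and h: "h \<noteq> 0" for U G u f \<delta> and h :: spacetime
  proof -
    note id = id_all[unfolded ray_representation_def, rule_format]
    have Um: "U \<in> borel_measurable borel" and Gm: "G \<in> borel_measurable borel" using U G by (simp_all add: slab_integrable_def)
    define V where "V y = (LINT k|lborel. U (y, k))" for y
    have Vm: "V \<in> borel_measurable borel" unfolding V_def[abs_def] by (rule momentum_integral_measurable[OF Um])
    define D where "D = (\<lambda>y. V (y + h) - V y)"
    have shm: "(\<lambda>y :: spacetime. y + h) \<in> borel_measurable borel" by (intro borel_measurable_continuous_onI continuous_intros)
    have Dm: "D \<in> borel_measurable borel" unfolding D_def
      by (rule borel_measurable_diff[OF measurable_compose[OF shm Vm] Vm])
    define \<epsilon> where "\<epsilon> = min 1 (norm h / \<delta>) powr \<kappa>"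
    have \<epsilon>: "\<epsilon> > 0" using h \<delta> by (auto simp: \<epsilon>_def min_def)
    define m where "m = M * \<epsilon> powr min 1 (q - 1)"
    have m: "m > 0" using M \<epsilon> by (simp add: m_def)
    \<comment> \<open>Chosen so that \<open>e powr (- q) * m = 1 / 4\<close>: the dual term of
      Young's inequality becomes \<open>X / 4\<close>.\<close>
    define e where "e = (4 * m) powr (1 / q)"
    have e: "e > 0" using m by (simp add: e_def)
    have eq': "e powr (- q) = 1 / (4 * m)" using m q1 by (simp add: e_def powr_powr powr_minus_divide)
    have ep: "2 * e powr p = C * min 1 (norm h / \<delta>) powr (\<kappa> * min 1 (p - 1))"
    proof -
      have "e powr p = (4 * M * \<epsilon> powr min 1 (q - 1)) powr (p - 1)"
        unfolding e_def powr_powr m_def using p by (simp add: q_def mult.assoc)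
      also have "\<dots> = (4 * M) powr (p - 1) * \<epsilon> powr (min 1 (q - 1) * (p - 1))"
        using M \<epsilon> by (simp add: powr_mult powr_powr)
      also have "min 1 (q - 1) * (p - 1) = min 1 (p - 1)"
      proof -
        have "(q - 1) * (p - 1) = 1" using p by (simp add: q_def field_simps)
        then have "min (1 * (p - 1)) ((q - 1) * (p - 1)) = min 1 (p - 1)" by (simp add: min.commute)
        then show ?thesis using p by (simp add: min_mult_distrib_right)
      qed
      finally show ?thesis by (simp add: C_def \<epsilon>_def powr_powr)
    qed
    \<comment> \<open>Bounded values at bounded points: this makes \<open>\<phi>\<close> a
      legitimate dual function and \<open>X\<close> finite before it is absorbed.\<close>
    define A where "A = (\<lambda>n. {y. \<bar>D y\<bar> \<le> real n} \<inter> cball 0 (real n))"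
    have A: "A n \<in> sets borel" for n
    proof -
      have "{y \<in> space borel. \<bar>D y\<bar> \<le> real n} \<in> sets borel"
        using borel_measurable_abs[OF Dm] by (rule borel_measurable_le) simp
      then show ?thesis by (simp add: A_def sets.Int)
    qed
    have "(\<integral>\<^sup>+ y. ennreal (\<bar>D y\<bar> powr p) \<partial>lborel) \<le> ennreal (2 * e powr p * (u + \<delta> powr p * f))"
    proof (rule nn_integral_le_of_truncations[OF _ A])
      show "(\<lambda>y. ennreal (\<bar>D y\<bar> powr p)) \<in> borel_measurable borel" using Dm by measurable
      show "incseq A" by (auto simp: A_def incseq_def intro: order_trans)
      show "(\<Union>n. A n) = UNIV"
      proof -
        have "\<exists>n. y \<in> A n" for y
        proof -
          obtain n where n: "max \<bar>D y\<bar> (norm y) \<le> real n" using real_arch_simple by blast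
          then have "\<bar>D y\<bar> \<le> real n" "norm y \<le> real n" by simp_all
          then show ?thesis unfolding A_def by auto
        qed
        then show ?thesis by auto
      qed
      fix n
      define \<phi> where "\<phi> = (\<lambda>y. indicator (A n) y * (D y * \<bar>D y\<bar> powr (p - 2)))"
      have abs1: "\<bar>D y * \<bar>D y\<bar> powr (p - 2)\<bar> = \<bar>D y\<bar> powr (p - 1)" for y
      proof (cases "D y = 0")
        case False
        have "\<bar>D y\<bar> powr (p - 1) = \<bar>D y\<bar> powr (1 + (p - 2))" by (rule arg_cong[where f="\<lambda>z. \<bar>D y\<bar> powr z"]) simp
        also have "\<dots> = \<bar>D y\<bar> * \<bar>D y\<bar> powr (p - 2)" using False by (subst powr_add) simp
        finally show ?thesis by (simp add: abs_mult)
      qed simp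
      have sq1: "D y * (D y * \<bar>D y\<bar> powr (p - 2)) = \<bar>D y\<bar> powr p" for y
      proof (cases "D y = 0")
        case False
        have "\<bar>D y\<bar> powr p = \<bar>D y\<bar> powr (1 + (1 + (p - 2)))" by (rule arg_cong[where f="\<lambda>z. \<bar>D y\<bar> powr z"]) simp
        also have "\<dots> = \<bar>D y\<bar> * (\<bar>D y\<bar> * \<bar>D y\<bar> powr (p - 2))" using False by (subst powr_add, subst powr_add) simp
        finally show ?thesis by (simp add: mult.assoc[symmetric])
      qed simp
      have \<phi>: "bounded_supp \<phi>"
      proof (rule bounded_suppI[where N="real n powr (p - 1)" and r="real n"])
        show "\<phi> \<in> borel_measurable borel" unfolding \<phi>_def
        proof -
          note [measurable] = Dm A
          show "(\<lambda>y. indicator (A n) y * (D y * \<bar>D y\<bar> powr (p - 2))) \<in> borel_measurable borel" by measurable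
        qed
        show "\<bar>\<phi> y\<bar> \<le> real n powr (p - 1)" for y
        proof (cases "y \<in> A n")
          case True
          then have "\<bar>D y\<bar> powr (p - 1) \<le> real n powr (p - 1)" using p by (intro powr_mono2) (auto simp: A_def)
          then show ?thesis using True unfolding \<phi>_def by (simp only: abs1 indicator_simps mult_1)
        qed (simp add: \<phi>_def)
        show "norm y \<le> real n" if "\<phi> y \<noteq> 0" for y
          using that by (cases "y \<in> A n") (auto simp: \<phi>_def A_def)
      qed
      have D\<phi>: "D y * \<phi> y = indicator (A n) y * \<bar>D y\<bar> powr p" for y
        unfolding \<phi>_def by (simp only: mult.left_commute[of "D y" "indicator (A n) y"] sq1)
      have \<phi>q: "\<bar>\<phi> y\<bar> powr q = indicator (A n) y * \<bar>D y\<bar> powr p" for y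
      proof (cases "y \<in> A n")
        case True
        then show ?thesis unfolding \<phi>_def by (simp only: abs1 indicator_simps mult_1 powr_powr pq)
      qed (simp add: \<phi>_def)
      define \<psi> where "\<psi> = (\<lambda>y. \<phi> (y - h) - \<phi> y)"
      have \<psi>: "bounded_supp \<psi>" unfolding \<psi>_def by (rule bounded_supp_shift_diff[OF \<phi>])
      have \<phi>h: "bounded_supp (\<lambda>y. \<phi> (y - h))" using bounded_supp_translate[OF \<phi>, of "- h"] by simp
      note V1 = momentum_integral_pairing[OF U \<phi>, folded V_def] and V2 = momentum_integral_pairing[OF U \<phi>h, folded V_def]
        and V3 = momentum_integral_pairing[OF U \<psi>, folded V_def]
      have iV: "integrable lborel (\<lambda>y. V (y + h) * \<phi> y)" "(LINT y|lborel. V (y + h) * \<phi> y) = (LINT y|lborel. V y * \<phi> (y - h))"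
      proof -
        have t: "lborel = distr lborel borel ((+) h)" by (simp add: lborel_distr_plus)
        have gm: "(\<lambda>y. V y * \<phi> (y - h)) \<in> borel_measurable borel" using borel_measurable_integrable[OF V2(1)] by simp
        have "integrable (distr lborel borel ((+) h)) (\<lambda>y. V y * \<phi> (y - h))" using V2(1) t by simp
        then have "integrable lborel (\<lambda>y. V (h + y) * \<phi> (h + y - h))"
          by (subst (asm) integrable_distr_eq[OF _ gm]) simp_all
        then show "integrable lborel (\<lambda>y. V (y + h) * \<phi> y)" by (simp add: add.commute)
        show "(LINT y|lborel. V (y + h) * \<phi> y) = (LINT y|lborel. V y * \<phi> (y - h))"
          using lborel_integral_translate[OF gm, of h] by simp
      qed
      define X where "X = (LINT y|lborel. D y * \<phi> y)"
      have iD: "integrable lborel (\<lambda>y. D y * \<phi> y)" unfolding D_def left_diff_distrib by (intro Bochner_Integration.integrable_diff iV V1)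
      have X0: "X \<ge> 0" unfolding X_def D\<phi> by (intro integral_nonneg_AE) simp
      have Xnn: "(\<integral>\<^sup>+ y. ennreal (indicator (A n) y * \<bar>D y\<bar> powr p) \<partial>lborel) = ennreal X"
        unfolding D\<phi>[symmetric] X_def by (intro nn_integral_eq_integral[OF iD] AE_I2) (simp only: D\<phi>, simp)
      have "X = (LINT y|lborel. V y * \<phi> (y - h)) - (LINT y|lborel. V y * \<phi> y)"
        unfolding X_def D_def left_diff_distrib using iV V1(1) by simp
      also have "\<dots> = (LINT y|lborel. V y * \<psi> y)"
        unfolding \<psi>_def right_diff_distrib by (rule Bochner_Integration.integral_diff[OF V2(1) V1(1), symmetric])
      also have "\<dots> = (LINT z|lborel. U z * \<psi> (fst z))" by (rule V3(2))
      also have "\<dots> = (LINT z|lborel. U z * phase_op \<rho> \<delta> (uniform_kernel \<delta>) h \<phi> z) + \<delta> * (LINT z|lborel. G z * phase_op \<rho> \<delta> (linear_kernel \<delta>) h \<phi> z)"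
        unfolding id[OF \<delta> \<psi>] unfolding \<psi>_def phase_op_pairing[OF U \<delta>] phase_op_pairing[OF G \<delta>] using \<delta> by simp
      finally have X_eq: "X = (LINT z|lborel. U z * phase_op \<rho> \<delta> (uniform_kernel \<delta>) h \<phi> z) + \<delta> * (LINT z|lborel. G z * phase_op \<rho> \<delta> (linear_kernel \<delta>) h \<phi> z)" .
      \<comment> \<open>Applied with \<open>c = 1\<close> to \<open>U\<close> and with
        \<open>c = \<delta>\<close> to \<open>G\<close>, whence the factor
        \<open>\<delta> powr p\<close> in front of \<open>f\<close>.\<close>
      have pair: "ennreal (c * (LINT z|lborel. g z * phase_op \<rho> \<delta> \<eta> h \<phi> z)) \<le> ennreal (e powr p * c powr p * w) + ennreal (X / 4)"
        if g: "g \<in> borel_measurable borel" "(\<integral>\<^sup>+ z. ennreal (\<bar>g z\<bar> powr p) \<partial>lborel) \<le> ennreal w" "0 \<le> w" and c: "0 < c" and \<eta>: "admissible \<delta> \<eta>" for g w c \<eta>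
      proof -
        have \<eta>m: "\<eta> \<in> borel_measurable borel" using \<eta> by (simp add: admissible_def)
        define T where "T = phase_op \<rho> \<delta> \<eta> h \<phi>"
        have Tm: "T \<in> borel_measurable borel" unfolding T_def by (rule phase_op_measurable[OF \<eta>m \<phi>])
        have Tq: "(\<integral>\<^sup>+ z. ennreal (\<bar>T z\<bar> powr q) \<partial>lborel) \<le> ennreal (m * X)"
        proof -
          have "(\<integral>\<^sup>+ z. ennreal (\<bar>T z\<bar> powr q) \<partial>lborel) \<le> ennreal m * (\<integral>\<^sup>+ y. ennreal (\<bar>\<phi> y\<bar> powr q) \<partial>lborel)"
            unfolding T_def m_def by (rule M(2)[OF \<epsilon>]) (unfold \<epsilon>_def, rule K(2)[OF \<delta> \<eta> \<phi>])
          also have "(\<integral>\<^sup>+ y. ennreal (\<bar>\<phi> y\<bar> powr q) \<partial>lborel) = ennreal X" unfolding \<phi>q by (rule Xnn)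
          finally show ?thesis using m X0 by (simp add: ennreal_mult)
        qed
        have gm: "(\<lambda>z. ennreal (\<bar>g z\<bar> powr p)) \<in> borel_measurable lborel" using g(1) by simp
        have tm: "(\<lambda>z. ennreal (\<bar>T z\<bar> powr q)) \<in> borel_measurable lborel" using Tm by simp
        have "ennreal (c * (LINT z|lborel. g z * T z)) \<le> ennreal (norm (LINT z|lborel. c * (g z * T z)))"
          by (intro ennreal_leI) (simp only: integral_mult_right_zero real_norm_def abs_ge_self)
        also have "\<dots> \<le> (\<integral>\<^sup>+ z. ennreal (norm (c * (g z * T z))) \<partial>lborel)"
          by (rule ennreal_norm_integral_le)
        also have "\<dots> \<le> (\<integral>\<^sup>+ z. ennreal (e powr p * c powr p) * ennreal (\<bar>g z\<bar> powr p) + ennreal (1 / (4 * m)) * ennreal (\<bar>T z\<bar> powr q) \<partial>lborel)"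
        proof (rule nn_integral_mono)
          fix z
          have "\<bar>c * g z\<bar> * \<bar>T z\<bar> \<le> e powr p * \<bar>c * g z\<bar> powr p + e powr (- q) * \<bar>T z\<bar> powr q"
            by (rule young_crude[OF p q_def e]) auto
          also have "\<bar>c * g z\<bar> powr p = c powr p * \<bar>g z\<bar> powr p" using c by (simp add: abs_mult powr_mult)
          finally have "norm (c * (g z * T z)) \<le> (e powr p * c powr p) * \<bar>g z\<bar> powr p + (1 / (4 * m)) * \<bar>T z\<bar> powr q"
            by (simp add: eq' abs_mult mult.assoc)
          then have "ennreal (norm (c * (g z * T z))) \<le> ennreal ((e powr p * c powr p) * \<bar>g z\<bar> powr p + (1 / (4 * m)) * \<bar>T z\<bar> powr q)"
            by (rule ennreal_leI)
          also have "\<dots> = ennreal (e powr p * c powr p) * ennreal (\<bar>g z\<bar> powr p) + ennreal (1 / (4 * m)) * ennreal (\<bar>T z\<bar> powr q)"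
          proof -
            have "ennreal (x1 * x2 + x3 * x4) = ennreal x1 * ennreal x2 + ennreal x3 * ennreal x4"
              if "0 \<le> x1" "0 \<le> x2" "0 \<le> x3" "0 \<le> x4" for x1 x2 x3 x4 :: real
              using that by (simp add: ennreal_mult)
            from this[of "e powr p * c powr p" "\<bar>g z\<bar> powr p" "1 / (4 * m)" "\<bar>T z\<bar> powr q"]
            show ?thesis using m by (simp only: mult_nonneg_nonneg powr_ge_zero zero_le_divide_1_iff mult_pos_pos zero_less_numeral less_imp_le)
          qed
          finally show "ennreal (norm (c * (g z * T z))) \<le> ennreal (e powr p * c powr p) * ennreal (\<bar>g z\<bar> powr p) + ennreal (1 / (4 * m)) * ennreal (\<bar>T z\<bar> powr q)" .
        qed
        also have "\<dots> = ennreal (e powr p * c powr p) * (\<integral>\<^sup>+ z. ennreal (\<bar>g z\<bar> powr p) \<partial>lborel) + ennreal (1 / (4 * m)) * (\<integral>\<^sup>+ z. ennreal (\<bar>T z\<bar> powr q) \<partial>lborel)"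
          using gm tm by (simp add: nn_integral_add nn_integral_cmult)
        also have "\<dots> \<le> ennreal (e powr p * c powr p) * ennreal w + ennreal (1 / (4 * m)) * ennreal (m * X)"
          by (intro add_mono mult_left_mono g Tq) auto
        also have "\<dots> = ennreal (e powr p * c powr p * w) + ennreal (1 / (4 * m) * (m * X))"
          using m X0 g(3) by (simp add: ennreal_mult[symmetric])
        also have "1 / (4 * m) * (m * X) = X / 4" using m by simp
        finally show ?thesis unfolding T_def .
      qed
      have le: "ennreal x \<le> ennreal a + ennreal b \<Longrightarrow> 0 \<le> a \<Longrightarrow> 0 \<le> b \<Longrightarrow> x \<le> a + b" for x a b :: real
      proof -
        assume a: "ennreal x \<le> ennreal a + ennreal b" "0 \<le> a" "0 \<le> b"
        then have "ennreal x \<le> ennreal (a + b)" by simp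
        then show "x \<le> a + b" by (rule iffD1[OF ennreal_le_iff, rotated]) (use a in simp)
      qed
      have "1 * (LINT z|lborel. U z * phase_op \<rho> \<delta> (uniform_kernel \<delta>) h \<phi> z) \<le> e powr p * 1 powr p * u + X / 4"
        using X0 u by (intro le[OF pair[OF Um Up u _ admissible_uniform_kernel[OF \<delta>]]]) auto
      moreover have "\<delta> * (LINT z|lborel. G z * phase_op \<rho> \<delta> (linear_kernel \<delta>) h \<phi> z) \<le> e powr p * \<delta> powr p * f + X / 4"
        using X0 f by (intro le[OF pair[OF Gm Gp f \<delta> admissible_linear_kernel[OF \<delta>]]]) auto
      ultimately have "X \<le> 2 * (e powr p * u + e powr p * \<delta> powr p * f)" (is ?thesis)
      proof -
        assume "1 * (LINT z|lborel. U z * phase_op \<rho> \<delta> (uniform_kernel \<delta>) h \<phi> z) \<le> e powr p * 1 powr p * u + X / 4"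
          and b: "\<delta> * (LINT z|lborel. G z * phase_op \<rho> \<delta> (linear_kernel \<delta>) h \<phi> z) \<le> e powr p * \<delta> powr p * f + X / 4"
        then have a: "(LINT z|lborel. U z * phase_op \<rho> \<delta> (uniform_kernel \<delta>) h \<phi> z) \<le> e powr p * u + X / 4"
          by (simp only: mult_1 mult_1_right powr_one_eq_one)
        show ?thesis by (rule absorb_quarters[OF a b X_eq])
      qed
      then have Xle: "X \<le> 2 * e powr p * (u + \<delta> powr p * f)" by (simp add: algebra_simps)
      have "(\<integral>\<^sup>+ y. indicator (A n) y * ennreal (\<bar>D y\<bar> powr p) \<partial>lborel) = ennreal X"
        unfolding Xnn[symmetric] by (intro nn_integral_cong) (auto simp: indicator_def)
      then show "(\<integral>\<^sup>+ y. indicator (A n) y * ennreal (\<bar>D y\<bar> powr p) \<partial>lborel) \<le> ennreal (2 * e powr p * (u + \<delta> powr p * f))"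
        using ennreal_leI[OF Xle] by simp
    qed
    then show ?thesis unfolding ep D_def V_def .
  qed
  show ?thesis
    by (intro exI[of _ C] conjI C allI impI) (rule main; assumption)
qed

subsection \<open>The Gagliardo integral\<close>

text \<open>Hoelder's inequality on the bounded set of momenta, derived from Young's inequality with
  an optimised weight. It is what puts the momentum average into \<open>L\<^sup>p\<close>.\<close>

lemma momentum_integral_Lp:
  fixes p \<rho> :: real
  assumes p: "1 < p"
  shows "\<exists>C>0. \<forall>U. slab_integrable \<rho> U \<longrightarrow>
    (\<integral>\<^sup>+ y. ennreal (\<bar>LINT k|lborel. U (y, k)\<bar> powr p) \<partial>lborel) \<le> ennreal C * (\<integral>\<^sup>+ z. ennreal (\<bar>U z\<bar> powr p) \<partial>lborel)"
proof -
  define q where "q = p / (p - 1)"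
  have q1: "q > 1" using p by (simp add: q_def field_simps)
  define B where "B = measure lborel (ball (0::real^3) \<rho>)"
  have B: "B \<ge> 0" by (simp add: B_def)
  have eB: "emeasure lborel (ball (0::real^3) \<rho>) = ennreal B"
    unfolding B_def using emeasure_lborel_ball_finite[of "0::real^3" \<rho>] by (intro emeasure_eq_ennreal_measure) (simp only: less_top infinity_ennreal_def)
  have main: "(\<integral>\<^sup>+ y. ennreal (\<bar>LINT k|lborel. U (y, k)\<bar> powr p) \<partial>lborel) \<le> ennreal ((1 + B) powr p) * (\<integral>\<^sup>+ z. ennreal (\<bar>U z\<bar> powr p) \<partial>lborel)"
    if U: "slab_integrable \<rho> U" for U
  proof -
    have Um: "U \<in> borel_measurable borel" and U0: "\<forall>z. \<rho> \<le> norm (snd z) \<longrightarrow> U z = 0"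
      using U unfolding slab_integrable_def by blast+
    have sect: "(\<lambda>k. U (y, k)) \<in> borel_measurable borel" for y
      by (rule measurable_compose[OF _ Um]) (intro borel_measurable_continuous_onI continuous_intros)
    define I where "I = (\<lambda>y. \<integral>\<^sup>+ k. ennreal (\<bar>U (y, k)\<bar> powr p) \<partial>lborel)"
    have Im: "I \<in> borel_measurable borel" and Iint: "(\<integral>\<^sup>+ y. I y \<partial>lborel) = (\<integral>\<^sup>+ z. ennreal (\<bar>U z\<bar> powr p) \<partial>lborel)"
    proof -
      have "(\<lambda>z. ennreal (\<bar>U z\<bar> powr p)) \<in> borel_measurable borel" using Um by measurable
      then have m: "(\<lambda>z. ennreal (\<bar>U z\<bar> powr p)) \<in> borel_measurable (lborel \<Otimes>\<^sub>M lborel)" unfolding lborel_prod by simp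
      show "I \<in> borel_measurable borel" unfolding I_def using lborel.borel_measurable_nn_integral_fst[OF m] by simp
      show "(\<integral>\<^sup>+ y. I y \<partial>lborel) = (\<integral>\<^sup>+ z. ennreal (\<bar>U z\<bar> powr p) \<partial>lborel)"
        unfolding I_def using lborel.nn_integral_fst[OF m] unfolding lborel_prod .
    qed
    have pt: "ennreal (\<bar>LINT k|lborel. U (y, k)\<bar> powr p) \<le> ennreal ((1 + B) powr p) * I y" for y
    proof (cases "I y")
      case top
      \<comment> \<open>In the infinite case the right side is infinite because its finite factor is
        positive.\<close>
      have "0 < (1 + B) powr p" using B by simp
      then have "ennreal ((1 + B) powr p) * I y = top" unfolding top by (simp add: ennreal_mult_top)
      then show ?thesis by simp
    next
      case (real i)
      have abs_le: "ennreal \<bar>LINT k|lborel. U (y, k)\<bar> \<le> (\<integral>\<^sup>+ k. ennreal \<bar>U (y, k)\<bar> \<partial>lborel)"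
        using ennreal_norm_integral_le[of lborel "\<lambda>k. U (y, k)"] by (simp only: real_norm_def)
      have young: "\<bar>LINT k|lborel. U (y, k)\<bar> \<le> e powr p * i + e powr (- q) * B" if e: "e > 0" for e
      proof -
        have "(\<integral>\<^sup>+ k. ennreal \<bar>U (y, k)\<bar> \<partial>lborel) \<le> (\<integral>\<^sup>+ k. ennreal (e powr p) * ennreal (\<bar>U (y, k)\<bar> powr p) + ennreal (e powr (- q)) * indicator (ball (0::real^3) \<rho>) k \<partial>lborel)"
        proof (rule nn_integral_mono)
          fix k :: "real^3"
          show "ennreal \<bar>U (y, k)\<bar> \<le> ennreal (e powr p) * ennreal (\<bar>U (y, k)\<bar> powr p) + ennreal (e powr (- q)) * indicator (ball (0::real^3) \<rho>) k"
          proof (cases "k \<in> ball 0 \<rho>")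
            case True
            have "\<bar>U (y, k)\<bar> * 1 \<le> e powr p * \<bar>U (y, k)\<bar> powr p + e powr (- q) * 1 powr q"
              by (rule young_crude[OF p q_def e]) auto
            then have "ennreal \<bar>U (y, k)\<bar> \<le> ennreal (e powr p * \<bar>U (y, k)\<bar> powr p + e powr (- q))" by (intro ennreal_leI) simp
            then show ?thesis using True by (simp add: ennreal_mult)
          next
            case False
            then have "\<rho> \<le> norm (snd (y, k))" by simp
            then have "U (y, k) = 0" using U0 by blast
            then show ?thesis by simp
          qed
        qed
        also have "\<dots> = ennreal (e powr p) * I y + ennreal (e powr (- q)) * ennreal B"
        proof -
          have m1: "(\<lambda>k. ennreal (\<bar>U (y, k)\<bar> powr p)) \<in> borel_measurable lborel" using sect[of y] by simp
          have m2: "ball (0::real^3) \<rho> \<in> sets lborel" by simp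
          have "(\<integral>\<^sup>+ k. ennreal (e powr p) * ennreal (\<bar>U (y, k)\<bar> powr p) + ennreal (e powr (- q)) * indicator (ball (0::real^3) \<rho>) k \<partial>lborel)
            = (\<integral>\<^sup>+ k. ennreal (e powr p) * ennreal (\<bar>U (y, k)\<bar> powr p) \<partial>lborel) + (\<integral>\<^sup>+ k. ennreal (e powr (- q)) * indicator (ball (0::real^3) \<rho>) k \<partial>lborel)"
            by (rule nn_integral_add[OF borel_measurable_times_ennreal[OF borel_measurable_const m1]
              borel_measurable_times_ennreal[OF borel_measurable_const borel_measurable_indicator[OF m2]]])
          also have "(\<integral>\<^sup>+ k. ennreal (e powr p) * ennreal (\<bar>U (y, k)\<bar> powr p) \<partial>lborel) = ennreal (e powr p) * I y"
            unfolding I_def by (rule nn_integral_cmult[OF m1])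
          also have "(\<integral>\<^sup>+ k. ennreal (e powr (- q)) * indicator (ball (0::real^3) \<rho>) k \<partial>lborel) = ennreal (e powr (- q)) * ennreal B"
            unfolding eB[symmetric] by (rule nn_integral_cmult_indicator[OF m2])
          finally show ?thesis .
        qed
        also have "\<dots> = ennreal (e powr p * i + e powr (- q) * B)"
          using real B by (simp add: ennreal_mult)
        finally have "ennreal \<bar>LINT k|lborel. U (y, k)\<bar> \<le> ennreal (e powr p * i + e powr (- q) * B)" using abs_le by (rule order_trans[rotated])
        then show ?thesis using real B by (subst (asm) ennreal_le_iff) auto
      qed
      have i0: "i \<ge> 0" using real by simp
      have "\<bar>LINT k|lborel. U (y, k)\<bar> \<le> (1 + B) * i powr (1 / p)"
      proof (cases "i = 0")
        \<comment> \<open>The optimal weight degenerates at \<open>i = 0\<close>; there the section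
          vanishes almost everywhere.\<close>
        case True
        have m: "(\<lambda>k. ennreal (\<bar>U (y, k)\<bar> powr p)) \<in> borel_measurable lborel" using sect[of y] by simp
        have "(\<integral>\<^sup>+ k. ennreal (\<bar>U (y, k)\<bar> powr p) \<partial>lborel) = 0" using real True by (simp add: I_def)
        then have "AE k in lborel. ennreal (\<bar>U (y, k)\<bar> powr p) = 0" using nn_integral_0_iff_AE[OF m] by simp
        then have "AE k in lborel. U (y, k) = 0" by eventually_elim simp
        then have "(LINT k|lborel. U (y, k)) = 0" by (rule integral_eq_zero_AE)
        then show ?thesis using B by simp
      next
        case False
        then have i: "i > 0" using i0 by simp
        \<comment> \<open>This weight balances the two terms: \<open>e powr p * i\<close> and
          \<open>e powr (- q)\<close> both equal \<open>i powr (1 / p)\<close>.\<close>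
        define e where "e = i powr (- 1 / (p * q))"
        have "e powr p = i powr (- 1 / q)" using p q1 by (simp add: e_def powr_powr)
        moreover have "- 1 / q + 1 = 1 / p" using p by (simp add: q_def field_simps)
        ultimately have 1: "e powr p * i = i powr (1 / p)" using i powr_add[of i "- 1 / q" 1] by simp
        have 2: "e powr (- q) = i powr (1 / p)" using p q1 by (simp add: e_def powr_powr)
        have "e > 0" using i by (simp add: e_def)
        from young[OF this] show ?thesis unfolding 1 2 by (simp add: algebra_simps)
      qed
      then have "\<bar>LINT k|lborel. U (y, k)\<bar> powr p \<le> ((1 + B) * i powr (1 / p)) powr p"
        using p by (intro powr_mono2) auto
      also have "\<dots> = (1 + B) powr p * i" using B i0 p by (simp add: powr_mult powr_powr)
      finally have "ennreal (\<bar>LINT k|lborel. U (y, k)\<bar> powr p) \<le> ennreal ((1 + B) powr p * i)" by (rule ennreal_leI)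
      also have "\<dots> = ennreal ((1 + B) powr p) * I y" using real i0 by (simp add: ennreal_mult)
      finally show ?thesis .
    qed
    have "(\<integral>\<^sup>+ y. ennreal (\<bar>LINT k|lborel. U (y, k)\<bar> powr p) \<partial>lborel) \<le> (\<integral>\<^sup>+ y. ennreal ((1 + B) powr p) * I y \<partial>lborel)"
      by (rule nn_integral_mono) (rule pt)
    also have "\<dots> = ennreal ((1 + B) powr p) * (\<integral>\<^sup>+ y. I y \<partial>lborel)"
      by (rule nn_integral_cmult) (use Im in simp)
    finally show ?thesis unfolding Iint .
  qed
  have "0 < (1 + B) powr p" using B by simp
  then show ?thesis using main by blast
qed

definition sobolev_kernel :: "real \<Rightarrow> real \<Rightarrow> (spacetime \<Rightarrow> real) \<Rightarrow> spacetime \<Rightarrow> spacetime \<Rightarrow> ennreal" where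
  "sobolev_kernel s p v y y' = ennreal (\<bar>v y - v y'\<bar> powr p * norm (y - y') powr (- (4 + s * p)))"

text \<open>The substitution \<open>y = y' + h\<close> followed by an exchange of the integrals
  collects all pairs of points with the same increment, so that the translation estimate applies for
  each \<open>h\<close>.\<close>

lemma sobolev_kernel_double_integral:
  fixes V :: "spacetime \<Rightarrow> real"
  assumes V: "V \<in> borel_measurable borel" and p: "p > 0" and s: "s > 0" and b: "s * p < b"
  shows "(\<integral>\<^sup>+ y'. \<integral>\<^sup>+ y. sobolev_kernel s p V y y' \<partial>lborel \<partial>lborel)
    = (\<integral>\<^sup>+ h. ennreal (norm h powr (- (4 + s * p))) * (\<integral>\<^sup>+ y. ennreal (\<bar>V (y + h) - V y\<bar> powr p) \<partial>lborel) \<partial>lborel)"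
proof -
  have c1: "(\<lambda>x :: spacetime \<times> spacetime. fst x + snd x) \<in> borel_measurable borel"
    by (intro borel_measurable_continuous_onI continuous_intros)
  have c2: "(\<lambda>x :: spacetime \<times> spacetime. fst x) \<in> borel_measurable borel"
    by (intro borel_measurable_continuous_onI continuous_intros)
  have c3: "(\<lambda>x :: spacetime \<times> spacetime. snd x) \<in> borel_measurable borel"
    by (intro borel_measurable_continuous_onI continuous_intros)
  have t: "(\<lambda>y :: spacetime. y + y') \<in> borel_measurable borel" for y'
    by (intro borel_measurable_continuous_onI continuous_intros)
  have d: "(\<lambda>x. \<bar>V (fst x + snd x) - V (fst x)\<bar> powr p) \<in> borel_measurable borel"
  proof -
    have "(\<lambda>x. V (fst x + snd x) - V (fst x)) \<in> borel_measurable borel"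
      by (rule borel_measurable_diff[OF measurable_compose[OF c1 V] measurable_compose[OF c2 V]])
    from measurable_compose[OF this, of "\<lambda>r. \<bar>r\<bar> powr p" borel] show ?thesis by simp
  qed
  have nm: "(\<lambda>x :: spacetime \<times> spacetime. norm (snd x) powr (- (4 + s * p))) \<in> borel_measurable borel"
    using measurable_compose[OF c3, of "\<lambda>h. norm h powr (- (4 + s * p))" borel] by simp
  define H where "H = (\<lambda>x. ennreal (norm (snd x) powr (- (4 + s * p))) * ennreal (\<bar>V (fst x + snd x) - V (fst x)\<bar> powr p))"
  have Hm: "H \<in> borel_measurable borel" unfolding H_def
    by (intro borel_measurable_times_ennreal measurable_compose[OF nm measurable_ennreal] measurable_compose[OF d measurable_ennreal])
  have "(\<integral>\<^sup>+ y. sobolev_kernel s p V y y' \<partial>lborel) = (\<integral>\<^sup>+ h. H (y', h) \<partial>lborel)" for y'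
  proof -
    have m: "(\<lambda>y. sobolev_kernel s p V y y') \<in> borel_measurable borel"
    proof -
      have 1: "(\<lambda>y. V y - V y') \<in> borel_measurable borel" using V by (rule borel_measurable_diff) simp
      have 2: "(\<lambda>r. \<bar>r\<bar> powr p) \<in> borel_measurable (borel :: real measure)" by measurable
      have 3: "(\<lambda>y :: spacetime. y - y') \<in> borel_measurable borel" by (intro borel_measurable_continuous_onI continuous_intros)
      have 4: "(\<lambda>h. norm h powr (- (4 + s * p))) \<in> borel_measurable (borel :: spacetime measure)" by measurable
      show ?thesis unfolding sobolev_kernel_def
        by (rule measurable_compose[OF borel_measurable_times[OF measurable_compose[OF 1 2] measurable_compose[OF 3 4]] measurable_ennreal])
    qed
    have "(\<integral>\<^sup>+ y. sobolev_kernel s p V y y' \<partial>lborel) = (\<integral>\<^sup>+ h. sobolev_kernel s p V (h + y') y' \<partial>lborel)"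
      by (rule lborel_nn_integral_translate[OF m, symmetric])
    also have "\<dots> = (\<integral>\<^sup>+ h. H (y', h) \<partial>lborel)"
      by (intro nn_integral_cong) (simp add: sobolev_kernel_def H_def ennreal_mult mult.commute add.commute)
    finally show ?thesis .
  qed
  then have "(\<integral>\<^sup>+ y'. \<integral>\<^sup>+ y. sobolev_kernel s p V y y' \<partial>lborel \<partial>lborel) = (\<integral>\<^sup>+ y'. \<integral>\<^sup>+ h. H (y', h) \<partial>lborel \<partial>lborel)"
    by simp
  also have "\<dots> = (\<integral>\<^sup>+ h. \<integral>\<^sup>+ y'. H (y', h) \<partial>lborel \<partial>lborel)"
  proof -
    have "case_prod (\<lambda>y' h. H (y', h)) \<in> borel_measurable (lborel \<Otimes>\<^sub>M lborel)" using Hm unfolding lborel_prod by simp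
    from lborel_pair.Fubini'[OF this] show ?thesis by simp
  qed
  also have "\<dots> = (\<integral>\<^sup>+ h. ennreal (norm h powr (- (4 + s * p))) * (\<integral>\<^sup>+ y. ennreal (\<bar>V (y + h) - V y\<bar> powr p) \<partial>lborel) \<partial>lborel)"
  proof (rule nn_integral_cong)
    fix h :: spacetime
    have "(\<lambda>y. V (y + h) - V y) \<in> borel_measurable borel"
      by (rule borel_measurable_diff[OF measurable_compose[OF t V] V])
    then have "(\<lambda>y. ennreal (\<bar>V (y + h) - V y\<bar> powr p)) \<in> borel_measurable lborel" by simp
    from nn_integral_cmult[OF this, of "ennreal (norm h powr (- (4 + s * p)))"]
    show "(\<integral>\<^sup>+ y'. H (y', h) \<partial>lborel) = ennreal (norm h powr (- (4 + s * p))) * (\<integral>\<^sup>+ y. ennreal (\<bar>V (y + h) - V y\<bar> powr p) \<partial>lborel)"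
      unfolding H_def fst_conv snd_conv .
  qed
  finally show ?thesis .
qed

text \<open>The strict inequality on \<open>s\<close> says \<open>s p < min 1 (p - 1)\<close>. A
  number \<open>b\<close> strictly in between is large enough for the radial integral to converge at
  \<open>h = 0\<close> and small enough to be of the form \<open>\<kappa> min 1 (p - 1)\<close> with
  \<open>\<kappa> < 1\<close>.\<close>

lemma sobolev_kernel_estimate:
  fixes p s \<rho> :: real
  assumes p: "1 < p" and s: "0 < s" and sp: "s < min (1 / p) (1 - 1 / p)"
  shows "\<exists>C>0. \<forall>U G u f. slab_integrable \<rho> U \<longrightarrow> slab_integrable \<rho> G \<longrightarrow> 0 \<le> u \<longrightarrow> 0 \<le> f \<longrightarrow>
    (\<integral>\<^sup>+ z. ennreal (\<bar>U z\<bar> powr p) \<partial>lborel) \<le> ennreal u \<longrightarrow> (\<integral>\<^sup>+ z. ennreal (\<bar>G z\<bar> powr p) \<partial>lborel) \<le> ennreal f \<longrightarrow>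
    ray_representation U G \<longrightarrow>
    (\<forall>\<delta>>0. (\<integral>\<^sup>+ y'. \<integral>\<^sup>+ y. sobolev_kernel s p (\<lambda>y. LINT k|lborel. U (y, k)) y y' \<partial>lborel \<partial>lborel)
        \<le> ennreal (C * \<delta> powr (- (s * p)) * (u + \<delta> powr p * f)))"
proof -
  define m where "m = min 1 (p - 1)"
  have m: "m > 0" using p by (simp add: m_def)
  have "s * p < m"
  proof -
    have "s < 1 / p" "s < 1 - 1 / p" using sp by simp_all
    from mult_strict_right_mono[OF this(1), of p] mult_strict_right_mono[OF this(2), of p] p
    have "s * p < 1 / p * p" "s * p < (1 - 1 / p) * p" by (simp_all only: less_trans[OF zero_less_one])
    moreover have "1 / p * p = 1" "(1 - 1 / p) * p = p - 1" using p by (simp_all add: left_diff_distrib)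
    ultimately show ?thesis by (simp add: m_def)
  qed
  then obtain b where b: "s * p < b" "b < m" using dense[of "s * p" m] by metis
  define \<kappa> where "\<kappa> = b / m"
  have b0: "b > 0" using p less_trans[OF mult_pos_pos[OF s, of p] b(1)] by simp
  have \<kappa>: "0 < \<kappa>" "\<kappa> < 1" "\<kappa> * m = b" unfolding \<kappa>_def using b m b0 by simp_all
  note te = translation_estimate[OF p \<kappa>(1,2), of \<rho>, folded m_def, unfolded \<kappa>(3)]
  obtain C1 where te1: "0 < C1 \<and> (\<forall>U G u f. slab_integrable \<rho> U \<longrightarrow> slab_integrable \<rho> G \<longrightarrow> 0 \<le> u \<longrightarrow> 0 \<le> f \<longrightarrow>
    (\<integral>\<^sup>+ z. ennreal (\<bar>U z\<bar> powr p) \<partial>lborel) \<le> ennreal u \<longrightarrow> (\<integral>\<^sup>+ z. ennreal (\<bar>G z\<bar> powr p) \<partial>lborel) \<le> ennreal f \<longrightarrow>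
    ray_representation U G \<longrightarrow>
    (\<forall>\<delta>>0. \<forall>h. h \<noteq> 0 \<longrightarrow>
      (\<integral>\<^sup>+ y. ennreal (\<bar>(LINT k|lborel. U (y + h, k)) - (LINT k|lborel. U (y, k))\<bar> powr p) \<partial>lborel)
        \<le> ennreal (C1 * min 1 (norm h / \<delta>) powr b * (u + \<delta> powr p * f))))"
    using te ..
  note C1 = conjunct1[OF te1] conjunct2[OF te1, rule_format]
  have D4: "real DIM(spacetime) = 4" by simp
  have spp: "0 < s * p" using s p by simp
  obtain C2 where C2: "C2 \<ge> 0" "\<And>\<delta>. \<delta> > 0 \<Longrightarrow> (\<integral>\<^sup>+ (h::spacetime). ennreal (norm h powr (- (4 + s * p)) * min 1 (norm h / \<delta>) powr b) \<partial>lborel) \<le> ennreal (C2 * \<delta> powr (- (s * p)))"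
    using nn_integral_radial_bound[OF spp b(1), where 'a=spacetime, unfolded D4] by blast
  \<comment> \<open>\<open>C2\<close> may be 0; adding 1 makes the constant positive.\<close>
  define C where "C = C1 * (C2 + 1)"
  have C: "C > 0" using C1(1) C2(1) by (simp add: C_def)
  have "(\<integral>\<^sup>+ y'. \<integral>\<^sup>+ y. sobolev_kernel s p (\<lambda>y. LINT k|lborel. U (y, k)) y y' \<partial>lborel \<partial>lborel)
        \<le> ennreal (C * \<delta> powr (- (s * p)) * (u + \<delta> powr p * f))"
    if U: "slab_integrable \<rho> U" and G: "slab_integrable \<rho> G" and u: "0 \<le> u" and f: "0 \<le> f"
      and Up: "(\<integral>\<^sup>+ z. ennreal (\<bar>U z\<bar> powr p) \<partial>lborel) \<le> ennreal u" and Gp: "(\<integral>\<^sup>+ z. ennreal (\<bar>G z\<bar> powr p) \<partial>lborel) \<le> ennreal f"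
      and id: "ray_representation U G"
      and \<delta>: "\<delta> > 0" for U G u f \<delta>
  proof -
    define V where "V y = (LINT k|lborel. U (y, k))" for y
    have Um: "U \<in> borel_measurable borel" using U by (simp add: slab_integrable_def)
    have Vm: "V \<in> borel_measurable borel" unfolding V_def[abs_def] by (rule momentum_integral_measurable[OF Um])
    define N where "N = u + \<delta> powr p * f"
    have N: "N \<ge> 0" using u f by (simp add: N_def)
    define k where "k = (\<lambda>h :: spacetime. ennreal (norm h powr (- (4 + s * p)) * min 1 (norm h / \<delta>) powr b))"
    have km: "k \<in> borel_measurable lborel" unfolding k_def by simp
    have "(\<integral>\<^sup>+ y'. \<integral>\<^sup>+ y. sobolev_kernel s p V y y' \<partial>lborel \<partial>lborel)
       = (\<integral>\<^sup>+ h. ennreal (norm h powr (- (4 + s * p))) * (\<integral>\<^sup>+ y. ennreal (\<bar>V (y + h) - V y\<bar> powr p) \<partial>lborel) \<partial>lborel)"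
      by (rule sobolev_kernel_double_integral[OF Vm _ s b(1)]) (use p in simp)
    also have "\<dots> \<le> (\<integral>\<^sup>+ h. ennreal (C1 * N) * k h \<partial>lborel)"
    proof (rule nn_integral_mono)
      fix h :: spacetime
      show "ennreal (norm h powr (- (4 + s * p))) * (\<integral>\<^sup>+ y. ennreal (\<bar>V (y + h) - V y\<bar> powr p) \<partial>lborel) \<le> ennreal (C1 * N) * k h"
      proof (cases "h = 0")
        case False
        have "ennreal (norm h powr (- (4 + s * p))) * (\<integral>\<^sup>+ y. ennreal (\<bar>V (y + h) - V y\<bar> powr p) \<partial>lborel)
          \<le> ennreal (norm h powr (- (4 + s * p))) * ennreal (C1 * min 1 (norm h / \<delta>) powr b * N)"
          unfolding V_def N_def by (intro mult_left_mono C1(2)[OF U G u f Up Gp id \<delta> False]) simp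
        also have "\<dots> = ennreal (norm h powr (- (4 + s * p)) * (C1 * min 1 (norm h / \<delta>) powr b * N))"
          using C1(1) N by (intro ennreal_mult[symmetric]) auto
        also have "norm h powr (- (4 + s * p)) * (C1 * min 1 (norm h / \<delta>) powr b * N) = (C1 * N) * (norm h powr (- (4 + s * p)) * min 1 (norm h / \<delta>) powr b)"
          by (simp only: mult_ac)
        also have "ennreal \<dots> = ennreal (C1 * N) * k h"
          unfolding k_def using C1(1) N by (intro ennreal_mult) auto
        finally show ?thesis .
      qed simp
    qed
    also have "\<dots> = ennreal (C1 * N) * (\<integral>\<^sup>+ h. k h \<partial>lborel)" by (rule nn_integral_cmult[OF km])
    also have "\<dots> \<le> ennreal (C1 * N) * ennreal (C2 * \<delta> powr (- (s * p)))"
      unfolding k_def by (intro mult_left_mono C2(2)[OF \<delta>]) simp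
    also have "\<dots> = ennreal (C1 * N * (C2 * \<delta> powr (- (s * p))))"
      using C1(1) C2(1) N by (intro ennreal_mult[symmetric]) auto
    also have "\<dots> \<le> ennreal (C * \<delta> powr (- (s * p)) * N)"
    proof (intro ennreal_leI)
      have "C1 * N * (C2 * \<delta> powr (- (s * p))) \<le> C1 * N * ((C2 + 1) * \<delta> powr (- (s * p)))"
        using C1(1) N by (intro mult_left_mono mult_right_mono) auto
      also have "\<dots> = C * \<delta> powr (- (s * p)) * N" by (simp add: C_def)
      finally show "C1 * N * (C2 * \<delta> powr (- (s * p))) \<le> C * \<delta> powr (- (s * p)) * N" .
    qed
    finally show ?thesis unfolding N_def V_def[abs_def] .
  qed
  then show ?thesis using C by (intro exI[of _ C] conjI allI impI) assumption+
qed

text \<open>The set where \<open>f\<close> and \<open>g\<close> differ, and the part of it cut out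
  by a condition on \<open>f\<close>, are null and hence measurable for the completion.\<close>

lemma measurable_completion_AE:
  fixes f g :: "'a \<Rightarrow> real"
  assumes g: "g \<in> borel_measurable M" and ae: "AE x in M. f x = g x"
  shows "f \<in> borel_measurable (completion M)"
proof (rule measurableI)
  fix B :: "real set" assume B: "B \<in> sets borel"
  have 1: "Measurable.pred (completion M) (\<lambda>x. f x \<noteq> g x)"
    by (rule sets_completion_AE) (use ae in simp)
  have 2: "Measurable.pred (completion M) (\<lambda>x. f x \<noteq> g x \<and> f x \<in> B)"
    by (rule sets_completion_AE) (use ae in eventually_elim, simp)
  have g': "g \<in> borel_measurable (completion M)" by (rule measurable_completion[OF g])
  have "f -` B \<inter> space (completion M) = ((g -` B \<inter> space (completion M)) - {x \<in> space (completion M). f x \<noteq> g x})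
      \<union> {x \<in> space (completion M). f x \<noteq> g x \<and> f x \<in> B}"
    by auto
  moreover have "{x \<in> space (completion M). f x \<noteq> g x} \<in> sets (completion M)" "{x \<in> space (completion M). f x \<noteq> g x \<and> f x \<in> B} \<in> sets (completion M)"
    using 1 2 unfolding pred_def .
  ultimately show "f -` B \<inter> space (completion M) \<in> sets (completion M)"
    using measurable_sets[OF g' B] by (simp only: sets.Un sets.Diff)
qed simp

section \<open>Comparison with the iterated Gagliardo integral\<close>

lemma sobolev_kernel_measurable:
  assumes V: "V \<in> borel_measurable borel"
  shows "(\<lambda>x. sobolev_kernel s p V (snd x) (fst x)) \<in> borel_measurable borel"
proof -
  have c: "(\<lambda>x :: spacetime \<times> spacetime. fst x) \<in> borel_measurable borel" "(\<lambda>x :: spacetime \<times> spacetime. snd x) \<in> borel_measurable borel"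
    "(\<lambda>x :: spacetime \<times> spacetime. snd x - fst x) \<in> borel_measurable borel"
    by (intro borel_measurable_continuous_onI continuous_intros)+
  have 2: "(\<lambda>r. \<bar>r\<bar> powr p) \<in> borel_measurable (borel :: real measure)" by measurable
  have 4: "(\<lambda>h. norm h powr (- (4 + s * p))) \<in> borel_measurable (borel :: spacetime measure)" by measurable
  show ?thesis unfolding sobolev_kernel_def
    by (rule measurable_compose[OF borel_measurable_times[OF measurable_compose[OF borel_measurable_diff[OF measurable_compose[OF c(2) V] measurable_compose[OF c(1) V]] 2] measurable_compose[OF c(3) 4]] measurable_ennreal])
qed

text \<open>The base in the denominator is the square of the product norm. When the two points
  coincide both sides are 0, by \<open>x / 0 = 0\<close> and \<open>0 powr x = 0\<close>.\<close>

lemma sobolev_kernel_eq: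
  "ennreal (\<bar>V (t1, x1) - V (t2, x2)\<bar> powr p / ((t1 - t2)\<^sup>2 + (norm (x1 - x2))\<^sup>2) powr ((4 + s * p) / 2)) = sobolev_kernel s p V (t1, x1) (t2, x2)"
proof -
  define n where "n = norm ((t1, x1) - (t2, x2))"
  have "(t1 - t2)\<^sup>2 + (norm (x1 - x2))\<^sup>2 = n\<^sup>2" unfolding n_def by (simp add: norm_Pair)
  moreover have "n\<^sup>2 powr ((4 + s * p) / 2) = n powr (4 + s * p)"
  proof (cases "n = 0")
    case False
    then have "n > 0" by (simp add: n_def)
    then have "n\<^sup>2 = n powr 2" by simp
    moreover have "2 * ((4 + s * p) / 2) = 4 + s * p" by simp
    ultimately show ?thesis by (simp only: powr_powr)
  qed simp
  ultimately show ?thesis unfolding sobolev_kernel_def n_def by (simp only: powr_minus divide_inverse)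
qed

text \<open>The function \<open>v\<close> is known only up to null sets, so its iterated integral is
  compared with that of the Borel function \<open>V\<close> one variable at a time: almost
  everywhere in \<open>(t, x)\<close> means, for almost every \<open>t\<close>, almost everywhere in
  \<open>x\<close>, and this nested form fits the order of the four integrals. Extending the times
  beyond the slab only enlarges the right side.\<close>

lemma gagliardo_integral_le:
  assumes V: "V \<in> borel_measurable borel" and ae: "AE y in lborel. y \<in> spacetime_domain T \<longrightarrow> v y = V y"
  shows "gagliardo_integral T s p v \<le> (\<integral>\<^sup>+ y'. \<integral>\<^sup>+ y. sobolev_kernel s p V y y' \<partial>lborel \<partial>lborel)"
proof -
  define K where "K = sobolev_kernel s p V"
  define k where "k t1 x1 t2 x2 = ennreal (\<bar>v (t1, x1) - v (t2, x2)\<bar> powr p / ((t1 - t2)\<^sup>2 + (norm (x1 - x2))\<^sup>2) powr ((4 + s * p) / 2))" for t1 t2 :: real and x1 x2 :: "real^3"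
  have kK: "k t1 x1 t2 x2 = K (t1, x1) (t2, x2)" if "v (t1, x1) = V (t1, x1)" "v (t2, x2) = V (t2, x2)" for t1 x1 t2 x2
    unfolding k_def that K_def by (rule sobolev_kernel_eq)
  have "AE y in (lborel \<Otimes>\<^sub>M lborel). y \<in> spacetime_domain T \<longrightarrow> v y = V y" using ae unfolding lborel_prod .
  from lborel_pair.AE_pair[OF this]
  have ae2: "AE t in lborel. AE x in lborel. t \<in> {0<..<T} \<longrightarrow> v (t, x) = V (t, x)"
    unfolding spacetime_domain_def by simp
  have leb: "(\<integral>\<^sup>+ t. g t \<partial>lebesgue_on {0<..<T}) = (\<integral>\<^sup>+ t. g t * indicator {0<..<T} t \<partial>lborel)" for g :: "real \<Rightarrow> ennreal"
    by (subst nn_integral_restrict_space) (simp_all add: nn_integral_completion)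
  have "gagliardo_integral T s p v = (\<integral>\<^sup>+ t2. (\<integral>\<^sup>+ x2. \<integral>\<^sup>+ t1. (\<integral>\<^sup>+ x1. k t1 x1 t2 x2 \<partial>lborel) * indicator {0<..<T} t1 \<partial>lborel \<partial>lborel) * indicator {0<..<T} t2 \<partial>lborel)"
    unfolding gagliardo_integral_def k_def leb nn_integral_completion ..
  also have "\<dots> \<le> (\<integral>\<^sup>+ t2. \<integral>\<^sup>+ x2. \<integral>\<^sup>+ t1. \<integral>\<^sup>+ x1. K (t1, x1) (t2, x2) \<partial>lborel \<partial>lborel \<partial>lborel \<partial>lborel)"
  proof (rule nn_integral_mono_AE, use ae2 in eventually_elim)
    fix t2 assume t2: "AE x in lborel. t2 \<in> {0<..<T} \<longrightarrow> v (t2, x) = V (t2, x)"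
    show "(\<integral>\<^sup>+ x2. \<integral>\<^sup>+ t1. (\<integral>\<^sup>+ x1. k t1 x1 t2 x2 \<partial>lborel) * indicator {0<..<T} t1 \<partial>lborel \<partial>lborel) * indicator {0<..<T} t2
      \<le> (\<integral>\<^sup>+ x2. \<integral>\<^sup>+ t1. \<integral>\<^sup>+ x1. K (t1, x1) (t2, x2) \<partial>lborel \<partial>lborel \<partial>lborel)"
    proof (cases "t2 \<in> {0<..<T}")
      case True
      have "(\<integral>\<^sup>+ x2. \<integral>\<^sup>+ t1. (\<integral>\<^sup>+ x1. k t1 x1 t2 x2 \<partial>lborel) * indicator {0<..<T} t1 \<partial>lborel \<partial>lborel)
        \<le> (\<integral>\<^sup>+ x2. \<integral>\<^sup>+ t1. \<integral>\<^sup>+ x1. K (t1, x1) (t2, x2) \<partial>lborel \<partial>lborel \<partial>lborel)"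
      proof (rule nn_integral_mono_AE, use t2 in eventually_elim)
        fix x2 assume "t2 \<in> {0<..<T} \<longrightarrow> v (t2, x2) = V (t2, x2)"
        then have v2: "v (t2, x2) = V (t2, x2)" using True by blast
        show "(\<integral>\<^sup>+ t1. (\<integral>\<^sup>+ x1. k t1 x1 t2 x2 \<partial>lborel) * indicator {0<..<T} t1 \<partial>lborel) \<le> (\<integral>\<^sup>+ t1. \<integral>\<^sup>+ x1. K (t1, x1) (t2, x2) \<partial>lborel \<partial>lborel)"
        proof (rule nn_integral_mono_AE, use ae2 in eventually_elim)
          fix t1 assume t1: "AE x in lborel. t1 \<in> {0<..<T} \<longrightarrow> v (t1, x) = V (t1, x)"
          show "(\<integral>\<^sup>+ x1. k t1 x1 t2 x2 \<partial>lborel) * indicator {0<..<T} t1 \<le> (\<integral>\<^sup>+ x1. K (t1, x1) (t2, x2) \<partial>lborel)"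
          proof (cases "t1 \<in> {0<..<T}")
            case t1T: True
            have "(\<integral>\<^sup>+ x1. k t1 x1 t2 x2 \<partial>lborel) \<le> (\<integral>\<^sup>+ x1. K (t1, x1) (t2, x2) \<partial>lborel)"
            proof (rule nn_integral_mono_AE, use t1 in eventually_elim)
              fix x1 assume "t1 \<in> {0<..<T} \<longrightarrow> v (t1, x1) = V (t1, x1)"
              then have "v (t1, x1) = V (t1, x1)" using t1T by blast
              then show "k t1 x1 t2 x2 \<le> K (t1, x1) (t2, x2)" by (simp only: kK[OF _ v2] order_refl)
            qed
            then show ?thesis using t1T by simp
          qed simp
        qed
      qed
      then show ?thesis using True by simp
    qed simp
  qed
  also have "\<dots> = (\<integral>\<^sup>+ t2. \<integral>\<^sup>+ x2. \<integral>\<^sup>+ y. K y (t2, x2) \<partial>lborel \<partial>lborel \<partial>lborel)"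
  proof -
    have "(\<integral>\<^sup>+ t1. \<integral>\<^sup>+ x1. K (t1, x1) y' \<partial>lborel \<partial>lborel) = (\<integral>\<^sup>+ y. K y y' \<partial>lborel)" for y'
    proof -
      have "(\<lambda>y. K y y') \<in> borel_measurable borel"
        unfolding K_def by (rule measurable_compose[OF _ sobolev_kernel_measurable[OF V], of "\<lambda>y. (y', y)", unfolded fst_conv snd_conv])
          (intro borel_measurable_continuous_onI continuous_intros)
      then have "(\<lambda>y. K y y') \<in> borel_measurable (lborel \<Otimes>\<^sub>M lborel)" unfolding lborel_prod by simp
      from lborel.nn_integral_fst[OF this] show ?thesis unfolding lborel_prod .
    qed
    then show ?thesis by (simp only:)
  qed
  also have "\<dots> = (\<integral>\<^sup>+ y'. \<integral>\<^sup>+ y. K y y' \<partial>lborel \<partial>lborel)"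
  proof -
    have "(\<lambda>x. K (snd x) (fst x)) \<in> borel_measurable (lborel \<Otimes>\<^sub>M lborel)"
      using sobolev_kernel_measurable[OF V] unfolding lborel_prod K_def by simp
    from lborel.borel_measurable_nn_integral_fst[OF this]
    have "(\<lambda>y'. \<integral>\<^sup>+ y. K y y' \<partial>lborel) \<in> borel_measurable (lborel \<Otimes>\<^sub>M lborel)" unfolding lborel_prod by simp
    from lborel.nn_integral_fst[OF this] show ?thesis unfolding lborel_prod .
  qed
  finally show ?thesis unfolding K_def .
qed

text \<open>Take \<open>\<delta> = a / b\<close>; if \<open>a = 0\<close> let \<open>\<delta> \<rightarrow> 0\<close>, if \<open>b = 0\<close> let \<open>\<delta> \<rightarrow> \<infinity>\<close>.\<close>

lemma optimise_scale:
  fixes g c a b p s :: real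
  assumes p: "1 < p" and s: "0 < s" "s < 1" and c: "0 < c" and a: "0 \<le> a" and b: "0 \<le> b" and g: "0 \<le> g"
    and le: "\<And>\<delta>. \<delta> > 0 \<Longrightarrow> g \<le> c * \<delta> powr (- (s * p)) * (a powr p + \<delta> powr p * b powr p)"
  shows "g powr (1 / p) \<le> (2 * c) powr (1 / p) * a powr (1 - s) * b powr s"
proof -
  \<comment> \<open>Used when one of the norms vanishes: \<open>\<delta>\<close> is then chosen so
    that the surviving power of \<open>\<delta>\<close> equals an arbitrary positive
    \<open>x\<close>.\<close>
  have small: "g = 0" if d: "d \<ge> 0" and h: "\<And>x. x > 0 \<Longrightarrow> g \<le> d * x" for d
  proof (rule ccontr)
    assume "g \<noteq> 0"
    then have g: "g > 0" using g by simp
    define x where "x = g / 2 / (d + 1)"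
    have "x > 0" using g d by (simp add: x_def)
    have "d * x \<le> (d + 1) * x" using \<open>x > 0\<close> by (intro mult_right_mono) auto
    also have "\<dots> = g / 2"
    proof -
      have "d + 1 \<noteq> 0" using d by simp
      then show ?thesis unfolding x_def by (metis nonzero_mult_div_cancel_left times_divide_eq_right)
    qed
    finally show False using h[OF \<open>x > 0\<close>] g by simp
  qed
  consider "a = 0" | "b = 0" | "a > 0" "b > 0" using a b by fastforce
  then show ?thesis
  proof cases
    case 1
    have "s * p < p" using s p by simp
    have "g = 0"
    proof (rule small[of "c * b powr p"])
      fix x :: real assume x: "x > 0"
      define \<delta> where "\<delta> = x powr (1 / (p - s * p))"
      have "\<delta> powr (- (s * p)) * \<delta> powr p = \<delta> powr (p - s * p)" by (simp add: powr_add[symmetric])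
      also have "\<dots> = x" using x p s by (simp add: \<delta>_def powr_powr)
      finally have e: "\<delta> powr (- (s * p)) * \<delta> powr p = x" .
      have "g \<le> c * \<delta> powr (- (s * p)) * (a powr p + \<delta> powr p * b powr p)" by (rule le) (use x in \<open>simp add: \<delta>_def\<close>)
      also have "\<dots> = c * b powr p * (\<delta> powr (- (s * p)) * \<delta> powr p)" using 1 by simp
      finally show "g \<le> c * b powr p * x" unfolding e .
    qed (use c in simp)
    then show ?thesis using 1 by simp
  next
    case 2
    have sp: "s * p > 0" using s p by simp
    have "g = 0"
    proof (rule small[of "c * a powr p"])
      fix x :: real assume x: "x > 0"
      define \<delta> where "\<delta> = x powr (- 1 / (s * p))"
      have e: "\<delta> powr (- (s * p)) = x" using x p s by (simp add: \<delta>_def powr_powr)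
      have "g \<le> c * \<delta> powr (- (s * p)) * (a powr p + \<delta> powr p * b powr p)" by (rule le) (use x in \<open>simp add: \<delta>_def\<close>)
      also have "\<dots> = c * a powr p * \<delta> powr (- (s * p))" using 2 by simp
      finally show "g \<le> c * a powr p * x" unfolding e .
    qed (use c in simp)
    then show ?thesis using 2 by simp
  next
    case 3
    define \<delta> where "\<delta> = a / b"
    have \<delta>: "\<delta> > 0" using 3 by (simp add: \<delta>_def)
    have "g \<le> c * \<delta> powr (- (s * p)) * (a powr p + \<delta> powr p * b powr p)" by (rule le[OF \<delta>])
    \<comment> \<open>At this scale both terms coincide, which is the origin of the factor
      2.\<close>
    also have "\<delta> powr p * b powr p = a powr p" using 3 by (simp add: \<delta>_def powr_divide)
    also have "c * \<delta> powr (- (s * p)) * (a powr p + a powr p) = (2 * c) * (a powr (1 - s) * b powr s) powr p"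
    proof -
      have "\<delta> powr (- (s * p)) * a powr p = a powr (p - s * p) * b powr (s * p)"
        using 3 by (simp add: \<delta>_def powr_divide powr_minus powr_diff field_simps)
      also have "\<dots> = (a powr (1 - s) * b powr s) powr p"
        using 3 by (simp add: powr_mult powr_powr algebra_simps)
      finally show ?thesis by (simp add: algebra_simps)
    qed
    finally have "g powr (1 / p) \<le> ((2 * c) * (a powr (1 - s) * b powr s) powr p) powr (1 / p)"
      using g p by (intro powr_mono2) auto
    also have "\<dots> = (2 * c) powr (1 / p) * (a powr (1 - s) * b powr s)"
      using c p 3 by (simp add: powr_mult powr_powr)
    finally show ?thesis by (simp add: mult.assoc)
  qed
qed

text \<open>The balls on which \<open>g\<close> vanishes almost everywhere may be uncountably many;
  by Lindelof's theorem countably many of them cover the complement of the support, so the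
  exceptional null sets unite to a null set.\<close>

lemma AE_zero_outside_ess_supp:
  fixes g :: "'a::euclidean_space \<Rightarrow> real"
  assumes D: "D \<in> sets lebesgue"
  shows "AE z in lebesgue. z \<in> D \<longrightarrow> z \<notin> ess_supp D g \<longrightarrow> g z = 0"
proof -
  have r: "AE z in lebesgue. z \<in> D \<longrightarrow> P z" if "AE z in lebesgue_on D. P z" for P
    using that D by (subst (asm) AE_restrict_space_iff) auto
  have "\<forall>z\<in>D - ess_supp D g. \<exists>r>0. AE w in lebesgue_on D. w \<in> ball z r \<longrightarrow> g w = 0"
    unfolding ess_supp_def by blast
  then obtain r where r': "\<And>z. z \<in> D - ess_supp D g \<Longrightarrow> r z > 0 \<and> (AE w in lebesgue_on D. w \<in> ball z (r z) \<longrightarrow> g w = 0)"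
    by metis
  define \<F> where "\<F> = (\<lambda>z. ball z (r z)) ` (D - ess_supp D g)"
  obtain \<F>' where F': "\<F>' \<subseteq> \<F>" "countable \<F>'" "\<Union>\<F>' = \<Union>\<F>"
    using Lindelof[of \<F>] unfolding \<F>_def by (metis (no_types, lifting) imageE open_ball)
  have "AE w in lebesgue. \<forall>B\<in>\<F>'. w \<in> D \<longrightarrow> w \<in> B \<longrightarrow> g w = 0"
    unfolding AE_ball_countable[OF F'(2)]
  proof
    fix B assume "B \<in> \<F>'"
    then obtain z where z: "z \<in> D - ess_supp D g" "B = ball z (r z)" using F'(1) unfolding \<F>_def by auto
    have "AE w in lebesgue_on D. w \<in> ball z (r z) \<longrightarrow> g w = 0" using r'[OF z(1)] by blast
    from r[OF this] show "AE w in lebesgue. w \<in> D \<longrightarrow> w \<in> B \<longrightarrow> g w = 0" unfolding z(2) .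
  qed
  then show ?thesis
  proof eventually_elim
    case (elim z)
    show ?case
    proof (intro impI)
      assume z: "z \<in> D" "z \<notin> ess_supp D g"
      then have "z \<in> \<Union>\<F>" unfolding \<F>_def using r' by force
      then show "g z = 0" using F'(3) elim z by blast
    qed
  qed
qed

text \<open>On a ball the bound \<open>|g| \<le> 1 + |g| powr p\<close> turns integrability of the
  \<open>p\<close>-th power into integrability of \<open>g\<close>.\<close>

lemma slab_integrableI:
  assumes m: "g \<in> borel_measurable borel" and z: "\<And>z. \<rho> \<le> norm (snd z) \<Longrightarrow> g z = 0"
    and p: "1 < p" and fin: "(\<integral>\<^sup>+ z. ennreal (\<bar>g z\<bar> powr p) \<partial>lborel) \<le> ennreal c"
  shows "slab_integrable \<rho> g"
proof -
  have "integrable lborel (\<lambda>z. indicator (cball 0 r) z * g z)" for r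
  proof (rule Bochner_Integration.integrable_bound)
    have 1: "integrable lborel (indicator (cball (0::phase) r) :: phase \<Rightarrow> real)"
      by (intro integrable_real_indicator emeasure_lborel_cball_finite) simp
    have 2: "integrable lborel (\<lambda>z. \<bar>g z\<bar> powr p)"
    proof (rule integrableI_bounded)
      show "(\<lambda>z. \<bar>g z\<bar> powr p) \<in> borel_measurable lborel" using m by simp
      show "(\<integral>\<^sup>+ z. ennreal (norm (\<bar>g z\<bar> powr p)) \<partial>lborel) < \<infinity>" using fin by (simp add: le_less_trans)
    qed
    show "integrable lborel (\<lambda>z. indicator (cball (0::phase) r) z + \<bar>g z\<bar> powr p)" using 1 2 by (rule Bochner_Integration.integrable_add)
    show "(\<lambda>z. indicator (cball 0 r) z * g z) \<in> borel_measurable lborel"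
      using borel_measurable_times[OF borel_measurable_indicator m, of "cball 0 r"] by simp
    show "AE z in lborel. norm (indicator (cball 0 r) z * g z) \<le> norm (indicator (cball 0 r) z + \<bar>g z\<bar> powr p)"
    proof (intro AE_I2)
      fix z
      have "\<bar>g z\<bar> \<le> 1 + \<bar>g z\<bar> powr p"
      proof (cases "\<bar>g z\<bar> \<le> 1")
        case True
        have "0 \<le> \<bar>g z\<bar> powr p" by simp
        then show ?thesis using True by linarith
      next
        case False
        then have "\<bar>g z\<bar> powr 1 \<le> \<bar>g z\<bar> powr p" using p by (intro powr_mono) auto
        then show ?thesis using False by simp
      qed
      then show "norm (indicator (cball 0 r) z * g z) \<le> norm (indicator (cball 0 r) z + \<bar>g z\<bar> powr p)"
        by (auto simp: indicator_def)
    qed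
  qed
  then show ?thesis unfolding slab_integrable_def using m z by blast
qed

lemma transport_measurable:
  assumes "C_k 1 \<phi>" shows "transport \<phi> \<in> borel_measurable borel"
proof (rule borel_measurable_continuous_onI)
  have diff: "\<phi> differentiable (at z)" for z using assms unfolding One_nat_def C_k.simps by blast
  have 1: "continuous_on UNIV (\<lambda>z. frechet_derivative \<phi> (at z) i)" if "i \<in> Basis" for i
    using assms that unfolding One_nat_def C_k.simps by blast
  have 2: "continuous_on UNIV (\<lambda>z :: phase. velocity (snd z))"
    by (rule continuous_on_compose2[OF continuous_on_velocity[of UNIV] continuous_on_snd[OF continuous_on_id]]) simp
  have "transport \<phi> = (\<lambda>z. \<Sum>i\<in>Basis. (((1, velocity (snd z)), 0) \<bullet> i) * frechet_derivative \<phi> (at z) i)"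
    by (rule ext) (simp only: transport_eq_directional[OF diff] frechet_derivative_sum_Basis[OF diff, symmetric])
  moreover have "continuous_on UNIV (\<lambda>z :: phase. \<Sum>i\<in>Basis. (((1, velocity (snd z)), 0) \<bullet> i) * frechet_derivative \<phi> (at z) i)"
    by (intro continuous_on_sum continuous_on_mult continuous_on_inner continuous_on_Pair continuous_on_const 1 2)
  ultimately show "continuous_on UNIV (transport \<phi>)" by simp
qed

section \<open>Borel representatives of functions on the slab\<close>

lemma lebesgue_on_borel_version:
  fixes u :: "'a::euclidean_space \<Rightarrow> real"
  assumes D: "D \<in> sets borel" and u: "u \<in> borel_measurable (lebesgue_on D)"
  shows "\<exists>u'. u' \<in> borel_measurable borel \<and> (AE z in lborel. z \<in> D \<longrightarrow> u z = u' z) \<and> (\<forall>z. z \<notin> D \<longrightarrow> u' z = 0)"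
proof -
  have Dl: "D \<in> sets lebesgue" using D by simp
  have "(\<lambda>z. indicat_real D z *\<^sub>R u z) \<in> borel_measurable lebesgue"
    using u Dl by (subst (asm) borel_measurable_restrict_space_iff) auto
  then obtain u0 where u0: "u0 \<in> borel_measurable lborel" "AE z in lborel. indicat_real D z *\<^sub>R u z = u0 z"
    using completion_ex_borel_measurable_real by blast
  show ?thesis
  proof (intro exI[of _ "\<lambda>z. indicat_real D z * u0 z"] conjI)
    show "(\<lambda>z. indicat_real D z * u0 z) \<in> borel_measurable borel" using u0(1) D by simp
    show "AE z in lborel. z \<in> D \<longrightarrow> u z = indicat_real D z * u0 z" using u0(2) by eventually_elim auto
  qed simp
qed

lemma lebesgue_on_integral_eq:
  fixes g h :: "'a::euclidean_space \<Rightarrow> real"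
  assumes D: "D \<in> sets borel" and g: "g \<in> borel_measurable borel"
    and eq: "AE z in lborel. z \<in> D \<longrightarrow> h z = g z" and z: "\<And>z. z \<notin> D \<Longrightarrow> g z = 0"
  shows "(LINT z|lebesgue_on D. h z) = (LINT z|lborel. g z)"
proof -
  have ae: "AE z in lborel. indicat_real D z *\<^sub>R h z = g z"
    using eq by eventually_elim (auto simp: indicator_def z)
  have "(LINT z|lebesgue_on D. h z) = (LINT z|lebesgue. indicat_real D z *\<^sub>R h z)"
    by (rule integral_restrict_space) (use D in simp)
  also have "\<dots> = (LINT z|lebesgue. g z)"
  proof (rule integral_cong_AE)
    show "(\<lambda>z. indicat_real D z *\<^sub>R h z) \<in> borel_measurable lebesgue"
      by (rule measurable_completion_AE[OF _ ae]) (use g in simp)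
    show "g \<in> borel_measurable lebesgue" by (rule measurable_completion) (use g in simp)
    show "AE z in lebesgue. indicat_real D z *\<^sub>R h z = g z" by (rule AE_completion[OF ae])
  qed
  also have "\<dots> = (LINT z|lborel. g z)" by (rule integral_completion) (use g in simp)
  finally show ?thesis .
qed

lemma Lp_norm_borel_version:
  fixes u U :: "'a::euclidean_space \<Rightarrow> real"
  assumes D: "D \<in> sets borel" and u: "in_Lp D p u" and p: "p > 0"
    and eq: "AE z in lborel. z \<in> D \<longrightarrow> u z = U z" and z: "\<And>z. z \<notin> D \<Longrightarrow> U z = 0"
  shows "(\<integral>\<^sup>+ z. ennreal (\<bar>U z\<bar> powr p) \<partial>lborel) = ennreal (Lp_norm D p u powr p)"
proof -
  have I: "integrable (lebesgue_on D) (\<lambda>z. \<bar>u z\<bar> powr p)" using u unfolding in_Lp_def by blast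
  have "(\<integral>\<^sup>+ z. ennreal (\<bar>U z\<bar> powr p) \<partial>lborel) = (\<integral>\<^sup>+ z. ennreal (\<bar>U z\<bar> powr p) \<partial>lebesgue)"
    by (simp only: nn_integral_completion)
  also have "\<dots> = (\<integral>\<^sup>+ z. ennreal (\<bar>u z\<bar> powr p) * indicator D z \<partial>lebesgue)"
  proof (rule nn_integral_cong_AE, use AE_completion[OF eq] in eventually_elim)
    fix w assume "w \<in> D \<longrightarrow> u w = U w"
    then show "ennreal (\<bar>U w\<bar> powr p) = ennreal (\<bar>u w\<bar> powr p) * indicator D w"
      using z[of w] by (cases "w \<in> D") auto
  qed
  also have "\<dots> = (\<integral>\<^sup>+ z. ennreal (\<bar>u z\<bar> powr p) \<partial>lebesgue_on D)"
    using D by (intro nn_integral_restrict_space[symmetric]) simp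
  also have "\<dots> = ennreal (LINT z|lebesgue_on D. \<bar>u z\<bar> powr p)"
    by (rule nn_integral_eq_integral[OF I]) simp
  also have "(LINT z|lebesgue_on D. \<bar>u z\<bar> powr p) = Lp_norm D p u powr p"
    unfolding Lp_norm_def using p by (simp add: powr_powr)
  finally show ?thesis .
qed

lemma in_Lp_borel_version:
  fixes v V :: "'a::euclidean_space \<Rightarrow> real"
  assumes D: "D \<in> sets borel" and V: "V \<in> borel_measurable borel"
    and eq: "AE z in lborel. z \<in> D \<longrightarrow> v z = V z"
    and fin: "(\<integral>\<^sup>+ z. ennreal (\<bar>V z\<bar> powr p) \<partial>lborel) < \<infinity>"
  shows "in_Lp D p v"
proof -
  have Dl: "D \<inter> space lebesgue \<in> sets lebesgue" using D by simp
  have ae: "AE z in lborel. indicat_real D z *\<^sub>R v z = indicat_real D z * V z"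
    using eq by eventually_elim (auto simp: indicator_def)
  have "(\<lambda>z. indicat_real D z *\<^sub>R v z) \<in> borel_measurable lebesgue"
    by (rule measurable_completion_AE[OF _ ae]) (use V D in simp)
  then have vm: "v \<in> borel_measurable (lebesgue_on D)"
    using borel_measurable_restrict_space_iff[OF Dl] by blast
  have "(\<integral>\<^sup>+ z. ennreal (norm (\<bar>v z\<bar> powr p)) \<partial>lebesgue_on D) = (\<integral>\<^sup>+ z. ennreal (\<bar>v z\<bar> powr p) * indicator D z \<partial>lebesgue)"
    by (subst nn_integral_restrict_space[OF Dl]) simp
  also have "\<dots> \<le> (\<integral>\<^sup>+ z. ennreal (\<bar>V z\<bar> powr p) \<partial>lebesgue)"
  proof (rule nn_integral_mono_AE, use AE_completion[OF eq] in eventually_elim)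
    fix w assume "w \<in> D \<longrightarrow> v w = V w"
    then show "ennreal (\<bar>v w\<bar> powr p) * indicator D w \<le> ennreal (\<bar>V w\<bar> powr p)"
      by (cases "w \<in> D") auto
  qed
  also have "\<dots> < \<infinity>" using fin by (simp only: nn_integral_completion)
  finally have "integrable (lebesgue_on D) (\<lambda>z. \<bar>v z\<bar> powr p)"
    using vm by (intro integrableI_bounded) measurable
  then show ?thesis unfolding in_Lp_def using vm by blast
qed

text \<open>Fubini for null sets: for almost every \<open>y\<close> the sections of \<open>u\<close>
  and \<open>U\<close> agree almost everywhere, and so do their momentum integrals.\<close>

lemma momentum_average_borel_version:
  assumes U: "U \<in> borel_measurable borel" and eq: "AE z in lborel. z \<in> A \<times> UNIV \<longrightarrow> u z = U z"
  shows "AE y in lborel. y \<in> A \<longrightarrow> momentum_average u y = (LINT k|lborel. U (y, k))"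
proof -
  have "AE z in (lborel \<Otimes>\<^sub>M lborel). z \<in> A \<times> UNIV \<longrightarrow> u z = U z" using eq unfolding lborel_prod .
  from lborel_pair.AE_pair[OF this]
  show ?thesis
  proof eventually_elim
    case (elim y)
    show ?case
    proof
      assume "y \<in> A"
      then have ae: "AE k in lborel. u (y, k) = U (y, k)" using elim by simp
      have m: "(\<lambda>k. U (y, k)) \<in> borel_measurable lborel"
        using measurable_compose[OF borel_measurable_continuous_onI[of "\<lambda>k. (y, k)"] U]
        by (simp add: continuous_intros)
      have "momentum_average u y = (LINT k|lebesgue. U (y, k))"
        unfolding momentum_average_def
      proof (rule integral_cong_AE)
        show "(\<lambda>k. u (y, k)) \<in> borel_measurable lebesgue" by (rule measurable_completion_AE[OF m ae])
        show "(\<lambda>k. U (y, k)) \<in> borel_measurable lebesgue" by (rule measurable_completion[OF m])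
        show "AE k in lebesgue. u (y, k) = U (y, k)" by (rule AE_completion[OF ae])
      qed
      also have "\<dots> = (LINT k|lborel. U (y, k))" by (rule integral_completion[OF m])
      finally show "momentum_average u y = (LINT k|lborel. U (y, k))" .
    qed
  qed
qed

theorem theorem1p1:
  fixes T \<epsilon>0 R p s :: real
  assumes "0 < T"
    and "0 < \<epsilon>0" and "\<epsilon>0 < T / 2"
    and "0 < R"
    and "1 < p"
    and "0 < s" and "s < min (1 / p) (1 - 1 / p)"
  shows "\<exists>C::real. \<forall>(u :: phase \<Rightarrow> real) (f :: phase \<Rightarrow> real).
    in_Lp (phase_domain T) p u \<longrightarrow>
    in_Lp (phase_domain T) p f \<longrightarrow>
    transport_equation T u f \<longrightarrow>
    ess_supp (phase_domain T) u \<subseteq> ({\<epsilon>0..T - \<epsilon>0} \<times> UNIV) \<times> ball 0 R \<longrightarrow>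
    in_Wsp T s p (momentum_average u) \<and>
    Wsp_seminorm T s p (momentum_average u)
      \<le> C * Lp_norm (phase_domain T) p u powr (1 - s) * Lp_norm (phase_domain T) p f powr s"
proof -
  \<comment> \<open>The radius that \<open>phase_cutoff_norm\<close> provides for the cut-off
    source; being at least \<open>R\<close>, it serves for \<open>u\<close> as well.\<close>
  define \<rho> where "\<rho> = 3 * R + 4"
  have \<rho>: "R \<le> \<rho>" using assms(4) by (simp add: \<rho>_def)
  have p0: "0 < p" using assms(5) by simp
  have s1: "s < 1"
  proof -
    have "1 / p > 0" using p0 by simp
    then show ?thesis using assms(7) by simp
  qed
  obtain CL where CL: "0 < CL \<and> (\<forall>U. slab_integrable \<rho> U \<longrightarrow>
    (\<integral>\<^sup>+ y. ennreal (\<bar>LINT k|lborel. U (y, k)\<bar> powr p) \<partial>lborel) \<le> ennreal CL * (\<integral>\<^sup>+ z. ennreal (\<bar>U z\<bar> powr p) \<partial>lborel))"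
    using momentum_integral_Lp[OF assms(5), of \<rho>] ..
  obtain Ck where Ck: "0 < Ck \<and> (\<forall>U G u f. slab_integrable \<rho> U \<longrightarrow> slab_integrable \<rho> G \<longrightarrow> 0 \<le> u \<longrightarrow> 0 \<le> f \<longrightarrow>
    (\<integral>\<^sup>+ z. ennreal (\<bar>U z\<bar> powr p) \<partial>lborel) \<le> ennreal u \<longrightarrow> (\<integral>\<^sup>+ z. ennreal (\<bar>G z\<bar> powr p) \<partial>lborel) \<le> ennreal f \<longrightarrow>
    ray_representation U G \<longrightarrow>
    (\<forall>\<delta>>0. (\<integral>\<^sup>+ y'. \<integral>\<^sup>+ y. sobolev_kernel s p (\<lambda>y. LINT k|lborel. U (y, k)) y y' \<partial>lborel \<partial>lborel)
        \<le> ennreal (Ck * \<delta> powr (- (s * p)) * (u + \<delta> powr p * f))))"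
    using sobolev_kernel_estimate[OF assms(5,6,7), of \<rho>] ..
  define D where "D = phase_domain T"
  have oD: "open D" unfolding D_def phase_domain_def spacetime_domain_def by (intro open_Times) auto
  then have D: "D \<in> sets borel" and Dl: "D \<in> sets lebesgue" by auto
  have DE: "spacetime_domain T \<in> sets borel" unfolding spacetime_domain_def by (intro borel_open open_Times) auto
  \<comment> \<open>The prescribed support as a Borel set. It lies inside the slab, so a function
    that vanishes off it is extended by zero to the whole space.\<close>
  define S where "S = {z :: phase. \<epsilon>0 \<le> fst (fst z) \<and> fst (fst z) \<le> T - \<epsilon>0 \<and> norm (snd z) < R}"
  have S: "S \<in> sets borel"
  proof -
    have "closed {z :: phase. \<epsilon>0 \<le> fst (fst z)}" "closed {z :: phase. fst (fst z) \<le> T - \<epsilon>0}"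
      by (intro closed_Collect_le continuous_intros)+
    moreover have "open {z :: phase. norm (snd z) < R}" by (intro open_Collect_less continuous_intros)
    moreover have "S = {z. \<epsilon>0 \<le> fst (fst z)} \<inter> {z. fst (fst z) \<le> T - \<epsilon>0} \<inter> {z. norm (snd z) < R}"
      unfolding S_def by blast
    ultimately show ?thesis by (simp add: borel_closed borel_open)
  qed
  have SD: "z \<in> D" if "z \<in> S" for z
    using that assms(2) unfolding S_def D_def phase_domain_def spacetime_domain_def by (auto simp: mem_Times_iff)
  have main: "in_Wsp T s p (momentum_average u) \<and> Wsp_seminorm T s p (momentum_average u)
      \<le> (2 * Ck) powr (1 / p) * Lp_norm D p u powr (1 - s) * Lp_norm D p f powr s"
    if u: "in_Lp D p u" and f: "in_Lp D p f" and eqn: "transport_equation T u f"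
      and supp: "ess_supp D u \<subseteq> ({\<epsilon>0..T - \<epsilon>0} \<times> UNIV) \<times> ball 0 R" for u f
  proof -
    obtain u' where u': "u' \<in> borel_measurable borel" "AE z in lborel. z \<in> D \<longrightarrow> u z = u' z" "\<And>z. z \<notin> D \<Longrightarrow> u' z = 0"
      using lebesgue_on_borel_version[OF D, of u] u unfolding in_Lp_def by blast
    obtain F where F: "F \<in> borel_measurable borel" "AE z in lborel. z \<in> D \<longrightarrow> f z = F z" "\<And>z. z \<notin> D \<Longrightarrow> F z = 0"
      using lebesgue_on_borel_version[OF D, of f] f unfolding in_Lp_def by blast
    \<comment> \<open>A Borel representative of \<open>u\<close>, changed on a null set so that the
      support condition holds at every point.\<close>
    define U where "U = (\<lambda>z. indicat_real S z * u' z)"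
    \<comment> \<open>The cutoff gives the source bounded momenta without enlarging its
      \<open>L\<^sup>p\<close> norm, and the ray identity involves the source only through this
      product.\<close>
    define G where "G = (\<lambda>z. F z * phase_cutoff \<epsilon>0 T R z)"
    have Um: "U \<in> borel_measurable borel" unfolding U_def using S u'(1) by simp
    have US: "U z \<noteq> 0 \<Longrightarrow> z \<in> S" for z by (auto simp: U_def indicator_def)
    then have UD: "z \<notin> D \<Longrightarrow> U z = 0" for z using SD by blast
    have cm: "phase_cutoff \<epsilon>0 T R \<in> borel_measurable borel"
      by (rule borel_measurable_continuous_onI[OF C_k_continuous[OF C_k_phase_cutoff]])
    have Gm: "G \<in> borel_measurable borel" unfolding G_def by (rule borel_measurable_times[OF F(1) cm])
    have uU: "AE z in lborel. z \<in> D \<longrightarrow> u z = U z"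
    proof -
      have "AE z in lborel. z \<in> D \<longrightarrow> z \<notin> ess_supp D u \<longrightarrow> u z = 0"
        using AE_zero_outside_ess_supp[OF Dl, of u] unfolding AE_completion_iff .
      with u'(2) show ?thesis
      proof eventually_elim
        case (elim z)
        show ?case
        proof
          assume z: "z \<in> D"
          show "u z = U z"
          proof (cases "z \<in> S")
            case True
            then show ?thesis using elim(1) z by (simp add: U_def)
          next
            case False
            have "z \<notin> ({\<epsilon>0..T - \<epsilon>0} \<times> UNIV) \<times> ball 0 R"
              using False by (auto simp: S_def mem_Times_iff)
            then have "u z = 0" using supp elim(2) z by blast
            then show ?thesis using False by (simp add: U_def)
          qed
        qed
      qed
    qed
    define a where "a = Lp_norm D p u"
    define b where "b = Lp_norm D p f"
    have a: "a \<ge> 0" and b: "b \<ge> 0" by (simp_all add: a_def b_def Lp_norm_def)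
    have Up: "(\<integral>\<^sup>+ z. ennreal (\<bar>U z\<bar> powr p) \<partial>lborel) = ennreal (a powr p)"
      unfolding a_def by (rule Lp_norm_borel_version[OF D u p0 uU UD])
    have Fp: "(\<integral>\<^sup>+ z. ennreal (\<bar>F z\<bar> powr p) \<partial>lborel) = ennreal (b powr p)"
      unfolding b_def by (rule Lp_norm_borel_version[OF D f p0 F(2,3)])
    have Gp: "(\<integral>\<^sup>+ z. ennreal (\<bar>G z\<bar> powr p) \<partial>lborel) \<le> ennreal (b powr p)"
      unfolding Fp[symmetric]
    proof (rule nn_integral_mono)
      fix z :: phase
      have "\<bar>phase_cutoff \<epsilon>0 T R z\<bar> \<le> 1" using phase_cutoff_bounds[of \<epsilon>0 T R z] by simp
      then have "\<bar>G z\<bar> \<le> \<bar>F z\<bar>" unfolding G_def abs_mult by (simp add: mult_left_le)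
      then show "ennreal (\<bar>G z\<bar> powr p) \<le> ennreal (\<bar>F z\<bar> powr p)" using p0 by (intro ennreal_leI powr_mono2) auto
    qed
    have Us: "slab_integrable \<rho> U"
    proof (rule slab_integrableI[OF Um _ assms(5)])
      show "(\<integral>\<^sup>+ z. ennreal (\<bar>U z\<bar> powr p) \<partial>lborel) \<le> ennreal (a powr p)" using Up by simp
      show "U z = 0" if "\<rho> \<le> norm (snd z)" for z
        using US[of z] that \<rho> unfolding S_def by force
    qed
    have Gs: "slab_integrable \<rho> G"
    proof (rule slab_integrableI[OF Gm _ assms(5) Gp])
      show "G z = 0" if "\<rho> \<le> norm (snd z)" for z
        using phase_cutoff_norm[of \<epsilon>0 T R z] that unfolding \<rho>_def G_def by force
    qed
    have weak: "- (LINT z|lborel. U z * transport \<phi> z) = (LINT z|lborel. F z * \<phi> z)" if \<phi>: "test_function (phase_domain T) \<phi>" for \<phi>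
    proof -
      have Ck\<phi>: "C_k k \<phi>" for k using \<phi> unfolding test_function_def by blast
      have \<phi>m: "\<phi> \<in> borel_measurable borel"
        by (rule borel_measurable_continuous_onI[OF C_k_continuous[OF Ck\<phi>]])
      have tm: "transport \<phi> \<in> borel_measurable borel" by (rule transport_measurable[OF Ck\<phi>])
      have "(LINT z|lebesgue_on D. u z * transport \<phi> z) = (LINT z|lborel. U z * transport \<phi> z)"
      proof (rule lebesgue_on_integral_eq[OF D borel_measurable_times[OF Um tm]])
        show "AE z in lborel. z \<in> D \<longrightarrow> u z * transport \<phi> z = U z * transport \<phi> z"
          using uU by eventually_elim simp
      qed (simp add: UD)
      moreover have "(LINT z|lebesgue_on D. f z * \<phi> z) = (LINT z|lborel. F z * \<phi> z)"
      proof (rule lebesgue_on_integral_eq[OF D borel_measurable_times[OF F(1) \<phi>m]])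
        show "AE z in lborel. z \<in> D \<longrightarrow> f z * \<phi> z = F z * \<phi> z"
          using F(2) by eventually_elim simp
      qed (simp add: F(3))
      moreover have "- (LINT z|lebesgue_on D. u z * transport \<phi> z) = (LINT z|lebesgue_on D. f z * \<phi> z)"
        using eqn \<phi> unfolding transport_equation_def D_def by blast
      ultimately show ?thesis by simp
    qed
    have USc: "U z \<noteq> 0 \<Longrightarrow> \<epsilon>0 \<le> fst (fst z) \<and> fst (fst z) \<le> T - \<epsilon>0 \<and> norm (snd z) < R" for z
      using US[of z] unfolding S_def by blast
    have rep: "ray_representation U G"
      unfolding ray_representation_def G_def
      by (intro allI impI) (rule weak_identity[OF assms(2,1) _ Us USc Gs[unfolded G_def] weak])
    define V where "V = (\<lambda>y :: spacetime. LINT k|lborel. U (y, k))"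
    have Vm: "V \<in> borel_measurable borel" unfolding V_def by (rule momentum_integral_measurable[OF Um])
    have vV: "AE y in lborel. y \<in> spacetime_domain T \<longrightarrow> momentum_average u y = V y"
      unfolding V_def by (rule momentum_average_borel_version[OF Um uU[unfolded D_def phase_domain_def]])
    have lp: "in_Lp (spacetime_domain T) p (momentum_average u)"
    proof (rule in_Lp_borel_version[OF DE Vm vV])
      have "(\<integral>\<^sup>+ y. ennreal (\<bar>V y\<bar> powr p) \<partial>lborel) \<le> ennreal CL * ennreal (a powr p)"
        using conjunct2[OF CL, rule_format, OF Us] unfolding V_def Up .
      also have "\<dots> < \<infinity>" by (simp add: ennreal_mult_less_top)
      finally show "(\<integral>\<^sup>+ y. ennreal (\<bar>V y\<bar> powr p) \<partial>lborel) < \<infinity>" .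
    qed
    define g where "g = gagliardo_integral T s p (momentum_average u)"
    have gle: "g \<le> ennreal (Ck * \<delta> powr (- (s * p)) * (a powr p + \<delta> powr p * b powr p))" if "\<delta> > 0" for \<delta>
    proof -
      have "g \<le> (\<integral>\<^sup>+ y'. \<integral>\<^sup>+ y. sobolev_kernel s p V y y' \<partial>lborel \<partial>lborel)"
        unfolding g_def by (rule gagliardo_integral_le[OF Vm vV])
      also have "\<dots> \<le> ennreal (Ck * \<delta> powr (- (s * p)) * (a powr p + \<delta> powr p * b powr p))"
        unfolding V_def by (rule conjunct2[OF Ck, rule_format, OF Us Gs _ _ eq_refl[OF Up] Gp rep that]) simp_all
      finally show ?thesis .
    qed
    \<comment> \<open>The choice \<open>\<delta> = 1\<close> already proves finiteness, without
      which \<open>enn2real\<close> could return the meaningless value 0.\<close>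
    have gfin: "g < \<infinity>" using le_less_trans[OF gle[OF zero_less_one] ennreal_less_top] by simp
    have gr: "enn2real g \<le> Ck * \<delta> powr (- (s * p)) * (a powr p + \<delta> powr p * b powr p)" if "\<delta> > 0" for \<delta>
      using enn2real_mono[OF gle[OF that] ennreal_less_top] conjunct1[OF Ck] a b by simp
    have "enn2real g powr (1 / p) \<le> (2 * Ck) powr (1 / p) * a powr (1 - s) * b powr s"
      by (rule optimise_scale[OF assms(5,6) s1 conjunct1[OF Ck] a b enn2real_nonneg gr])
    then show ?thesis
      unfolding in_Wsp_def Wsp_seminorm_def a_def b_def using lp gfin unfolding g_def by blast
  qed
  show ?thesis
    by (rule exI[of _ "(2 * Ck) powr (1 / p)"], intro allI impI) (rule main[unfolded D_def])
qed

end
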